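(* Let $(M,d,\mu)$ be a metric measure space satisfying the volume doubling property, and let $\phi_c,\phi_j$ be scale functions satisfying $LU(\beta_{1,c},\beta_{2,c})$ and $LU(\beta_{1,j},\beta_{2,j})$ respectively, with $1<\beta_{1,c}\le\beta_{2,c}<\infty$ and $0<\beta_{1,j}\le\beta_{2,j}<\infty$, such that $\phi_c(r)\le\phi_j(r)$ for $r\in(0,1]$ and $\phi_c(r)\ge\phi_j(r)$ for $r\in(1,\infty)$. Put $\phi:=\phi_c\wedge\phi_j$, and let $\psi$ be a scale function such that $\int_0^\infty(1\wedge t)\frac{dt}{t\,\psi(\phi^{-1}(t))}<\infty$. Assume that $(\mathcal{E},\mathcal{F})$ is a diffusion+jump type regular Dirichlet form on $L^2(M;\mu)$ satisfying the heat kernel estimate $\mathrm{HK}_-(\phi_c,\phi_j)$, with associated $\mu$-symmetric Hunt process $X$, and let $S$ be an independent subordinator whose Bernstein function is $$\overline{\phi}(\lambda):=\int_0^\infty(1-e^{-\lambda t})\frac{dt}{t\,\psi(\phi^{-1}(t))},\qquad\lambda>0.$$ Then the jump kernel $J(x,y)$ of the subordinate process $X_{S_t}$ satisfies $$J(x,y)\simeq\frac{1}{V(x,r)}\left(\frac{1}{\psi(r)}+\overline{\phi}\bigl(\phi_j(r)^{-1}\bigr)\right),\qquad r:=d(x,y)>0.$$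
   Context: **Space.** $(M,d)$ is a locally compact separable metric space and $\mu$ is a Radon measure on $M$ with full support. $B(x,r)=\{y\in M: d(x,y)<r\}$, $V(x,r)=\mu(B(x,r))$. Volume doubling property: there exist $C\ge1$, $d_2>0$ with $V(x,R)/V(x,r)\le C(R/r)^{d_2}$ for all $x\in M$, $0<r\le R$. $a\wedge b=\min(a,b)$. **Scale functions.** For $0<\alpha_1\le\alpha_2$, a continuous function $\psi:[0,\infty)\to[0,\infty)$ satisfies $LU(\alpha_1,\alpha_2)$ if it is strictly increasing, $\psi(0)=0$, $\psi(1)=1$, and there is $C\ge1$ with $C^{-1}(R/r)^{\alpha_1}\le\psi(R)/\psi(r)\le C(R/r)^{\alpha_2}$ for $0<r\le R$. A function satisfying $LU(\alpha_1,\alpha_2)$ for some $0<\alpha_1\le\alpha_2$ is called a scale function. **Dirichlet forms.** By the Beurling–Deny decomposition a regular Dirichlet form on $L^2(M;\mu)$ is $\mathcal{E}(u,u)=\mathcal{E}^{(c)}(u,u)+\int_{M\times M\setminus\mathrm{diag}}(u(x)-u(y))^2J(dx,dy)+\int_Mu^2\,dk$, with $\mathcal{E}^{(c)}$ strongly local, $J$ the (symmetric Radon) jumping measure and $k$ the killing measure. It is of diffusion+jump type if $k=0$ (no killing inside). The jump kernel $J(x,y)$ is the density of the jumping measure with respect to $\mu\otimes\mu$, i.e. $J(dx,dy)=J(x,y)\mu(dx)\mu(dy)$ off the diagonal; estimates on it are understood for $\mu\otimes\mu$-a.e. $(x,y)$ with $x\ne y$. The jump kernel of the subordinate process is that of its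 associated Dirichlet form; by a known theorem of Ôkura it is $J(x,y)=\frac12\int_0^\infty p(t,x,y)\,\nu(dt)$, where $p$ is the heat kernel of $(\mathcal{E},\mathcal{F})$ and $\nu$ the Lévy measure of $S$. $f\simeq g$ means there is a constant $C>0$ with $C^{-1}f\le g\le Cf$ (here $C$ is independent of $x,y$). **Heat kernel estimates $\mathrm{HK}_-(\phi_c,\phi_j)$.** For $t>0$, $x,y\in M$ put $$p^{(c)}(t,x,y):=\frac{1}{V(x,\phi_c^{-1}(t))}\exp\left(-\sup_{s>0}\left\{\frac{d(x,y)}{s}-\frac{t}{\phi_c(s)}\right\}\right),$$ $$p^{(j)}(t,x,y):=\frac{1}{V(x,\phi_j^{-1}(t))}\wedge\frac{t}{V(x,d(x,y))\phi_j(d(x,y))}$$ (the last fraction being read as $+\infty$ if $x=y$). $\mathrm{HK}_-(\phi_c,\phi_j)$ holds for $(\mathcal{E},\mathcal{F})$ if there exist a heat kernel $p(t,x,y)$ of $(\mathcal{E},\mathcal{F})$, a properly exceptional set $\mathcal{N}$ (in particular $\mu(\mathcal{N})=0$) and constants $c_1,c_2,c_3,c_4>0$ such that for all $t>0$ and $x,y\in M\setminus\mathcal{N}$, with $r=d(x,y)$ and $\phi=\phi_c\wedge\phi_j$, $$c_1\left(\frac{1_{\{\phi(c_2r)\le t\}}}{V(x,\phi^{-1}(t))}+\frac{t\,1_{\{\phi(c_2r)>t\}}}{V(x,r)\phi_j(r)}\right)\le p(t,x,y)\le c_3\left(\frac{1}{V(x,\phi^{-1}(t))}\wedge\bigl(p^{(c)}(c_4t,x,y)+p^{(j)}(t,x,y)\bigr)\right),$$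 where the second term on the left is read as $0$ when $r=0$. **Subordinators.** A subordinator is a non-negative Lévy process $S_t$; its Bernstein function $\Phi$ is given by $E[e^{-\lambda S_t}]=e^{-t\Phi(\lambda)}$, $\Phi(\lambda)=b\lambda+\int_0^\infty(1-e^{-\lambda t})\nu(dt)$ with $b\ge0$ and $\nu$ a Lévy measure on $(0,\infty)$. In the claim $b=0$ and $\nu(dt)=\frac{dt}{t\psi(\phi^{-1}(t))}$. *)

theory Defs
  imports "HOL-Probability.Probability"
begin

section \<open>Metric measure spaces and scale functions\<close>

text \<open>
  Separability is the class \<open>second_countable_topology\<close>. On a locally compact separable metric space
  a Radon measure is a Borel measure that is finite on compact sets (regularity is then automatic).
\<close>

definition radon_measure :: "'a::topological_space measure \<Rightarrow> bool" where
  "radon_measure \<mu> \<longleftrightarrow> sets \<mu> = sets borel \<and> (\<forall>K. compact K \<longrightarrow> emeasure \<mu> K < \<infinity>)"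

definition metric_measure_space :: "'a::{metric_space,second_countable_topology} measure \<Rightarrow> bool" where
  "metric_measure_space \<mu> \<longleftrightarrow>
     locally_compact_space (euclidean :: 'a topology) \<and> radon_measure \<mu> \<and>
     (\<forall>U. open U \<and> U \<noteq> {} \<longrightarrow> emeasure \<mu> U > 0)"

definition vol :: "'a::metric_space measure \<Rightarrow> 'a \<Rightarrow> real \<Rightarrow> real" where
  "vol \<mu> x r = measure \<mu> (ball x r)"

text \<open>
  Stated in \<open>ennreal\<close>, because \<open>measure\<close> sends infinite mass to \<open>0\<close>. Small balls have finite positive
  mass, so doubling makes all balls have finite positive mass and \<open>vol\<close> is then the true volume.
\<close>

definition volume_doubling :: "'a::metric_space measure \<Rightarrow> bool" where
  "volume_doubling \<mu> \<longleftrightarrow>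
     (\<exists>C\<ge>1. \<exists>d2>0. \<forall>x r R. 0 < r \<and> r \<le> R \<longrightarrow>
        emeasure \<mu> (ball x R) \<le> ennreal (C * (R / r) powr d2) * emeasure \<mu> (ball x r))"

text \<open>Only the values of a scale function on \<open>[0,\<infinity>)\<close> matter.\<close>

definition LU :: "real \<Rightarrow> real \<Rightarrow> (real \<Rightarrow> real) \<Rightarrow> bool" where
  "LU \<alpha>1 \<alpha>2 \<psi> \<longleftrightarrow>
     0 < \<alpha>1 \<and> \<alpha>1 \<le> \<alpha>2 \<and> continuous_on {0..} \<psi> \<and> strict_mono_on {0..} \<psi> \<and> \<psi> 0 = 0 \<and> \<psi> 1 = 1 \<and>
     (\<exists>C\<ge>1. \<forall>r R. 0 < r \<and> r \<le> R \<longrightarrow>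
        (R / r) powr \<alpha>1 / C \<le> \<psi> R / \<psi> r \<and> \<psi> R / \<psi> r \<le> C * (R / r) powr \<alpha>2)"

definition scale_function :: "(real \<Rightarrow> real) \<Rightarrow> bool" where
  "scale_function \<psi> \<longleftrightarrow> (\<exists>\<alpha>1 \<alpha>2. LU \<alpha>1 \<alpha>2 \<psi>)"

definition scale_min :: "(real \<Rightarrow> real) \<Rightarrow> (real \<Rightarrow> real) \<Rightarrow> real \<Rightarrow> real" where
  "scale_min \<phi>c \<phi>j r = min (\<phi>c r) (\<phi>j r)"

definition scale_inv :: "(real \<Rightarrow> real) \<Rightarrow> real \<Rightarrow> real" where
  "scale_inv \<phi> = inv_into {0..} \<phi>"


section \<open>Dirichlet forms\<close>

text \<open>
  Elements of \<open>L\<^sup>2(M;\<mu>)\<close> are represented by Borel functions; a form is a function \<open>E\<close> together with its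
  domain \<open>F\<close>, both compatible with a.e. equality.
\<close>

definition L2 :: "'a measure \<Rightarrow> ('a \<Rightarrow> real) set" where
  "L2 \<mu> = {u \<in> borel_measurable \<mu>. integrable \<mu> (\<lambda>x. (u x)\<^sup>2)}"

definition support :: "('a::topological_space \<Rightarrow> real) \<Rightarrow> 'a set" where
  "support u = closure {x. u x \<noteq> 0}"

definition Cc :: "('a::topological_space \<Rightarrow> real) set" where
  "Cc = {u. continuous_on UNIV u \<and> compact (support u)}"

definition symmetric_form ::
  "('a \<Rightarrow> real) set \<Rightarrow> (('a \<Rightarrow> real) \<Rightarrow> ('a \<Rightarrow> real) \<Rightarrow> real) \<Rightarrow> bool" where
  "symmetric_form D E \<longleftrightarrow>
     (\<lambda>x. 0) \<in> D \<and>
     (\<forall>u\<in>D. \<forall>v\<in>D. \<forall>a b. (\<lambda>x. a * u x + b * v x) \<in> D) \<and>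
     (\<forall>u\<in>D. \<forall>v\<in>D. \<forall>w\<in>D. \<forall>a b. E (\<lambda>x. a * u x + b * v x) w = a * E u w + b * E v w) \<and>
     (\<forall>u\<in>D. \<forall>v\<in>D. E u v = E v u) \<and>
     (\<forall>u\<in>D. 0 \<le> E u u)"

definition energy1 ::
  "'a measure \<Rightarrow> (('a \<Rightarrow> real) \<Rightarrow> ('a \<Rightarrow> real) \<Rightarrow> real) \<Rightarrow> ('a \<Rightarrow> real) \<Rightarrow> real" where
  "energy1 \<mu> E u = E u u + (\<integral>x. (u x)\<^sup>2 \<partial>\<mu>)"

definition dirichlet_form ::
  "'a measure \<Rightarrow> (('a \<Rightarrow> real) \<Rightarrow> ('a \<Rightarrow> real) \<Rightarrow> real) \<Rightarrow> ('a \<Rightarrow> real) set \<Rightarrow> bool" where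
  "dirichlet_form \<mu> E F \<longleftrightarrow>
     F \<subseteq> L2 \<mu> \<and> symmetric_form F E \<and>
     \<comment> \<open>compatibility with a.e. equality\<close>
     (\<forall>u\<in>F. \<forall>v\<in>borel_measurable \<mu>. (AE x in \<mu>. u x = v x) \<longrightarrow> v \<in> F \<and> (\<forall>w\<in>F. E u w = E v w)) \<and>
     \<comment> \<open>densely defined\<close>
     (\<forall>u\<in>L2 \<mu>. \<forall>e>0. \<exists>v\<in>F. (\<integral>x. (u x - v x)\<^sup>2 \<partial>\<mu>) < e) \<and>
     \<comment> \<open>closed\<close>
     (\<forall>s :: nat \<Rightarrow> 'a \<Rightarrow> real.
        (\<forall>n. s n \<in> F) \<and>
        (\<forall>e>0. \<exists>N. \<forall>m\<ge>N. \<forall>n\<ge>N. energy1 \<mu> E (\<lambda>x. s m x - s n x) < e) \<longrightarrow>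
        (\<exists>u\<in>F. (\<lambda>n. energy1 \<mu> E (\<lambda>x. s n x - u x)) \<longlonglongrightarrow> 0)) \<and>
     \<comment> \<open>Markovian\<close>
     (\<forall>u\<in>F. (\<lambda>x. min (max (u x) 0) 1) \<in> F \<and>
        E (\<lambda>x. min (max (u x) 0) 1) (\<lambda>x. min (max (u x) 0) 1) \<le> E u u)"

definition regular_dirichlet_form ::
  "'a::topological_space measure \<Rightarrow> (('a \<Rightarrow> real) \<Rightarrow> ('a \<Rightarrow> real) \<Rightarrow> real) \<Rightarrow> ('a \<Rightarrow> real) set \<Rightarrow> bool" where
  "regular_dirichlet_form \<mu> E F \<longleftrightarrow>
     dirichlet_form \<mu> E F \<and>
     (\<forall>u\<in>F. \<forall>e>0. \<exists>v\<in>F \<inter> Cc. energy1 \<mu> E (\<lambda>x. u x - v x) < e) \<and>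
     (\<forall>u\<in>Cc. \<forall>e>0. \<exists>v\<in>F \<inter> Cc. \<forall>x. \<bar>u x - v x\<bar> < e)"

definition strongly_local ::
  "('a::topological_space \<Rightarrow> real) set \<Rightarrow> (('a \<Rightarrow> real) \<Rightarrow> ('a \<Rightarrow> real) \<Rightarrow> real) \<Rightarrow> bool" where
  "strongly_local D E \<longleftrightarrow>
     (\<forall>u\<in>D. \<forall>v\<in>D. (\<exists>U c. open U \<and> support u \<subseteq> U \<and> (\<forall>x\<in>U. v x = c)) \<longrightarrow> E u v = 0)"

text \<open>
  The Beurling--Deny decomposition, as in Fukushima--Oshima--Takeda (Theorem 3.2.1), on the core
  \<open>F \<inter> C\<^sub>c(M)\<close>, where no quasi-continuous versions are needed and where it determines \<open>Ec\<close>, \<open>Jm\<close>, \<open>k\<close>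
  uniquely. The jumping measure is a measure on \<open>M \<times> M\<close> minus the diagonal, encoded as a Borel measure
  on \<open>M \<times> M\<close> that does not charge the diagonal; it is Radon off the diagonal. Since all terms are
  nonnegative, writing the identity in \<open>ennreal\<close> includes the finiteness of both integrals.
\<close>

definition beurling_deny ::
  "(('a::{metric_space,second_countable_topology} \<Rightarrow> real) \<Rightarrow> ('a \<Rightarrow> real) \<Rightarrow> real) \<Rightarrow> ('a \<Rightarrow> real) set \<Rightarrow>
   (('a \<Rightarrow> real) \<Rightarrow> ('a \<Rightarrow> real) \<Rightarrow> real) \<Rightarrow> ('a \<times> 'a) measure \<Rightarrow> 'a measure \<Rightarrow> bool" where
  "beurling_deny E F Ec Jm k \<longleftrightarrow>
     symmetric_form (F \<inter> Cc) Ec \<and> strongly_local (F \<inter> Cc) Ec \<and>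
     sets Jm = sets borel \<and> distr Jm borel prod.swap = Jm \<and>
     emeasure Jm {z. fst z = snd z} = 0 \<and>
     (\<forall>K. compact K \<and> K \<inter> {z. fst z = snd z} = {} \<longrightarrow> emeasure Jm K < \<infinity>) \<and>
     radon_measure k \<and>
     (\<forall>u\<in>F \<inter> Cc. ennreal (E u u) =
        ennreal (Ec u u) + (\<integral>\<^sup>+z. ennreal ((u (fst z) - u (snd z))\<^sup>2) \<partial>Jm) + (\<integral>\<^sup>+x. ennreal ((u x)\<^sup>2) \<partial>k))"

definition diffusion_jump_type ::
  "(('a::{metric_space,second_countable_topology} \<Rightarrow> real) \<Rightarrow> ('a \<Rightarrow> real) \<Rightarrow> real) \<Rightarrow> ('a \<Rightarrow> real) set \<Rightarrow> bool" where
  "diffusion_jump_type E F \<longleftrightarrow> (\<exists>Ec Jm. beurling_deny E F Ec Jm (null_measure borel))"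

definition jump_kernel ::
  "'a::{metric_space,second_countable_topology} measure \<Rightarrow> (('a \<Rightarrow> real) \<Rightarrow> ('a \<Rightarrow> real) \<Rightarrow> real) \<Rightarrow>
   ('a \<Rightarrow> real) set \<Rightarrow> ('a \<Rightarrow> 'a \<Rightarrow> real) \<Rightarrow> bool" where
  "jump_kernel \<mu> E F J \<longleftrightarrow>
     (\<lambda>z. J (fst z) (snd z)) \<in> borel_measurable (\<mu> \<Otimes>\<^sub>M \<mu>) \<and> (\<forall>x y. 0 \<le> J x y) \<and>
     (\<exists>Ec Jm k. beurling_deny E F Ec Jm k \<and>
        (\<forall>A\<in>sets borel. A \<inter> {z. fst z = snd z} = {} \<longrightarrow>
           emeasure Jm A = (\<integral>\<^sup>+z\<in>A. ennreal (J (fst z) (snd z)) \<partial>(\<mu> \<Otimes>\<^sub>M \<mu>))))"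


section \<open>Markov processes and their Dirichlet forms\<close>

text \<open>
  Processes take values in \<open>'a option\<close>: the one-point compactification of \<open>M\<close>, with \<open>None\<close> as the
  cemetery (an isolated point if \<open>M\<close> is compact). Time runs through \<open>[0,\<infinity>]\<close>, i.e. \<open>ennreal\<close>.
\<close>

definition top_cem :: "'a::topological_space option topology" where
  "top_cem = Alexandroff_compactification euclidean"

definition borel_cem :: "'a::topological_space option measure" where
  "borel_cem = sigma UNIV {U. openin top_cem U}"

definition history :: "'w set \<Rightarrow> (ennreal \<Rightarrow> 'w \<Rightarrow> 'a::topological_space option) \<Rightarrow> ennreal \<Rightarrow> 'w measure" where
  "history \<Omega> X t = sigma \<Omega> {X s -` A \<inter> \<Omega> | s A. s \<le> t \<and> A \<in> sets borel_cem}"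

definition history_plus :: "'w set \<Rightarrow> (ennreal \<Rightarrow> 'w \<Rightarrow> 'a::topological_space option) \<Rightarrow> ennreal \<Rightarrow> 'w measure" where
  "history_plus \<Omega> X t =
     (if t = \<infinity> then history \<Omega> X \<infinity> else sigma \<Omega> (\<Inter>u\<in>{t<..}. sets (history \<Omega> X u)))"

text \<open>
  Hunt processes, with the strong Markov property and quasi-left-continuity stated for the raw
  right-continuous filtration; stating them for all starting points is the same as stating them for all
  initial laws. Any other right-continuous admissible filtration contains this one, so this is
  the weakest version of the axioms. On \<open>\<sigma> = \<infinity>\<close> the convention \<open>X\<^sub>\<infinity> = None\<close> applies.
\<close>

definition hunt_process ::
  "('a::{metric_space,second_countable_topology} option \<Rightarrow> 'w measure) \<Rightarrow> (ennreal \<Rightarrow> 'w \<Rightarrow> 'a option) \<Rightarrow> bool" where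
  "hunt_process P X \<longleftrightarrow>
     (let \<Omega> = space (P None); G = history_plus \<Omega> X in
     (\<forall>x. prob_space (P x) \<and> sets (P x) = sets (P None)) \<and>
     (\<forall>t. X t \<in> measurable (P None) borel_cem) \<and>
     (\<forall>t. \<forall>A\<in>sets borel_cem.
        (\<lambda>x. emeasure (P x) {\<omega>\<in>\<Omega>. X t \<omega> \<in> A}) \<in> borel_measurable borel_cem) \<and>
     \<comment> \<open>normality\<close>
     (\<forall>x. AE \<omega> in P x. X 0 \<omega> = x) \<and>
     \<comment> \<open>the cemetery is absorbing\<close>
     (\<forall>t. AE \<omega> in P None. X t \<omega> = None) \<and>
     (\<forall>\<omega>\<in>\<Omega>. X \<infinity> \<omega> = None) \<and>
     (\<forall>\<omega>\<in>\<Omega>. \<forall>s t. s \<le> t \<and> X s \<omega> = None \<longrightarrow> X t \<omega> = None) \<and>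
     \<comment> \<open>shifts\<close>
     (\<exists>\<theta>. \<forall>t. \<forall>\<omega>\<in>\<Omega>. \<theta> t \<omega> \<in> \<Omega> \<and> (\<forall>s. X s (\<theta> t \<omega>) = X (s + t) \<omega>)) \<and>
     \<comment> \<open>right-continuous paths with left limits\<close>
     (\<forall>\<omega>\<in>\<Omega>. \<forall>t<\<infinity>. limitin top_cem (\<lambda>s. X s \<omega>) (X t \<omega>) (at_right t)) \<and>
     (\<forall>\<omega>\<in>\<Omega>. \<forall>t. 0 < t \<and> t < \<infinity> \<longrightarrow> (\<exists>l. limitin top_cem (\<lambda>s. X s \<omega>) l (at_left t))) \<and>
     \<comment> \<open>strong Markov property\<close>
     (\<forall>\<sigma>. stopping_time G \<sigma> \<longrightarrow>
        (\<forall>x s. \<forall>A\<in>sets borel_cem. \<forall>L\<in>sets (filtration.pre_sigma \<Omega> G \<sigma>).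
           emeasure (P x) {\<omega>\<in>L. X (\<sigma> \<omega> + s) \<omega> \<in> A} =
           (\<integral>\<^sup>+\<omega>\<in>L. emeasure (P (X (\<sigma> \<omega>) \<omega>)) {\<omega>'\<in>\<Omega>. X s \<omega>' \<in> A} \<partial>P x))) \<and>
     \<comment> \<open>quasi-left-continuity\<close>
     (\<forall>\<sigma> :: nat \<Rightarrow> 'w \<Rightarrow> ennreal.
        (\<forall>n. stopping_time G (\<sigma> n)) \<and> (\<forall>\<omega>\<in>\<Omega>. incseq (\<lambda>n. \<sigma> n \<omega>)) \<longrightarrow>
        (\<forall>x. AE \<omega> in P x. (SUP n. \<sigma> n \<omega>) < \<infinity> \<longrightarrow>
           limitin top_cem (\<lambda>n. X (\<sigma> n \<omega>) \<omega>) (X (SUP n. \<sigma> n \<omega>) \<omega>) sequentially)))"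

text \<open>Transition operators \<open>f \<mapsto> E\<^sup>x[f(Y\<^sub>t)]\<close>, with \<open>f(None) = 0\<close>; here \<open>Y\<close> is indexed by real times \<open>t \<ge> 0\<close>.\<close>

definition transition ::
  "('a option \<Rightarrow> 'w measure) \<Rightarrow> (real \<Rightarrow> 'w \<Rightarrow> 'a option) \<Rightarrow> real \<Rightarrow> ('a \<Rightarrow> real) \<Rightarrow> 'a \<Rightarrow> real" where
  "transition P Y t f x = (\<integral>\<omega>. (case Y t \<omega> of None \<Rightarrow> 0 | Some y \<Rightarrow> f y) \<partial>P (Some x))"

definition symmetric_process ::
  "'a measure \<Rightarrow> ('a option \<Rightarrow> 'w measure) \<Rightarrow> (real \<Rightarrow> 'w \<Rightarrow> 'a option) \<Rightarrow> bool" where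
  "symmetric_process \<mu> P Y \<longleftrightarrow>
     (\<forall>t\<ge>0. \<forall>A\<in>sets \<mu>. \<forall>B\<in>sets \<mu>.
        (\<integral>\<^sup>+x\<in>A. emeasure (P (Some x)) {\<omega>\<in>space (P (Some x)). Y t \<omega> \<in> Some ` B} \<partial>\<mu>) =
        (\<integral>\<^sup>+x\<in>B. emeasure (P (Some x)) {\<omega>\<in>space (P (Some x)). Y t \<omega> \<in> Some ` A} \<partial>\<mu>))"

text \<open>
  The Dirichlet form of a symmetric \<open>L\<^sup>2\<close>-semigroup \<open>T\<close>: the limit of the approximating forms
  \<open>t\<^sup>-\<^sup>1 (u - T\<^sub>t u, v)\<close> as \<open>t\<close> decreases to \<open>0\<close>, on the set of \<open>u\<close> for which it is finite at \<open>(u, u)\<close>.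
\<close>

definition approx_form ::
  "'a measure \<Rightarrow> (real \<Rightarrow> ('a \<Rightarrow> real) \<Rightarrow> 'a \<Rightarrow> real) \<Rightarrow> real \<Rightarrow> ('a \<Rightarrow> real) \<Rightarrow> ('a \<Rightarrow> real) \<Rightarrow> real" where
  "approx_form \<mu> T t u v = (\<integral>x. (u x - T t u x) * v x \<partial>\<mu>) / t"

definition form_domain :: "'a measure \<Rightarrow> (real \<Rightarrow> ('a \<Rightarrow> real) \<Rightarrow> 'a \<Rightarrow> real) \<Rightarrow> ('a \<Rightarrow> real) set" where
  "form_domain \<mu> T = {u \<in> L2 \<mu>. \<exists>l. ((\<lambda>t. approx_form \<mu> T t u u) \<longlongrightarrow> l) (at_right 0)}"

definition form_of ::
  "'a measure \<Rightarrow> (real \<Rightarrow> ('a \<Rightarrow> real) \<Rightarrow> 'a \<Rightarrow> real) \<Rightarrow> ('a \<Rightarrow> real) \<Rightarrow> ('a \<Rightarrow> real) \<Rightarrow> real" where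
  "form_of \<mu> T u v = Lim (at_right 0) (\<lambda>t. approx_form \<mu> T t u v)"

definition real_time :: "(ennreal \<Rightarrow> 'w \<Rightarrow> 'a option) \<Rightarrow> real \<Rightarrow> 'w \<Rightarrow> 'a option" where
  "real_time X t = X (ennreal t)"

definition associated_hunt_process ::
  "'a::{metric_space,second_countable_topology} measure \<Rightarrow> (('a \<Rightarrow> real) \<Rightarrow> ('a \<Rightarrow> real) \<Rightarrow> real) \<Rightarrow>
   ('a \<Rightarrow> real) set \<Rightarrow> ('a option \<Rightarrow> 'w measure) \<Rightarrow> (ennreal \<Rightarrow> 'w \<Rightarrow> 'a option) \<Rightarrow> bool" where
  "associated_hunt_process \<mu> E F P X \<longleftrightarrow>
     hunt_process P X \<and> symmetric_process \<mu> P (real_time X) \<and>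
     F = form_domain \<mu> (transition P (real_time X)) \<and>
     (\<forall>u\<in>F. \<forall>v\<in>F. E u v = form_of \<mu> (transition P (real_time X)) u v)"


section \<open>Heat kernel estimates\<close>

definition properly_exceptional ::
  "'a::topological_space measure \<Rightarrow> ('a option \<Rightarrow> 'w measure) \<Rightarrow> (ennreal \<Rightarrow> 'w \<Rightarrow> 'a option) \<Rightarrow> 'a set \<Rightarrow> bool" where
  "properly_exceptional \<mu> P X N \<longleftrightarrow>
     N \<in> null_sets \<mu> \<and> (\<forall>x. x \<notin> N \<longrightarrow> (AE \<omega> in P (Some x). \<forall>t>0. X t \<omega> \<notin> Some ` N))"

text \<open>
  A heat kernel is an integral kernel of the \<open>L\<^sup>2\<close>-semigroup; symmetry and the Chapman--Kolmogorov
  identity then hold almost everywhere.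
\<close>

definition heat_kernel ::
  "'a measure \<Rightarrow> (real \<Rightarrow> ('a \<Rightarrow> real) \<Rightarrow> 'a \<Rightarrow> real) \<Rightarrow> (real \<Rightarrow> 'a \<Rightarrow> 'a \<Rightarrow> real) \<Rightarrow> bool" where
  "heat_kernel \<mu> T p \<longleftrightarrow>
     (\<lambda>(t, x, y). p t x y) \<in> borel_measurable (restrict_space lborel {0<..} \<Otimes>\<^sub>M \<mu> \<Otimes>\<^sub>M \<mu>) \<and>
     (\<forall>t>0. \<forall>x y. 0 \<le> p t x y) \<and>
     (\<forall>t>0. \<forall>f\<in>L2 \<mu>. AE x in \<mu>. integrable \<mu> (\<lambda>y. p t x y * f y) \<and> T t f x = (\<integral>y. p t x y * f y \<partial>\<mu>))"

text \<open>The supremum is finite when \<open>\<phi>c\<close> has lower index greater than \<open>1\<close>.\<close>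

definition p_c :: "'a::metric_space measure \<Rightarrow> (real \<Rightarrow> real) \<Rightarrow> real \<Rightarrow> 'a \<Rightarrow> 'a \<Rightarrow> real" where
  "p_c \<mu> \<phi>c t x y =
     1 / vol \<mu> x (scale_inv \<phi>c t) * exp (- (SUP s\<in>{0<..}. dist x y / s - t / \<phi>c s))"

definition p_j :: "'a::metric_space measure \<Rightarrow> (real \<Rightarrow> real) \<Rightarrow> real \<Rightarrow> 'a \<Rightarrow> 'a \<Rightarrow> real" where
  "p_j \<mu> \<phi>j t x y =
     (if x = y then 1 / vol \<mu> x (scale_inv \<phi>j t)
      else min (1 / vol \<mu> x (scale_inv \<phi>j t)) (t / (vol \<mu> x (dist x y) * \<phi>j (dist x y))))"

text \<open>For \<open>r = 0\<close> the off-diagonal term of the lower bound vanishes, as division by \<open>0\<close> gives \<open>0\<close>.\<close>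

definition HK_minus ::
  "'a::{metric_space,second_countable_topology} measure \<Rightarrow> ('a option \<Rightarrow> 'w measure) \<Rightarrow>
   (ennreal \<Rightarrow> 'w \<Rightarrow> 'a option) \<Rightarrow> (real \<Rightarrow> real) \<Rightarrow> (real \<Rightarrow> real) \<Rightarrow> bool" where
  "HK_minus \<mu> P X \<phi>c \<phi>j \<longleftrightarrow>
     (\<exists>p N c1 c2 c3 c4.
        heat_kernel \<mu> (transition P (real_time X)) p \<and> properly_exceptional \<mu> P X N \<and>
        0 < c1 \<and> 0 < c2 \<and> 0 < c3 \<and> 0 < c4 \<and>
        (\<forall>t>0. \<forall>x y. x \<notin> N \<and> y \<notin> N \<longrightarrow>
           (let r = dist x y; \<phi> = scale_min \<phi>c \<phi>j in
            c1 * ((if \<phi> (c2 * r) \<le> t then 1 / vol \<mu> x (scale_inv \<phi> t) else 0) +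
                  (if \<phi> (c2 * r) > t then t / (vol \<mu> x r * \<phi>j r) else 0)) \<le> p t x y \<and>
            p t x y \<le> c3 * min (1 / vol \<mu> x (scale_inv \<phi> t))
                              (p_c \<mu> \<phi>c (c4 * t) x y + p_j \<mu> \<phi>j t x y))))"


section \<open>Subordination\<close>

definition levy_process :: "'w measure \<Rightarrow> (real \<Rightarrow> 'w \<Rightarrow> real) \<Rightarrow> bool" where
  "levy_process Q S \<longleftrightarrow>
     prob_space Q \<and> (\<forall>t\<ge>0. S t \<in> borel_measurable Q) \<and>
     (AE \<omega> in Q. S 0 \<omega> = 0) \<and>
     (AE \<omega> in Q. (\<forall>t\<ge>0. ((\<lambda>s. S s \<omega>) \<longlongrightarrow> S t \<omega>) (at_right t)) \<and>
                 (\<forall>t>0. \<exists>l. ((\<lambda>s. S s \<omega>) \<longlongrightarrow> l) (at_left t))) \<and>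
     (\<forall>s\<ge>0. \<forall>t\<ge>0. distr Q borel (\<lambda>\<omega>. S (s + t) \<omega> - S s \<omega>) = distr Q borel (S t)) \<and>
     (\<forall>(n::nat) (\<tau>::nat \<Rightarrow> real). 0 \<le> \<tau> 0 \<and> (\<forall>i<n. \<tau> i \<le> \<tau> (Suc i)) \<longrightarrow>
        prob_space.indep_vars Q (\<lambda>_. borel) (\<lambda>i \<omega>. S (\<tau> (Suc i)) \<omega> - S (\<tau> i) \<omega>) {..<n})"

definition subordinator :: "'w measure \<Rightarrow> (real \<Rightarrow> 'w \<Rightarrow> real) \<Rightarrow> (real \<Rightarrow> real) \<Rightarrow> bool" where
  "subordinator Q S \<Phi> \<longleftrightarrow>
     levy_process Q S \<and> (AE \<omega> in Q. \<forall>t\<ge>0. 0 \<le> S t \<omega>) \<and>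
     (\<forall>t\<ge>0. \<forall>l>0. (\<integral>\<omega>. exp (- l * S t \<omega>) \<partial>Q) = exp (- t * \<Phi> l))"

text \<open>
  \<open>S\<close> lives on the same sample space as \<open>X\<close> and, under each \<open>P x\<close>, is a subordinator independent of
  the whole process \<open>X\<close>.
\<close>

definition independent_subordinator ::
  "('a::topological_space option \<Rightarrow> 'w measure) \<Rightarrow> (ennreal \<Rightarrow> 'w \<Rightarrow> 'a option) \<Rightarrow>
   (real \<Rightarrow> 'w \<Rightarrow> real) \<Rightarrow> (real \<Rightarrow> real) \<Rightarrow> bool" where
  "independent_subordinator P X S \<Phi> \<longleftrightarrow>
     (\<forall>x. subordinator (P x) S \<Phi> \<and>
        prob_space.indep_set (P x) (sets (history (space (P x)) X \<infinity>))
          (sigma_sets (space (P x)) {S s -` A \<inter> space (P x) | s A. 0 \<le> s \<and> A \<in> sets borel}))"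

definition subordinate :: "(ennreal \<Rightarrow> 'w \<Rightarrow> 'a option) \<Rightarrow> (real \<Rightarrow> 'w \<Rightarrow> real) \<Rightarrow> real \<Rightarrow> 'w \<Rightarrow> 'a option" where
  "subordinate X S t \<omega> = X (ennreal (S t \<omega>)) \<omega>"

definition levy_density :: "(real \<Rightarrow> real) \<Rightarrow> (real \<Rightarrow> real) \<Rightarrow> real \<Rightarrow> real" where
  "levy_density \<phi> \<psi> t = 1 / (t * \<psi> (scale_inv \<phi> t))"

definition bernstein :: "(real \<Rightarrow> real) \<Rightarrow> (real \<Rightarrow> real) \<Rightarrow> real \<Rightarrow> real" where
  "bernstein \<phi> \<psi> l = (LINT t:{0<..}|lborel. (1 - exp (- l * t)) * levy_density \<phi> \<psi> t)"

end

theory Submission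
  imports Defs
begin

text \<open>
  By independence, \<open>T\<^sup>S\<^sub>t u = \<integral> T\<^sub>s u \<eta>\<^sub>t(ds)\<close>, where \<open>\<eta>\<^sub>t\<close> is the law of \<open>S\<^sub>t\<close>, so the approximating forms of the
  subordinate process are \<open>t\<^sup>-\<^sup>1 \<integral> (f 0 - f s) \<eta>\<^sub>t(ds)\<close> with \<open>f s = (T\<^sub>s u, u)\<close>. For \<open>u \<in> C\<^sub>c\<close> the function \<open>f\<close> is
  convex, decreasing and continuous, since \<open>f s = \<parallel>T\<^sub>s\<^sub>/\<^sub>2 u\<parallel>\<^sup>2\<close> is midpoint convex. This, together with the vague
  convergence \<open>\<eta>\<^sub>t / t \<rightarrow> \<nu>\<close> read off from Laplace transforms, shows that the forms converge to
  \<open>\<integral> (f 0 - f s) \<nu>(ds)\<close>, without any use of the spectral theorem. Writing \<open>f 0 - f s\<close> as half the energy of the kernel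
  \<open>p\<^sub>s\<close> plus a killing term yields Okura's formula \<open>J = 1/2 \<integral> p\<^sub>s \<nu>(ds)\<close>. Any other jump kernel agrees with it
  because polarising the form on functions with disjoint supports isolates the jump part.

  The estimate comes from splitting the integral at \<open>t = \<phi>(r)\<close>: large \<open>t\<close> contribute \<open>1 / (V(x,r) \<psi>(r))\<close>; for small \<open>t\<close>
  the jump part \<open>t / (V(x,r) \<phi>\<^sub>j(r))\<close> contributes \<open>\<Phi>(1 / \<phi>\<^sub>j(r)) / V(x,r)\<close>, up to a multiple of the first contribution,
  and the diffusive part is bounded by the first contribution, because it decays
  faster than any power of \<open>\<phi>\<^sub>c\<^sup>-\<^sup>1(t) / r\<close>.
\<close>

section \<open>Scale functions\<close>

text \<open>Of the domain of the subordinate form only bump functions in \<open>Cc\<close> are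
  wanted. They come from the original regular form, because for its functions in \<open>Cc\<close>
  the decay \<open>f 0 - f s\<close> is O(s) at 0 and so integrable against \<nu>. The obstacle in
  the limit is that for a general u in \<open>Cc\<close> the decay need not be O(s), so weak
  convergence does not apply to it directly; hence the detour over increments of \<open>f\<close>
  started at e > 0. The limit is kept in [0,\<infinity>], so that Tonelli separates jump and killing
  parts for every u in \<open>Cc\<close>; finiteness is extracted afterwards, on products of
  disjoint compact sets. In the estimate the Levy density is governed by \<phi>, the diffusive decay
  by \<phi>c. As \<phi> \<le> \<phi>c, the density is at most 1 / (t \<psi>(\<rho>)), \<rho> being
  the inverse of \<phi>c at t. From the decay one takes (\<rho>/r)^(b'+1), b' the upper exponent of
  \<psi>: the power b' pays for replacing \<psi>(\<rho>) by \<psi>(r), and the remaining factor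
  makes dt/t integrable at 0.\<close>

locale scaling =
  fixes \<phi> :: "real \<Rightarrow> real" and a b C :: real
  assumes a: "0 < a" and ab: "a \<le> b" and cont: "continuous_on {0..} \<phi>"
    and smono: "strict_mono_on {0..} \<phi>" and zero [simp]: "\<phi> 0 = 0" and C: "1 \<le> C"
    and lower: "\<And>r R. 0 < r \<Longrightarrow> r \<le> R \<Longrightarrow> (R / r) powr a / C \<le> \<phi> R / \<phi> r"
    and upper: "\<And>r R. 0 < r \<Longrightarrow> r \<le> R \<Longrightarrow> \<phi> R / \<phi> r \<le> C * (R / r) powr b"
begin

lemma b: "0 < b" using a ab by simp

lemma less: "0 \<le> r \<Longrightarrow> r < R \<Longrightarrow> \<phi> r < \<phi> R"
  using smono by (simp add: strict_mono_on_def)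

lemma mono: "0 \<le> r \<Longrightarrow> r \<le> R \<Longrightarrow> \<phi> r \<le> \<phi> R"
  using less[of r R] by (cases "r = R") auto

lemma pos: "0 < r \<Longrightarrow> 0 < \<phi> r"
  using less[of 0 r] by simp

lemma le_iff: "0 \<le> r \<Longrightarrow> 0 \<le> s \<Longrightarrow> \<phi> r \<le> \<phi> s \<longleftrightarrow> r \<le> s"
  using less[of s r] mono[of r s] by (cases "r \<le> s") auto

lemma surj: assumes "0 \<le> t" shows "\<exists>r\<ge>0. \<phi> r = t"
proof -
  \<comment> \<open>So large that the lower scaling bound between 1 and \<open>R\<close> forces
    \<open>t \<le> \<phi> R\<close>; the intermediate value theorem on [0,R] does the rest.\<close>
  define R where "R = max 1 ((C * t / \<phi> 1) powr (1 / a))"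
  have p1: "0 < \<phi> 1" by (rule pos) simp
  have R: "1 \<le> R" by (simp add: R_def)
  have "C * t / \<phi> 1 = ((C * t / \<phi> 1) powr (1 / a)) powr a"
    using a assms C p1 by (simp add: powr_powr)
  also have "\<dots> \<le> R powr a"
    using a by (intro powr_mono2) (auto simp: R_def)
  finally have "C * t / \<phi> 1 \<le> R powr a" .
  then have "t / \<phi> 1 \<le> R powr a / C"
    using C p1 by (simp add: field_simps)
  also have "\<dots> \<le> \<phi> R / \<phi> 1" using lower[of 1 R] R by simp
  finally have "t \<le> \<phi> R" using p1 by (simp add: divide_simps)
  moreover have "continuous_on {0..R} \<phi>" by (rule continuous_on_subset[OF cont]) auto
  ultimately show ?thesis
    using IVT'[of \<phi> 0 t R] assms R by auto
qed

lemma inv: assumes "0 \<le> t" shows "\<phi> (scale_inv \<phi> t) = t" "0 \<le> scale_inv \<phi> t"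
proof -
  have "t \<in> \<phi> ` {0..}" using surj[OF assms] by auto
  from f_inv_into_f[OF this] inv_into_into[OF this]
  show "\<phi> (scale_inv \<phi> t) = t" "0 \<le> scale_inv \<phi> t" by (auto simp: scale_inv_def)
qed

lemma inv_pos: "0 < t \<Longrightarrow> 0 < scale_inv \<phi> t"
  using inv[of t] zero by (metis less_eq_real_def order_less_irrefl)

lemma inv_le_iff: "0 \<le> t \<Longrightarrow> 0 \<le> r \<Longrightarrow> scale_inv \<phi> t \<le> r \<longleftrightarrow> t \<le> \<phi> r"
  using le_iff[of "scale_inv \<phi> t" r] inv by simp

lemma le_inv_iff: "0 \<le> t \<Longrightarrow> 0 \<le> r \<Longrightarrow> r \<le> scale_inv \<phi> t \<longleftrightarrow> \<phi> r \<le> t"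
  using le_iff[of r "scale_inv \<phi> t"] inv by simp

lemma inv_mono: "0 \<le> t \<Longrightarrow> t \<le> T \<Longrightarrow> scale_inv \<phi> t \<le> scale_inv \<phi> T"
  using inv_le_iff[of t "scale_inv \<phi> T"] inv[of T] by simp

lemma inv_phi: "0 \<le> r \<Longrightarrow> scale_inv \<phi> (\<phi> r) = r"
  using inv_le_iff[of "\<phi> r" r] le_inv_iff[of "\<phi> r" r] mono[of 0 r] by simp

text \<open>Inversion exchanges the two sides of the scaling condition: the lower exponent
  \<open>a\<close> of \<phi> limits the growth of the inverse by 1/a, and in
  \<open>inv_lower\<close> the upper exponent \<open>b\<close> guarantees growth 1/b.\<close>

lemma inv_upper: assumes "0 < t" "t \<le> T" shows "scale_inv \<phi> T / scale_inv \<phi> t \<le> (C * (T / t)) powr (1 / a)"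
proof -
  let ?q = "scale_inv \<phi> T / scale_inv \<phi> t"
  have q: "0 < ?q" using assms inv_pos by simp
  have "?q powr a / C \<le> T / t"
    using lower[OF inv_pos inv_mono, of t T] assms inv[of t] inv[of T] by simp
  then have "?q powr a \<le> C * (T / t)" using C assms by (simp add: field_simps)
  then have "(?q powr a) powr (1 / a) \<le> (C * (T / t)) powr (1 / a)"
    using a by (intro powr_mono2) auto
  moreover have "(?q powr a) powr (1 / a) = ?q" using a assms inv_pos[of t] inv_pos[of T] by (simp add: powr_powr)
  ultimately show ?thesis by (simp only:)
qed

lemma inv_lower: assumes "0 < t" "t \<le> T" shows "(T / t / C) powr (1 / b) \<le> scale_inv \<phi> T / scale_inv \<phi> t"
proof -
  let ?q = "scale_inv \<phi> T / scale_inv \<phi> t"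
  have q: "0 < ?q" using assms inv_pos by simp
  have "T / t \<le> C * ?q powr b"
    using upper[OF inv_pos inv_mono, of t T] assms inv[of t] inv[of T] by simp
  then have "T / t / C \<le> ?q powr b" using C assms by (simp add: field_simps)
  then have "(T / t / C) powr (1 / b) \<le> (?q powr b) powr (1 / b)"
    using assms b C by (intro powr_mono2) auto
  moreover have "(?q powr b) powr (1 / b) = ?q" using b assms inv_pos[of t] inv_pos[of T] by (simp add: powr_powr)
  ultimately show ?thesis by (simp only:)
qed

text \<open>Absorbs constant factors in the time variable, such as \<open>c4\<close> in the
  Gaussian-type term and the factor 2 of a dyadic time interval, into a constant factor of the
  radius.\<close>

lemma inv_scaled: assumes "0 < c" "0 < t"
  shows "scale_inv \<phi> (c * t) \<le> max 1 ((C * c) powr (1 / a)) * scale_inv \<phi> t"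
proof (cases "c \<le> 1")
  case True
  then have "scale_inv \<phi> (c * t) \<le> scale_inv \<phi> t"
    using assms by (intro inv_mono) (auto simp: mult_left_le_one_le)
  also have "\<dots> \<le> max 1 ((C * c) powr (1 / a)) * scale_inv \<phi> t"
    using inv_pos[OF assms(2)] by (simp add: mult_le_cancel_right1)
  finally show ?thesis .
next
  case False
  have "scale_inv \<phi> (c * t) / scale_inv \<phi> t \<le> (C * (c * t / t)) powr (1 / a)"
    using False assms by (intro inv_upper) auto
  then have "scale_inv \<phi> (c * t) / scale_inv \<phi> t \<le> max 1 ((C * c) powr (1 / a))"
    using assms by simp
  then show ?thesis using inv_pos[OF assms(2)] by (simp add: divide_simps)
qed

text \<open>The upper scaling bound between \<open>s\<close> and \<open>r\<close>, solved for the
  value at the smaller radius. For \<psi> it converts a power of s/r into the quotient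
  \<psi>(s)/\<psi>(r).\<close>

lemma ge_powr: assumes "0 < s" "s \<le> r" shows "\<phi> r / C * (s / r) powr b \<le> \<phi> s"
proof -
  have "\<phi> r \<le> C * (r / s) powr b * \<phi> s"
    using upper[OF assms] pos[OF assms(1)] by (simp add: divide_simps)
  moreover have "(s / r) powr b * (r / s) powr b = 1"
    using assms by (simp flip: powr_mult)
  ultimately have "\<phi> r * (s / r) powr b \<le> C * \<phi> s"
    using mult_right_mono[of "\<phi> r" "C * (r / s) powr b * \<phi> s" "(s / r) powr b"]
    by (simp add: mult_ac)
  then show ?thesis using C by (simp add: field_simps)
qed

lemma inverse_scaled: assumes "0 < c"
  obtains K where "0 < K" "\<And>r. 0 < r \<Longrightarrow> 1 / \<phi> (c * r) \<le> K / \<phi> r" "\<And>r. 0 < r \<Longrightarrow> 1 / \<phi> r \<le> K / \<phi> (c * r)"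
proof -
  \<comment> \<open>One inequality suffices: the reverse one is the same statement for 1/c at the
    radius c r.\<close>
  have *: "\<exists>K>0. \<forall>r>0. 1 / \<phi> (c * r) \<le> K / \<phi> r" if c: "0 < c" for c
  proof (cases "c \<le> 1")
    case True
    have "1 / \<phi> (c * r) \<le> (C * (1 / c) powr b) / \<phi> r" if "0 < r" for r
      using upper[of "c * r" r] True that c pos[of r] pos[of "c * r"]
      by (simp add: divide_simps mult_left_le_one_le)
    then show ?thesis using C c by (intro exI[of _ "C * (1 / c) powr b"]) auto
  next
    case False
    have "1 / \<phi> (c * r) \<le> 1 / \<phi> r" if "0 < r" for r
      using mono[of r "c * r"] False that c pos[of r] pos[of "c * r"] by (simp add: frac_le)
    then show ?thesis by (intro exI[of _ 1]) auto
  qed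
  obtain K1 where K1: "K1 > 0" "\<And>r. 0 < r \<Longrightarrow> 1 / \<phi> (c * r) \<le> K1 / \<phi> r" using *[OF assms] by blast
  obtain K2 where K2: "K2 > 0" "\<And>r. 0 < r \<Longrightarrow> 1 / \<phi> (1 / c * r) \<le> K2 / \<phi> r" using *[of "1 / c"] assms by auto
  show thesis
  proof (rule that[of "max K1 K2"])
    show "0 < max K1 K2" using K1 by auto
    fix r :: real assume r: "0 < r"
    have "K1 / \<phi> r \<le> max K1 K2 / \<phi> r" using pos[OF r] by (simp add: divide_right_mono)
    with K1(2)[OF r] show "1 / \<phi> (c * r) \<le> max K1 K2 / \<phi> r" by simp
    have "K2 / \<phi> (c * r) \<le> max K1 K2 / \<phi> (c * r)" using pos[of "c * r"] r assms by (simp add: divide_right_mono)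
    with K2(2)[of "c * r"] r assms show "1 / \<phi> r \<le> max K1 K2 / \<phi> (c * r)" by simp
  qed
qed

end

lemma LU_scaling: assumes "LU a b \<phi>" obtains C where "scaling \<phi> a b C"
  using assms by (auto simp: LU_def scaling_def)

text \<open>Decide which function attains the minimum in the place where it should not be changed:
  at \<open>R\<close> for the lower bound, at \<open>r\<close> for the upper one. In the other place
  the minimum only moves the quotient in the favourable direction. The extreme exponents serve both
  functions since R/r \<ge> 1.\<close>

lemma scaling_scale_min:
  assumes "scaling f a1 b1 C1" and "scaling g a2 b2 C2"
  shows "scaling (scale_min f g) (min a1 a2) (max b1 b2) (max C1 C2)"
proof -
  interpret f: scaling f a1 b1 C1 by fact
  interpret g: scaling g a2 b2 C2 by fact
  let ?h = "scale_min f g"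
  have pos: "0 < ?h r" if "0 < r" for r using f.pos g.pos that by (simp add: scale_min_def)
  have L: "q powr min a1 a2 / max C1 C2 \<le> q powr a1 / C1" "q powr min a1 a2 / max C1 C2 \<le> q powr a2 / C2"
    and U: "C1 * q powr b1 \<le> max C1 C2 * q powr max b1 b2" "C2 * q powr b2 \<le> max C1 C2 * q powr max b1 b2"
    if "1 \<le> q" for q :: real
    using that f.C g.C by (auto intro!: frac_le mult_mono powr_mono)
  show ?thesis
  proof
    show "0 < min a1 a2" "min a1 a2 \<le> max b1 b2" "1 \<le> max C1 C2"
      using f.a g.a f.ab f.C by auto
    show "continuous_on {0..} ?h"
      unfolding scale_min_def by (intro continuous_on_min f.cont g.cont)
    show "strict_mono_on {0..} ?h"
      using f.less g.less by (auto simp: strict_mono_on_def scale_min_def min_def) fastforce+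
    show "?h 0 = 0" by (simp add: scale_min_def)
    fix r R :: real assume rR: "0 < r" "r \<le> R"
    then have q: "1 \<le> R / r" and R: "0 < R" by auto
    have p: "0 < f r" "0 < g r" "0 < f R" "0 < g R" using f.pos g.pos rR R by auto
    have hr: "?h r \<le> f r" "?h r \<le> g r" "?h R \<le> f R" "?h R \<le> g R" by (auto simp: scale_min_def)
    note pr = pos[OF rR(1)] pos[OF R]
    show "(R / r) powr min a1 a2 / max C1 C2 \<le> ?h R / ?h r"
    proof (cases "f R \<le> g R")
      case True
      have "(R / r) powr min a1 a2 / max C1 C2 \<le> f R / f r"
        using L(1)[OF q] f.lower[OF rR] by linarith
      also have "\<dots> \<le> f R / ?h r" using p pr hr by (intro divide_left_mono) auto
      finally show ?thesis using True by (simp add: scale_min_def)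
    next
      case False
      have "(R / r) powr min a1 a2 / max C1 C2 \<le> g R / g r"
        using L(2)[OF q] g.lower[OF rR] by linarith
      also have "\<dots> \<le> g R / ?h r" using p pr hr by (intro divide_left_mono) auto
      finally show ?thesis using False by (simp add: scale_min_def)
    qed
    show "?h R / ?h r \<le> max C1 C2 * (R / r) powr max b1 b2"
    proof (cases "f r \<le> g r")
      case True
      have "?h R / f r \<le> f R / f r" using p hr by (simp add: divide_right_mono)
      also have "\<dots> \<le> max C1 C2 * (R / r) powr max b1 b2"
        using U(1)[OF q] f.upper[OF rR] by linarith
      finally show ?thesis using True by (simp add: scale_min_def)
    next
      case False
      have "?h R / g r \<le> g R / g r" using p hr by (simp add: divide_right_mono)
      also have "\<dots> \<le> max C1 C2 * (R / r) powr max b1 b2"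
        using U(2)[OF q] g.upper[OF rR] by linarith
      finally show ?thesis using False by (simp add: scale_min_def)
    qed
  qed
qed

section \<open>The Levy measure\<close>

lemma nn_integral_powr_tail:
  fixes g T :: real assumes "0 < g" "0 < T"
  shows "(\<integral>\<^sup>+t. ennreal (t powr (- g - 1)) * indicator {T..} t \<partial>lborel) = ennreal (T powr (- g) / g)"
proof -
  have "((\<lambda>t. t powr - g) \<longlongrightarrow> 0) at_top"
    using assms by (intro tendsto_neg_powr filterlim_ident) auto
  then have lim: "((\<lambda>t. - (t powr - g) / g) \<longlongrightarrow> - 0 / g) at_top"
    by (intro tendsto_intros) (use assms in auto)
  have "(\<integral>\<^sup>+t. ennreal (t powr (- g - 1)) * indicator {T..} t \<partial>lborel) = ennreal (0 - (- (T powr (- g)) / g))"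
  proof (rule nn_integral_FTC_atLeast)
    show "((\<lambda>t. - (t powr (- g)) / g) has_real_derivative t powr (- g - 1)) (at t)" if "T \<le> t" for t
      using assms that by (auto intro!: derivative_eq_intros simp: powr_diff powr_minus field_simps)
    show "((\<lambda>t. - (t powr - g) / g) \<longlongrightarrow> 0) at_top" using lim by simp
  qed auto
  then show ?thesis by simp
qed

lemma nn_integral_powr_0:
  fixes g T :: real assumes "0 < g" "0 < T"
  shows "(\<integral>\<^sup>+t. ennreal (t powr (g - 1)) * indicator {0<..T} t \<partial>lborel) = ennreal (T powr g / g)"
proof -
  have "((\<lambda>t. t powr (g - 1)) has_integral (T powr (g - 1 + 1) / (g - 1 + 1))) {0..T}"
    using assms by (intro has_integral_powr_from_0) auto
  then have "(\<integral>\<^sup>+t. ennreal (t powr (g - 1)) * indicator {0..T} t \<partial>lborel) = ennreal (T powr (g - 1 + 1) / (g - 1 + 1))"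
    by (intro nn_integral_has_integral_lebesgue') auto
  also have "(\<integral>\<^sup>+t. ennreal (t powr (g - 1)) * indicator {0..T} t \<partial>lborel) = (\<integral>\<^sup>+t. ennreal (t powr (g - 1)) * indicator {0<..T} t \<partial>lborel)"
    by (intro nn_integral_cong) (auto split: split_indicator)
  finally show ?thesis by simp
qed

text \<open>The right-hand side is the maximum of the left one, attained at x = M;
  \<open>ln y \<le> y - 1\<close> at y = x/M yields it without differentiation.\<close>

lemma powr_times_exp_le:
  fixes x M :: real assumes "0 < M" "0 < x" shows "x powr M * exp (- x) \<le> exp (M * ln M - M)"
proof -
  have "ln (x / M) \<le> x / M - 1" using assms by (intro ln_le_minus_one) auto
  then have "M * ln (x / M) \<le> M * (x / M - 1)" using assms by (intro mult_left_mono) auto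
  then have "M * ln x - x \<le> M * ln M - M"
    using assms by (simp add: ln_div algebra_simps)
  then have "exp (M * ln x - x) \<le> exp (M * ln M - M)" by simp
  then show ?thesis using assms by (simp add: powr_def exp_diff exp_minus divide_inverse)
qed

definition levy_measure :: "(real \<Rightarrow> real) \<Rightarrow> (real \<Rightarrow> real) \<Rightarrow> real measure" where
  "levy_measure \<phi> \<psi> = density lborel (\<lambda>t. ennreal (indicator {0<..} t * levy_density \<phi> \<psi> t))"

lemma space_levy_measure [simp]: "space (levy_measure \<phi> \<psi>) = UNIV"
  and sets_levy_measure [simp, measurable_cong]: "sets (levy_measure \<phi> \<psi>) = sets borel"
  by (auto simp: levy_measure_def)

locale levy_scaling = phi: scaling \<phi> a b C + psi: scaling \<psi> a' b' C'
  for \<phi> a b C \<psi> a' b' C'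
begin

abbreviation n where "n \<equiv> levy_density \<phi> \<psi>"
abbreviation N where "N \<equiv> levy_measure \<phi> \<psi>"
abbreviation iv where "iv \<equiv> scale_inv \<phi>"

lemma n_pos: "0 < t \<Longrightarrow> 0 < n t"
  using phi.inv_pos psi.pos by (simp add: levy_density_def)

text \<open>Measurability comes from monotonicity: \<psi> composed with the inverse of \<phi> is
  increasing on the positive half-line.\<close>

lemma measurable_n [measurable]: "(\<lambda>t. indicator {0<..} t * n t) \<in> borel_measurable borel"
proof -
  have "(\<lambda>t. \<psi> (iv t)) \<in> borel_measurable (restrict_space borel {0<..})"
    by (rule borel_measurable_mono_on_fnc)
       (auto simp: mono_on_def intro!: psi.mono phi.inv_mono phi.inv)
  moreover have "(\<lambda>t::real. t) \<in> borel_measurable (restrict_space borel {0<..})"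
    by (intro measurable_restrict_space1) auto
  ultimately have "n \<in> borel_measurable (restrict_space borel {0<..})"
    unfolding levy_density_def by (intro borel_measurable_divide borel_measurable_times) auto
  then show ?thesis by (subst (asm) borel_measurable_restrict_space_iff) auto
qed

lemma nn_integral_N:
  assumes [measurable]: "f \<in> borel_measurable borel"
  shows "(\<integral>\<^sup>+t. f t \<partial>N) = (\<integral>\<^sup>+t. f t * ennreal (n t) * indicator {0<..} t \<partial>lborel)"
  unfolding levy_measure_def
  by (subst nn_integral_density)
     (auto intro!: nn_integral_cong simp: mult_ac[where 'a = ennreal] split: split_indicator)

lemma AE_N_pos: "AE t in N. 0 < t"
  unfolding levy_measure_def by (subst AE_density) (auto split: split_indicator)

text \<open>\<psi> composed with the inverse of \<phi> grows at least like a positive power of t, so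
  beyond T the Levy density is dominated by a pure power decaying faster than 1/t, normalised by its
  value at T. The tail is thus comparable to T times the density there.\<close>

lemma tail: obtains K where "0 < K" "\<And>T. 0 < T \<Longrightarrow> emeasure N {T..} \<le> ennreal (K / \<psi> (iv T))"
proof -
  \<comment> \<open>Lower scaling exponent of \<psi> composed with the inverse of \<phi>:
    \<open>a'\<close> from \<psi>, 1/b from the inverse.\<close>
  define g where "g = a' / b"
  define A where "A = C' * C powr g"
  have g: "0 < g" using psi.a phi.b by (simp add: g_def)
  have A: "0 < A" using psi.C phi.C by (simp add: A_def)
  have "emeasure N {T..} \<le> ennreal (A / g / \<psi> (iv T))" if T: "0 < T" for T
  proof -
    have le: "n t \<le> A / \<psi> (iv T) * T powr g * t powr (- g - 1)" if t: "T \<le> t" for t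
    proof -
      have t0: "0 < t" using T t by simp
      have p: "0 < \<psi> (iv T)" "0 < \<psi> (iv t)" using T t0 phi.inv_pos psi.pos by auto
      have "(t / T) powr g / C powr g = ((t / T / C) powr (1 / b)) powr a'"
        using T t0 phi.C by (simp add: powr_powr g_def powr_divide powr_mult)
      also have "\<dots> \<le> (iv t / iv T) powr a'"
        using phi.inv_lower[OF T t] psi.a by (intro powr_mono2) auto
      also have "\<dots> \<le> C' * (\<psi> (iv t) / \<psi> (iv T))"
        using psi.lower[OF phi.inv_pos[OF T] phi.inv_mono, of t] T t psi.C by (simp add: field_simps)
      finally have "(t / T) powr g \<le> C powr g * (C' * (\<psi> (iv t) / \<psi> (iv T)))"
        using phi.C by (simp add: field_simps)
      also have "\<dots> = A * \<psi> (iv t) / \<psi> (iv T)" by (simp add: A_def)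
      finally have *: "(t / T) powr g * \<psi> (iv T) \<le> A * \<psi> (iv t)" using p by (simp add: field_simps)
      have **: "T powr g * t powr (-g) * (t / T) powr g = 1"
        using T t0 by (simp add: powr_divide powr_minus)
      have "1 * \<psi> (iv T) = T powr g * t powr (-g) * ((t / T) powr g * \<psi> (iv T))"
        using ** by (simp only: mult.assoc[symmetric])
      also have "\<dots> \<le> T powr g * t powr (-g) * (A * \<psi> (iv t))"
        using * by (intro mult_left_mono) auto
      finally have "1 / \<psi> (iv t) \<le> A / \<psi> (iv T) * T powr g * t powr (-g)"
        using p by (simp add: field_simps)
      then have "1 / \<psi> (iv t) / t \<le> A / \<psi> (iv T) * T powr g * t powr (-g) / t"
        using t0 by (intro divide_right_mono) auto
      also have "\<dots> = A / \<psi> (iv T) * T powr g * t powr (-g - 1)"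
        using t0 by (simp add: powr_diff)
      finally show ?thesis by (simp add: levy_density_def mult.commute)
    qed
    have "emeasure N {T..} = (\<integral>\<^sup>+t. indicator {T..} t \<partial>N)" by simp
    also have "\<dots> = (\<integral>\<^sup>+t. indicator {T..} t * ennreal (n t) * indicator {0<..} t \<partial>lborel)"
      by (rule nn_integral_N) simp
    also have "\<dots> \<le> (\<integral>\<^sup>+t. ennreal (A / \<psi> (iv T) * T powr g) * (ennreal (t powr (- g - 1)) * indicator {T..} t) \<partial>lborel)"
      using T A le psi.pos[OF phi.inv_pos[OF T]] by (intro nn_integral_mono) (auto simp flip: ennreal_mult'' split: split_indicator intro!: ennreal_leI)
    also have "\<dots> = ennreal (A / \<psi> (iv T) * T powr g) * ennreal (T powr (- g) / g)"
      using g T by (simp add: nn_integral_cmult nn_integral_powr_tail)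
    also have "\<dots> = ennreal (A / \<psi> (iv T) * T powr g * (T powr (- g) / g))"
      using g T A by (intro ennreal_mult[symmetric]) (auto intro!: mult_nonneg_nonneg divide_nonneg_nonneg less_imp_le[OF psi.pos[OF phi.inv_pos]])
    also have "A / \<psi> (iv T) * T powr g * (T powr (- g) / g) = A / g / \<psi> (iv T)"
      using T by (simp add: powr_minus field_simps)
    finally show ?thesis .
  qed
  with A g show thesis by (intro that[of "A / g"]) auto
qed

context
  assumes integrable: "set_integrable lborel {0<..} (\<lambda>t. min 1 t * levy_density \<phi> \<psi> t)"
begin

lemma nn_integral_min1_finite: "(\<integral>\<^sup>+t. ennreal (min 1 t) \<partial>N) < \<infinity>"
proof -
  have "(\<integral>\<^sup>+t. ennreal (min 1 t) \<partial>N) = (\<integral>\<^sup>+t. ennreal (norm (indicator {0<..} t *\<^sub>R (min 1 t * n t))) \<partial>lborel)"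
    using n_pos by (subst nn_integral_N) (auto intro!: nn_integral_cong simp: ennreal_mult' less_imp_le abs_mult split: split_indicator)
  also have "\<dots> < \<infinity>" using integrable unfolding set_integrable_def integrable_iff_bounded by blast
  finally show ?thesis .
qed

lemma one_minus_exp_le: fixes l t :: real assumes that: "0 < l" "0 < t"
  shows "1 - exp (- (l * t)) \<le> max 1 l * min 1 t"
proof -
  have "1 - exp (- (l * t)) \<le> l * t" using exp_ge_add_one_self[of "- (l * t)"] by simp
  moreover have "1 - exp (- (l * t)) \<le> max 1 l" by (rule order_trans[of _ 1]) auto
  moreover have "l * t \<le> max 1 l * t" using that by (intro mult_right_mono) auto
  ultimately show ?thesis by (cases "t \<le> 1") (auto simp: min_def)
qed

text \<open>As a nonnegative integral against \<open>N\<close> the Bernstein function can be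
  compared with truncated moments by mere monotonicity; integrability of the integrand comes from
  its bound by a multiple of \<open>min 1 t\<close>.\<close>

lemma bernstein_eq: assumes l: "0 < l"
  shows "ennreal (bernstein \<phi> \<psi> l) = (\<integral>\<^sup>+t. ennreal (1 - exp (- l * t)) \<partial>N)"
proof -
  have eq: "(\<integral>\<^sup>+t. ennreal (1 - exp (- l * t)) \<partial>N) = (\<integral>\<^sup>+t. ennreal (indicator {0<..} t *\<^sub>R ((1 - exp (- l * t)) * n t)) \<partial>lborel)"
    using n_pos l by (subst nn_integral_N) (auto intro!: nn_integral_cong simp: ennreal_mult' less_imp_le split: split_indicator)
  have m: "(\<lambda>t. indicator {0<..} t *\<^sub>R ((1 - exp (- l * t)) * n t)) \<in> borel_measurable lborel"
  proof -
    have "(\<lambda>t. (1 - exp (- l * t)) * (indicator {0<..} t * n t)) \<in> borel_measurable borel" by measurable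
    then show ?thesis by (simp add: mult_ac)
  qed
  have "integrable lborel (\<lambda>t. indicator {0<..} t *\<^sub>R ((1 - exp (- l * t)) * n t))"
  proof (rule Bochner_Integration.integrable_bound)
    show "integrable lborel (\<lambda>t. max 1 l * (indicator {0<..} t *\<^sub>R (min 1 t * n t)))"
      using integrable by (simp add: set_integrable_def)
    show "AE t in lborel. norm (indicator {0<..} t *\<^sub>R ((1 - exp (- l * t)) * n t)) \<le> norm (max 1 l * (indicator {0<..} t *\<^sub>R (min 1 t * n t)))"
    proof (intro AE_I2)
      fix t :: real
      have "(1 - exp (- (l * t))) * n t \<le> max 1 l * min 1 t * n t" if "0 < t"
        using one_minus_exp_le[OF l that] n_pos[OF that] by (intro mult_right_mono) auto
      then show "norm (indicator {0<..} t *\<^sub>R ((1 - exp (- l * t)) * n t)) \<le> norm (max 1 l * (indicator {0<..} t *\<^sub>R (min 1 t * n t)))"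
        using l n_pos[of t] by (auto simp: abs_mult mult_ac split: split_indicator)
    qed
  qed fact
  then have "(\<integral>\<^sup>+t. ennreal (indicator {0<..} t *\<^sub>R ((1 - exp (- l * t)) * n t)) \<partial>lborel) = ennreal (bernstein \<phi> \<psi> l)"
    unfolding bernstein_def set_lebesgue_integral_def
    using l n_pos by (intro nn_integral_eq_integral) (auto split: split_indicator intro!: mult_nonneg_nonneg less_imp_le)
  then show ?thesis unfolding eq by (rule sym)
qed

lemma bernstein_nonneg: "0 < l \<Longrightarrow> 0 \<le> bernstein \<phi> \<psi> l"
  unfolding bernstein_def set_lebesgue_integral_def
proof (intro integral_nonneg_AE AE_I2)
  fix t :: real assume "0 < l"
  then show "0 \<le> indicator {0<..} t *\<^sub>R ((1 - exp (- l * t)) * n t)"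
    using n_pos[of t] by (auto split: split_indicator)
qed

text \<open>A zero value would make \<open>N\<close> the null measure although its density is
  positive on (0,1]. Positivity is what allows the laws of the subordinator to be normalised
  later.\<close>

lemma bernstein_pos: assumes l: "0 < l" shows "0 < bernstein \<phi> \<psi> l"
proof (rule ccontr)
  assume "\<not> 0 < bernstein \<phi> \<psi> l"
  then have "(\<integral>\<^sup>+t. ennreal (1 - exp (- l * t)) \<partial>N) = 0" using bernstein_eq[OF l] bernstein_nonneg[OF l] by simp
  then have "AE t in N. ennreal (1 - exp (- l * t)) = 0" by (subst (asm) nn_integral_0_iff_AE) auto
  then have "AE t in N. False" using AE_N_pos by eventually_elim (use l in \<open>auto simp: ennreal_eq_0_iff mult_le_0_iff\<close>)
  then have "AE t in lborel. 0 < ennreal (indicator {0<..} t * n t) \<longrightarrow> False"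
    unfolding levy_measure_def by (subst (asm) AE_density) simp_all
  then have "AE t in lborel. t \<notin> {0::real<..}"
    by (rule eventually_mono) (use n_pos in \<open>auto simp: indicator_def split: if_splits\<close>)
  then have "AE t in lborel. t \<notin> {0<..1::real}" by (rule eventually_mono) auto
  then have "emeasure lborel {0<..1::real} = 0"
    by (subst (asm) AE_iff_measurable[of "{0<..1}"]) auto
  then show False by simp
qed

text \<open>For 0 < z \<le> 1 one has z \<le> 2 (1 - exp (-z)), because exp (-z) \<le> 1 / (1 + z)
  \<le> 1 - z/2. With z = t/R the truncated first moment is controlled by the Bernstein function at
  1/R.\<close>

lemma small_jumps_le: assumes "0 < R"
  shows "(\<integral>\<^sup>+t. ennreal (t / R) * indicator {0<..R} t \<partial>N) \<le> ennreal (2 * bernstein \<phi> \<psi> (1 / R))"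
proof -
  have "t / R \<le> 2 * (1 - exp (- (1 / R) * t))" if "0 < t" "t \<le> R" for t
  proof -
    define z where "z = t / R"
    have z: "0 < z" "z \<le> 1" using that by (auto simp: z_def)
    have "exp (- z) \<le> 1 / (1 + z)" using exp_ge_add_one_self[of z] z by (simp add: exp_minus divide_simps)
    moreover have "1 / (1 + z) \<le> 1 - z / 2" using z by (simp add: field_simps)
    ultimately show ?thesis by (simp add: z_def)
  qed
  then have "(\<integral>\<^sup>+t. ennreal (t / R) * indicator {0<..R} t \<partial>N) \<le> (\<integral>\<^sup>+t. ennreal 2 * ennreal (1 - exp (- (1 / R) * t)) \<partial>N)"
    by (intro nn_integral_mono) (auto split: split_indicator intro!: ennreal_leI simp del: ennreal_numeral simp flip: ennreal_mult')
  also have "\<dots> = ennreal 2 * ennreal (bernstein \<phi> \<psi> (1 / R))"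
    using assms by (simp add: nn_integral_cmult bernstein_eq del: ennreal_numeral)
  finally show ?thesis by (simp add: ennreal_mult')
qed

text \<open>Converse comparison, from 1 - exp (-z) \<le> z and 1 - exp (-z) \<le> 1. The cut-off T
  is independent of R because the lower heat kernel bound changes its form at \<phi>(c2 r), whereas
  R will be \<phi>j(r).\<close>

lemma bernstein_le_split: assumes "0 < R" "0 < T"
  shows "ennreal (bernstein \<phi> \<psi> (1 / R)) \<le> (\<integral>\<^sup>+t. ennreal (t / R) * indicator {0<..<T} t \<partial>N) + emeasure N {T..}"
proof -
  have "ennreal (bernstein \<phi> \<psi> (1 / R)) = (\<integral>\<^sup>+t. ennreal (1 - exp (- (1 / R) * t)) \<partial>N)"
    using assms by (simp add: bernstein_eq)
  also have "\<dots> \<le> (\<integral>\<^sup>+t. ennreal (t / R) * indicator {0<..<T} t + indicator {T..} t \<partial>N)"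
  proof (intro nn_integral_mono_AE, use AE_N_pos in eventually_elim)
    fix t :: real assume "0 < t"
    have "1 - exp (- (1 / R) * t) \<le> t / R" using exp_ge_add_one_self[of "- t / R"] by simp
    moreover have "1 - exp (- (1 / R) * t) \<le> 1" by simp
    ultimately show "ennreal (1 - exp (- (1 / R) * t)) \<le> ennreal (t / R) * indicator {0<..<T} t + indicator {T..} t"
      using \<open>0 < t\<close> by (cases "T \<le> t") (auto intro!: ennreal_leI)
  qed
  also have "\<dots> = (\<integral>\<^sup>+t. ennreal (t / R) * indicator {0<..<T} t \<partial>N) + emeasure N {T..}"
    by (subst nn_integral_add) auto
  finally show ?thesis .
qed

end

end

section \<open>Integrating the heat kernel bounds\<close>

locale kernel_estimate =
  c: scaling \<phi>c ac bc Cc + j: scaling \<phi>j aj bj Cj + levy_scaling "scale_min \<phi>c \<phi>j" a b C \<psi> a' b' C'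
  for \<phi>c ac bc Cc \<phi>j aj bj Cj a b C \<psi> a' b' C' +
  fixes \<mu> :: "'a::metric_space measure" and D d :: real
  assumes ac: "1 < ac"
    and integrable: "set_integrable lborel {0<..} (\<lambda>t. min 1 t * levy_density (scale_min \<phi>c \<phi>j) \<psi> t)"
    and vol_pos: "\<And>x r. 0 < r \<Longrightarrow> 0 < vol \<mu> x r"
    and vol_mono: "\<And>x r R. r \<le> R \<Longrightarrow> vol \<mu> x r \<le> vol \<mu> x R"
    and D: "1 \<le> D" and d: "0 < d"
    and doubling: "\<And>x r R. 0 < r \<Longrightarrow> r \<le> R \<Longrightarrow> vol \<mu> x R \<le> D * (R / r) powr d * vol \<mu> x r"
begin

abbreviation \<phi> where "\<phi> \<equiv> scale_min \<phi>c \<phi>j"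
abbreviation \<Phi> where "\<Phi> \<equiv> bernstein \<phi> \<psi>"

lemma phi_le: "\<phi> r \<le> \<phi>c r" "\<phi> r \<le> \<phi>j r" by (auto simp: scale_min_def)

text \<open>Near s = 0 the lower exponent \<open>ac\<close> > 1 makes t/\<phi>c(s) overtake r/s.
  Boundedness is what makes the real-valued \<open>SUP\<close> in \<open>p_c\<close> a true upper
  bound of its terms.\<close>

lemma bdd_above_exponent:
  assumes "0 < r" "0 < t" shows "bdd_above ((\<lambda>s. r / s - t / \<phi>c s) ` {0<..})"
proof -
  define k where "k = Cc * \<phi>c 1"
  have k: "0 < k" using c.C c.pos by (simp add: k_def)
  \<comment> \<open>Solution of r/s = t / (k s^ac): below \<open>s0\<close> the difference is
    nonpositive, from \<open>s0\<close> up to 1 it is at most r/s0, and beyond 1 at most r.\<close>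
  define s0 where "s0 = (t / (k * r)) powr (1 / (ac - 1))"
  have s0: "0 < s0" using assms k by (simp add: s0_def)
  have "r / s - t / \<phi>c s \<le> max 0 (max r (r / s0))" if s: "0 < s" for s
  proof (cases "s \<le> 1")
    case True
    have ps: "0 < \<phi>c s" using c.pos s by simp
    have "(1 / s) powr ac / Cc \<le> \<phi>c 1 / \<phi>c s" using c.lower[OF s True] .
    then have le: "\<phi>c s \<le> k * s powr ac"
      using ps s c.C by (simp add: k_def powr_divide field_simps)
    show ?thesis
    proof (cases "s powr (ac - 1) \<le> t / (k * r)")
      case True
      then have "k * r * (s powr ac / s) \<le> t" using k assms s by (simp add: powr_diff field_simps)
      then have "r / s \<le> t / (k * s powr ac)" using k s by (simp add: field_simps)
      also have "\<dots> \<le> t / \<phi>c s" using le ps assms by (intro divide_left_mono) auto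
      finally show ?thesis by simp
    next
      case False
      then have "s0 \<le> (s powr (ac - 1)) powr (1 / (ac - 1))"
        unfolding s0_def using assms k ac by (intro powr_mono2) auto
      then have "s0 \<le> s" using ac s by (simp add: powr_powr)
      then have "r / s \<le> r / s0" using assms s0 by (simp add: frac_le)
      moreover have "0 \<le> t / \<phi>c s" using ps assms by simp
      ultimately show ?thesis by simp
    qed
  next
    case False
    have "r / s \<le> r" using False assms by (simp add: divide_simps)
    moreover have "0 \<le> t / \<phi>c s" using c.pos[OF s] assms by simp
    ultimately show ?thesis by simp
  qed
  then show ?thesis by (intro bdd_aboveI[of _ "max 0 (max r (r / s0))"]) auto
qed

text \<open>The supremum is bounded from below by its value at \<open>s = \<phi>c\<^sup>-\<^sup>1(t)\<close>.\<close>

lemma p_c_le: assumes M: "0 < M"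
  obtains A where "0 < A"
    "\<And>x y t. x \<noteq> y \<Longrightarrow> 0 < t \<Longrightarrow>
      p_c \<mu> \<phi>c t x y \<le> A / vol \<mu> x (dist x y) * (scale_inv \<phi>c t / dist x y) powr M"
proof -
  \<comment> \<open>Maximum of x^(d+M) exp (-x), to be used at x = 1 + z; \<open>d\<close> is the
    exponent of volume doubling.\<close>
  define B where "B = exp ((d + M) * ln (d + M) - (d + M))"
  define A where "A = D * exp 2 * B"
  have A: "0 < A" using D by (simp add: A_def B_def)
  have "p_c \<mu> \<phi>c t x y \<le> A / vol \<mu> x (dist x y) * (scale_inv \<phi>c t / dist x y) powr M"
    if xy: "x \<noteq> y" and t: "0 < t" for x y t
  proof -
    define r \<rho> where "r = dist x y" and "\<rho> = scale_inv \<phi>c t"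
    have r: "0 < r" and \<rho>: "0 < \<rho>" and fr: "\<phi>c \<rho> = t"
      using xy t c.inv_pos c.inv by (auto simp: r_def \<rho>_def)
    define z where "z = r / \<rho>"
    have z: "0 < z" using r \<rho> by (simp add: z_def)
    have "r / \<rho> - t / \<phi>c \<rho> \<le> (SUP s\<in>{0<..}. r / s - t / \<phi>c s)"
      using \<rho> by (intro cSUP_upper bdd_above_exponent r t) auto
    then have e: "exp (- (SUP s\<in>{0<..}. r / s - t / \<phi>c s)) \<le> exp (1 - z)"
      using t by (simp add: fr z_def)
    \<comment> \<open>With 1 + z in place of z = r/\<rho> one bound covers both cases, doubling for
      \<rho> \<le> r and monotonicity of the volume for \<rho> > r.\<close>
    have v: "vol \<mu> x r \<le> D * (1 + z) powr d * vol \<mu> x \<rho>"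
    proof (cases "\<rho> \<le> r")
      case True
      have "vol \<mu> x r \<le> D * z powr d * vol \<mu> x \<rho>" using doubling[OF \<rho> True] by (simp add: z_def)
      also have "\<dots> \<le> D * (1 + z) powr d * vol \<mu> x \<rho>"
        using D d z vol_pos[OF \<rho>, of x] by (intro mult_right_mono mult_left_mono powr_mono2) auto
      finally show ?thesis .
    next
      case False
      have "1 \<le> (1 + z) powr d" using z d by (simp add: ge_one_powr_ge_zero)
      then have "1 \<le> D * (1 + z) powr d" using D mult_mono[of 1 D 1 "(1 + z) powr d"] by simp
      then have "vol \<mu> x \<rho> \<le> D * (1 + z) powr d * vol \<mu> x \<rho>"
        using vol_pos[OF \<rho>, of x] by simp
      then show ?thesis using vol_mono[of r \<rho> x] False by linarith
    qed
    then have v': "1 / vol \<mu> x \<rho> \<le> D * (1 + z) powr d / vol \<mu> x r"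
      using vol_pos[OF \<rho>, of x] vol_pos[OF r, of x] by (simp add: field_simps)
    \<comment> \<open>Rewriting exp (1 - z) as exp 2 times exp (-(1 + z)) brings everything to the
      variable 1 + z, which explains the factor \<open>exp 2\<close> in \<open>A\<close>.\<close>
    have "(1 + z) powr d * exp (1 - z) * z powr M \<le> (1 + z) powr d * exp (1 - z) * (1 + z) powr M"
      using z M by (intro mult_left_mono powr_mono2) auto
    also have "\<dots> = exp 2 * ((1 + z) powr (d + M) * exp (- (1 + z)))"
      using exp_add[of 2 "- (1 + z)"] by (simp add: powr_add mult_ac)
    also have "\<dots> \<le> exp 2 * B"
      unfolding B_def using z d M by (intro mult_left_mono powr_times_exp_le) auto
    finally have "(1 + z) powr d * exp (1 - z) \<le> exp 2 * B * z powr (- M)"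
      using z by (simp add: powr_minus field_simps)
    then have ze: "D * ((1 + z) powr d * exp (1 - z)) \<le> A * z powr (- M)"
      using D unfolding A_def by (simp add: mult.assoc)
    have "p_c \<mu> \<phi>c t x y \<le> 1 / vol \<mu> x \<rho> * exp (1 - z)"
      unfolding p_c_def using e vol_pos[OF \<rho>, of x]
      by (intro mult_mono) (auto simp: r_def \<rho>_def)
    also have "\<dots> \<le> D * (1 + z) powr d / vol \<mu> x r * exp (1 - z)"
      using v' by (intro mult_right_mono) auto
    also have "\<dots> = D * ((1 + z) powr d * exp (1 - z)) / vol \<mu> x r" by simp
    also have "\<dots> \<le> A * z powr (- M) / vol \<mu> x r"
      using ze vol_pos[OF r, of x] by (intro divide_right_mono) auto
    also have "z powr (- M) = (\<rho> / r) powr M"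
      using r \<rho> by (simp add: z_def powr_minus_divide powr_divide)
    finally show ?thesis by (simp add: r_def \<rho>_def)
  qed
  with A show thesis by (rule that)
qed

text \<open>Three factors meet: the decay of \<open>p_c\<close>, the density bounded by 1 / (t
  \<psi>(\<rho>)), and the scaling of \<psi> between \<rho> and r, which cancels \<psi>(\<rho>). The
  result is a power of t with exponent above -1, normalised by \<phi>c(r), so its integral up to
  \<phi>c(r) no longer depends on \<phi>c.\<close>

lemma p_c_density_le: assumes c4: "0 < c4"
  obtains B where "0 < B"
    "\<And>x y t. x \<noteq> y \<Longrightarrow> 0 < t \<Longrightarrow> t \<le> \<phi> (dist x y) \<Longrightarrow>
      p_c \<mu> \<phi>c (c4 * t) x y * n t \<le>
        B / (vol \<mu> x (dist x y) * \<psi> (dist x y)) * \<phi>c (dist x y) powr (- (1 / bc)) * t powr (1 / bc - 1)"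
proof -
  \<comment> \<open>The power \<open>b'\<close> is consumed by \<psi>, the additional factor
    \<rho>/r provides the positive power of t that makes the integral converge at 0.\<close>
  define M where "M = b' + 1"
  have M: "0 < M" using psi.b by (simp add: M_def)
  obtain A where A: "0 < A" and pc: "\<And>x y t. x \<noteq> y \<Longrightarrow> 0 < t \<Longrightarrow>
      p_c \<mu> \<phi>c t x y \<le> A / vol \<mu> x (dist x y) * (scale_inv \<phi>c t / dist x y) powr M"
    using p_c_le[OF M] by metis
  define k where "k = max 1 ((Cc * c4) powr (1 / ac))"
  define B where "B = A * k powr M * C' * Cc powr (1 / bc)"
  have k: "1 \<le> k" by (simp add: k_def)
  have B: "0 < B" using A k c.C psi.C by (simp add: B_def)
  have "p_c \<mu> \<phi>c (c4 * t) x y * n t \<le>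
        B / (vol \<mu> x (dist x y) * \<psi> (dist x y)) * \<phi>c (dist x y) powr (- (1 / bc)) * t powr (1 / bc - 1)"
    if xy: "x \<noteq> y" and t: "0 < t" "t \<le> \<phi> (dist x y)" for x y t
  proof -
    define r \<rho> where "r = dist x y" and "\<rho> = scale_inv \<phi>c t"
    have r: "0 < r" using xy by (simp add: r_def)
    have \<rho>: "0 < \<rho>" "\<phi>c \<rho> = t" using t c.inv_pos c.inv by (auto simp: \<rho>_def)
    have tr: "t \<le> \<phi>c r" using t phi_le(1)[of r] by (simp add: r_def)
    have \<rho>r: "\<rho> \<le> r" using tr t r c.inv_le_iff[of t r] by (simp add: \<rho>_def)
    \<comment> \<open>Since \<phi> lies below \<phi>c, its inverse lies above that of
      \<phi>c.\<close>
    have iv: "0 < iv t" "\<rho> \<le> iv t"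
      using phi.inv_pos phi.le_inv_iff[of t \<rho>] phi_le(1)[of \<rho>] t \<rho> by auto
    have p: "0 < vol \<mu> x r" "0 < \<psi> r" "0 < \<phi>c r" "0 < \<psi> \<rho>"
      using vol_pos psi.pos c.pos r \<rho> by auto
    have "scale_inv \<phi>c (c4 * t) \<le> k * \<rho>" using c.inv_scaled[OF c4 t(1)] by (simp add: k_def \<rho>_def)
    then have "scale_inv \<phi>c (c4 * t) / r \<le> k * (\<rho> / r)" using r by (simp add: divide_right_mono)
    then have "(scale_inv \<phi>c (c4 * t) / r) powr M \<le> (k * (\<rho> / r)) powr M"
      using M r c.inv_pos[of "c4 * t"] c4 t by (intro powr_mono2) auto
    also have "\<dots> = k powr M * ((\<rho> / r) powr b' * (\<rho> / r))"
      using k \<rho> r by (simp add: M_def powr_mult powr_add powr_divide)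
    finally have pw: "(scale_inv \<phi>c (c4 * t) / r) powr M \<le> k powr M * ((\<rho> / r) powr b' * (\<rho> / r))" .
    have "p_c \<mu> \<phi>c (c4 * t) x y \<le> A / vol \<mu> x r * (scale_inv \<phi>c (c4 * t) / r) powr M"
      using pc[OF xy, of "c4 * t"] c4 t by (simp add: r_def)
    also have "\<dots> \<le> A / vol \<mu> x r * (k powr M * ((\<rho> / r) powr b' * (\<rho> / r)))"
      using pw A p by (intro mult_left_mono) auto
    finally have 1: "p_c \<mu> \<phi>c (c4 * t) x y \<le> A / vol \<mu> x r * (k powr M * ((\<rho> / r) powr b' * (\<rho> / r)))" .
    have 2: "(\<rho> / r) powr b' \<le> C' * \<psi> \<rho> / \<psi> r"
      using psi.ge_powr[OF \<rho>(1) \<rho>r] p psi.C by (simp add: field_simps)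
    have "(\<phi>c r / t / Cc) powr (1 / bc) \<le> r / \<rho>"
      using c.inv_lower[OF t(1) tr] r by (simp add: c.inv_phi \<rho>_def)
    then have 3: "\<rho> / r \<le> Cc powr (1 / bc) * (\<phi>c r powr (- (1 / bc)) * t powr (1 / bc))"
      using p t r \<rho> c.C by (simp add: powr_divide powr_minus powr_mult field_simps)
    have 4: "n t \<le> 1 / (t * \<psi> \<rho>)"
      unfolding levy_density_def using t p \<rho> iv psi.mono[of \<rho> "iv t"] by (intro divide_left_mono mult_left_mono) auto
    have "p_c \<mu> \<phi>c (c4 * t) x y * n t \<le>
        A / vol \<mu> x r * (k powr M * ((\<rho> / r) powr b' * (\<rho> / r))) * (1 / (t * \<psi> \<rho>))"
      using 1 4 A p k \<rho> r t n_pos[OF t(1)] by (intro mult_mono) auto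
    also have "\<dots> \<le> A / vol \<mu> x r * (k powr M * ((C' * \<psi> \<rho> / \<psi> r) *
        (Cc powr (1 / bc) * (\<phi>c r powr (- (1 / bc)) * t powr (1 / bc))))) * (1 / (t * \<psi> \<rho>))"
      using 2 3 A p k \<rho> r t psi.C by (intro mult_right_mono mult_left_mono mult_mono) auto
    also have "\<dots> = B / (vol \<mu> x r * \<psi> r) * \<phi>c r powr (- (1 / bc)) * (t powr (1 / bc) / t)"
      using p t by (simp add: B_def)
    also have "t powr (1 / bc) / t = t powr (1 / bc - 1)" using t by (simp add: powr_diff)
    finally show ?thesis by (simp add: r_def)
  qed
  with B show thesis by (rule that)
qed

end

section \<open>Upper and lower bounds for the heat kernel integrated against the Levy
  measure\<close>

context kernel_estimate
begin

lemma jump_upper: assumes "0 < c3" "0 < c4"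
  obtains K where "0 < K" "\<And>x y p. x \<noteq> y \<Longrightarrow> p \<in> borel_measurable borel \<Longrightarrow>
    (\<And>t. 0 < t \<Longrightarrow> p t \<le> c3 * min (1 / vol \<mu> x (iv t)) (p_c \<mu> \<phi>c (c4 * t) x y + p_j \<mu> \<phi>j t x y)) \<Longrightarrow>
    (\<integral>\<^sup>+t. ennreal (p t) \<partial>N) \<le> ennreal (K * (1 / vol \<mu> x (dist x y) * (1 / \<psi> (dist x y) + \<Phi> (1 / \<phi>j (dist x y)))))"
proof -
  obtain K1 where K1: "0 < K1" "\<And>T. 0 < T \<Longrightarrow> emeasure N {T..} \<le> ennreal (K1 / \<psi> (iv T))"
    using tail by metis
  define g where "g = 1 / bc"
  have g: "0 < g" using c.b by (simp add: g_def)
  obtain B where B: "0 < B"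
    "\<And>x y t. x \<noteq> y \<Longrightarrow> 0 < t \<Longrightarrow> t \<le> \<phi> (dist x y) \<Longrightarrow>
      p_c \<mu> \<phi>c (c4 * t) x y * n t \<le>
        B / (vol \<mu> x (dist x y) * \<psi> (dist x y)) * \<phi>c (dist x y) powr (- g) * t powr (g - 1)"
    using p_c_density_le[OF assms(2)] unfolding g_def by metis
  \<comment> \<open>The summands belong to the tail of the Levy measure, to the diffusive part and
    to the factor 2 of \<open>small_jumps_le\<close>.\<close>
  define K where "K = c3 * (K1 + B / g + 2)"
  have K: "0 < K" using K1 B g assms by (simp add: K_def add_pos_pos)
  have "(\<integral>\<^sup>+t. ennreal (p t) \<partial>N) \<le> ennreal (K * (1 / vol \<mu> x (dist x y) * (1 / \<psi> (dist x y) + \<Phi> (1 / \<phi>j (dist x y)))))"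
    if xy: "x \<noteq> y" and [measurable]: "p \<in> borel_measurable borel"
      and p: "\<And>t. 0 < t \<Longrightarrow> p t \<le> c3 * min (1 / vol \<mu> x (iv t)) (p_c \<mu> \<phi>c (c4 * t) x y + p_j \<mu> \<phi>j t x y)"
    for x y p
  proof -
    define r where "r = dist x y"
    have r: "0 < r" using xy by (simp add: r_def)
    define v where "v = vol \<mu> x r"
    have v: "0 < v" using vol_pos r by (simp add: v_def)
    have ps: "0 < \<psi> r" "0 < \<phi>c r" "0 < \<phi>j r" "0 < \<phi> r" "0 \<le> \<Phi> (1 / \<phi>j r)"
      using psi.pos c.pos j.pos phi.pos r bernstein_nonneg[OF integrable] by auto
    define E where "E = B / (v * \<psi> r) * \<phi>c r powr (- g)"
    have E: "0 \<le> E" using B v ps by (simp add: E_def)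
    define n' where "n' = (\<lambda>t. indicator {0<..} t * n t)"
    have [measurable]: "n' \<in> borel_measurable borel" unfolding n'_def by simp
    have n': "0 \<le> n' t" for t using n_pos[of t] by (auto simp: n'_def split: split_indicator)
    \<comment> \<open>For t < \<phi>(r) the two small-time terms are allowed to live on the larger
      intervals up to \<phi>c(r) and \<phi>j(r): the power integral then cancels
      \<open>\<phi>c r powr (- g)\<close> exactly, and \<open>small_jumps_le\<close> applies with R
      = \<phi>j(r).\<close>
    have pointwise: "ennreal (p t) * ennreal (n t) * indicator {0<..} t \<le>
        ennreal (c3 / v) * (indicator {\<phi> r..} t * ennreal (n' t)) +
        (ennreal (c3 * E) * (ennreal (t powr (g - 1)) * indicator {0<..\<phi>c r} t) +
         ennreal (c3 / v) * (ennreal (t / \<phi>j r) * indicator {0<..\<phi>j r} t * ennreal (n' t)))" for t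
    proof (cases "0 < t")
      case t: True
      then have nt: "n' t = n t" "0 < n t" using n_pos by (auto simp: n'_def)
      show ?thesis
      proof (cases "\<phi> r \<le> t")
        case True
        then have "r \<le> iv t" using phi.le_inv_iff[of t r] r t by simp
        then have "1 / vol \<mu> x (iv t) \<le> 1 / v"
          unfolding v_def using vol_mono vol_pos r by (intro divide_left_mono) (auto intro!: mult_pos_pos)
        then have "c3 * min (1 / vol \<mu> x (iv t)) (p_c \<mu> \<phi>c (c4 * t) x y + p_j \<mu> \<phi>j t x y) \<le> c3 * (1 / v)"
          using assms by (intro mult_left_mono) auto
        then have "p t \<le> c3 / v" using p[OF t] by simp
        then have "p t * n t \<le> c3 / v * n' t" unfolding nt(1) using nt(2) by (intro mult_right_mono) auto
        then have "ennreal (p t) * ennreal (n t) * indicator {0<..} t \<le> ennreal (c3 / v) * (indicator {\<phi> r..} t * ennreal (n' t))"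
          using True t nt assms v by (simp flip: ennreal_mult' ennreal_mult'' add: ennreal_leI)
        then show ?thesis by (rule order_trans) (simp add: add_increasing2)
      next
        case False
        then have t': "t \<le> \<phi> r" "t \<le> \<phi>c r" "t \<le> \<phi>j r" using phi_le[of r] by auto
        have "p_j \<mu> \<phi>j t x y \<le> t / (v * \<phi>j r)" using xy by (simp add: p_j_def r_def v_def)
        then have "c3 * min (1 / vol \<mu> x (iv t)) (p_c \<mu> \<phi>c (c4 * t) x y + p_j \<mu> \<phi>j t x y) \<le> c3 * (p_c \<mu> \<phi>c (c4 * t) x y + t / (v * \<phi>j r))"
          using assms by (intro mult_left_mono) auto
        then have "p t \<le> c3 * (p_c \<mu> \<phi>c (c4 * t) x y + t / (v * \<phi>j r))"
          using p[OF t] by linarith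
        then have "p t * n t \<le> c3 * (p_c \<mu> \<phi>c (c4 * t) x y + t / (v * \<phi>j r)) * n t"
          using nt by (intro mult_right_mono) auto
        also have "\<dots> = c3 * (p_c \<mu> \<phi>c (c4 * t) x y * n t) + c3 / v * (t / \<phi>j r * n' t)"
          using nt by (simp add: field_simps)
        also have "p_c \<mu> \<phi>c (c4 * t) x y * n t \<le> E * t powr (g - 1)"
          using B(2)[OF xy t] t' by (simp add: r_def E_def v_def)
        finally have "p t * n t \<le> c3 * E * t powr (g - 1) + c3 / v * (t / \<phi>j r * n' t)"
          using assms by (simp add: mult.assoc)
        then have "ennreal (p t * n t) \<le> ennreal (c3 * E * t powr (g - 1) + c3 / v * (t / \<phi>j r * n' t))"
          by (rule ennreal_leI)
        also have "\<dots> = ennreal (c3 * E * t powr (g - 1)) + ennreal (c3 / v * (t / \<phi>j r * n' t))"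
          using assms E v t ps n'[of t] by (intro ennreal_plus mult_nonneg_nonneg) auto
        also have "ennreal (c3 * E * t powr (g - 1)) = ennreal (c3 * E) * ennreal (t powr (g - 1))"
          using assms E by (intro ennreal_mult) auto
        also have "ennreal (c3 / v * (t / \<phi>j r * n' t)) = ennreal (c3 / v) * (ennreal (t / \<phi>j r) * ennreal (n' t))"
          using assms v t ps n'[of t] by (subst ennreal_mult, simp, simp, subst ennreal_mult) auto
        finally have "ennreal (p t * n t) \<le> ennreal (c3 * E) * ennreal (t powr (g - 1)) +
          ennreal (c3 / v) * (ennreal (t / \<phi>j r) * ennreal (n' t))" .
        moreover have "ennreal (p t * n t) = ennreal (p t) * ennreal (n t)" using nt by (intro ennreal_mult'') auto
        ultimately have "ennreal (p t) * ennreal (n t) * indicator {0<..} t \<le>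
           (ennreal (c3 * E) * (ennreal (t powr (g - 1)) * indicator {0<..\<phi>c r} t) +
         ennreal (c3 / v) * (ennreal (t / \<phi>j r) * indicator {0<..\<phi>j r} t * ennreal (n' t)))"
          using t' t by simp
        then show ?thesis by (rule order_trans) (simp add: add_increasing)
      qed
    qed simp
    have n'eq: "(\<integral>\<^sup>+t. f t * ennreal (n' t) \<partial>lborel) = (\<integral>\<^sup>+t. f t \<partial>N)" if [measurable]: "f \<in> borel_measurable borel" for f
      using that by (subst nn_integral_N) (auto intro!: nn_integral_cong simp: n'_def mult_ac split: split_indicator)
    have I1: "(\<integral>\<^sup>+t. indicator {\<phi> r..} t * ennreal (n' t) \<partial>lborel) \<le> ennreal (K1 / \<psi> r)"
      using K1(2)[of "\<phi> r"] ps r by (simp add: n'eq phi.inv_phi)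
    have I2: "(\<integral>\<^sup>+t. ennreal (t powr (g - 1)) * indicator {0<..\<phi>c r} t \<partial>lborel) = ennreal (\<phi>c r powr g / g)"
      using g ps by (intro nn_integral_powr_0) auto
    have I3: "(\<integral>\<^sup>+t. ennreal (t / \<phi>j r) * indicator {0<..\<phi>j r} t * ennreal (n' t) \<partial>lborel) \<le> ennreal (2 * \<Phi> (1 / \<phi>j r))"
      using small_jumps_le[OF integrable ps(3)] by (simp add: n'eq)
    have "(\<integral>\<^sup>+t. ennreal (p t) \<partial>N) = (\<integral>\<^sup>+t. ennreal (p t) * ennreal (n t) * indicator {0<..} t \<partial>lborel)"
      by (rule nn_integral_N) simp
    also have "\<dots> \<le> (\<integral>\<^sup>+t. ennreal (c3 / v) * (indicator {\<phi> r..} t * ennreal (n' t)) +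
        (ennreal (c3 * E) * (ennreal (t powr (g - 1)) * indicator {0<..\<phi>c r} t) +
         ennreal (c3 / v) * (ennreal (t / \<phi>j r) * indicator {0<..\<phi>j r} t * ennreal (n' t))) \<partial>lborel)"
      by (intro nn_integral_mono pointwise)
    also have "\<dots> = ennreal (c3 / v) * (\<integral>\<^sup>+t. indicator {\<phi> r..} t * ennreal (n' t) \<partial>lborel) +
        (ennreal (c3 * E) * (\<integral>\<^sup>+t. ennreal (t powr (g - 1)) * indicator {0<..\<phi>c r} t \<partial>lborel) +
         ennreal (c3 / v) * (\<integral>\<^sup>+t. ennreal (t / \<phi>j r) * indicator {0<..\<phi>j r} t * ennreal (n' t) \<partial>lborel))"
      by (simp add: nn_integral_add nn_integral_cmult)
    also have "\<dots> \<le> ennreal (c3 / v) * ennreal (K1 / \<psi> r) +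
        (ennreal (c3 * E) * ennreal (\<phi>c r powr g / g) + ennreal (c3 / v) * ennreal (2 * \<Phi> (1 / \<phi>j r)))"
      unfolding I2 by (intro add_mono mult_left_mono I1 I3) auto
    also have "\<dots> = ennreal (c3 / v * (K1 / \<psi> r) + (c3 * E * (\<phi>c r powr g / g) + c3 / v * (2 * \<Phi> (1 / \<phi>j r))))"
      using assms v K1 ps E g by (simp add: ennreal_mult'[symmetric] ennreal_plus[symmetric] del: ennreal_plus)
    also have "\<dots> \<le> ennreal (K * (1 / v * (1 / \<psi> r + \<Phi> (1 / \<phi>j r))))"
    proof (rule ennreal_leI)
      have "c3 * E * (\<phi>c r powr g / g) = c3 / v * (B / g / \<psi> r)"
        using ps by (simp add: E_def powr_minus field_simps)
      then have "c3 / v * (K1 / \<psi> r) + (c3 * E * (\<phi>c r powr g / g) + c3 / v * (2 * \<Phi> (1 / \<phi>j r)))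
        = c3 / v * ((K1 + B / g) / \<psi> r + 2 * \<Phi> (1 / \<phi>j r))"
        by (simp add: algebra_simps add_divide_distrib)
      also have "\<dots> \<le> c3 / v * ((K1 + B / g + 2) / \<psi> r + (K1 + B / g + 2) * \<Phi> (1 / \<phi>j r))"
      proof (rule mult_left_mono)
        have k: "0 \<le> K1 + B / g" using K1 B g by simp
        have "(K1 + B / g) / \<psi> r \<le> (K1 + B / g + 2) / \<psi> r" using ps by (intro divide_right_mono) auto
        moreover have "2 * \<Phi> (1 / \<phi>j r) \<le> (K1 + B / g + 2) * \<Phi> (1 / \<phi>j r)" using ps k by (intro mult_right_mono) auto
        ultimately show "(K1 + B / g) / \<psi> r + 2 * \<Phi> (1 / \<phi>j r) \<le> (K1 + B / g + 2) / \<psi> r + (K1 + B / g + 2) * \<Phi> (1 / \<phi>j r)"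
          by simp
      qed (use v assms in simp)
      also have "\<dots> = K * (1 / v * (1 / \<psi> r + \<Phi> (1 / \<phi>j r)))"
        by (simp add: K_def algebra_simps add_divide_distrib)
      finally show "c3 / v * (K1 / \<psi> r) + (c3 * E * (\<phi>c r powr g / g) + c3 / v * (2 * \<Phi> (1 / \<phi>j r)))
          \<le> K * (1 / v * (1 / \<psi> r + \<Phi> (1 / \<phi>j r)))" .
    qed
    finally show ?thesis by (simp add: v_def r_def)
  qed
  with K show thesis by (rule that)
qed

text \<open>Put T = \<phi>(c2 r). The on-diagonal bound on [T,2T] alone produces 1 / (V(x,r)
  \<psi>(r)). The off-diagonal bound on (0,T) produces the linear part of the Bernstein function;
  the part it misses, the tail of the Levy measure beyond T, is of order 1/\<psi>(r) and hence
  already covered by the first contribution.\<close>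

lemma jump_lower: assumes "0 < c1" "0 < c2"
  obtains K where "0 < K" "\<And>x y p. x \<noteq> y \<Longrightarrow> p \<in> borel_measurable borel \<Longrightarrow> (\<And>t. 0 \<le> p t) \<Longrightarrow>
    (\<And>t. 0 < t \<Longrightarrow> c1 * ((if \<phi> (c2 * dist x y) \<le> t then 1 / vol \<mu> x (iv t) else 0) +
      (if \<phi> (c2 * dist x y) > t then t / (vol \<mu> x (dist x y) * \<phi>j (dist x y)) else 0)) \<le> p t) \<Longrightarrow>
    ennreal (1 / vol \<mu> x (dist x y) * (1 / \<psi> (dist x y) + \<Phi> (1 / \<phi>j (dist x y)))) \<le> ennreal K * (\<integral>\<^sup>+t. ennreal (p t) \<partial>N)"
proof -
  obtain K1 where K1: "0 < K1" "\<And>T. 0 < T \<Longrightarrow> emeasure N {T..} \<le> ennreal (K1 / \<psi> (iv T))"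
    using tail by metis
  obtain K2 where K2: "0 < K2" "\<And>r. 0 < r \<Longrightarrow> 1 / \<psi> (c2 * r) \<le> K2 / \<psi> r"
    using psi.inverse_scaled[OF assms(2)] by metis
  \<comment> \<open>For t \<le> 2T the radius \<open>iv t\<close> is at most \<open>L * r\<close>,
    by \<open>inv_scaled\<close> with factor 2 and \<open>iv T = c2 * r\<close>.\<close>
  define L where "L = max 1 (max 1 ((C * 2) powr (1 / a)) * c2)"
  have L: "1 \<le> L" by (simp add: L_def)
  obtain K3 where K3: "0 < K3" "\<And>r. 0 < r \<Longrightarrow> 1 / \<psi> r \<le> K3 / \<psi> (L * r)"
    using psi.inverse_scaled[of L] L by (metis less_le_trans zero_less_one)
  \<comment> \<open>Collects the losses on [T,2T]: \<open>D * L powr d\<close> from doubling the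
    volume of radius r to radius \<open>L * r\<close>, 2 from t \<le> 2T in the density, and
    \<open>K3\<close> from \<psi> at \<open>L * r\<close>.\<close>
  define c where "c = c1 / (D * L powr d * (2 * K3))"
  have c: "0 < c" using assms D L K3 by (simp add: c_def)
  \<comment> \<open>1/c1 is the price of the off-diagonal part; 1 + K1 K2 counts the term
    1/\<psi>(r) together with the tail beyond T, both paid for by the integral over [T,2T].\<close>
  define K where "K = (1 + K1 * K2) / c + 1 / c1"
  have K: "0 < K" using K1 K2 c assms by (simp add: K_def add_pos_pos)
  have "ennreal (1 / vol \<mu> x (dist x y) * (1 / \<psi> (dist x y) + \<Phi> (1 / \<phi>j (dist x y)))) \<le> ennreal K * (\<integral>\<^sup>+t. ennreal (p t) \<partial>N)"
    if xy: "x \<noteq> y" and [measurable]: "p \<in> borel_measurable borel" and p0: "\<And>t. 0 \<le> p t"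
      and p: "\<And>t. 0 < t \<Longrightarrow> c1 * ((if \<phi> (c2 * dist x y) \<le> t then 1 / vol \<mu> x (iv t) else 0) +
        (if \<phi> (c2 * dist x y) > t then t / (vol \<mu> x (dist x y) * \<phi>j (dist x y)) else 0)) \<le> p t"
    for x y p
  proof -
    define r where "r = dist x y"
    have r: "0 < r" using xy by (simp add: r_def)
    define v where "v = vol \<mu> x r"
    have v: "0 < v" using vol_pos r by (simp add: v_def)
    define T where "T = \<phi> (c2 * r)"
    have T: "0 < T" using phi.pos assms r by (simp add: T_def)
    have Lr: "0 < L * r" using L r by simp
    have ps: "0 < \<psi> r" "0 < \<phi>j r" "0 \<le> \<Phi> (1 / \<phi>j r)" "0 < \<psi> (L * r)"
      using psi.pos j.pos r Lr bernstein_nonneg[OF integrable] by auto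
    let ?I = "\<integral>\<^sup>+t. ennreal (p t) \<partial>N"
    have near: "c / (v * \<psi> r) / T \<le> p t * n t" if t: "T \<le> t" "t \<le> 2 * T" for t
    proof -
      have t0: "0 < t" using t T by simp
      have "iv t \<le> iv (2 * T)" using t t0 by (intro phi.inv_mono) auto
      also have "\<dots> \<le> max 1 ((C * 2) powr (1 / a)) * iv T" using T by (intro phi.inv_scaled) auto
      also have "iv T = c2 * r" using assms r by (simp add: T_def phi.inv_phi)
      also have "max 1 ((C * 2) powr (1 / a)) * (c2 * r) = (max 1 ((C * 2) powr (1 / a)) * c2) * r" by simp
      also have "\<dots> \<le> L * r" using r by (intro mult_right_mono) (auto simp: L_def)
      finally have iv: "iv t \<le> L * r" .
      have iv0: "0 < iv t" using phi.inv_pos t0 by simp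
      have "vol \<mu> x (iv t) \<le> vol \<mu> x (L * r)" using iv by (rule vol_mono)
      also have "\<dots> \<le> D * L powr d * v" using doubling[OF r, of "L * r" x] L r by (simp add: v_def)
      finally have "c1 / (D * L powr d * v) \<le> c1 * (1 / vol \<mu> x (iv t))"
        using assms vol_pos[OF iv0, of x] D L v by (simp add: frac_le)
      also have "\<dots> \<le> p t" using p[OF t0] t by (simp add: T_def r_def)
      finally have 1: "c1 / (D * L powr d * v) \<le> p t" .
      have "1 / (2 * T * (\<psi> r * K3)) \<le> 1 / (2 * T * \<psi> (L * r))"
        using K3(2)[OF r] ps T K3(1) by (simp add: field_simps)
      also have "\<dots> \<le> n t" unfolding levy_density_def
        using t t0 T iv iv0 psi.mono[of "iv t" "L * r"] psi.pos[OF iv0] ps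
        by (intro divide_left_mono mult_mono mult_pos_pos) auto
      finally have 2: "1 / (2 * T * (\<psi> r * K3)) \<le> n t" .
      have "c1 / (D * L powr d * v) * (1 / (2 * T * (\<psi> r * K3))) \<le> p t * n t"
        using 1 2 p0 T ps K3 by (intro mult_mono) auto
      then show ?thesis by (simp add: c_def mult_ac)
    qed
    \<comment> \<open>The length T of the interval cancels the factor 1/T of the density.\<close>
    have "ennreal (c / (v * \<psi> r)) = ennreal (c / (v * \<psi> r) / T) * emeasure lborel {T..2*T}"
      using T c v ps by (simp add: ennreal_mult'[symmetric])
    also have "\<dots> = (\<integral>\<^sup>+t. ennreal (c / (v * \<psi> r) / T) * indicator {T..2*T} t \<partial>lborel)"
      by (simp add: nn_integral_cmult)
    also have "\<dots> \<le> (\<integral>\<^sup>+t. ennreal (p t) * ennreal (n t) * indicator {0<..} t \<partial>lborel)"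
      using near T p0 by (intro nn_integral_mono) (auto split: split_indicator simp flip: ennreal_mult' intro!: ennreal_leI)
    also have "\<dots> = ?I" by (rule nn_integral_N[symmetric]) simp
    finally have A: "ennreal (c / (v * \<psi> r)) \<le> ?I" .
    have "(\<integral>\<^sup>+t. ennreal (t / \<phi>j r) * indicator {0<..<T} t \<partial>N) \<le> (\<integral>\<^sup>+t. ennreal (v / c1) * ennreal (p t) \<partial>N)"
    proof (intro nn_integral_mono)
      fix t :: real
      show "ennreal (t / \<phi>j r) * indicator {0<..<T} t \<le> ennreal (v / c1) * ennreal (p t)"
      proof (cases "0 < t \<and> t < T")
        case True
        then have "c1 * (t / (v * \<phi>j r)) \<le> p t" using p[of t] by (simp add: T_def r_def v_def)
        then have "t / \<phi>j r \<le> v / c1 * p t" using v assms ps by (simp add: field_simps)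
        then show ?thesis using True v assms by (simp add: ennreal_mult'[symmetric] ennreal_leI)
      qed auto
    qed
    also have "\<dots> = ennreal (v / c1) * ?I" by (rule nn_integral_cmult) simp
    finally have B: "(\<integral>\<^sup>+t. ennreal (t / \<phi>j r) * indicator {0<..<T} t \<partial>N) \<le> ennreal (v / c1) * ?I" .
    have "emeasure N {T..} \<le> ennreal (K1 / \<psi> (iv T))" using K1(2) T by simp
    also have "K1 / \<psi> (iv T) = K1 * (1 / \<psi> (c2 * r))" using assms r by (simp add: T_def phi.inv_phi)
    also have "\<dots> \<le> K1 * (K2 / \<psi> r)" using K1 K2(2)[OF r] by (intro mult_left_mono) auto
    finally have C: "emeasure N {T..} \<le> ennreal (K1 * (K2 / \<psi> r))" by (simp add: ennreal_leI)
    have "ennreal (1 / v * (1 / \<psi> r + \<Phi> (1 / \<phi>j r))) = ennreal (1 / v) * (ennreal (1 / \<psi> r) + ennreal (\<Phi> (1 / \<phi>j r)))"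
      using v ps by (subst ennreal_mult', simp) (subst ennreal_plus, auto)
    also have "\<dots> \<le> ennreal (1 / v) * (ennreal (1 / \<psi> r) + (ennreal (v / c1) * ?I + ennreal (K1 * (K2 / \<psi> r))))"
      using bernstein_le_split[OF integrable ps(2) T] B C
      by (intro mult_left_mono add_left_mono) (auto intro: order_trans add_mono)
    also have "\<dots> = ennreal (1 / v) * ennreal (v / c1) * ?I + ennreal (1 / v) * (ennreal (1 / \<psi> r) + ennreal (K1 * (K2 / \<psi> r)))"
      by (simp add: algebra_simps)
    also have "ennreal (1 / v) * ennreal (v / c1) = ennreal (1 / c1)"
      using v assms by (simp add: ennreal_mult'[symmetric])
    also have "ennreal (1 / v) * (ennreal (1 / \<psi> r) + ennreal (K1 * (K2 / \<psi> r))) = ennreal ((1 + K1 * K2) / c) * ennreal (c / (v * \<psi> r))"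
      using v ps K1 K2 c by (simp add: ennreal_plus[symmetric] ennreal_mult'[symmetric] field_simps del: ennreal_plus)
    also have "ennreal (1 / c1) * ?I + ennreal ((1 + K1 * K2) / c) * ennreal (c / (v * \<psi> r)) \<le> ennreal (1 / c1) * ?I + ennreal ((1 + K1 * K2) / c) * ?I"
      by (intro add_left_mono mult_left_mono A) auto
    also have "\<dots> = ennreal K * ?I"
      using assms K1 K2 c by (simp add: K_def ennreal_plus distrib_right add.commute)
    finally show ?thesis by (simp add: r_def v_def)
  qed
  with K show thesis by (rule that)
qed

end

section \<open>Laws of a subordinator at small times\<close>

text \<open>Weierstrass approximation: on [0,1] a continuous test function is uniformly close to a
  polynomial, and integrals of polynomials are combinations of moments.\<close>

lemma moments_imp_weak_conv:
  fixes M_seq :: "nat \<Rightarrow> real measure" and M :: "real measure"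
  assumes D: "\<And>n. real_distribution (M_seq n)" "real_distribution M"
    and AE: "\<And>n. AE w in M_seq n. w \<in> {0..1}" "AE w in M. w \<in> {0..1}"
    and mom: "\<And>k. (\<lambda>n. \<integral>w. w ^ k \<partial>M_seq n) \<longlonglongrightarrow> (\<integral>w. w ^ k \<partial>M)"
  shows "weak_conv_m M_seq M"
proof (rule integral_bdd_continuous_conv_imp_weak_conv)
  fix f :: "real \<Rightarrow> real" assume f: "\<And>x. isCont f x" and f1: "\<And>x. \<bar>f x\<bar> \<le> 1"
  have [measurable]: "f \<in> borel_measurable borel"
    using f by (intro borel_measurable_continuous_onI continuous_at_imp_continuous_on) auto
  show "(\<lambda>n. integral\<^sup>L (M_seq n) f) \<longlonglongrightarrow> integral\<^sup>L M f"
  proof (rule LIMSEQ_I)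
    fix e :: real assume e: "0 < e"
    have "continuous_on {0..1} f" using f by (intro continuous_at_imp_continuous_on) auto
    then obtain q where "real_polynomial_function q" and q: "\<And>x. x \<in> {0..1} \<Longrightarrow> \<bar>f x - q x\<bar> < e / 3"
      using Stone_Weierstrass_real_polynomial_function[of "{0..1::real}" f "e / 3"] e by auto
    then obtain c N where qe: "q = (\<lambda>x. \<Sum>i\<le>N. c i * x ^ i)"
      by (auto simp: real_polynomial_function_iff_sum)
    have near: "\<bar>integral\<^sup>L P f - integral\<^sup>L P q\<bar> \<le> e / 3" "integral\<^sup>L P q = (\<Sum>i\<le>N. c i * (\<integral>w. w ^ i \<partial>P))"
      if P: "real_distribution P" and AE: "AE w in P. w \<in> {0..1}" for P
    proof -
      interpret P: real_distribution P by fact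
      have pw: "integrable P (\<lambda>w. w ^ i)" for i
        by (rule P.integrable_const_bound[of _ 1])
           (auto intro!: eventually_mono[OF AE] power_le_one)
      show "integral\<^sup>L P q = (\<Sum>i\<le>N. c i * (\<integral>w. w ^ i \<partial>P))"
        using pw by (simp add: qe)
      have iq: "integrable P q" using pw by (simp add: qe)
      have "integrable P f" by (rule P.integrable_const_bound[of _ 1]) (use f1 in auto)
      then have "\<bar>integral\<^sup>L P f - integral\<^sup>L P q\<bar> = \<bar>\<integral>w. f w - q w \<partial>P\<bar>" using iq by simp
      also have "\<dots> \<le> (\<integral>w. \<bar>f w - q w\<bar> \<partial>P)" by (rule integral_abs_bound)
      also have "\<dots> \<le> (\<integral>w. e / 3 \<partial>P)"
        using \<open>integrable P f\<close> iq q by (intro integral_mono_AE eventually_mono[OF AE]) (auto intro: less_imp_le)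
      also have "\<dots> = e / 3" using P.prob_space by simp
      finally show "\<bar>integral\<^sup>L P f - integral\<^sup>L P q\<bar> \<le> e / 3" .
    qed
    have "(\<lambda>n. \<Sum>i\<le>N. c i * (\<integral>w. w ^ i \<partial>M_seq n)) \<longlonglongrightarrow> (\<Sum>i\<le>N. c i * (\<integral>w. w ^ i \<partial>M))"
      by (intro tendsto_intros mom)
    from LIMSEQ_D[OF this, of "e / 3"] e obtain n0 where
      n0: "\<And>n. n0 \<le> n \<Longrightarrow> \<bar>integral\<^sup>L (M_seq n) q - integral\<^sup>L M q\<bar> < e / 3"
      using near(2)[OF D(1) AE(1)] near(2)[OF D(2) AE(2)] by auto
    show "\<exists>n0. \<forall>n\<ge>n0. norm (integral\<^sup>L (M_seq n) f - integral\<^sup>L M f) < e"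
    proof (intro exI allI impI)
      fix n assume "n0 \<le> n"
      from n0[OF this] near(1)[OF D(1) AE(1), of n] near(1)[OF D(2) AE(2)]
      show "norm (integral\<^sup>L (M_seq n) f - integral\<^sup>L M f) < e" unfolding real_norm_def by linarith
    qed
  qed
qed (use D in auto)

text \<open>Under w = exp (-s) the values of the Laplace transform at positive integers become the
  moments of a law on [0,1]. These determine the law, and w \<mapsto> - ln w recovers the original
  measure.\<close>

lemma Laplace_uniqueness:
  fixes M N :: "real measure"
  assumes M: "prob_space M" "sets M = sets borel" "AE s in M. 0 \<le> s"
    and N: "prob_space N" "sets N = sets borel" "AE s in N. 0 \<le> s"
    and eq: "\<And>l. 0 < l \<Longrightarrow> (\<integral>s. exp (- l * s) \<partial>M) = (\<integral>s. exp (- l * s) \<partial>N)"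
  shows "M = N"
proof -
  define X where "X = (\<lambda>P. distr P borel (\<lambda>s::real. exp (- s)))"
  have X: "real_distribution (X P)" "AE w in X P. w \<in> {0..1}" "distr (X P) borel (\<lambda>w. - ln w) = P"
    "(\<integral>w. w ^ k \<partial>X P) = (if k = 0 then 1 else \<integral>s. exp (- real k * s) \<partial>P)"
    if P: "prob_space P" "sets P = sets borel" "AE s in P. 0 \<le> s" for P k
  proof -
    interpret prob_space P by fact
    note [measurable_cong] = P(2)
    show "real_distribution (X P)"
      unfolding X_def by (intro real_distribution_distr) simp
    show "AE w in X P. w \<in> {0..1}"
      unfolding X_def using P(3) by (subst AE_distr_iff) (auto elim!: eventually_mono)
    have "(\<lambda>w. - ln w) \<circ> (\<lambda>s. exp (- s)) = (\<lambda>s::real. s)" by (auto simp: fun_eq_iff)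
    then show "distr (X P) borel (\<lambda>w. - ln w) = P"
      unfolding X_def using P(2) by (subst distr_distr) (auto intro!: distr_id2)
    show "(\<integral>w. w ^ k \<partial>X P) = (if k = 0 then 1 else \<integral>s. exp (- real k * s) \<partial>P)"
      unfolding X_def using prob_space by (subst integral_distr) (auto simp flip: exp_of_nat_mult)
  qed
  \<comment> \<open>Weak convergence of a constant sequence: together with the continuity theorem it
    forces the two characteristic functions to agree.\<close>
  have "weak_conv_m (\<lambda>_. X M) (X N)"
    using X[OF M] X[OF N] eq by (intro moments_imp_weak_conv) auto
  then have "char (X M) t = char (X N) t" for t
    using levy_continuity1[of "\<lambda>_. X M" "X N" t] X(1)[OF M] X(1)[OF N]
    by (simp add: LIMSEQ_const_iff)
  then have "X M = X N"
    using X(1)[OF M] X(1)[OF N] by (intro Levy_uniqueness) (auto simp: fun_eq_iff)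
  then show ?thesis using X(3)[OF M] X(3)[OF N] by metis
qed

lemma half_min1_le: assumes "0 \<le> (s::real)" shows "min 1 s / 2 \<le> 1 - exp (- s)"
proof -
  have "exp (- s) \<le> 1 / (1 + s)" using exp_ge_add_one_self[of s] assms by (simp add: exp_minus divide_simps)
  moreover have "min 1 s / 2 \<le> 1 - 1 / (1 + s)"
    using assms mult_left_le[of s s] by (cases "s \<le> 1") (auto simp: field_simps)
  ultimately show ?thesis by simp
qed

text \<open>\<open>e + s\<close> and \<open>e + r\<close> are convex combinations of the outer
  points with complementary weights, so adding the two convexity inequalities gives the claim. It
  says at once that increments of a convex function shrink as their starting point moves right and
  that the decrements from \<open>e\<close> are subadditive in the step.\<close>

lemma convex_four_points:
  fixes f :: "real \<Rightarrow> real"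
  assumes f: "convex_on {0..} f" and "0 \<le> e" "0 \<le> s" "0 \<le> r"
  shows "f (e + s) + f (e + r) \<le> f e + f (e + s + r)"
proof (cases "s + r = 0")
  case False
  then have p: "0 < s + r" using assms by auto
  define u where "u = s / (s + r)"
  have u: "0 \<le> u" "u \<le> 1" "u * (s + r) = s" "(1 - u) * (s + r) = r"
    using assms p by (auto simp: u_def field_simps)
  have "f ((1 - u) * e + u * (e + s + r)) \<le> (1 - u) * f e + u * f (e + s + r)"
    using convex_onD[OF f, of u e "e + s + r"] u assms by simp
  moreover have "f (u * e + (1 - u) * (e + s + r)) \<le> u * f e + (1 - u) * f (e + s + r)"
    using convex_onD[OF f, of "1 - u" e "e + s + r"] u assms by simp
  moreover have "(1 - u) * e + u * (e + s + r) = e + s" "u * e + (1 - u) * (e + s + r) = e + r"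
    using u(3,4) by (auto simp: algebra_simps)
  ultimately show ?thesis by (simp add: algebra_simps)
next
  case True
  then have "s = 0" "r = 0" using assms by auto
  then show ?thesis by simp
qed

section \<open>Vague convergence of the normalised laws to the Levy measure\<close>

locale subordinator_laws =
  fixes \<nu> :: "real measure" and \<eta> :: "real \<Rightarrow> real measure" and \<Phi> :: "real \<Rightarrow> real"
  assumes sets_nu [simp, measurable_cong]: "sets \<nu> = sets borel"
    and nu_pos: "AE s in \<nu>. 0 < s"
    and nu_finite: "(\<integral>\<^sup>+s. ennreal (min 1 s) \<partial>\<nu>) < \<infinity>"
    and Phi_pos: "\<And>l. 0 < l \<Longrightarrow> 0 < \<Phi> l"
    and Phi: "\<And>l. 0 < l \<Longrightarrow> ennreal (\<Phi> l) = (\<integral>\<^sup>+s. ennreal (1 - exp (- l * s)) \<partial>\<nu>)"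
    and prob_eta: "\<And>t. 0 \<le> t \<Longrightarrow> prob_space (\<eta> t)"
    and sets_eta [simp, measurable_cong]: "\<And>t. sets (\<eta> t) = sets borel"
    and eta_nonneg: "\<And>t. 0 \<le> t \<Longrightarrow> AE s in \<eta> t. 0 \<le> s"
    and eta: "\<And>t l. 0 \<le> t \<Longrightarrow> 0 < l \<Longrightarrow> (\<integral>s. exp (- l * s) \<partial>\<eta> t) = exp (- t * \<Phi> l)"
begin

lemma space_nu [simp]: "space \<nu> = UNIV" using sets_eq_imp_space_eq[OF sets_nu] by simp
lemma space_eta [simp]: "space (\<eta> t) = UNIV" using sets_eq_imp_space_eq[OF sets_eta] by simp

lemma integrable_nu:
  fixes g :: "real \<Rightarrow> real"
  assumes [measurable]: "g \<in> borel_measurable borel" and "\<And>s. 0 < s \<Longrightarrow> \<bar>g s\<bar> \<le> B * min 1 s"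
  shows "integrable \<nu> g"
proof (rule Bochner_Integration.integrable_bound)
  have "integrable \<nu> (\<lambda>s. min 1 (max 0 s))"
  proof (rule integrableI_bounded)
    have "(\<integral>\<^sup>+s. ennreal (norm (min 1 (max 0 s))) \<partial>\<nu>) = (\<integral>\<^sup>+s. ennreal (min 1 s) \<partial>\<nu>)"
      using nu_pos by (intro nn_integral_cong_AE) (auto elim!: eventually_mono)
    then show "(\<integral>\<^sup>+s. ennreal (norm (min 1 (max 0 s))) \<partial>\<nu>) < \<infinity>" using nu_finite by simp
  qed simp
  then show "integrable \<nu> (\<lambda>s. B * min 1 (max 0 s))" by simp
  show "AE s in \<nu>. norm (g s) \<le> norm (B * min 1 (max 0 s))"
    using nu_pos
  proof eventually_elim
    fix s :: real assume "0 < s"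
    then show "norm (g s) \<le> norm (B * min 1 (max 0 s))" using assms(2)[of s] by simp
  qed
qed simp

lemma integral_nu_exp: assumes "0 < l" shows "integrable \<nu> (\<lambda>s. 1 - exp (- l * s))" "(\<integral>s. 1 - exp (- l * s) \<partial>\<nu>) = \<Phi> l"
proof -
  show i: "integrable \<nu> (\<lambda>s. 1 - exp (- l * s))"
  proof (rule integrable_nu[of _ "max 1 l"])
    fix s :: real assume s: "0 < s"
    have "1 - exp (- (l * s)) \<le> l * s" using exp_ge_add_one_self[of "- (l * s)"] by simp
    moreover have "l * s \<le> max 1 l * s" using s by (intro mult_right_mono) auto
    moreover have "1 - exp (- (l * s)) \<le> max 1 l" by (rule order_trans[of _ 1]) auto
    moreover have "\<bar>1 - exp (- l * s)\<bar> = 1 - exp (- (l * s))" using assms s by simp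
    ultimately show "\<bar>1 - exp (- l * s)\<bar> \<le> max 1 l * min 1 s"
      by (cases "1 \<le> s") (simp_all only: min.absorb1 min.absorb2 mult_1_right not_le less_imp_le)
  qed simp
  have "ennreal (\<integral>s. 1 - exp (- l * s) \<partial>\<nu>) = ennreal (\<Phi> l)"
    unfolding Phi[OF assms] using i nu_pos assms
    by (intro nn_integral_eq_integral[symmetric]) (auto elim!: eventually_mono)
  moreover have "0 \<le> (\<integral>s. 1 - exp (- l * s) \<partial>\<nu>)"
    using nu_pos assms by (intro integral_nonneg_AE) (auto elim!: eventually_mono)
  ultimately show "(\<integral>s. 1 - exp (- l * s) \<partial>\<nu>) = \<Phi> l" using Phi_pos[OF assms] by (simp add: less_imp_le)
qed

lemma integral_eta_exp: assumes "0 \<le> t" "0 \<le> l"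
  shows "integrable (\<eta> t) (\<lambda>s. exp (- l * s))" "(\<integral>s. exp (- l * s) \<partial>\<eta> t) = exp (- t * (if l = 0 then 0 else \<Phi> l))"
proof -
  interpret prob_space "\<eta> t" by (rule prob_eta) fact
  show "integrable (\<eta> t) (\<lambda>s. exp (- l * s))"
    by (rule integrable_const_bound[of _ 1]) (use eta_nonneg[OF assms(1)] assms(2) in \<open>auto elim!: eventually_mono\<close>)
  show "(\<integral>s. exp (- l * s) \<partial>\<eta> t) = exp (- t * (if l = 0 then 0 else \<Phi> l))"
    using eta[OF assms(1), of l] assms(2) prob_space by auto
qed

text \<open>Under \<open>w = exp (-s)\<close> the normalised measures \<open>(1 - exp (-s)) \<eta>\<^sub>t(ds)\<close> live on \<open>[0,1]\<close>, and their
  moments are differences of Laplace transforms.\<close>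

lemma eta_div_tendsto:
  fixes g :: "real \<Rightarrow> real"
  assumes [measurable]: "g \<in> borel_measurable borel" and cont: "\<And>s. 0 < s \<Longrightarrow> isCont g s" and g0: "g 0 = 0"
    and bd: "\<And>s. 0 < s \<Longrightarrow> \<bar>g s\<bar> \<le> B * min 1 s"
  shows "((\<lambda>t. (\<integral>s. g s \<partial>\<eta> t) / t) \<longlongrightarrow> (\<integral>s. g s \<partial>\<nu>)) (at_right 0)"
proof (rule tendsto_at_right_sequentially[of 0 1])
  fix t :: "nat \<Rightarrow> real" assume t: "\<And>n. 0 < t n" and t0: "t \<longlonglongrightarrow> 0"
  have B: "0 \<le> B" using bd[of 1] by simp
  \<comment> \<open>Total mass of (1 - exp (-s)) under the law at time \<open>t n\<close>, that is
    one minus the Laplace transform at 1.\<close>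
  define Z where "Z = (\<lambda>n. 1 - exp (- t n * \<Phi> 1))"
  have Z: "0 < Z n" for n using t Phi_pos[of 1] by (simp add: Z_def)
  define M where "M = (\<lambda>P z. distr (density P (\<lambda>s. ennreal ((1 - exp (- s)) / z))) borel (\<lambda>s. exp (- s)))"
  have M: "real_distribution (M P z)" "AE w in M P z. w \<in> {0..1}"
    "\<And>F. F \<in> borel_measurable borel \<Longrightarrow> (\<integral>w. F w \<partial>M P z) = (\<integral>s. (1 - exp (- s)) * F (exp (- s)) \<partial>P) / z"
    if P: "sets P = sets borel" "AE s in P. 0 \<le> s" "integrable P (\<lambda>s. 1 - exp (- s))" "(\<integral>s. 1 - exp (- s) \<partial>P) = z" "0 < z"
    for P and z :: real
  proof -
    note [measurable_cong] = P(1)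
    have "(\<integral>\<^sup>+s. ennreal ((1 - exp (- s)) / z) \<partial>P) = ennreal (\<integral>s. (1 - exp (- s)) / z \<partial>P)"
      using P by (intro nn_integral_eq_integral) (auto elim!: eventually_mono)
    also have "(\<integral>s. (1 - exp (- s)) / z \<partial>P) = 1" using P by simp
    finally have "prob_space (density P (\<lambda>s. ennreal ((1 - exp (- s)) / z)))"
      using sets_eq_imp_space_eq[OF P(1)] by (intro prob_spaceI) (simp add: emeasure_density)
    then interpret prob_space "density P (\<lambda>s. ennreal ((1 - exp (- s)) / z))" .
    show "real_distribution (M P z)" unfolding M_def by (intro real_distribution_distr) simp
    show "AE w in M P z. w \<in> {0..1}"
      unfolding M_def using P(2) by (subst AE_distr_iff) (auto simp: AE_density elim!: eventually_mono)
    fix F :: "real \<Rightarrow> real" assume [measurable]: "F \<in> borel_measurable borel"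
    have "(\<integral>w. F w \<partial>M P z) = (\<integral>s. F (exp (- s)) \<partial>density P (\<lambda>s. ennreal ((1 - exp (- s)) / z)))"
      unfolding M_def by (rule integral_distr) simp_all
    also have "\<dots> = (\<integral>s. ((1 - exp (- s)) / z) *\<^sub>R F (exp (- s)) \<partial>P)"
      using P by (intro integral_density) (auto elim!: eventually_mono)
    also have "\<dots> = (\<integral>s. (1 - exp (- s)) * F (exp (- s)) / z \<partial>P)" by simp
    also have "\<dots> = (\<integral>s. (1 - exp (- s)) * F (exp (- s)) \<partial>P) / z" by (rule integral_divide_zero)
    finally show "(\<integral>w. F w \<partial>M P z) = (\<integral>s. (1 - exp (- s)) * F (exp (- s)) \<partial>P) / z" .
  qed
  have Pe: "sets (\<eta> (t n)) = sets borel" "AE s in \<eta> (t n). 0 \<le> s" "integrable (\<eta> (t n)) (\<lambda>s. 1 - exp (- s))"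
    "(\<integral>s. 1 - exp (- s) \<partial>\<eta> (t n)) = Z n" "0 < Z n" for n
  proof -
    have t': "0 \<le> t n" using t[of n] by simp
    interpret prob_space "\<eta> (t n)" by (rule prob_eta) fact
    show "sets (\<eta> (t n)) = sets borel" "AE s in \<eta> (t n). 0 \<le> s" "0 < Z n" using t' eta_nonneg Z by auto
    show "integrable (\<eta> (t n)) (\<lambda>s. 1 - exp (- s))" "(\<integral>s. 1 - exp (- s) \<partial>\<eta> (t n)) = Z n"
      using integral_eta_exp[OF t', of 1] prob_space by (auto simp: Z_def)
  qed
  have Pn: "sets \<nu> = sets borel" "AE s in \<nu>. 0 \<le> s" "integrable \<nu> (\<lambda>s. 1 - exp (- s))"
    "(\<integral>s. 1 - exp (- s) \<partial>\<nu>) = \<Phi> 1" "0 < \<Phi> 1"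
    using nu_pos integral_nu_exp[of 1] Phi_pos[of 1] by (auto elim!: eventually_mono)
  \<comment> \<open>Difference quotient at 0 of 1 - exp (-x c); each Laplace exponent is recovered
    in this way.\<close>
  have Zt: "(\<lambda>n. (1 - exp (- t n * c)) / t n) \<longlonglongrightarrow> c" for c
  proof -
    have "((\<lambda>x. 1 - exp (- x * c)) has_real_derivative c) (at 0)"
      by (auto intro!: derivative_eq_intros)
    then have "(\<lambda>x. (1 - exp (- x * c)) / x) \<midarrow>0\<rightarrow> c" by (simp add: DERIV_def)
    moreover have "\<forall>n. t n \<in> UNIV - {0}" using t by (auto simp: less_imp_neq[THEN not_sym])
    ultimately show ?thesis using t0 unfolding tendsto_at_iff_sequentially comp_def by blast
  qed
  \<comment> \<open>The exponent extended by its value 0 at the origin, since the moment of order 0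
    involves the Laplace transform at 0 while \<open>\<Phi>\<close> is only specified for positive
    arguments.\<close>
  define p where "p = (\<lambda>k. if k = (0::nat) then 0 else \<Phi> (real k))"
  have mom: "(\<lambda>n. \<integral>w. w ^ k \<partial>M (\<eta> (t n)) (Z n)) \<longlonglongrightarrow> (\<integral>w. w ^ k \<partial>M \<nu> (\<Phi> 1))" for k
  proof -
    have e: "(1 - exp (- s)) * exp (- s) ^ k = exp (- real k * s) - exp (- real (Suc k) * s)" for s :: real
      by (simp add: algebra_simps exp_add exp_diff exp_minus exp_of_nat_mult[symmetric] field_simps)
    have "(\<integral>w. w ^ k \<partial>M (\<eta> (t n)) (Z n)) = ((1 - exp (- t n * p (Suc k))) / t n - (1 - exp (- t n * p k)) / t n) / (Z n / t n)" for n
    proof -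
      have t': "0 \<le> t n" using t[of n] by simp
      have "(\<integral>w. w ^ k \<partial>M (\<eta> (t n)) (Z n)) = (\<integral>s. exp (- real k * s) - exp (- real (Suc k) * s) \<partial>\<eta> (t n)) / Z n"
        unfolding M(3)[OF Pe, of "\<lambda>w. w ^ k", simplified] e ..
      also have "\<dots> = (exp (- t n * p k) - exp (- t n * p (Suc k))) / Z n"
        using integral_eta_exp[OF t', of "real k"] integral_eta_exp[OF t', of "real (Suc k)"]
        by (subst Bochner_Integration.integral_diff) (auto simp: p_def)
      also have "\<dots> = ((1 - exp (- t n * p (Suc k))) / t n - (1 - exp (- t n * p k)) / t n) / (Z n / t n)"
        using t[of n] Z[of n] by (simp add: field_simps)
      finally show ?thesis .
    qed
    moreover have "(\<lambda>n. ((1 - exp (- t n * p (Suc k))) / t n - (1 - exp (- t n * p k)) / t n) / (Z n / t n)) \<longlonglongrightarrow> (p (Suc k) - p k) / \<Phi> 1"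
      unfolding Z_def using Phi_pos[of 1] by (intro tendsto_intros Zt) auto
    moreover have "(\<integral>w. w ^ k \<partial>M \<nu> (\<Phi> 1)) = (p (Suc k) - p k) / \<Phi> 1"
    proof -
      have "(\<integral>w. w ^ k \<partial>M \<nu> (\<Phi> 1)) = (\<integral>s. (1 - exp (- real (Suc k) * s)) - (1 - exp (- real k * s)) \<partial>\<nu>) / \<Phi> 1"
        unfolding M(3)[OF Pn, of "\<lambda>w. w ^ k", simplified] e by simp
      also have "\<dots> = (p (Suc k) - p k) / \<Phi> 1"
      proof (cases "k = 0")
        case True
        then show ?thesis using integral_nu_exp[of 1] by (simp add: p_def)
      next
        case False
        then show ?thesis
          using integral_nu_exp[of "real k"] integral_nu_exp[of "real (Suc k)"]
          by (subst Bochner_Integration.integral_diff) (auto simp: p_def)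
      qed
      finally show ?thesis .
    qed
    ultimately show ?thesis by simp
  qed
  have wc: "weak_conv_m (\<lambda>n. M (\<eta> (t n)) (Z n)) (M \<nu> (\<Phi> 1))"
    by (intro moments_imp_weak_conv M(1,2)[OF Pe] M(1,2)[OF Pn] mom)
  \<comment> \<open>Chosen so that weighting by 1 - w gives back g at s = - ln w. It is bounded
    because 1 - exp (-s) dominates \<open>min 1 s / 2\<close>, and it may jump only at w = 1 and w =
    0, that is s = 0 and s = \<infinity>, which the limit law does not charge. The approximating
    laws may have an atom at s = 0; there both sides vanish as g 0 = 0.\<close>
  define F where "F = (\<lambda>w. if 0 < w \<and> w < 1 then g (- ln w) / (1 - w) else 0)"
  have [measurable]: "F \<in> borel_measurable borel" unfolding F_def by measurable
  have F: "(1 - exp (- s)) * F (exp (- s)) = g s" if "0 \<le> s" for s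
    using that g0 by (cases "s = 0") (auto simp: F_def)
  have cF: "isCont F w" if "w \<noteq> 0" "w \<noteq> 1" for w
  proof (cases "0 < w \<and> w < 1")
    case True
    have "isCont (\<lambda>w. g (- ln w) / (1 - w)) w"
      using True by (intro continuous_intros isCont_o2[OF _ cont]) auto
    moreover have "eventually (\<lambda>w. F w = g (- ln w) / (1 - w)) (nhds w)"
      using True by (intro eventually_nhds_in_open[of "{0<..<1}", THEN eventually_mono]) (auto simp: F_def)
    ultimately show ?thesis by (simp add: isCont_cong)
  next
    case False
    have "eventually (\<lambda>w. F w = 0) (nhds w)"
      using False that by (intro eventually_nhds_in_open[of "- {0..1}", THEN eventually_mono]) (auto simp: F_def)
    then show ?thesis by (simp add: isCont_cong)
  qed
  have bF: "norm (F w) \<le> 2 * B" for w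
  proof (cases "0 < w \<and> w < 1")
    case True
    define s where "s = - ln w"
    have s: "0 < s" "w = exp (- s)" using True by (auto simp: s_def)
    have "\<bar>g s\<bar> \<le> B * min 1 s" by (rule bd) fact
    also have "\<dots> \<le> B * (2 * (1 - exp (- s)))" using half_min1_le[of s] s B by (intro mult_left_mono) auto
    finally show ?thesis using True s by (simp add: F_def s_def[symmetric] divide_simps mult_ac)
  qed (use B in \<open>auto simp: F_def\<close>)
  have "(\<lambda>n. \<integral>w. F w \<partial>M (\<eta> (t n)) (Z n)) \<longlonglongrightarrow> (\<integral>w. F w \<partial>M \<nu> (\<Phi> 1))"
  proof (rule weak_conv_imp_bdd_ae_continuous_conv[OF _ _ wc _ bF])
    have "AE w in M \<nu> (\<Phi> 1). w \<noteq> 0 \<and> w \<noteq> 1"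
      unfolding M_def using nu_pos by (subst AE_distr_iff) (auto simp: AE_density elim!: eventually_mono)
    then have "AE w in M \<nu> (\<Phi> 1). w \<notin> {0,1}" by simp
    then have "emeasure (M \<nu> (\<Phi> 1)) {0,1} = 0"
      by (subst (asm) AE_iff_measurable[of "{0,1}"]) (auto simp: M_def)
    moreover have "{x. \<not> isCont F x} \<subseteq> {0,1}" using cF by auto
    moreover have "{0,1} \<in> sets (M \<nu> (\<Phi> 1))" by (simp add: M_def)
    ultimately show "emeasure (M \<nu> (\<Phi> 1)) {x. \<not> isCont F x} = 0"
      using emeasure_eq_0 by metis
  qed (rule M(1)[OF Pe] M(1)[OF Pn] \<open>F \<in> borel_measurable borel\<close>)+
  \<comment> \<open>Multiplying by \<open>Z n / t n\<close>, which tends to \<open>\<Phi> 1\<close>,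
    undoes the normalisation and introduces the division by t.\<close>
  then have "(\<lambda>n. (\<integral>w. F w \<partial>M (\<eta> (t n)) (Z n)) * (Z n / t n)) \<longlonglongrightarrow> (\<integral>w. F w \<partial>M \<nu> (\<Phi> 1)) * \<Phi> 1"
    unfolding Z_def by (intro tendsto_mult Zt)
  moreover have "(\<integral>w. F w \<partial>M (\<eta> (t n)) (Z n)) * (Z n / t n) = (\<integral>s. g s \<partial>\<eta> (t n)) / t n" for n
  proof -
    have "(\<integral>s. (1 - exp (- s)) * F (exp (- s)) \<partial>\<eta> (t n)) = (\<integral>s. g s \<partial>\<eta> (t n))"
      using Pe(2)[of n] by (intro integral_cong_AE) (auto elim!: eventually_mono simp: F)
    then show ?thesis using M(3)[OF Pe, of F n] Z[of n] by simp
  qed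
  moreover have "(\<integral>w. F w \<partial>M \<nu> (\<Phi> 1)) * \<Phi> 1 = (\<integral>s. g s \<partial>\<nu>)"
  proof -
    have "(\<integral>s. (1 - exp (- s)) * F (exp (- s)) \<partial>\<nu>) = (\<integral>s. g s \<partial>\<nu>)"
      using Pn(2) by (intro integral_cong_AE) (auto elim!: eventually_mono simp: F)
    then show ?thesis using M(3)[OF Pn, of F] Phi_pos[of 1] by simp
  qed
  ultimately show "(\<lambda>n. (\<integral>s. g s \<partial>\<eta> (t n)) / t n) \<longlonglongrightarrow> (\<integral>s. g s \<partial>\<nu>)" by (simp only:)
qed simp

end

section \<open>Convolution semigroup and limits along convex functions\<close>

context subordinator_laws
begin

text \<open>Read off from Laplace transforms: the exponent is linear in time, so the product of two
  transforms is the transform at the sum of the times.\<close>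

lemma eta_convolution: assumes "0 \<le> s" "0 \<le> t" shows "\<eta> s \<star> \<eta> t = \<eta> (s + t)"
proof (rule Laplace_uniqueness)
  interpret s: prob_space "\<eta> s" by (rule prob_eta) fact
  interpret t: prob_space "\<eta> t" by (rule prob_eta) fact
  interpret st: prob_space "\<eta> (s + t)" using assms by (intro prob_eta) simp
  interpret pair_prob_space "\<eta> s" "\<eta> t" ..
  show "prob_space (\<eta> s \<star> \<eta> t)" unfolding convolution_def by (intro prob_space_distr) simp
  then interpret c: prob_space "\<eta> s \<star> \<eta> t" .
  show "sets (\<eta> s \<star> \<eta> t) = sets borel" "sets (\<eta> (s + t)) = sets borel" by (auto simp: convolution_def)
  note [measurable_cong] = this(1)
  show "prob_space (\<eta> (s + t))" "AE r in \<eta> (s + t). 0 \<le> r" using assms by (auto intro!: prob_eta eta_nonneg)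
  have ae2: "AE z in \<eta> s \<Otimes>\<^sub>M \<eta> t. 0 \<le> fst z \<and> 0 \<le> snd z"
  proof (rule AE_pair_measure)
    show "{z \<in> space (\<eta> s \<Otimes>\<^sub>M \<eta> t). 0 \<le> fst z \<and> 0 \<le> snd z} \<in> sets (\<eta> s \<Otimes>\<^sub>M \<eta> t)" by measurable
    show "AE a in \<eta> s. AE b in \<eta> t. 0 \<le> fst (a, b) \<and> 0 \<le> snd (a, b)"
      using eta_nonneg[OF assms(1)] by eventually_elim (use eta_nonneg[OF assms(2)] in \<open>auto elim!: eventually_mono\<close>)
  qed
  show ae: "AE r in \<eta> s \<star> \<eta> t. 0 \<le> r"
    unfolding convolution_def by (subst AE_distr_iff) (auto intro!: eventually_mono[OF ae2])
  fix l :: real assume l: "0 < l"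
  have E: "(\<integral>\<^sup>+r. ennreal (exp (- l * r)) \<partial>\<eta> t) = ennreal (exp (- t * \<Phi> l))" if "0 \<le> t" for t
    using integral_eta_exp[OF that, of l] l by (subst nn_integral_eq_integral) auto
  have "(\<integral>\<^sup>+r. ennreal (exp (- l * r)) \<partial>(\<eta> s \<star> \<eta> t)) = (\<integral>\<^sup>+a. \<integral>\<^sup>+b. ennreal (exp (- l * (a + b))) \<partial>\<eta> t \<partial>\<eta> s)"
    by (rule nn_integral_convolution) (auto intro: s.finite_measure_axioms t.finite_measure_axioms)
  also have "\<dots> = (\<integral>\<^sup>+a. \<integral>\<^sup>+b. ennreal (exp (- l * a)) * ennreal (exp (- l * b)) \<partial>\<eta> t \<partial>\<eta> s)"
    by (simp add: exp_add[symmetric] ennreal_mult[symmetric] distrib_left[symmetric] algebra_simps)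
  also have "\<dots> = ennreal (exp (- s * \<Phi> l)) * ennreal (exp (- t * \<Phi> l))"
    using E[OF assms(1)] E[OF assms(2)] by (simp add: nn_integral_cmult nn_integral_multc)
  also have "\<dots> = ennreal (exp (- (s + t) * \<Phi> l))"
    by (simp add: ennreal_mult[symmetric] exp_add[symmetric] algebra_simps)
  finally have "(\<integral>\<^sup>+r. ennreal (exp (- l * r)) \<partial>(\<eta> s \<star> \<eta> t)) = ennreal (exp (- (s + t) * \<Phi> l))" .
  moreover have "integrable (\<eta> s \<star> \<eta> t) (\<lambda>r. exp (- l * r))"
    by (rule c.integrable_const_bound[of _ 1]) (use ae l in \<open>auto elim!: eventually_mono\<close>)
  ultimately have "(\<integral>r. exp (- l * r) \<partial>(\<eta> s \<star> \<eta> t)) = exp (- (s + t) * \<Phi> l)"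
    by (subst (asm) nn_integral_eq_integral) auto
  then show "(\<integral>r. exp (- l * r) \<partial>(\<eta> s \<star> \<eta> t)) = (\<integral>r. exp (- l * r) \<partial>\<eta> (s + t))"
    using eta[of "s + t" l] assms l by simp
qed

text \<open>By the convolution property the law at time 2t is that of a sum of two independent
  variables with the law at time t, to which subadditivity applies. Iterated, the mean divided by t
  can only grow when t is halved.\<close>

lemma integral_eta_double_le:
  fixes g :: "real \<Rightarrow> real"
  assumes [measurable]: "g \<in> borel_measurable borel" and t: "0 \<le> t"
    and g0: "\<And>s. 0 \<le> s \<Longrightarrow> 0 \<le> g s" and gb: "\<And>s. 0 \<le> s \<Longrightarrow> g s \<le> B"
    and sub: "\<And>s r. 0 \<le> s \<Longrightarrow> 0 \<le> r \<Longrightarrow> g (s + r) \<le> g s + g r"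
  shows "(\<integral>s. g s \<partial>\<eta> (2 * t)) \<le> 2 * (\<integral>s. g s \<partial>\<eta> t)"
proof -
  interpret t: prob_space "\<eta> t" by (rule prob_eta) fact
  have nn: "(\<integral>\<^sup>+s. ennreal (g s) \<partial>\<eta> t) = ennreal (\<integral>s. g s \<partial>\<eta> t)" "0 \<le> (\<integral>s. g s \<partial>\<eta> t)" if t: "0 \<le> t" for t
  proof -
    interpret u: prob_space "\<eta> t" by (rule prob_eta) fact
    have "AE s in \<eta> t. norm (g s) \<le> B" using eta_nonneg[OF t] g0 gb by (auto elim!: eventually_mono)
    then have "integrable (\<eta> t) g" by (rule u.integrable_const_bound) simp
    then show "(\<integral>\<^sup>+s. ennreal (g s) \<partial>\<eta> t) = ennreal (\<integral>s. g s \<partial>\<eta> t)"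
      using eta_nonneg[OF t] g0 by (intro nn_integral_eq_integral) (auto elim!: eventually_mono)
    show "0 \<le> (\<integral>s. g s \<partial>\<eta> t)" using eta_nonneg[OF t] g0 by (intro integral_nonneg_AE) (auto elim!: eventually_mono)
  qed
  have "ennreal (\<integral>s. g s \<partial>\<eta> (2 * t)) = (\<integral>\<^sup>+s. ennreal (g s) \<partial>\<eta> (2 * t))" using nn t by simp
  also have "\<dots> = (\<integral>\<^sup>+s. ennreal (g s) \<partial>(\<eta> t \<star> \<eta> t))" using eta_convolution[of t t] t by simp
  also have "\<dots> = (\<integral>\<^sup>+a. \<integral>\<^sup>+b. ennreal (g (a + b)) \<partial>\<eta> t \<partial>\<eta> t)"
    by (rule nn_integral_convolution) (auto intro: t.finite_measure_axioms)
  also have "\<dots> \<le> (\<integral>\<^sup>+a. \<integral>\<^sup>+b. ennreal (g a) + ennreal (g b) \<partial>\<eta> t \<partial>\<eta> t)"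
  proof (intro nn_integral_mono_AE)
    show "AE a in \<eta> t. (\<integral>\<^sup>+b. ennreal (g (a + b)) \<partial>\<eta> t) \<le> (\<integral>\<^sup>+b. ennreal (g a) + ennreal (g b) \<partial>\<eta> t)"
      using eta_nonneg[OF t]
    proof eventually_elim
      fix a :: real assume a: "0 \<le> a"
      have "AE b in \<eta> t. ennreal (g (a + b)) \<le> ennreal (g a) + ennreal (g b)"
        using eta_nonneg[OF t]
      proof eventually_elim
        fix b :: real assume b: "0 \<le> b"
        have "ennreal (g (a + b)) \<le> ennreal (g a + g b)" using sub a b by (intro ennreal_leI) auto
        then show "ennreal (g (a + b)) \<le> ennreal (g a) + ennreal (g b)" using g0 a b by simp
      qed
      then show "(\<integral>\<^sup>+b. ennreal (g (a + b)) \<partial>\<eta> t) \<le> (\<integral>\<^sup>+b. ennreal (g a) + ennreal (g b) \<partial>\<eta> t)"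
        by (rule nn_integral_mono_AE)
    qed
  qed
  also have "\<dots> = ennreal (\<integral>s. g s \<partial>\<eta> t) + ennreal (\<integral>s. g s \<partial>\<eta> t)"
    using t.emeasure_space_1 nn(1)[OF t] by (simp add: nn_integral_add)
  also have "\<dots> = ennreal (2 * (\<integral>s. g s \<partial>\<eta> t))" using nn(2)[OF t] by (simp flip: ennreal_plus)
  finally show ?thesis using nn(2)[OF t] by simp
qed

text \<open>The shifted increments \<open>f e - f (e + s)\<close> of a convex \<open>f\<close> are Lipschitz at \<open>0\<close>, so that
  \<open>eta_div_tendsto\<close> applies to them; they are subadditive, so that their means are bounded by the limit
  for every \<open>t\<close>, and they increase to \<open>f 0 - f s\<close> as \<open>e\<close> decreases to \<open>0\<close>.\<close>

lemma convex_decay_tendsto: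
  fixes f :: "real \<Rightarrow> real"
  assumes conv: "convex_on {0..} f" and cont: "continuous_on UNIV f"
    and f0: "\<And>s. 0 \<le> s \<Longrightarrow> 0 \<le> f s" and anti: "\<And>s r. 0 \<le> s \<Longrightarrow> s \<le> r \<Longrightarrow> f r \<le> f s"
  shows "((\<lambda>t. ennreal ((\<integral>s. f 0 - f s \<partial>\<eta> t) / t)) \<longlongrightarrow> (\<integral>\<^sup>+s. ennreal (f 0 - f s) \<partial>\<nu>)) (at_right 0)"
proof -
  have [measurable]: "f \<in> borel_measurable borel" by (rule borel_measurable_continuous_onI) fact
  have fc: "isCont f s" for s using cont by (simp add: continuous_on_eq_continuous_at)
  define h where "h = (\<lambda>e s. f e - f (e + s))"
  have [measurable]: "h e \<in> borel_measurable borel" for e unfolding h_def by measurable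
  have h0: "0 \<le> h e s" "h e s \<le> f 0" if "0 \<le> e" "0 \<le> s" for e s
    using anti[of e "e + s"] anti[of 0 e] f0[of "e + s"] that by (auto simp: h_def)
  have hle: "h e s \<le> h 0 s" if "0 \<le> e" "0 \<le> s" for e s
    using convex_four_points[OF conv, of 0 e s] that by (simp add: h_def)
  have hsub: "h e (s + r) \<le> h e s + h e r" if "0 \<le> e" "0 \<le> s" "0 \<le> r" for e s r
    using convex_four_points[OF conv, of e s r] that by (simp add: h_def add.assoc)
  \<comment> \<open>Convexity with \<open>e\<close> as a combination of 0 and \<open>s + e\<close>.
    The constant blows up as \<open>e\<close> tends to 0, which is harmless because \<open>e\<close>
    stays fixed while t tends to 0.\<close>
  have hlip: "h e s \<le> f 0 / e * s" if e: "0 < e" and s: "0 \<le> s" for e s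
  proof -
    define u where "u = e / (s + e)"
    have u: "0 \<le> u" "u \<le> 1" using e s by (auto simp: u_def)
    have "f ((1 - u) * 0 + u * (s + e)) \<le> (1 - u) * f 0 + u * f (s + e)"
      using convex_onD[OF conv u, of 0 "s + e"] e s by simp
    moreover have "u * (s + e) = e" using e s by (auto simp: u_def field_simps)
    ultimately have "h e s \<le> (1 - u) * f 0 + (u - 1) * f (s + e)" by (simp add: h_def left_diff_distrib add.commute)
    also have "\<dots> = (1 - u) * (f 0 - f (s + e))" by (simp add: algebra_simps)
    also have "\<dots> \<le> (1 - u) * f 0" using u f0[of "s + e"] e s by (intro mult_left_mono) auto
    also have "\<dots> = s / (s + e) * f 0" using e s by (simp add: u_def field_simps)
    also have "\<dots> \<le> s / e * f 0" using e s f0[of 0] by (intro mult_right_mono divide_left_mono) auto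
    finally show ?thesis by (simp add: mult.commute)
  qed
  have hbd: "\<bar>h e s\<bar> \<le> (f 0 * max 1 (1 / e)) * min 1 s" if e: "0 < e" and s: "0 < s" for e s
  proof (cases "1 \<le> s")
    case True
    have "h e s \<le> f 0 * 1" using h0[of e s] e s by simp
    also have "\<dots> \<le> f 0 * max 1 (1 / e)" using f0[of 0] by (intro mult_left_mono) auto
    finally show ?thesis using True h0[of e s] e s by simp
  next
    case False
    have "h e s \<le> f 0 * (1 / e) * s" using hlip[of e s] e s by simp
    also have "\<dots> \<le> f 0 * max 1 (1 / e) * s" using f0[of 0] s by (intro mult_left_mono mult_right_mono) auto
    finally show ?thesis using False h0[of e s] e s by simp
  qed
  define A where "A = (\<lambda>e t. \<integral>s. h e s \<partial>\<eta> t)"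
  define L where "L = (\<integral>\<^sup>+s. ennreal (h 0 s) \<partial>\<nu>)"
  have lim: "((\<lambda>t. A e t / t) \<longlongrightarrow> (\<integral>s. h e s \<partial>\<nu>)) (at_right 0)" if "0 < e" for e
    unfolding A_def
  proof (rule eta_div_tendsto[OF _ _ _ hbd[OF that]])
    show "isCont (h e) s" for s unfolding h_def by (intro continuous_intros isCont_o2[OF _ fc])
    show "h e 0 = 0" by (simp add: h_def)
  qed simp_all
  have int_nu: "ennreal (\<integral>s. h e s \<partial>\<nu>) = (\<integral>\<^sup>+s. ennreal (h e s) \<partial>\<nu>)" if "0 < e" for e
    using integrable_nu[OF _ hbd[OF that]] nu_pos h0[of e] that
    by (intro nn_integral_eq_integral[symmetric]) (auto elim!: eventually_mono)
  have int_le: "(\<integral>\<^sup>+s. ennreal (h e s) \<partial>\<nu>) \<le> L" if "0 \<le> e" for e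
    unfolding L_def using nu_pos hle that by (intro nn_integral_mono_AE) (auto elim!: eventually_mono intro: ennreal_leI)
  have int_eta: "integrable (\<eta> t) (h e)" if "0 \<le> e" "0 \<le> t" for e t
  proof -
    interpret prob_space "\<eta> t" by (rule prob_eta) fact
    show ?thesis by (rule integrable_const_bound[of _ "f 0"])
      (use eta_nonneg[OF that(2)] h0[OF that(1)] in \<open>auto elim!: eventually_mono\<close>)
  qed
  have A_le: "ennreal (A e t / t) \<le> L" if e: "0 < e" and t: "0 < t" for e t
  proof -
    \<comment> \<open>Along t, t/2, t/4, ... the quotients increase, and their limit is the integral
      against \<nu>; this turns the limit into a bound at each t > 0, uniform in \<open>e\<close>
      through \<open>L\<close>.\<close>
    have mono: "A e t / t \<le> A e (t / 2 ^ n) / (t / 2 ^ n)" for n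
    proof (induction n)
      case (Suc n)
      have "A e (2 * (t / 2 ^ Suc n)) \<le> 2 * A e (t / 2 ^ Suc n)"
        unfolding A_def using e t h0[of e] hsub[of e] by (intro integral_eta_double_le[of _ _ "f 0"]) auto
      then have "A e (t / 2 ^ n) / (t / 2 ^ n) \<le> A e (t / 2 ^ Suc n) / (t / 2 ^ Suc n)"
        using t by (simp add: field_simps)
      with Suc show ?case by simp
    qed simp
    have "(\<lambda>n. t * (1 / 2) ^ n) \<longlonglongrightarrow> t * 0" by (intro tendsto_intros LIMSEQ_power_zero) auto
    then have "filterlim (\<lambda>n. t / 2 ^ n) (at_right 0) sequentially"
      using t by (simp add: filterlim_at_right_to_0 filterlim_at power_divide)
    from filterlim_compose[OF lim[OF e] this]
    have "A e t / t \<le> (\<integral>s. h e s \<partial>\<nu>)" by (rule LIMSEQ_le_const) (use mono in auto)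
    then have "ennreal (A e t / t) \<le> ennreal (\<integral>s. h e s \<partial>\<nu>)" by (rule ennreal_leI)
    also have "\<dots> \<le> L" using int_nu int_le e by simp
    finally show ?thesis .
  qed
  define e where "e = (\<lambda>n. inverse (real (Suc n)))"
  have e: "0 < e n" "e \<longlonglongrightarrow> 0" for n unfolding e_def using LIMSEQ_inverse_real_of_nat by auto
  have hlim: "(\<lambda>n. h (e n) s) \<longlonglongrightarrow> h 0 s" for s
  proof -
    have "(\<lambda>n. h (e n) s) \<longlonglongrightarrow> f 0 - f (0 + s)"
      unfolding h_def by (intro tendsto_intros isCont_tendsto_compose[OF fc] e(2))
    then show ?thesis by (simp add: h_def)
  qed
  have A0_le: "ennreal (A 0 t / t) \<le> L" if t: "0 < t" for t
  proof -
    interpret prob_space "\<eta> t" using t by (intro prob_eta) simp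
    have "(\<lambda>n. A (e n) t) \<longlonglongrightarrow> A 0 t"
      unfolding A_def
    proof (rule integral_dominated_convergence)
      show "AE s in \<eta> t. norm (h (e n) s) \<le> f 0" for n
        using eta_nonneg[of t] h0[of "e n"] e(1)[of n] t by (auto elim!: eventually_mono)
    qed (use hlim in auto)
    then have "(\<lambda>n. ennreal (A (e n) t / t)) \<longlonglongrightarrow> ennreal (A 0 t / t)"
      using t by (intro tendsto_ennrealI tendsto_intros) auto
    then show ?thesis by (rule LIMSEQ_le_const2) (use A_le e t in auto)
  qed
  have "((\<lambda>t. ennreal (A 0 t / t)) \<longlongrightarrow> L) (at_right 0)"
  proof (rule order_tendstoI)
    fix c assume "c < L"
    \<comment> \<open>Fatou's lemma: any c below \<open>L\<close> is exceeded by the integral for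
      some fixed \<open>e n\<close>, and for that increment the limit is already known. It bounds
      the quotients of \<open>h 0\<close> from below, while \<open>A0_le\<close> bounds them from
      above.\<close>
    have "L \<le> liminf (\<lambda>n. \<integral>\<^sup>+s. ennreal (h (e n) s) \<partial>\<nu>)"
    proof -
      have "L = (\<integral>\<^sup>+s. liminf (\<lambda>n. ennreal (h (e n) s)) \<partial>\<nu>)"
        unfolding L_def by (intro nn_integral_cong lim_imp_Liminf[symmetric] tendsto_ennrealI hlim) simp
      also have "\<dots> \<le> liminf (\<lambda>n. \<integral>\<^sup>+s. ennreal (h (e n) s) \<partial>\<nu>)" by (rule nn_integral_liminf) simp
      finally show ?thesis .
    qed
    with \<open>c < L\<close> have "c < liminf (\<lambda>n. \<integral>\<^sup>+s. ennreal (h (e n) s) \<partial>\<nu>)" by simp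
    then have "eventually (\<lambda>n. c < (\<integral>\<^sup>+s. ennreal (h (e n) s) \<partial>\<nu>)) sequentially" by (rule less_LiminfD)
    then obtain n where n: "c < (\<integral>\<^sup>+s. ennreal (h (e n) s) \<partial>\<nu>)" by (auto dest: eventually_happens)
    have "((\<lambda>t. ennreal (A (e n) t / t)) \<longlongrightarrow> (\<integral>\<^sup>+s. ennreal (h (e n) s) \<partial>\<nu>)) (at_right 0)"
      using tendsto_ennrealI[OF lim[OF e(1)]] int_nu[OF e(1)] by simp
    from order_tendstoD(1)[OF this n] eventually_at_right_less
    show "eventually (\<lambda>t. c < ennreal (A 0 t / t)) (at_right 0)"
    proof eventually_elim
      fix t assume "c < ennreal (A (e n) t / t)" and t: "(0::real) < t"
      note this(1)
      also have "A (e n) t \<le> A 0 t"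
        unfolding A_def using int_eta[of "e n" t] int_eta[of 0 t] t e(1)[of n] eta_nonneg[of t] hle[of "e n"]
        by (intro integral_mono_AE) (auto elim!: eventually_mono)
      then have "ennreal (A (e n) t / t) \<le> ennreal (A 0 t / t)" using t by (intro ennreal_leI divide_right_mono) auto
      finally show "c < ennreal (A 0 t / t)" .
    qed
  next
    fix c assume "L < c"
    show "eventually (\<lambda>t. ennreal (A 0 t / t) < c) (at_right 0)"
      using eventually_at_right_less by (rule eventually_mono) (use A0_le \<open>L < c\<close> in \<open>blast intro: le_less_trans\<close>)
  qed
  then show ?thesis by (simp add: A_def L_def h_def)
qed

end

section \<open>Midpoint convexity\<close>

text \<open>Induction on the level: a dyadic point of level n+1 is a dyadic point of level n in the
  left or in the right half of the interval, and the value at the common midpoint is bounded by the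
  hypothesis.\<close>

lemma midpoint_convex_dyadic:
  fixes f :: "real \<Rightarrow> real"
  assumes mid: "\<And>a b. 0 \<le> a \<Longrightarrow> 0 \<le> b \<Longrightarrow> f ((a + b) / 2) \<le> (f a + f b) / 2"
    and "k \<le> 2 ^ n" "0 \<le> a" "0 \<le> b"
  shows "f (a + real k / 2 ^ n * (b - a)) \<le> (1 - real k / 2 ^ n) * f a + real k / 2 ^ n * f b"
  using assms(2-)
proof (induction n arbitrary: k a b)
  case 0
  then have "k = 0 \<or> k = 1" by auto
  then show ?case by auto
next
  case (Suc n)
  define m where "m = (a + b) / 2"
  have m: "0 \<le> m" "f m \<le> (f a + f b) / 2" using Suc.prems mid[of a b] by (auto simp: m_def)
  show ?case
  proof (cases "k \<le> 2 ^ n")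
    case True
    define u where "u = real k / 2 ^ n"
    have u: "0 \<le> u" "real k / 2 ^ Suc n = u / 2" by (auto simp: u_def)
    have "f (a + u * (m - a)) \<le> (1 - u) * f a + u * f m"
      unfolding u_def using Suc.IH[OF True, of a m] Suc.prems m by simp
    also have "u * f m \<le> u * ((f a + f b) / 2)" using u m by (intro mult_left_mono) auto
    finally show ?thesis unfolding u(2) by (simp add: m_def algebra_simps add_divide_distrib diff_divide_distrib)
  next
    case False
    define j where "j = k - 2 ^ n"
    define u where "u = real j / 2 ^ n"
    have j: "j \<le> 2 ^ n" "real k = real j + 2 ^ n" using False Suc.prems by (auto simp: j_def of_nat_diff)
    have u: "u \<le> 1" "real k / 2 ^ Suc n = (1 + u) / 2"
      using j(1) by (auto simp: u_def j(2) field_simps)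
    have "f (m + u * (b - m)) \<le> (1 - u) * f m + u * f b"
      unfolding u_def using Suc.IH[OF j(1), of m b] Suc.prems m by simp
    also have "(1 - u) * f m \<le> (1 - u) * ((f a + f b) / 2)" using u m by (intro mult_left_mono) auto
    finally show ?thesis unfolding u(2) by (simp add: m_def algebra_simps add_divide_distrib diff_divide_distrib)
  qed
qed

lemma midpoint_right_continuous_convex:
  fixes f :: "real \<Rightarrow> real"
  assumes mid: "\<And>a b. 0 \<le> a \<Longrightarrow> 0 \<le> b \<Longrightarrow> f ((a + b) / 2) \<le> (f a + f b) / 2"
    and rc: "\<And>t. 0 \<le> t \<Longrightarrow> (f \<longlongrightarrow> f t) (at_right t)"
  shows "convex_on {0..} f"
proof (rule convex_on_linorderI)
  fix u a b :: real assume u: "0 < u" "u < 1" and "a \<in> {0..}" "b \<in> {0..}" and ab: "a < b"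
  then have a: "0 \<le> a" and b: "0 \<le> b" by auto
  \<comment> \<open>The added 1 makes the dyadic approximations of u strictly larger than u. As a <
    b the points then approach from the right, the side on which continuity is available; u < 1
    keeps the numerators at most 2^n.\<close>
  define k where "k = (\<lambda>n::nat. nat \<lfloor>u * 2 ^ n\<rfloor> + 1)"
  define v where "v = (\<lambda>n. real (k n) / 2 ^ n)"
  have fl: "u * 2 ^ n < real (k n)" "real (k n) \<le> u * 2 ^ n + 1" for n
    using u by (auto simp: k_def) linarith
  have k: "k n \<le> 2 ^ n" for n
  proof -
    have "u * 2 ^ n < 2 ^ n" using u by simp
    then have "\<lfloor>u * 2 ^ n\<rfloor> < 2 ^ n" by (simp add: floor_less_iff)
    then show ?thesis using u unfolding k_def by (simp add: nat_less_iff Suc_le_eq)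
  qed
  have v: "u < v n" "v n \<le> u + (1 / 2) ^ n" for n
    using fl[of n] by (auto simp: v_def field_simps)
  have "(\<lambda>n. u + (1 / 2) ^ n) \<longlonglongrightarrow> u + 0" by (intro tendsto_intros LIMSEQ_power_zero) auto
  then have vl: "v \<longlonglongrightarrow> u"
    by (intro tendsto_sandwich[of "\<lambda>_. u" v sequentially "\<lambda>n. u + (1 / 2) ^ n" u]) (use v in \<open>auto intro!: always_eventually less_imp_le\<close>)
  have "filterlim (\<lambda>n. a + v n * (b - a)) (at_right (a + u * (b - a))) sequentially"
    unfolding filterlim_at
  proof
    show "(\<lambda>n. a + v n * (b - a)) \<longlonglongrightarrow> a + u * (b - a)" by (intro tendsto_intros vl)
    show "\<forall>\<^sub>F n in sequentially. a + v n * (b - a) \<in> {a + u * (b - a)<..} \<and> a + v n * (b - a) \<noteq> a + u * (b - a)"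
      using v ab by (auto intro!: always_eventually simp: less_imp_neq[THEN not_sym])
  qed
  from filterlim_compose[OF rc this]
  have "(\<lambda>n. f (a + v n * (b - a))) \<longlonglongrightarrow> f (a + u * (b - a))" using u a ab by simp
  moreover have "(\<lambda>n. (1 - v n) * f a + v n * f b) \<longlonglongrightarrow> (1 - u) * f a + u * f b" by (intro tendsto_intros vl)
  moreover have "f (a + v n * (b - a)) \<le> (1 - v n) * f a + v n * f b" for n
    unfolding v_def by (rule midpoint_convex_dyadic[OF mid k a b])
  ultimately have "f (a + u * (b - a)) \<le> (1 - u) * f a + u * f b"
    using LIMSEQ_le by blast
  then show "f ((1 - u) *\<^sub>R a + u *\<^sub>R b) \<le> (1 - u) * f a + u * f b" by (simp add: algebra_simps)
qed simp

lemma convex_bounded_antimono: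
  fixes f :: "real \<Rightarrow> real"
  assumes f: "convex_on {0..} f" and B: "\<And>s. 0 \<le> s \<Longrightarrow> f s \<le> B" and "0 \<le> s" "s \<le> r"
  shows "f r \<le> f s"
proof (rule ccontr)
  assume "\<not> f r \<le> f s"
  then have d: "f s < f r" "s < r" using assms(4) by (auto simp: less_le)
  \<comment> \<open>If f increased from s to r, convexity would continue this slope; stretching the
    distance by \<open>M\<close> raises f by more than B - f s, past the bound.\<close>
  define M where "M = 1 + \<bar>B - f s\<bar> / (f r - f s)"
  have M: "1 \<le> M" using d by (simp add: M_def)
  define z where "z = s + M * (r - s)"
  have z: "0 \<le> z" using assms M d by (simp add: z_def)
  have "f ((1 - 1 / M) *\<^sub>R s + (1 / M) *\<^sub>R z) \<le> (1 - 1 / M) * f s + 1 / M * f z"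
    using M z assms by (intro convex_onD[OF f]) auto
  also have "(1 - 1 / M) *\<^sub>R s + (1 / M) *\<^sub>R z = r" using M by (simp add: z_def field_simps)
  finally have "M * f r \<le> (M - 1) * f s + f z" using M by (simp add: field_simps)
  then have "M * (f r - f s) \<le> f z - f s" by (simp add: algebra_simps)
  also have "\<dots> \<le> B - f s" using B[OF z] by simp
  finally have "M * (f r - f s) \<le> B - f s" .
  moreover have "M * (f r - f s) = f r - f s + \<bar>B - f s\<bar>" using d by (simp add: M_def distrib_right)
  ultimately have "f r - f s + \<bar>B - f s\<bar> \<le> B - f s" by simp
  then show False using d by linarith
qed

text \<open>Interior points are covered by convexity; at 0 right continuity meets the constant
  extension to the left. The semigroup form satisfies the latter because negative times are
  truncated to 0.\<close>

lemma convex_right_continuous_continuous: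
  fixes f :: "real \<Rightarrow> real"
  assumes f: "convex_on {0..} f" and rc: "(f \<longlongrightarrow> f 0) (at_right 0)" and neg: "\<And>t. t \<le> 0 \<Longrightarrow> f t = f 0"
  shows "continuous_on UNIV f"
proof (rule continuous_at_imp_continuous_on, intro ballI)
  fix t :: real
  consider "t < 0" | "t = 0" | "0 < t" by linarith
  then show "isCont f t"
  proof cases
    case 1
    then have "eventually (\<lambda>s. f s = f 0) (nhds t)"
      by (intro eventually_nhds_in_open[of "{..<0}", THEN eventually_mono]) (auto intro: neg)
    then show ?thesis by (simp add: isCont_cong)
  next
    case 2
    have "(f \<longlongrightarrow> f 0) (at_left 0)"
      by (rule tendsto_eventually) (auto simp: eventually_at_filter intro!: always_eventually intro: neg)
    then have "(f \<longlongrightarrow> f 0) (at 0)" using rc by (simp add: filterlim_at_split)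
    then show ?thesis using 2 by (simp add: isCont_def)
  next
    case 3
    have "continuous_on {0<..} f" by (rule convex_on_continuous) (auto intro: convex_on_subset[OF f])
    then show ?thesis using 3 by (simp add: continuous_on_eq_continuous_at)
  qed
qed

section \<open>Markov semigroup of a Hunt process\<close>

lemma openin_top_cem:
  "openin top_cem V \<longleftrightarrow> (\<exists>U. open U \<and> V = Some ` U) \<or> (\<exists>C. compact C \<and> closed C \<and> V = insert None (Some ` (- C)))"
  by (auto simp: top_cem_def openin_Alexandroff_compactification Compl_eq_Diff_UNIV)

lemma space_borel_cem [simp]: "space borel_cem = UNIV" and sets_borel_cem: "sets borel_cem = sigma_sets UNIV {U. openin top_cem U}"
  by (simp_all add: borel_cem_def)

lemma Some_image_borel_cem:
  assumes "B \<in> sets borel" shows "Some ` B \<in> sets borel_cem"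
proof -
  have "B \<in> sigma_sets UNIV {S. open S}" using assms by (simp add: borel_def)
  then show ?thesis
  proof induction
    case (Basic a)
    then show ?case by (auto simp: sets_borel_cem openin_top_cem intro!: sigma_sets.Basic)
  next
    case (Compl a)
    have "Some ` UNIV \<in> sets borel_cem"
      by (auto simp: sets_borel_cem openin_top_cem intro!: sigma_sets.Basic)
    from sets.Diff[OF this Compl.IH] show ?case by (simp add: image_set_diff)
  next
    case (Union a)
    then show ?case by (simp add: image_UN)
  qed simp
qed

lemma measurable_Some_cem [measurable]: "Some \<in> borel \<rightarrow>\<^sub>M borel_cem"
  unfolding borel_cem_def
proof (rule measurable_sigma_sets)
  fix V :: "'a option set" assume "V \<in> {U. openin top_cem U}"
  moreover have "Some -` Some ` U = U" "Some -` insert None (Some ` U) = U" for U :: "'a set" by auto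
  ultimately have "open (Some -` V)" by (auto simp: openin_top_cem)
  then show "Some -` V \<inter> space borel \<in> sets borel" by simp
qed auto

lemma measurable_case_option_cem [measurable]:
  assumes f: "f \<in> borel \<rightarrow>\<^sub>M M" and c: "c \<in> space M"
  shows "case_option c f \<in> borel_cem \<rightarrow>\<^sub>M M"
proof (rule measurableI)
  show "case_option c f z \<in> space M" for z using c measurable_space[OF f] by (cases z) auto
  fix A assume A: "A \<in> sets M"
  have 1: "Some ` (f -` A) \<in> sets borel_cem"
    using measurable_sets[OF f A] by (intro Some_image_borel_cem) simp
  have "{None} = space borel_cem - Some ` UNIV" by (auto simp: notin_range_Some)
  also have "\<dots> \<in> sets borel_cem" by (intro sets.compl_sets Some_image_borel_cem) simp
  finally have 2: "{None :: 'a option} \<in> sets borel_cem" .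
  have "case_option c f -` A \<inter> space borel_cem = Some ` (f -` A) \<union> (if c \<in> A then {None} else {})"
    by (auto split: option.splits if_splits)
  then show "case_option c f -` A \<inter> space borel_cem \<in> sets borel_cem" using 1 sets.Un[OF 2 1] by auto
qed

text \<open>Compact support gives continuity at the added point: if V contains 0, the complement of
  the preimage of V is a closed subset of the support, hence compact, so its complement with
  \<open>None\<close> is open in the compactification.\<close>

lemma continuous_map_case_option_Cc:
  assumes u: "u \<in> Cc" shows "continuous_map top_cem euclideanreal (case_option 0 u)"
  unfolding continuous_map_def
proof (intro conjI allI impI)
  show "case_option 0 u \<in> topspace top_cem \<rightarrow> topspace euclideanreal" by simp
  fix V :: "real set" assume V: "openin euclidean V"
  have c: "continuous_on UNIV u" and k: "compact (support u)" using u by (auto simp: Cc_def)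
  have o: "open (u -` V)" using V c by (simp add: continuous_on_open_vimage)
  show "openin top_cem {x \<in> topspace top_cem. case_option 0 u x \<in> V}"
  proof (cases "0 \<in> V")
    case False
    have "{x \<in> topspace top_cem. case_option 0 u x \<in> V} = Some ` (u -` V)"
      using False by (auto simp: top_cem_def split: option.splits)
    then show ?thesis using o by (auto simp: openin_top_cem)
  next
    case True
    have "- (u -` V) \<subseteq> support u" using True by (force simp: support_def intro: closure_subset[THEN subsetD])
    moreover have "closed (- (u -` V))" using o by (simp add: closed_Compl)
    ultimately have "compact (- (u -` V))" using k by (metis compact_Int_closed inf.absorb_iff2)
    moreover have "x \<in> topspace top_cem \<and> case_option 0 u x \<in> V \<longleftrightarrow> x \<in> insert None (Some ` (- (- (u -` V))))" for x
      using True by (cases x) (auto simp: top_cem_def)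
    then have "{x \<in> topspace top_cem. case_option 0 u x \<in> V} = insert None (Some ` (- (- (u -` V))))"
      by blast
    ultimately show ?thesis using \<open>closed (- (u -` V))\<close> by (auto simp: openin_top_cem)
  qed
qed

lemma Cc_measurable: "u \<in> Cc \<Longrightarrow> u \<in> borel_measurable borel"
  by (auto simp: Cc_def intro: borel_measurable_continuous_onI)

lemma Cc_bounded: assumes "u \<in> Cc" obtains B where "0 < B" "\<And>x. \<bar>u x\<bar> \<le> B"
proof -
  have "compact (u ` support u)"
    using assms by (auto simp: Cc_def intro: compact_continuous_image continuous_on_subset)
  then obtain B where B: "0 < B" "\<And>y. y \<in> u ` support u \<Longrightarrow> norm y \<le> B"
    using bounded_pos[of "u ` support u"] compact_imp_bounded by blast
  have "\<bar>u x\<bar> \<le> B" for x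
  proof (cases "u x = 0")
    case False
    then have "x \<in> support u" by (auto simp: support_def intro: closure_subset[THEN subsetD])
    then show ?thesis using B(2)[of "u x"] by simp
  qed (use B in simp)
  with B show thesis by (intro that[of B])
qed

text \<open>Retains from the Hunt axioms what the semigroup argument rests on, with the Markov
  property at deterministic times only.\<close>

locale cemetery_process =
  fixes P :: "'a::{metric_space,second_countable_topology} option \<Rightarrow> 'w measure" and X :: "ennreal \<Rightarrow> 'w \<Rightarrow> 'a option"
  assumes prob: "prob_space (P x)"
    and sets_P: "sets (P x) = sets (P None)"
    and X_measurable: "X t \<in> P None \<rightarrow>\<^sub>M borel_cem"
    and kernel_measurable: "A \<in> sets borel_cem \<Longrightarrow>
      (\<lambda>x. emeasure (P x) {\<omega>\<in>space (P None). X t \<omega> \<in> A}) \<in> borel_measurable borel_cem"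
    and normal: "AE \<omega> in P x. X 0 \<omega> = x"
    and dead: "AE \<omega> in P None. X t \<omega> = None"
    and right_continuous: "\<omega> \<in> space (P None) \<Longrightarrow> t < \<infinity> \<Longrightarrow> limitin top_cem (\<lambda>s. X s \<omega>) (X t \<omega>) (at_right t)"
    and markov: "A \<in> sets borel_cem \<Longrightarrow> emeasure (P x) {\<omega>\<in>space (P None). X (s + t) \<omega> \<in> A} =
      (\<integral>\<^sup>+\<omega>. emeasure (P (X s \<omega>)) {\<omega>'\<in>space (P None). X t \<omega>' \<in> A} \<partial>P x)"

text \<open>Needed to know that the whole sample space belongs to the stopped sigma-algebra. Time
  \<infinity> is split off because no later times exist there and the intersection would be over an
  empty family.\<close>

lemma filtration_history_plus: "filtration \<Omega> (history_plus \<Omega> X)"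
proof
  have sub: "{X s -` A \<inter> \<Omega> | s A. s \<le> t \<and> A \<in> sets borel_cem} \<subseteq> Pow \<Omega>" for t by auto
  have h: "space (history \<Omega> X t) = \<Omega>" "sets (history \<Omega> X t) \<subseteq> Pow \<Omega>" for t
    using sets.sets_into_space[of _ "history \<Omega> X t"] by (auto simp: history_def space_measure_of_conv)
  have hm: "sets (history \<Omega> X s) \<subseteq> sets (history \<Omega> X t)" if "s \<le> t" for s t
    unfolding history_def sets_measure_of[OF sub]
    using that by (intro sigma_sets_mono'' sigma_sets_top) (auto intro: order_trans)
  show "space (history_plus \<Omega> X t) = \<Omega>" for t by (simp add: history_plus_def h space_measure_of_conv)
  have P: "(\<Inter>u\<in>{t<..}. sets (history \<Omega> X u)) \<subseteq> Pow \<Omega>" if "t < \<infinity>" for t using h(2)[of \<infinity>] that by auto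
  fix s t :: ennreal assume st: "s \<le> t"
  show "sets (history_plus \<Omega> X s) \<subseteq> sets (history_plus \<Omega> X t)"
  proof (cases "t = \<infinity>")
    case True
    show ?thesis
    proof (cases "s = \<infinity>")
      case False
      then have s: "s < \<infinity>" by (simp add: less_top)
      have "sigma_sets \<Omega> (\<Inter>u\<in>{s<..}. sets (history \<Omega> X u)) \<subseteq> sets (history \<Omega> X \<infinity>)"
        using sets.sigma_sets_subset[of "\<Inter>u\<in>{s<..}. sets (history \<Omega> X u)" "history \<Omega> X \<infinity>"] s by (auto simp: h)
      then show ?thesis using True False P[OF s] by (simp add: history_plus_def)
    qed (simp add: True)
  next
    case False
    then have "t < \<infinity>" "s < \<infinity>" using st by (auto simp: less_top intro: le_less_trans)
    moreover have "(\<Inter>u\<in>{s<..}. sets (history \<Omega> X u)) \<subseteq> (\<Inter>u\<in>{t<..}. sets (history \<Omega> X u))"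
      by (intro INF_superset_mono) (use st in \<open>auto intro: le_less_trans\<close>)
    ultimately show ?thesis
      using P[of s] P[of t] less_imp_neq[OF \<open>t < \<infinity>\<close>] less_imp_neq[OF \<open>s < \<infinity>\<close>]
      by (simp add: history_plus_def sigma_sets_subseteq)
  qed
qed

lemma hunt_process_cemetery_process:
  fixes P :: "'a::{metric_space,second_countable_topology} option \<Rightarrow> 'w measure"
  assumes "hunt_process P X" shows "cemetery_process P X"
proof -
  define \<Omega> where "\<Omega> = space (P None)"
  define G where "G = history_plus \<Omega> X"
  note H = assms[unfolded hunt_process_def Let_def, folded \<Omega>_def, folded G_def]
  have sp: "space (P x) = \<Omega>" for x using H sets_eq_imp_space_eq[of "P x" "P None"] by (auto simp: \<Omega>_def)
  show ?thesis
  proof (rule cemetery_process.intro)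
    fix A :: "'a option set" and x s t assume A: "A \<in> sets borel_cem"
    \<comment> \<open>The simple Markov property is the strong one at a constant time, tested on the
      event of all paths.\<close>
    have "stopping_time G (\<lambda>_. s)" by (rule stopping_time_const)
    moreover have "space (filtration.pre_sigma \<Omega> G (\<lambda>_. s)) = \<Omega>"
      unfolding G_def by (rule filtration.space_pre_sigma[OF filtration_history_plus])
    then have "\<Omega> \<in> sets (filtration.pre_sigma \<Omega> G (\<lambda>_. s))"
      using sets.top[of "filtration.pre_sigma \<Omega> G (\<lambda>_. s)"] by simp
    ultimately have "emeasure (P x) {\<omega>\<in>\<Omega>. X (s + t) \<omega> \<in> A} =
        (\<integral>\<^sup>+\<omega>\<in>\<Omega>. emeasure (P (X s \<omega>)) {\<omega>'\<in>\<Omega>. X t \<omega>' \<in> A} \<partial>P x)"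
      using H A by blast
    also have "\<dots> = (\<integral>\<^sup>+\<omega>. emeasure (P (X s \<omega>)) {\<omega>'\<in>\<Omega>. X t \<omega>' \<in> A} \<partial>P x)"
      by (intro nn_integral_cong) (simp add: sp)
    finally show "emeasure (P x) {\<omega>\<in>space (P None). X (s + t) \<omega> \<in> A} =
      (\<integral>\<^sup>+\<omega>. emeasure (P (X s \<omega>)) {\<omega>'\<in>space (P None). X t \<omega>' \<in> A} \<partial>P x)" by (simp add: \<Omega>_def)
  next
    fix x show "prob_space (P x)" using H[THEN conjunct1] by simp
  next
    fix x show "sets (P x) = sets (P None)" using H[THEN conjunct1] by simp
  next
    fix t show "X t \<in> P None \<rightarrow>\<^sub>M borel_cem" using H[THEN conjunct2, THEN conjunct1] by simp
  next
    fix t and A :: "'a option set" assume "A \<in> sets borel_cem"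
    then show "(\<lambda>x. emeasure (P x) {\<omega>\<in>space (P None). X t \<omega> \<in> A}) \<in> borel_measurable borel_cem"
      using H[THEN conjunct2, THEN conjunct2, THEN conjunct1] by (simp add: \<Omega>_def)
  next
    fix x show "AE \<omega> in P x. X 0 \<omega> = x" using H[THEN conjunct2, THEN conjunct2, THEN conjunct2, THEN conjunct1] by simp
  next
    fix t show "AE \<omega> in P None. X t \<omega> = None" using H[THEN conjunct2, THEN conjunct2, THEN conjunct2, THEN conjunct2, THEN conjunct1] by simp
  next
    fix \<omega> and t :: ennreal assume "\<omega> \<in> space (P None)" "t < \<infinity>"
    then show "limitin top_cem (\<lambda>s. X s \<omega>) (X t \<omega>) (at_right t)"
      using H[THEN conjunct2, THEN conjunct2, THEN conjunct2, THEN conjunct2, THEN conjunct2, THEN conjunct2, THEN conjunct2, THEN conjunct2, THEN conjunct1] by (simp add: \<Omega>_def)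
  qed
qed

context cemetery_process
begin

lemma space_P: "space (P x) = space (P None)" by (rule sets_eq_imp_space_eq[OF sets_P])

lemma X_measurable' [measurable]: "X t \<in> P x \<rightarrow>\<^sub>M borel_cem"
  by (subst measurable_cong_sets[OF sets_P refl]) (rule X_measurable)

text \<open>On the enlarged state space the transition kernels are probability measures; the mass
  lost by the process sits at \<open>None\<close>.\<close>

definition kern :: "ennreal \<Rightarrow> 'a option \<Rightarrow> 'a option measure" where
  "kern t x = distr (P x) borel_cem (X t)"

lemma sets_kern [simp, measurable_cong]: "sets (kern t x) = sets borel_cem" by (simp add: kern_def)
lemma space_kern [simp]: "space (kern t x) = UNIV" by (simp add: kern_def)

lemma prob_space_kern: "prob_space (kern t x)"
proof -
  interpret prob_space "P x" by (rule prob)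
  show ?thesis unfolding kern_def by (rule prob_space_distr) simp
qed

lemma emeasure_kern: "A \<in> sets borel_cem \<Longrightarrow> emeasure (kern t x) A = emeasure (P x) {\<omega>\<in>space (P None). X t \<omega> \<in> A}"
  by (auto simp: kern_def emeasure_distr space_P[of x] intro!: arg_cong[where f = "emeasure (P x)"])

lemma measurable_kern [measurable]: "kern t \<in> borel_cem \<rightarrow>\<^sub>M subprob_algebra borel_cem"
  by (rule measurable_subprob_algebra)
     (auto simp: emeasure_kern kernel_measurable prob_space_kern intro: prob_space_imp_subprob_space)

text \<open>The Chapman-Kolmogorov equation, which is the Markov property pushed forward to the
  state space.\<close>

lemma kern_add: "kern (s + t) x = kern s x \<bind> kern t"
proof (rule measure_eqI)
  show "sets (kern (s + t) x) = sets (kern s x \<bind> kern t)"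
    by (simp add: sets_bind[of _ _ borel_cem] measurable_space)
  fix A assume "A \<in> sets (kern (s + t) x)"
  then have A: "A \<in> sets borel_cem" by simp
  have "emeasure (kern s x \<bind> kern t) A = (\<integral>\<^sup>+y. emeasure (kern t y) A \<partial>kern s x)"
    using A by (intro emeasure_bind) auto
  also have "\<dots> = (\<integral>\<^sup>+\<omega>. emeasure (kern t (X s \<omega>)) A \<partial>P x)"
    unfolding kern_def[of s] using A by (subst nn_integral_distr) (auto intro!: measurable_emeasure_kernel[of _ _ borel_cem])
  finally show "emeasure (kern (s + t) x) A = emeasure (kern s x \<bind> kern t) A"
    using A by (simp add: emeasure_kern markov)
qed

abbreviation T where "T \<equiv> transition P (real_time X)"

lemma T_kern: "f \<in> borel_measurable borel \<Longrightarrow> T t f x = (\<integral>z. case_option 0 f z \<partial>kern (ennreal t) (Some x))"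
  unfolding transition_def real_time_def kern_def by (subst integral_distr) auto

lemma T_measurable [measurable]:
  assumes [measurable]: "f \<in> borel_measurable borel" shows "T t f \<in> borel_measurable borel"
proof -
  have "(\<lambda>x. \<integral>z. case_option 0 f z \<partial>kern (ennreal t) (Some x)) \<in> borel_measurable borel" by measurable
  then show ?thesis by (simp add: T_kern[symmetric] fun_eq_iff[symmetric] cong: measurable_cong)
qed

lemma integrable_kern:
  fixes g :: "'a option \<Rightarrow> real"
  assumes [measurable]: "g \<in> borel_measurable borel_cem" and "\<And>z. \<bar>g z\<bar> \<le> B" shows "integrable (kern t x) g"
proof -
  interpret prob_space "kern t x" by (rule prob_space_kern)
  show ?thesis by (rule integrable_const_bound[of _ B]) (use assms in auto)
qed

lemma T_bounded:
  assumes [measurable]: "f \<in> borel_measurable borel" and B: "\<And>x. \<bar>f x\<bar> \<le> B" shows "\<bar>T t f x\<bar> \<le> B"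
proof -
  interpret prob_space "kern (ennreal t) (Some x)" by (rule prob_space_kern)
  have B0: "0 \<le> B" using B[of undefined] by simp
  have b: "\<bar>case_option 0 f z\<bar> \<le> B" for z using B B0 by (cases z) auto
  have "\<bar>T t f x\<bar> \<le> (\<integral>z. \<bar>case_option 0 f z\<bar> \<partial>kern (ennreal t) (Some x))"
    by (simp add: T_kern)
  also have "\<dots> \<le> (\<integral>z. B \<partial>kern (ennreal t) (Some x))"
    using b B0 by (intro integral_mono integrable_kern[of _ B]) auto
  finally show ?thesis using prob_space by simp
qed

text \<open>\<open>ennreal\<close> truncates negative times to 0, so the semigroup is frozen at the
  identity there and its quadratic form is a function on the whole line.\<close>

lemma T_nonpos: assumes [measurable]: "f \<in> borel_measurable borel" and "t \<le> 0" shows "T t f x = f x"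
proof -
  interpret prob_space "P (Some x)" by (rule prob)
  have "T t f x = (\<integral>\<omega>. f x \<partial>P (Some x))"
    unfolding transition_def real_time_def using assms(2) normal[of "Some x"]
    by (intro integral_cong_AE) (auto simp: ennreal_neg elim!: eventually_mono)
  then show ?thesis using prob_space by simp
qed

text \<open>Adding B makes the integrand nonnegative, so that the rule for nonnegative integrals
  against a bind applies; B is subtracted afterwards since all kernels have mass 1.\<close>

lemma integral_kern_add:
  fixes g :: "'a option \<Rightarrow> real"
  assumes [measurable]: "g \<in> borel_measurable borel_cem" and B: "\<And>z. \<bar>g z\<bar> \<le> B"
  shows "(\<integral>z. g z \<partial>kern (s + t) x) = (\<integral>y. \<integral>z. g z \<partial>kern t y \<partial>kern s x)"
proof -
  interpret st: prob_space "kern (s + t) x" by (rule prob_space_kern)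
  interpret s: prob_space "kern s x" by (rule prob_space_kern)
  have B0: "0 \<le> g z + B" "g z + B \<le> 2 * B" "\<bar>g z + B\<bar> \<le> 2 * B" for z using B[of z] by auto
  have int: "integrable (kern r y) g" "integrable (kern r y) (\<lambda>z. g z + B)" for r y
    using integrable_kern[of g B r y] integrable_kern[of "\<lambda>z. g z + B" "2 * B" r y] B B0(3) by auto
  have eq: "(\<integral>z. g z + B \<partial>kern r y) = (\<integral>z. g z \<partial>kern r y) + B" for r y
  proof -
    interpret r: prob_space "kern r y" by (rule prob_space_kern)
    show ?thesis using int r.prob_space by simp
  qed
  have nn: "(\<integral>\<^sup>+z. ennreal (g z + B) \<partial>kern r y) = ennreal (\<integral>z. g z + B \<partial>kern r y)" for r y
    using int B0 by (intro nn_integral_eq_integral) auto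
  have b2: "0 \<le> (\<integral>z. g z + B \<partial>kern t y)" "\<bar>\<integral>z. g z + B \<partial>kern t y\<bar> \<le> 2 * B" for y
  proof -
    interpret r: prob_space "kern t y" by (rule prob_space_kern)
    show "0 \<le> (\<integral>z. g z + B \<partial>kern t y)" using B0 by (intro integral_nonneg_AE) auto
    moreover have "(\<integral>z. g z + B \<partial>kern t y) \<le> (\<integral>z. 2 * B \<partial>kern t y)"
      using int B0 by (intro integral_mono) auto
    ultimately show "\<bar>\<integral>z. g z + B \<partial>kern t y\<bar> \<le> 2 * B" using r.prob_space by simp
  qed
  have m: "(\<lambda>y. \<integral>z. g z + B \<partial>kern t y) \<in> borel_measurable borel_cem" by measurable
  have "ennreal (\<integral>z. g z + B \<partial>kern (s + t) x) = (\<integral>\<^sup>+z. ennreal (g z + B) \<partial>(kern s x \<bind> kern t))"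
    by (simp add: nn flip: kern_add)
  also have "\<dots> = (\<integral>\<^sup>+y. \<integral>\<^sup>+z. ennreal (g z + B) \<partial>kern t y \<partial>kern s x)"
    by (rule nn_integral_bind[of _ borel_cem]) measurable
  also have "\<dots> = ennreal (\<integral>y. (\<integral>z. g z + B \<partial>kern t y) \<partial>kern s x)"
    unfolding nn using b2 m by (intro nn_integral_eq_integral integrable_kern[of _ "2 * B"]) auto
  finally have "(\<integral>z. g z + B \<partial>kern (s + t) x) = (\<integral>y. (\<integral>z. g z + B \<partial>kern t y) \<partial>kern s x)"
    using b2(1) B0 by (subst (asm) ennreal_inj) (auto intro!: integral_nonneg_AE)
  moreover have "(\<integral>y. (\<integral>z. g z \<partial>kern t y) + B \<partial>kern s x) = (\<integral>y. (\<integral>z. g z \<partial>kern t y) \<partial>kern s x) + B"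
  proof -
    have "\<bar>\<integral>z. g z \<partial>kern t y\<bar> \<le> 3 * B" for y using b2[of y] eq[of t y] B0(1)[of None] B[of None] by auto
    then have "integrable (kern s x) (\<lambda>y. \<integral>z. g z \<partial>kern t y)" by (intro integrable_kern) auto
    then show ?thesis using s.prob_space by simp
  qed
  ultimately show ?thesis by (simp add: eq)
qed

text \<open>The extension by 0 at \<open>None\<close> commutes with the kernels because the cemetery
  is absorbing.\<close>

lemma T_add:
  assumes [measurable]: "f \<in> borel_measurable borel" and B: "\<And>x. \<bar>f x\<bar> \<le> B" and "0 \<le> s" "0 \<le> t"
  shows "T (s + t) f x = T s (T t f) x"
proof -
  have b: "\<bar>case_option 0 f z\<bar> \<le> \<bar>B\<bar>" for z using order_trans[OF B abs_ge_self] by (cases z) auto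
  have "(\<integral>z. case_option 0 f z \<partial>kern (ennreal t) y) = case_option 0 (T t f) y" for y
  proof (cases y)
    case None
    have "(\<integral>z. case_option 0 f z \<partial>kern (ennreal t) None) = (\<integral>\<omega>. 0 \<partial>P None)"
      unfolding kern_def using dead[of "ennreal t"]
      by (subst integral_distr, simp, simp, intro integral_cong_AE) (auto elim!: eventually_mono)
    with None show ?thesis by simp
  qed (simp add: T_kern)
  then have "T (s + t) f x = (\<integral>y. case_option 0 (T t f) y \<partial>kern (ennreal s) (Some x))"
    using assms integral_kern_add[of "case_option 0 f" "\<bar>B\<bar>" "ennreal s" "ennreal t" "Some x"] b
    by (simp add: T_kern ennreal_plus)
  then show ?thesis by (simp add: T_kern)
qed

lemma ennreal_at_right: assumes "0 \<le> t" shows "filterlim ennreal (at_right (ennreal t)) (at_right t)"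
  unfolding filterlim_at
proof
  show "(ennreal \<longlongrightarrow> ennreal t) (at_right t)" by (intro tendsto_ennrealI) simp
  show "eventually (\<lambda>s. ennreal s \<in> {ennreal t<..} \<and> ennreal s \<noteq> ennreal t) (at_right t)"
    using eventually_at_right_less by (rule eventually_mono) (use assms in \<open>auto simp: ennreal_less_iff\<close>)
qed

lemma path_right_continuous:
  assumes "u \<in> Cc" "\<omega> \<in> space (P None)" "0 \<le> t"
  shows "((\<lambda>s. case_option 0 u (X (ennreal s) \<omega>)) \<longlongrightarrow> case_option 0 u (X (ennreal t) \<omega>)) (at_right t)"
proof -
  have "limitin euclideanreal (case_option 0 u \<circ> (\<lambda>s. X s \<omega>)) (case_option 0 u (X (ennreal t) \<omega>)) (at_right (ennreal t))"
    by (rule continuous_map_limit[OF continuous_map_case_option_Cc right_continuous]) (use assms in auto)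
  then have "((\<lambda>s. case_option 0 u (X s \<omega>)) \<longlongrightarrow> case_option 0 u (X (ennreal t) \<omega>)) (at_right (ennreal t))"
    by (simp add: comp_def)
  from filterlim_compose[OF this ennreal_at_right[OF assms(3)]] show ?thesis .
qed

lemma T_right_continuous:
  assumes u: "u \<in> Cc" and t: "0 \<le> t"
  shows "((\<lambda>s. T s u x) \<longlongrightarrow> T t u x) (at_right t)"
proof (rule tendsto_at_right_sequentially[of t "t + 1"])
  fix S :: "nat \<Rightarrow> real" assume S: "\<And>n. t < S n" "S \<longlonglongrightarrow> t"
  interpret prob_space "P (Some x)" by (rule prob)
  obtain B where B: "0 < B" "\<And>x. \<bar>u x\<bar> \<le> B" using Cc_bounded[OF u] by metis
  have b: "\<bar>case_option 0 u z\<bar> \<le> B" for z using B by (cases z) auto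
  have [measurable]: "u \<in> borel_measurable borel" by (rule Cc_measurable) fact
  have flim: "filterlim S (at_right t) sequentially"
    using S by (auto simp: filterlim_at less_imp_neq[THEN not_sym])
  show "(\<lambda>n. T (S n) u x) \<longlonglongrightarrow> T t u x"
    unfolding transition_def real_time_def
  proof (rule integral_dominated_convergence[where w = "\<lambda>_. B"])
    show "AE \<omega> in P (Some x). (\<lambda>n. case_option 0 u (X (ennreal (S n)) \<omega>)) \<longlonglongrightarrow> case_option 0 u (X (ennreal t) \<omega>)"
      using filterlim_compose[OF path_right_continuous[OF u _ t] flim] by (intro AE_I2) (simp add: space_P[of "Some x"])
  qed (use b in auto)
qed simp

end

section \<open>Symmetric sub-Markovian kernels\<close>

locale ball_finite_measure =
  fixes \<mu> :: "'a::{metric_space,second_countable_topology} measure"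
  assumes sets_mu [simp, measurable_cong]: "sets \<mu> = sets borel"
    and cball_finite: "emeasure \<mu> (cball x r) < \<infinity>"
begin

lemma space_mu [simp]: "space \<mu> = UNIV" using sets_eq_imp_space_eq[OF sets_mu] by simp

lemma measurable_mu [simp]: "borel_measurable \<mu> = borel_measurable borel"
  by (rule measurable_cong_sets) simp_all

sublocale sigma_finite_measure \<mu>
proof
  fix x0 :: 'a
  have "(\<Union>n. cball x0 (real n)) = UNIV" using real_arch_simple by fastforce
  then show "\<exists>A. countable A \<and> A \<subseteq> sets \<mu> \<and> \<Union> A = space \<mu> \<and> (\<forall>a\<in>A. emeasure \<mu> a \<noteq> \<infinity>)"
    using cball_finite[of x0] by (intro exI[of _ "range (\<lambda>n. cball x0 (real n))"]) (auto simp: less_top)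
qed

sublocale pair: pair_sigma_finite \<mu> \<mu> ..

lemma sets_pair: "sets (\<mu> \<Otimes>\<^sub>M \<mu>) = sets (borel :: ('a \<times> 'a) measure)"
  using sets_pair_measure_cong[OF sets_mu sets_mu] unfolding borel_prod .

lemma bounded_finite: assumes "bounded S" "S \<in> sets borel" shows "emeasure \<mu> S < \<infinity>"
proof -
  obtain x r where "S \<subseteq> cball x r" using assms by (auto simp: bounded_def subset_eq)
  then have "emeasure \<mu> S \<le> emeasure \<mu> (cball x r)" by (intro emeasure_mono) auto
  then show ?thesis using cball_finite[of x r] by (rule le_less_trans)
qed

lemma compact_finite: "compact K \<Longrightarrow> emeasure \<mu> K < \<infinity>"
  by (intro bounded_finite) (auto intro: compact_imp_bounded borel_compact)

lemma integrable_bounded_support: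
  fixes f :: "'a \<Rightarrow> real"
  assumes [measurable]: "f \<in> borel_measurable borel" and "\<And>x. \<bar>f x\<bar> \<le> B" and "\<And>x. x \<notin> K \<Longrightarrow> f x = 0" "compact K"
  shows "integrable \<mu> f"
proof (rule Bochner_Integration.integrable_bound)
  show "integrable \<mu> (\<lambda>x. B * indicator K x)"
    using compact_finite[OF assms(4)] assms(4) by (intro integrable_mult_right integrable_real_indicator) (auto simp: borel_compact)
  show "AE x in \<mu>. norm (f x) \<le> norm (B * indicator K x)"
    using assms(2,3) by (intro AE_I2) (auto simp: indicator_def intro: order_trans[OF _ abs_ge_self])
qed simp

lemma integrable_Cc_mult:
  assumes u: "u \<in> Cc" and [measurable]: "f \<in> borel_measurable borel" and B: "\<And>x. \<bar>f x\<bar> \<le> B"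
  shows "integrable \<mu> (\<lambda>x. f x * u x)"
proof -
  obtain C where C: "0 < C" "\<And>x. \<bar>u x\<bar> \<le> C" using Cc_bounded[OF u] by metis
  note Cc_measurable[OF u, measurable]
  have B0: "0 \<le> B" using B[of undefined] by simp
  show ?thesis
  proof (rule integrable_bounded_support[of _ "B * C" "support u"])
    show "\<bar>f x * u x\<bar> \<le> B * C" for x using B C B0 by (simp add: abs_mult mult_mono)
    show "f x * u x = 0" if "x \<notin> support u" for x
      using that closure_subset[of "{x. u x \<noteq> 0}"] by (auto simp: support_def)
  qed (use u in \<open>auto simp: Cc_def\<close>)
qed

lemma Cc_L2: assumes u: "u \<in> Cc" shows "u \<in> L2 \<mu>"
proof -
  obtain C where C: "0 < C" "\<And>x. \<bar>u x\<bar> \<le> C" using Cc_bounded[OF u] by metis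
  have "integrable \<mu> (\<lambda>x. u x * u x)" by (rule integrable_Cc_mult[OF u Cc_measurable[OF u] C(2)])
  then show ?thesis using Cc_measurable[OF u] by (simp add: L2_def power2_eq_square)
qed

lemma nn_integral_swap:
  assumes [measurable]: "H \<in> borel_measurable (\<mu> \<Otimes>\<^sub>M \<mu>)"
  shows "(\<integral>\<^sup>+z. H z \<partial>(\<mu> \<Otimes>\<^sub>M \<mu>)) = (\<integral>\<^sup>+z. H (snd z, fst z) \<partial>(\<mu> \<Otimes>\<^sub>M \<mu>))"
proof -
  have "(\<integral>\<^sup>+z. H z \<partial>(\<mu> \<Otimes>\<^sub>M \<mu>)) = (\<integral>\<^sup>+z. H z \<partial>distr (\<mu> \<Otimes>\<^sub>M \<mu>) (\<mu> \<Otimes>\<^sub>M \<mu>) (\<lambda>(x, y). (y, x)))"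
    using pair.distr_pair_swap by simp
  also have "\<dots> = (\<integral>\<^sup>+z. H (snd z, fst z) \<partial>(\<mu> \<Otimes>\<^sub>M \<mu>))"
    by (subst nn_integral_distr) (auto simp: case_prod_unfold)
  finally show ?thesis .
qed

lemma integral_swap:
  fixes H :: "'a \<times> 'a \<Rightarrow> real"
  assumes [measurable]: "H \<in> borel_measurable (\<mu> \<Otimes>\<^sub>M \<mu>)"
  shows "(\<integral>z. H z \<partial>(\<mu> \<Otimes>\<^sub>M \<mu>)) = (\<integral>z. H (snd z, fst z) \<partial>(\<mu> \<Otimes>\<^sub>M \<mu>))"
proof -
  have "(\<integral>z. H z \<partial>(\<mu> \<Otimes>\<^sub>M \<mu>)) = (\<integral>z. H z \<partial>distr (\<mu> \<Otimes>\<^sub>M \<mu>) (\<mu> \<Otimes>\<^sub>M \<mu>) (\<lambda>(x, y). (y, x)))"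
    using pair.distr_pair_swap by simp
  also have "\<dots> = (\<integral>z. H (snd z, fst z) \<partial>(\<mu> \<Otimes>\<^sub>M \<mu>))"
    by (subst integral_distr) (auto simp: case_prod_unfold)
  finally show ?thesis .
qed

text \<open>Closed rectangles are stable under intersection and generate the product sigma-algebra,
  so the two densities, cut to the box, define the same finite measure and agree almost everywhere.
  This serves both for the symmetry of the heat kernel and for the uniqueness of the jump
  kernel.\<close>

lemma AE_eq_on_box:
  fixes F G :: "'a \<times> 'a \<Rightarrow> ennreal"
  assumes [measurable]: "F \<in> borel_measurable (\<mu> \<Otimes>\<^sub>M \<mu>)" "G \<in> borel_measurable (\<mu> \<Otimes>\<^sub>M \<mu>)"
    and N: "closed N1" "closed N2"
    and fin: "(\<integral>\<^sup>+z. F z * indicator (N1 \<times> N2) z \<partial>(\<mu> \<Otimes>\<^sub>M \<mu>)) < \<infinity>"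
    and eq: "\<And>A B. closed A \<Longrightarrow> closed B \<Longrightarrow> A \<subseteq> N1 \<Longrightarrow> B \<subseteq> N2 \<Longrightarrow>
      (\<integral>\<^sup>+z. F z * indicator (A \<times> B) z \<partial>(\<mu> \<Otimes>\<^sub>M \<mu>)) = (\<integral>\<^sup>+z. G z * indicator (A \<times> B) z \<partial>(\<mu> \<Otimes>\<^sub>M \<mu>))"
  shows "AE z in \<mu> \<Otimes>\<^sub>M \<mu>. z \<in> N1 \<times> N2 \<longrightarrow> F z = G z"
proof -
  have [measurable]: "N1 \<in> sets borel" "N2 \<in> sets borel" using N by auto
  define M where "M = (\<lambda>F. density (\<mu> \<Otimes>\<^sub>M \<mu>) (\<lambda>z. F z * indicator (N1 \<times> N2) z :: ennreal))"
  have emM: "emeasure (M F) (A \<times> B) = (\<integral>\<^sup>+z. F z * indicator ((A \<inter> N1) \<times> (B \<inter> N2)) z \<partial>(\<mu> \<Otimes>\<^sub>M \<mu>))"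
    if [measurable]: "F \<in> borel_measurable (\<mu> \<Otimes>\<^sub>M \<mu>)" and "closed A" "closed B" for F A B
  proof -
    have [measurable]: "A \<in> sets borel" "B \<in> sets borel" using that by auto
    show ?thesis unfolding M_def
      by (subst emeasure_density) (auto intro!: nn_integral_cong split: split_indicator)
  qed
  let ?E = "{a \<times> b | a b. a \<in> {S. closed (S :: 'a set)} \<and> b \<in> {S. closed (S :: 'a set)}}"
  have sets_gen: "sets (\<mu> \<Otimes>\<^sub>M \<mu>) = sigma_sets UNIV ?E"
  proof -
    have "sets (\<mu> \<Otimes>\<^sub>M \<mu>) = sets (sigma (space (borel :: 'a measure) \<times> space (borel :: 'a measure)) ?E)"
      unfolding sets_pair_measure_cong[OF sets_mu sets_mu]
    proof (rule sets_pair_eq)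
      show "{S. closed S} \<subseteq> Pow (space (borel :: 'a measure))" "{S. closed S} \<subseteq> Pow (space (borel :: 'a measure))" by auto
      show "sets (borel :: 'a measure) = sigma_sets (space borel) {S. closed S}"
        "sets (borel :: 'a measure) = sigma_sets (space borel) {S. closed S}"
        by (simp_all add: borel_eq_closed)
      show "countable {UNIV :: 'a set}" "countable {UNIV :: 'a set}" by auto
      show "{UNIV :: 'a set} \<subseteq> {S. closed S}" "{UNIV :: 'a set} \<subseteq> {S. closed S}" by auto
    qed auto
    then show ?thesis by simp
  qed
  have "M F = M G"
  proof (rule measure_eqI_generator_eq[where E = ?E and \<Omega> = UNIV and A = "\<lambda>_. UNIV \<times> UNIV"])
    show "Int_stable ?E"
    proof (rule Int_stableI)
      fix a b assume "a \<in> ?E" "b \<in> ?E"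
      then obtain a1 a2 b1 b2 where "a = a1 \<times> a2" "b = b1 \<times> b2" "closed a1" "closed a2" "closed b1" "closed b2" by auto
      moreover have "a \<inter> b = (a1 \<inter> b1) \<times> (a2 \<inter> b2)" using calculation by auto
      ultimately show "a \<inter> b \<in> ?E" by auto
    qed
    show "?E \<subseteq> Pow UNIV" by simp
    show "emeasure (M F) X = emeasure (M G) X" if "X \<in> ?E" for X
    proof -
      from that obtain A B where X: "X = A \<times> B" "closed A" "closed B" by auto
      show ?thesis unfolding X(1) by (subst (1 2) emM) (use X N in \<open>auto intro!: eq closed_Int\<close>)
    qed
    show "sets (M F) = sigma_sets UNIV ?E" "sets (M G) = sigma_sets UNIV ?E" unfolding M_def sets_density by (rule sets_gen)+
    show "range (\<lambda>_::nat. UNIV \<times> UNIV) \<subseteq> ?E" by (auto intro!: exI[of _ UNIV])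
    show "(\<Union>i::nat. UNIV \<times> UNIV) = (UNIV :: ('a \<times> 'a) set)" by auto
    show "emeasure (M F) (UNIV \<times> UNIV) \<noteq> \<infinity>" using fin unfolding emM[OF assms(1) closed_UNIV closed_UNIV] by (simp add: less_top)
  qed
  moreover have "sigma_finite_measure (M F)"
  proof -
    have "finite_measure (M F)"
      using fin emM[of F UNIV UNIV] by (intro finite_measureI) (simp add: M_def space_pair_measure less_top)
    then show ?thesis by (simp add: finite_measure_def)
  qed
  ultimately have "AE z in \<mu> \<Otimes>\<^sub>M \<mu>. F z * indicator (N1 \<times> N2) z = G z * indicator (N1 \<times> N2) z"
    unfolding M_def by (subst (asm) sigma_finite_density_unique) auto
  then show ?thesis by (rule eventually_mono) (auto split: split_indicator_asm)
qed

end

locale symmetric_kernel = ball_finite_measure \<mu>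
  for \<mu> :: "'a::{metric_space,second_countable_topology} measure" +
  fixes q :: "'a \<Rightarrow> 'a \<Rightarrow> real"
  assumes q_measurable [measurable]: "(\<lambda>z. q (fst z) (snd z)) \<in> borel_measurable (\<mu> \<Otimes>\<^sub>M \<mu>)"
    and q_nonneg: "0 \<le> q x y"
    and q_symmetric: "AE z in \<mu> \<Otimes>\<^sub>M \<mu>. q (fst z) (snd z) = q (snd z) (fst z)"
    and q_sub: "AE x in \<mu>. (\<integral>\<^sup>+y. ennreal (q x y) \<partial>\<mu>) \<le> 1"
begin

definition mass :: "'a \<Rightarrow> ennreal" where "mass x = (\<integral>\<^sup>+y. ennreal (q x y) \<partial>\<mu>)"

lemma measurable_q1 [measurable]: "(\<lambda>y. q x y) \<in> borel_measurable borel"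
  using measurable_compose[OF measurable_Pair1' q_measurable, of x] by simp

lemma q_measurable_swap [measurable]: "(\<lambda>z. q (snd z) (fst z)) \<in> borel_measurable (\<mu> \<Otimes>\<^sub>M \<mu>)"
  using measurable_compose[OF measurable_pair_swap' q_measurable] by (simp add: case_prod_unfold)

lemma measurable_mass [measurable]: "mass \<in> borel_measurable borel"
proof -
  have "(\<lambda>x. \<integral>\<^sup>+y. ennreal (q x y) \<partial>\<mu>) \<in> borel_measurable \<mu>"
    by (rule borel_measurable_nn_integral) (use q_measurable in \<open>simp add: case_prod_unfold\<close>)
  then show ?thesis by (simp add: mass_def[abs_def])
qed

lemma nn_q_fst:
  assumes [measurable]: "g \<in> borel_measurable borel"
  shows "(\<integral>\<^sup>+z. ennreal (q (fst z) (snd z)) * g (fst z) \<partial>(\<mu> \<Otimes>\<^sub>M \<mu>)) = (\<integral>\<^sup>+x. mass x * g x \<partial>\<mu>)"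
proof -
  have "(\<integral>\<^sup>+z. ennreal (q (fst z) (snd z)) * g (fst z) \<partial>(\<mu> \<Otimes>\<^sub>M \<mu>)) = (\<integral>\<^sup>+x. \<integral>\<^sup>+y. ennreal (q x y) * g x \<partial>\<mu> \<partial>\<mu>)"
    by (subst nn_integral_fst[of "\<lambda>z. ennreal (q (fst z) (snd z)) * g (fst z)" \<mu>, symmetric]) simp_all
  then show ?thesis by (simp add: nn_integral_multc mass_def)
qed

lemma nn_q_snd:
  assumes [measurable]: "g \<in> borel_measurable borel"
  shows "(\<integral>\<^sup>+z. ennreal (q (fst z) (snd z)) * g (snd z) \<partial>(\<mu> \<Otimes>\<^sub>M \<mu>)) = (\<integral>\<^sup>+x. mass x * g x \<partial>\<mu>)"
proof -
  have "(\<integral>\<^sup>+z. ennreal (q (fst z) (snd z)) * g (snd z) \<partial>(\<mu> \<Otimes>\<^sub>M \<mu>)) = (\<integral>\<^sup>+z. ennreal (q (snd z) (fst z)) * g (fst z) \<partial>(\<mu> \<Otimes>\<^sub>M \<mu>))"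
    by (subst nn_integral_swap) simp_all
  also have "\<dots> = (\<integral>\<^sup>+z. ennreal (q (fst z) (snd z)) * g (fst z) \<partial>(\<mu> \<Otimes>\<^sub>M \<mu>))"
    using q_symmetric by (intro nn_integral_cong_AE) (auto elim!: eventually_mono)
  finally show ?thesis by (simp add: nn_q_fst)
qed

lemma mass_le: "AE x in \<mu>. mass x \<le> 1" using q_sub by (simp add: mass_def)

lemma nn_mass_le: assumes [measurable]: "g \<in> borel_measurable borel"
  shows "(\<integral>\<^sup>+x. mass x * g x \<partial>\<mu>) \<le> (\<integral>\<^sup>+x. g x \<partial>\<mu>)"
  using mass_le by (intro nn_integral_mono_AE) (auto elim!: eventually_mono dest: mult_right_mono[of _ 1])

lemma integrable_q:
  fixes g :: "'a \<Rightarrow> real"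
  assumes g: "integrable \<mu> g"
  shows "integrable (\<mu> \<Otimes>\<^sub>M \<mu>) (\<lambda>z. q (fst z) (snd z) * g (fst z))" "integrable (\<mu> \<Otimes>\<^sub>M \<mu>) (\<lambda>z. q (fst z) (snd z) * g (snd z))"
proof -
  have [measurable]: "g \<in> borel_measurable borel" using borel_measurable_integrable[OF g] by simp
  have fin: "(\<integral>\<^sup>+x. mass x * ennreal \<bar>g x\<bar> \<partial>\<mu>) < \<infinity>"
    using nn_mass_le[of "\<lambda>x. ennreal \<bar>g x\<bar>"] g by (auto simp: integrable_iff_bounded)
  show "integrable (\<mu> \<Otimes>\<^sub>M \<mu>) (\<lambda>z. q (fst z) (snd z) * g (fst z))"
  proof (rule integrableI_bounded)
    have "(\<integral>\<^sup>+z. ennreal (norm (q (fst z) (snd z) * g (fst z))) \<partial>(\<mu> \<Otimes>\<^sub>M \<mu>)) = (\<integral>\<^sup>+x. mass x * ennreal \<bar>g x\<bar> \<partial>\<mu>)"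
      by (subst nn_q_fst[symmetric]) (auto intro!: nn_integral_cong simp: abs_mult q_nonneg ennreal_mult)
    then show "(\<integral>\<^sup>+z. ennreal (norm (q (fst z) (snd z) * g (fst z))) \<partial>(\<mu> \<Otimes>\<^sub>M \<mu>)) < \<infinity>" using fin by simp
  qed simp
  show "integrable (\<mu> \<Otimes>\<^sub>M \<mu>) (\<lambda>z. q (fst z) (snd z) * g (snd z))"
  proof (rule integrableI_bounded)
    have "(\<integral>\<^sup>+z. ennreal (norm (q (fst z) (snd z) * g (snd z))) \<partial>(\<mu> \<Otimes>\<^sub>M \<mu>)) = (\<integral>\<^sup>+x. mass x * ennreal \<bar>g x\<bar> \<partial>\<mu>)"
      by (subst nn_q_snd[symmetric]) (auto intro!: nn_integral_cong simp: abs_mult q_nonneg ennreal_mult)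
    then show "(\<integral>\<^sup>+z. ennreal (norm (q (fst z) (snd z) * g (snd z))) \<partial>(\<mu> \<Otimes>\<^sub>M \<mu>)) < \<infinity>" using fin by simp
  qed simp
qed

lemma integrable_q_mult:
  assumes "f \<in> L2 \<mu>" "g \<in> L2 \<mu>"
  shows "integrable (\<mu> \<Otimes>\<^sub>M \<mu>) (\<lambda>z. q (fst z) (snd z) * f (snd z) * g (fst z))"
proof (rule Bochner_Integration.integrable_bound)
  have [measurable]: "f \<in> borel_measurable borel" "g \<in> borel_measurable borel" using assms by (auto simp: L2_def)
  show "integrable (\<mu> \<Otimes>\<^sub>M \<mu>) (\<lambda>z. q (fst z) (snd z) * (f (snd z))\<^sup>2 + q (fst z) (snd z) * (g (fst z))\<^sup>2)"
    using assms by (intro Bochner_Integration.integrable_add integrable_q) (auto simp: L2_def)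
  show "(\<lambda>z. q (fst z) (snd z) * f (snd z) * g (fst z)) \<in> borel_measurable (\<mu> \<Otimes>\<^sub>M \<mu>)" by measurable
  show "AE z in \<mu> \<Otimes>\<^sub>M \<mu>. norm (q (fst z) (snd z) * f (snd z) * g (fst z)) \<le> norm (q (fst z) (snd z) * (f (snd z))\<^sup>2 + q (fst z) (snd z) * (g (fst z))\<^sup>2)"
  proof (intro AE_I2)
    fix z :: "'a \<times> 'a"
    have "\<bar>f (snd z) * g (fst z)\<bar> \<le> (f (snd z))\<^sup>2 + (g (fst z))\<^sup>2"
    proof -
      have "\<bar>f (snd z) * g (fst z)\<bar> \<le> 2 * \<bar>f (snd z)\<bar> * \<bar>g (fst z)\<bar>" by (simp add: abs_mult)
      also have "\<dots> \<le> \<bar>f (snd z)\<bar>\<^sup>2 + \<bar>g (fst z)\<bar>\<^sup>2" by (rule sum_squares_bound)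
      finally show ?thesis by simp
    qed
    then have "q (fst z) (snd z) * \<bar>f (snd z) * g (fst z)\<bar> \<le> q (fst z) (snd z) * ((f (snd z))\<^sup>2 + (g (fst z))\<^sup>2)"
      using q_nonneg by (intro mult_left_mono)
    then show "norm (q (fst z) (snd z) * f (snd z) * g (fst z)) \<le> norm (q (fst z) (snd z) * (f (snd z))\<^sup>2 + q (fst z) (snd z) * (g (fst z))\<^sup>2)"
      using q_nonneg[of "fst z" "snd z"] by (simp add: abs_mult distrib_left mult.assoc)
  qed
qed

lemma integral_q_symmetric:
  assumes "f \<in> L2 \<mu>" "g \<in> L2 \<mu>"
  shows "(\<integral>x. (\<integral>y. q x y * f y \<partial>\<mu>) * g x \<partial>\<mu>) = (\<integral>x. f x * (\<integral>y. q x y * g y \<partial>\<mu>) \<partial>\<mu>)"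
    and "(\<integral>x. (\<integral>y. q x y * f y \<partial>\<mu>) * g x \<partial>\<mu>) = (\<integral>z. q (fst z) (snd z) * f (snd z) * g (fst z) \<partial>(\<mu> \<Otimes>\<^sub>M \<mu>))"
proof -
  have [measurable]: "f \<in> borel_measurable borel" "g \<in> borel_measurable borel" using assms by (auto simp: L2_def)
  have eq: "(\<integral>x. (\<integral>y. q x y * f y \<partial>\<mu>) * g x \<partial>\<mu>) = (\<integral>z. q (fst z) (snd z) * f (snd z) * g (fst z) \<partial>(\<mu> \<Otimes>\<^sub>M \<mu>))"
    if "f \<in> L2 \<mu>" "g \<in> L2 \<mu>" for f g
    using pair.integral_fst'[OF integrable_q_mult[OF that]] by simp
  show "(\<integral>x. (\<integral>y. q x y * f y \<partial>\<mu>) * g x \<partial>\<mu>) = (\<integral>z. q (fst z) (snd z) * f (snd z) * g (fst z) \<partial>(\<mu> \<Otimes>\<^sub>M \<mu>))"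
    using assms by (rule eq)
  also have "\<dots> = (\<integral>z. q (snd z) (fst z) * f (fst z) * g (snd z) \<partial>(\<mu> \<Otimes>\<^sub>M \<mu>))"
    by (subst integral_swap) simp_all
  also have "\<dots> = (\<integral>z. q (fst z) (snd z) * g (snd z) * f (fst z) \<partial>(\<mu> \<Otimes>\<^sub>M \<mu>))"
    using q_symmetric by (intro integral_cong_AE) (auto elim!: eventually_mono)
  also have "\<dots> = (\<integral>x. (\<integral>y. q x y * g y \<partial>\<mu>) * f x \<partial>\<mu>)" using assms by (intro eq[symmetric])
  finally show "(\<integral>x. (\<integral>y. q x y * f y \<partial>\<mu>) * g x \<partial>\<mu>) = (\<integral>x. f x * (\<integral>y. q x y * g y \<partial>\<mu>) \<partial>\<mu>)"
    by (simp add: mult.commute)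
qed

text \<open>Let A be the integral of u(x)^2, B that of q u(x)^2, which by symmetry equals that of q
  u(y)^2, and C that of q u(x) u(y). Then A - C = (B - C) + (A - B): expanding the square identifies
  B - C as the jump part, and A - B is the mass defect.\<close>

lemma energy_identity:
  assumes u: "u \<in> L2 \<mu>"
  shows "ennreal ((\<integral>x. (u x)\<^sup>2 \<partial>\<mu>) - (\<integral>x. (\<integral>y. q x y * u y \<partial>\<mu>) * u x \<partial>\<mu>)) =
    (\<integral>\<^sup>+z. ennreal (q (fst z) (snd z) / 2) * ennreal ((u (fst z) - u (snd z))\<^sup>2) \<partial>(\<mu> \<Otimes>\<^sub>M \<mu>)) +
    (\<integral>\<^sup>+x. (1 - mass x) * ennreal ((u x)\<^sup>2) \<partial>\<mu>)"
proof -
  have [measurable]: "u \<in> borel_measurable borel" and u2: "integrable \<mu> (\<lambda>x. (u x)\<^sup>2)" using u by (auto simp: L2_def)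
  let ?P = "\<mu> \<Otimes>\<^sub>M \<mu>"
  let ?A = "\<integral>x. (u x)\<^sup>2 \<partial>\<mu>"
  let ?B = "\<integral>z. q (fst z) (snd z) * (u (fst z))\<^sup>2 \<partial>?P"
  let ?B' = "\<integral>z. q (fst z) (snd z) * (u (snd z))\<^sup>2 \<partial>?P"
  let ?C = "\<integral>z. q (fst z) (snd z) * u (snd z) * u (fst z) \<partial>?P"
  note i = integrable_q[OF u2] integrable_q_mult[OF u u]
  have nnB: "(\<integral>\<^sup>+x. mass x * ennreal ((u x)\<^sup>2) \<partial>\<mu>) = ennreal ?B"
    unfolding nn_q_fst[symmetric, of "\<lambda>x. ennreal ((u x)\<^sup>2)", simplified]
    by (subst nn_integral_eq_integral[symmetric, OF i(1)]) (auto simp: q_nonneg ennreal_mult)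
  have nnB': "(\<integral>\<^sup>+x. mass x * ennreal ((u x)\<^sup>2) \<partial>\<mu>) = ennreal ?B'"
    unfolding nn_q_snd[symmetric, of "\<lambda>x. ennreal ((u x)\<^sup>2)", simplified]
    by (subst nn_integral_eq_integral[symmetric, OF i(2)]) (auto simp: q_nonneg ennreal_mult)
  have BB: "?B' = ?B"
  proof -
    have "0 \<le> ?B" "0 \<le> ?B'" by (auto intro!: integral_nonneg_AE AE_I2 mult_nonneg_nonneg q_nonneg)
    then show ?thesis using nnB nnB' by simp
  qed
  have "(\<integral>\<^sup>+z. ennreal (q (fst z) (snd z) / 2) * ennreal ((u (fst z) - u (snd z))\<^sup>2) \<partial>?P) =
    (\<integral>\<^sup>+z. ennreal ((q (fst z) (snd z) * (u (fst z))\<^sup>2 + q (fst z) (snd z) * (u (snd z))\<^sup>2) / 2 - q (fst z) (snd z) * u (snd z) * u (fst z)) \<partial>?P)"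
  proof (intro nn_integral_cong)
    fix z :: "'a \<times> 'a"
    have "q (fst z) (snd z) / 2 * (u (fst z) - u (snd z))\<^sup>2 = (q (fst z) (snd z) * (u (fst z))\<^sup>2 + q (fst z) (snd z) * (u (snd z))\<^sup>2) / 2 - q (fst z) (snd z) * u (snd z) * u (fst z)"
      by (simp add: power2_diff field_simps)
    moreover have "ennreal (q (fst z) (snd z) / 2) * ennreal ((u (fst z) - u (snd z))\<^sup>2) = ennreal (q (fst z) (snd z) / 2 * (u (fst z) - u (snd z))\<^sup>2)"
      using q_nonneg by (intro ennreal_mult[symmetric]) auto
    ultimately show "ennreal (q (fst z) (snd z) / 2) * ennreal ((u (fst z) - u (snd z))\<^sup>2) =
      ennreal ((q (fst z) (snd z) * (u (fst z))\<^sup>2 + q (fst z) (snd z) * (u (snd z))\<^sup>2) / 2 - q (fst z) (snd z) * u (snd z) * u (fst z))"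
      by (simp only:)
  qed
  also have "\<dots> = ennreal (\<integral>z. (q (fst z) (snd z) * (u (fst z))\<^sup>2 + q (fst z) (snd z) * (u (snd z))\<^sup>2) / 2 - q (fst z) (snd z) * u (snd z) * u (fst z) \<partial>?P)"
  proof (intro nn_integral_eq_integral AE_I2)
    fix z :: "'a \<times> 'a"
    have "(q (fst z) (snd z) * (u (fst z))\<^sup>2 + q (fst z) (snd z) * (u (snd z))\<^sup>2) / 2 - q (fst z) (snd z) * u (snd z) * u (fst z) = q (fst z) (snd z) / 2 * (u (fst z) - u (snd z))\<^sup>2"
      by (simp add: power2_diff field_simps)
    then show "0 \<le> (q (fst z) (snd z) * (u (fst z))\<^sup>2 + q (fst z) (snd z) * (u (snd z))\<^sup>2) / 2 - q (fst z) (snd z) * u (snd z) * u (fst z)"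
      by (simp only:) (simp add: q_nonneg)
  qed (intro Bochner_Integration.integrable_diff Bochner_Integration.integrable_add integrable_divide_zero i impI)
  also have "(\<integral>z. (q (fst z) (snd z) * (u (fst z))\<^sup>2 + q (fst z) (snd z) * (u (snd z))\<^sup>2) / 2 - q (fst z) (snd z) * u (snd z) * u (fst z) \<partial>?P) = (?B + ?B') / 2 - ?C"
    using i by simp
  also have "\<dots> = ?B - ?C" by (simp add: BB)
  finally have jump: "(\<integral>\<^sup>+z. ennreal (q (fst z) (snd z) / 2) * ennreal ((u (fst z) - u (snd z))\<^sup>2) \<partial>?P) = ennreal (?B - ?C)" .
  have A: "(\<integral>\<^sup>+x. ennreal ((u x)\<^sup>2) \<partial>\<mu>) = ennreal ?A" using u2 by (intro nn_integral_eq_integral) auto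
  have "(\<integral>\<^sup>+x. (1 - mass x) * ennreal ((u x)\<^sup>2) \<partial>\<mu>) = (\<integral>\<^sup>+x. ennreal ((u x)\<^sup>2) - mass x * ennreal ((u x)\<^sup>2) \<partial>\<mu>)"
    using mass_le
  proof (intro nn_integral_cong_AE, eventually_elim)
    fix x assume "mass x \<le> 1"
    then obtain m where "0 \<le> m" "m \<le> 1" "mass x = ennreal m" by (cases "mass x") (auto simp: top_unique)
    then show "(1 - mass x) * ennreal ((u x)\<^sup>2) = ennreal ((u x)\<^sup>2) - mass x * ennreal ((u x)\<^sup>2)"
      by (simp add: ennreal_minus ennreal_mult[symmetric] left_diff_distrib del: ennreal_1 flip: ennreal_1)
  qed
  also have "\<dots> = ennreal ?A - ennreal ?B"
    using mass_le unfolding nnB[symmetric] A[symmetric]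
    by (intro nn_integral_diff) (auto simp: nnB elim!: eventually_mono dest: mult_right_mono[of _ 1])
  also have "\<dots> = ennreal (?A - ?B)" by (intro ennreal_minus integral_nonneg_AE AE_I2 mult_nonneg_nonneg q_nonneg) auto
  finally have kill: "(\<integral>\<^sup>+x. (1 - mass x) * ennreal ((u x)\<^sup>2) \<partial>\<mu>) = ennreal (?A - ?B)" .
  have "0 \<le> ?B - ?C"
  proof -
    have "0 \<le> (\<integral>z. q (fst z) (snd z) / 2 * (u (fst z) - u (snd z))\<^sup>2 \<partial>?P)"
      by (auto intro!: integral_nonneg_AE AE_I2 mult_nonneg_nonneg q_nonneg)
    also have "\<dots> = (\<integral>z. (q (fst z) (snd z) * (u (fst z))\<^sup>2 + q (fst z) (snd z) * (u (snd z))\<^sup>2) / 2 - q (fst z) (snd z) * u (snd z) * u (fst z) \<partial>?P)"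
      by (intro Bochner_Integration.integral_cong) (auto simp: power2_diff field_simps)
    also have "\<dots> = ?B - ?C" using i by (simp add: BB)
    finally show ?thesis .
  qed
  moreover have "0 \<le> ?A - ?B"
  proof -
    have "ennreal ?B \<le> ennreal ?A" using nn_mass_le[of "\<lambda>x. ennreal ((u x)\<^sup>2)"] by (simp add: nnB A)
    then show ?thesis by (subst (asm) ennreal_le_iff) (auto intro!: integral_nonneg_AE)
  qed
  ultimately show ?thesis
    unfolding jump kill integral_q_symmetric(2)[OF u u] by (simp add: ennreal_plus[symmetric] del: ennreal_plus)
qed

end

section \<open>The decay of the semigroup quadratic form\<close>

locale heat_process = cemetery_process P X + ball_finite_measure \<mu>
  for P :: "'a::{metric_space,second_countable_topology} option \<Rightarrow> 'w measure" and X and \<mu> :: "'a measure" +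
  fixes p :: "real \<Rightarrow> 'a \<Rightarrow> 'a \<Rightarrow> real"
  assumes sym: "symmetric_process \<mu> P (real_time X)" and hk: "heat_kernel \<mu> (transition P (real_time X)) p"
begin

lemma p_nonneg: "0 < t \<Longrightarrow> 0 \<le> p t x y"
  and T_p: "0 < t \<Longrightarrow> f \<in> L2 \<mu> \<Longrightarrow> AE x in \<mu>. integrable \<mu> (\<lambda>y. p t x y * f y) \<and> T t f x = (\<integral>y. p t x y * f y \<partial>\<mu>)"
  using hk by (auto simp: heat_kernel_def)

lemma measurable_p3:
  "(\<lambda>w. p (if fst w > 0 then fst w else 1) (fst (snd w)) (snd (snd w))) \<in> borel_measurable (borel \<Otimes>\<^sub>M (\<mu> \<Otimes>\<^sub>M \<mu>))"
proof -
  have c: "(\<lambda>s::real. if s > 0 then s else 1) \<in> borel \<rightarrow>\<^sub>M restrict_space lborel {0<..}"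
    by (rule measurable_restrict_space2) auto
  have "(\<lambda>w :: real \<times> 'a \<times> 'a. (if fst w > 0 then fst w else 1, snd w)) \<in> borel \<Otimes>\<^sub>M (\<mu> \<Otimes>\<^sub>M \<mu>) \<rightarrow>\<^sub>M restrict_space lborel {0<..} \<Otimes>\<^sub>M (\<mu> \<Otimes>\<^sub>M \<mu>)"
    by (rule measurable_Pair[OF measurable_compose[OF measurable_fst c] measurable_snd])
  moreover have "(\<lambda>(t, x, y). p t x y) \<in> borel_measurable (restrict_space lborel {0<..} \<Otimes>\<^sub>M (\<mu> \<Otimes>\<^sub>M \<mu>))"
    using hk by (simp add: heat_kernel_def)
  ultimately show ?thesis by (rule measurable_compose[THEN measurable_cong[THEN iffD1, rotated]]) (simp add: case_prod_unfold)
qed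

lemma measurable_p: assumes "0 < t" shows "(\<lambda>z. p t (fst z) (snd z)) \<in> borel_measurable (\<mu> \<Otimes>\<^sub>M \<mu>)"
  using measurable_compose[OF measurable_Pair1'[of t borel "\<mu> \<Otimes>\<^sub>M \<mu>"] measurable_p3] assms by simp

lemma indicator_L2: "B \<in> sets borel \<Longrightarrow> emeasure \<mu> B < \<infinity> \<Longrightarrow> indicator B \<in> L2 \<mu>"
proof -
  assume B: "B \<in> sets borel" "emeasure \<mu> B < \<infinity>"
  have "(\<lambda>x. (indicator B x :: real)\<^sup>2) = indicator B" by (auto simp: fun_eq_iff indicator_def)
  then show "indicator B \<in> L2 \<mu>" using B by (simp add: L2_def integrable_real_indicator)
qed

lemma emeasure_T: assumes B: "B \<in> sets borel"
  shows "emeasure (P (Some x)) {\<omega>\<in>space (P (Some x)). real_time X t \<omega> \<in> Some ` B} = ennreal (T t (indicator B) x)"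
proof -
  interpret prob_space "kern (ennreal t) (Some x)" by (rule prob_space_kern)
  have "case_option 0 (indicator B) z = (indicator (Some ` B) z :: real)" for z :: "'a option"
    by (cases z) (auto simp: indicator_def)
  then have "case_option 0 (indicator B) = (indicator (Some ` B) :: 'a option \<Rightarrow> real)" by (rule ext)
  then have "T t (indicator B) x = measure (kern (ennreal t) (Some x)) (Some ` B)"
    using B by (subst T_kern) (auto simp: Some_image_borel_cem)
  then show ?thesis
    using B by (simp add: emeasure_eq_measure[symmetric] emeasure_kern Some_image_borel_cem real_time_def space_P[of "Some x"])
qed

lemma nn_p_indicator:
  assumes t: "0 < t" and B: "B \<in> sets borel" "emeasure \<mu> B < \<infinity>"
  shows "AE x in \<mu>. (\<integral>\<^sup>+y. ennreal (p t x y) * indicator B y \<partial>\<mu>) =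
    emeasure (P (Some x)) {\<omega>\<in>space (P (Some x)). real_time X t \<omega> \<in> Some ` B}"
  using T_p[OF t indicator_L2[OF B]]
proof eventually_elim
  fix x assume *: "integrable \<mu> (\<lambda>y. p t x y * indicator B y) \<and> T t (indicator B) x = (\<integral>y. p t x y * indicator B y \<partial>\<mu>)"
  have "(\<integral>\<^sup>+y. ennreal (p t x y) * indicator B y \<partial>\<mu>) = (\<integral>\<^sup>+y. ennreal (p t x y * indicator B y) \<partial>\<mu>)"
    by (intro nn_integral_cong) (auto split: split_indicator)
  also have "\<dots> = ennreal (T t (indicator B) x)"
    using * p_nonneg[OF t] by (subst nn_integral_eq_integral) auto
  finally show "(\<integral>\<^sup>+y. ennreal (p t x y) * indicator B y \<partial>\<mu>) = emeasure (P (Some x)) {\<omega>\<in>space (P (Some x)). real_time X t \<omega> \<in> Some ` B}"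
    using emeasure_T[OF B(1)] by simp
qed

text \<open>The kernel represents the semigroup on square integrable functions, to which the
  constant 1 need not belong. So the bound is taken from indicators of balls, off one null set for
  all radii, and passed to the limit by monotone convergence.\<close>

lemma p_sub: assumes t: "0 < t" shows "AE x in \<mu>. (\<integral>\<^sup>+y. ennreal (p t x y) \<partial>\<mu>) \<le> 1"
proof -
  obtain x0 :: 'a where True by simp
  have "AE x in \<mu>. \<forall>n. (\<integral>\<^sup>+y. ennreal (p t x y) * indicator (cball x0 (real n)) y \<partial>\<mu>) \<le> 1"
    unfolding AE_all_countable
  proof
    fix n :: nat
    show "AE x in \<mu>. (\<integral>\<^sup>+y. ennreal (p t x y) * indicator (cball x0 (real n)) y \<partial>\<mu>) \<le> 1"
      using nn_p_indicator[OF t _ cball_finite[of x0 "real n"]]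
      by (rule eventually_mono) (auto intro: prob_space.emeasure_le_1[OF prob] simp: prob_space.emeasure_le_1[OF prob])
  qed
  then show ?thesis
  proof eventually_elim
    fix x assume *: "\<forall>n. (\<integral>\<^sup>+y. ennreal (p t x y) * indicator (cball x0 (real n)) y \<partial>\<mu>) \<le> 1"
    have m [measurable]: "(\<lambda>y. p t x y) \<in> borel_measurable \<mu>"
      using measurable_compose[OF measurable_Pair1' measurable_p[OF t], of x] by simp
    have "ennreal (p t x y) = (SUP n. ennreal (p t x y) * indicator (cball x0 (real n)) y)" for y
    proof (rule antisym)
      obtain n where "dist x0 y \<le> real n" using real_arch_simple by blast
      then show "ennreal (p t x y) \<le> (SUP n. ennreal (p t x y) * indicator (cball x0 (real n)) y)"
        by (intro SUP_upper2[of n]) auto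
    qed (auto intro!: SUP_least simp: indicator_def)
    then have "(\<integral>\<^sup>+y. ennreal (p t x y) \<partial>\<mu>) = (\<integral>\<^sup>+y. (SUP n. ennreal (p t x y) * indicator (cball x0 (real n)) y) \<partial>\<mu>)"
      by simp
    also have "\<dots> = (SUP n. \<integral>\<^sup>+y. ennreal (p t x y) * indicator (cball x0 (real n)) y \<partial>\<mu>)"
      by (intro nn_integral_monotone_convergence_SUP) (auto simp: incseq_def le_fun_def indicator_def intro: order_trans)
    also have "\<dots> \<le> 1" using * by (auto intro: SUP_least)
    finally show "(\<integral>\<^sup>+y. ennreal (p t x y) \<partial>\<mu>) \<le> 1" .
  qed
qed

text \<open>Symmetry of the process equates the integrals of the kernel over A x B and over B x A.
  Restricting to balls makes these integrals finite, as \<open>AE_eq_on_box\<close>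
  requires.\<close>

lemma p_symmetric: assumes t: "0 < t" shows "AE z in \<mu> \<Otimes>\<^sub>M \<mu>. p t (fst z) (snd z) = p t (snd z) (fst z)"
proof -
  obtain x0 :: 'a where True by simp
  note [measurable] = measurable_p[OF t]
  have m2 [measurable]: "(\<lambda>z. p t (snd z) (fst z)) \<in> borel_measurable (\<mu> \<Otimes>\<^sub>M \<mu>)"
    using measurable_compose[OF measurable_pair_swap' measurable_p[OF t]] by (simp add: case_prod_unfold)
  have rect: "(\<integral>\<^sup>+z. ennreal (p t (fst z) (snd z)) * indicator (A \<times> B) z \<partial>(\<mu> \<Otimes>\<^sub>M \<mu>)) =
      (\<integral>\<^sup>+x\<in>A. emeasure (P (Some x)) {\<omega>\<in>space (P (Some x)). real_time X t \<omega> \<in> Some ` B} \<partial>\<mu>)"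
    if [measurable]: "A \<in> sets borel" "B \<in> sets borel" and "emeasure \<mu> B < \<infinity>" for A B
  proof -
    have "(\<integral>\<^sup>+z. ennreal (p t (fst z) (snd z)) * indicator (A \<times> B) z \<partial>(\<mu> \<Otimes>\<^sub>M \<mu>)) =
      (\<integral>\<^sup>+x. \<integral>\<^sup>+y. ennreal (p t x y) * indicator B y * indicator A x \<partial>\<mu> \<partial>\<mu>)"
      by (subst nn_integral_fst[symmetric]) (auto intro!: nn_integral_cong split: split_indicator)
    also have "\<dots> = (\<integral>\<^sup>+x. (\<integral>\<^sup>+y. ennreal (p t x y) * indicator B y \<partial>\<mu>) * indicator A x \<partial>\<mu>)"
      using measurable_compose[OF measurable_Pair1' measurable_p[OF t]]
      by (intro nn_integral_cong nn_integral_multc) auto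
    also have "\<dots> = (\<integral>\<^sup>+x\<in>A. emeasure (P (Some x)) {\<omega>\<in>space (P (Some x)). real_time X t \<omega> \<in> Some ` B} \<partial>\<mu>)"
      using nn_p_indicator[OF t that(2,3)] by (intro nn_integral_cong_AE) (auto elim!: eventually_mono)
    finally show ?thesis .
  qed
  have "AE z in \<mu> \<Otimes>\<^sub>M \<mu>. \<forall>n. z \<in> cball x0 (real n) \<times> cball x0 (real n) \<longrightarrow> ennreal (p t (fst z) (snd z)) = ennreal (p t (snd z) (fst z))"
    unfolding AE_all_countable
  proof
    fix n :: nat
    let ?N = "cball x0 (real n)"
    show "AE z in \<mu> \<Otimes>\<^sub>M \<mu>. z \<in> ?N \<times> ?N \<longrightarrow> ennreal (p t (fst z) (snd z)) = ennreal (p t (snd z) (fst z))"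
    proof (rule AE_eq_on_box)
      have "(\<integral>\<^sup>+z. ennreal (p t (fst z) (snd z)) * indicator (?N \<times> ?N) z \<partial>(\<mu> \<Otimes>\<^sub>M \<mu>)) \<le> (\<integral>\<^sup>+x. indicator ?N x \<partial>\<mu>)"
        unfolding rect[OF borel_closed[OF closed_cball] borel_closed[OF closed_cball] cball_finite]
        by (intro nn_integral_mono) (auto intro!: prob_space.emeasure_le_1[OF prob] split: split_indicator)
      also have "\<dots> < \<infinity>" using cball_finite by simp
      finally show "(\<integral>\<^sup>+z. ennreal (p t (fst z) (snd z)) * indicator (?N \<times> ?N) z \<partial>(\<mu> \<Otimes>\<^sub>M \<mu>)) < \<infinity>" .
      fix A B assume cl: "closed A" "closed B" and sub: "A \<subseteq> ?N" "B \<subseteq> ?N"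
      then have AB [measurable]: "A \<in> sets borel" "B \<in> sets borel" by auto
      have fin: "emeasure \<mu> A < \<infinity>" "emeasure \<mu> B < \<infinity>"
        using le_less_trans[OF emeasure_mono[OF sub(1)] cball_finite] le_less_trans[OF emeasure_mono[OF sub(2)] cball_finite]
        by auto
      have "(\<integral>\<^sup>+z. ennreal (p t (snd z) (fst z)) * indicator (A \<times> B) z \<partial>(\<mu> \<Otimes>\<^sub>M \<mu>)) =
          (\<integral>\<^sup>+z. ennreal (p t (fst z) (snd z)) * indicator (B \<times> A) z \<partial>(\<mu> \<Otimes>\<^sub>M \<mu>))"
        by (subst nn_integral_swap) (auto intro!: nn_integral_cong split: split_indicator)
      then show "(\<integral>\<^sup>+z. ennreal (p t (fst z) (snd z)) * indicator (A \<times> B) z \<partial>(\<mu> \<Otimes>\<^sub>M \<mu>)) =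
          (\<integral>\<^sup>+z. ennreal (p t (snd z) (fst z)) * indicator (A \<times> B) z \<partial>(\<mu> \<Otimes>\<^sub>M \<mu>))"
        using sym t AB fin by (simp add: rect symmetric_process_def)
    qed auto
  qed
  then show ?thesis
  proof eventually_elim
    fix z :: "'a \<times> 'a"
    assume *: "\<forall>n. z \<in> cball x0 (real n) \<times> cball x0 (real n) \<longrightarrow> ennreal (p t (fst z) (snd z)) = ennreal (p t (snd z) (fst z))"
    obtain n where "max (dist x0 (fst z)) (dist x0 (snd z)) \<le> real n" using real_arch_simple by blast
    then have "z \<in> cball x0 (real n) \<times> cball x0 (real n)" by (auto simp: mem_Times_iff)
    then show "p t (fst z) (snd z) = p t (snd z) (fst z)" using * p_nonneg[OF t] by (metis ennreal_inj)
  qed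
qed

lemma symmetric_kernel_p: assumes t: "0 < t" shows "symmetric_kernel \<mu> (p t)"
  by unfold_locales (use p_symmetric[OF t] p_sub[OF t] p_nonneg[OF t] measurable_p[OF t] in auto)

definition F :: "('a \<Rightarrow> real) \<Rightarrow> real \<Rightarrow> real" where "F u t = (\<integral>x. T t u x * u x \<partial>\<mu>)"

context
  fixes u :: "'a \<Rightarrow> real"
  assumes u: "u \<in> Cc"
begin

lemma u_measurable [measurable]: "u \<in> borel_measurable borel" by (rule Cc_measurable[OF u])

text \<open>Symmetry and total mass at most 1 bound the integral of |T u| by that of |u|; multiplied
  by the supremum bound this controls the square.\<close>

lemma T_L2: assumes t: "0 \<le> t" shows "T t u \<in> L2 \<mu>"
proof (cases "t = 0")
  case True
  then have "T t u = u" by (auto simp: T_nonpos)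
  then show ?thesis using Cc_L2[OF u] by simp
next
  case False
  then have t: "0 < t" using t by simp
  interpret symmetric_kernel \<mu> "p t" by (rule symmetric_kernel_p[OF t])
  obtain B where B: "0 < B" "\<And>x. \<bar>u x\<bar> \<le> B" using Cc_bounded[OF u] by metis
  have ui: "integrable \<mu> u" using integrable_Cc_mult[OF u, of "\<lambda>_. 1" 1] by simp
  have "integrable \<mu> (\<lambda>x. \<integral>y. p t x y * u y \<partial>\<mu>)"
    using pair.integrable_fst'[OF integrable_q(2)[OF ui]] by simp
  then have "integrable \<mu> (T t u)"
    using T_p[OF t Cc_L2[OF u]] by (subst integrable_cong_AE) (auto elim!: eventually_mono intro!: borel_measurable_integrable)
  then have "integrable \<mu> (\<lambda>x. B * T t u x)" by simp
  then have "integrable \<mu> (\<lambda>x. (T t u x)\<^sup>2)"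
  proof (rule Bochner_Integration.integrable_bound)
    show "AE x in \<mu>. norm ((T t u x)\<^sup>2) \<le> norm (B * T t u x)"
    proof (intro AE_I2)
      fix x
      have "\<bar>T t u x\<bar> * \<bar>T t u x\<bar> \<le> B * \<bar>T t u x\<bar>"
        by (intro mult_right_mono T_bounded[OF u_measurable B(2)]) simp
      then show "norm ((T t u x)\<^sup>2) \<le> norm (B * T t u x)" using B(1) by (simp add: power2_eq_square abs_mult)
    qed
  qed simp
  then show ?thesis by (simp add: L2_def)
qed

lemma integrable_T_mult: assumes "0 \<le> s" "0 \<le> t" shows "integrable \<mu> (\<lambda>x. T s u x * T t u x)"
proof (rule Bochner_Integration.integrable_bound)
  show "integrable \<mu> (\<lambda>x. (T s u x)\<^sup>2 + (T t u x)\<^sup>2)" using T_L2 assms by (auto simp: L2_def)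
  show "AE x in \<mu>. norm (T s u x * T t u x) \<le> norm ((T s u x)\<^sup>2 + (T t u x)\<^sup>2)"
  proof (intro AE_I2)
    fix x
    have "\<bar>T s u x * T t u x\<bar> \<le> 2 * \<bar>T s u x\<bar> * \<bar>T t u x\<bar>" by (simp add: abs_mult)
    also have "\<dots> \<le> \<bar>T s u x\<bar>\<^sup>2 + \<bar>T t u x\<bar>\<^sup>2" by (rule sum_squares_bound)
    finally show "norm (T s u x * T t u x) \<le> norm ((T s u x)\<^sup>2 + (T t u x)\<^sup>2)" by simp
  qed
qed simp

text \<open>Semigroup property followed by self-adjointness of one factor. Together with 2xy \<le>
  x^2 + y^2 this is the source of midpoint convexity.\<close>

lemma F_add: assumes "0 \<le> s" "0 \<le> t" shows "F u (s + t) = (\<integral>x. T s u x * T t u x \<partial>\<mu>)"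
proof -
  consider "s = 0" | "t = 0" | "0 < s" "0 < t" using assms by linarith
  then show ?thesis
  proof cases
    case 3
    interpret symmetric_kernel \<mu> "p s" by (rule symmetric_kernel_p) fact
    obtain B where B: "0 < B" "\<And>x. \<bar>u x\<bar> \<le> B" using Cc_bounded[OF u] by metis
    have "F u (s + t) = (\<integral>x. (\<integral>y. p s x y * T t u y \<partial>\<mu>) * u x \<partial>\<mu>)"
    proof -
      have "F u (s + t) = (\<integral>x. T s (T t u) x * u x \<partial>\<mu>)"
        unfolding F_def using T_add[OF u_measurable B(2)] assms by simp
      also have "\<dots> = (\<integral>x. (\<integral>y. p s x y * T t u y \<partial>\<mu>) * u x \<partial>\<mu>)"
        by (intro integral_cong_AE eventually_mono[OF T_p[OF 3(1) T_L2[OF assms(2)]]]) auto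
      finally show ?thesis .
    qed
    also have "\<dots> = (\<integral>x. T t u x * (\<integral>y. p s x y * u y \<partial>\<mu>) \<partial>\<mu>)"
      by (rule integral_q_symmetric(1)[OF T_L2[OF assms(2)] Cc_L2[OF u]])
    also have "\<dots> = (\<integral>x. T s u x * T t u x \<partial>\<mu>)"
      by (intro integral_cong_AE eventually_mono[OF T_p[OF 3(1) Cc_L2[OF u]]]) auto
    finally show ?thesis .
  qed (simp_all add: F_def T_nonpos mult.commute)
qed

lemma F_nonpos: "t \<le> 0 \<Longrightarrow> F u t = (\<integral>x. (u x)\<^sup>2 \<partial>\<mu>)" by (simp add: F_def T_nonpos power2_eq_square)

lemma F_half: "0 \<le> t \<Longrightarrow> F u t = (\<integral>x. (T (t / 2) u x)\<^sup>2 \<partial>\<mu>)"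
  using F_add[of "t / 2" "t / 2"] by (simp add: power2_eq_square)

lemma F_nonneg: "0 \<le> t \<Longrightarrow> 0 \<le> F u t" by (simp add: F_half)

lemma F_midpoint: assumes "0 \<le> a" "0 \<le> b" shows "F u ((a + b) / 2) \<le> (F u a + F u b) / 2"
proof -
  have sq: "integrable \<mu> (\<lambda>x. (T t u x)\<^sup>2)" if "0 \<le> t" for t using T_L2[OF that] by (simp add: L2_def)
  have "F u ((a + b) / 2) = (\<integral>x. T (a / 2) u x * T (b / 2) u x \<partial>\<mu>)"
    using F_add[of "a / 2" "b / 2"] assms by (simp add: add_divide_distrib)
  also have "\<dots> \<le> (\<integral>x. ((T (a / 2) u x)\<^sup>2 + (T (b / 2) u x)\<^sup>2) / 2 \<partial>\<mu>)"
  proof (intro integral_mono integrable_T_mult)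
    show "integrable \<mu> (\<lambda>x. ((T (a / 2) u x)\<^sup>2 + (T (b / 2) u x)\<^sup>2) / 2)" using assms sq[of "a / 2"] sq[of "b / 2"] by simp
    show "T (a / 2) u x * T (b / 2) u x \<le> ((T (a / 2) u x)\<^sup>2 + (T (b / 2) u x)\<^sup>2) / 2" for x
      using sum_squares_bound[of "T (a / 2) u x" "T (b / 2) u x"] by simp
  qed (use assms in auto)
  also have "\<dots> = (F u a + F u b) / 2" using assms sq by (simp add: F_half)
  finally show ?thesis .
qed

lemma F_right_continuous: assumes t: "0 \<le> t" shows "(F u \<longlongrightarrow> F u t) (at_right t)"
proof (rule tendsto_at_right_sequentially[of t "t + 1"])
  fix S :: "nat \<Rightarrow> real" assume S: "\<And>n. t < S n" "S \<longlonglongrightarrow> t"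
  obtain B where B: "0 < B" "\<And>x. \<bar>u x\<bar> \<le> B" using Cc_bounded[OF u] by metis
  have flim: "filterlim S (at_right t) sequentially"
    using S by (auto simp: filterlim_at less_imp_neq[THEN not_sym])
  have ui: "integrable \<mu> u" using integrable_Cc_mult[OF u, of "\<lambda>_. 1" 1] by simp
  show "(\<lambda>n. F u (S n)) \<longlonglongrightarrow> F u t"
    unfolding F_def
  proof (rule integral_dominated_convergence[where w = "\<lambda>x. B * \<bar>u x\<bar>"])
    show "AE x in \<mu>. (\<lambda>n. T (S n) u x * u x) \<longlonglongrightarrow> T t u x * u x"
      by (intro AE_I2 tendsto_intros filterlim_compose[OF T_right_continuous[OF u t] flim])
    show "AE x in \<mu>. norm (T (S n) u x * u x) \<le> B * \<bar>u x\<bar>" for n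
      using T_bounded[OF u_measurable B(2)] by (intro AE_I2) (auto simp: abs_mult intro!: mult_right_mono)
  qed (use ui in auto)
qed simp

lemma F_bounded: obtains B where "\<And>t. F u t \<le> B"
proof -
  obtain B where B: "0 < B" "\<And>x. \<bar>u x\<bar> \<le> B" using Cc_bounded[OF u] by metis
  have ui: "integrable \<mu> u" using integrable_Cc_mult[OF u, of "\<lambda>_. 1" 1] by simp
  have "F u t \<le> (\<integral>x. B * \<bar>u x\<bar> \<partial>\<mu>)" for t
    unfolding F_def
  proof (intro integral_mono)
    show "integrable \<mu> (\<lambda>x. T t u x * u x)"
      using integrable_Cc_mult[OF u T_measurable[OF u_measurable] T_bounded[OF u_measurable B(2)]] .
    show "T t u x * u x \<le> B * \<bar>u x\<bar>" for x
      using T_bounded[OF u_measurable B(2), of t x]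
      by (metis abs_ge_self abs_ge_zero abs_mult mult_right_mono order_trans)
  qed (use ui in auto)
  then show thesis by (rule that)
qed

lemma F_convex: "convex_on {0..} (F u)"
  by (rule midpoint_right_continuous_convex) (use F_midpoint F_right_continuous in auto)

lemma F_antimono: assumes "0 \<le> s" "s \<le> t" shows "F u t \<le> F u s"
proof -
  obtain B where "\<And>t. F u t \<le> B" using F_bounded by metis
  then show ?thesis using convex_bounded_antimono[OF F_convex] assms by blast
qed

lemma F_continuous: "continuous_on UNIV (F u)"
  by (rule convex_right_continuous_continuous[OF F_convex F_right_continuous]) (auto simp: F_nonpos)

lemma F_energy: assumes t: "0 < t"
  shows "ennreal (F u 0 - F u t) =
    (\<integral>\<^sup>+z. ennreal (p t (fst z) (snd z) / 2) * ennreal ((u (fst z) - u (snd z))\<^sup>2) \<partial>(\<mu> \<Otimes>\<^sub>M \<mu>)) +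
    (\<integral>\<^sup>+x. (1 - (\<integral>\<^sup>+y. ennreal (p t x y) \<partial>\<mu>)) * ennreal ((u x)\<^sup>2) \<partial>\<mu>)"
proof -
  interpret symmetric_kernel \<mu> "p t" by (rule symmetric_kernel_p[OF t])
  have "F u t = (\<integral>x. (\<integral>y. p t x y * u y \<partial>\<mu>) * u x \<partial>\<mu>)"
    unfolding F_def
    by (intro integral_cong_AE eventually_mono[OF T_p[OF t Cc_L2[OF u]]]) auto
  then show ?thesis using energy_identity[OF Cc_L2[OF u]] by (simp add: F_nonpos mass_def)
qed

lemma approx_form_T: "approx_form \<mu> T t u u = (F u 0 - F u t) / t"
proof -
  obtain B where B: "0 < B" "\<And>x. \<bar>u x\<bar> \<le> B" using Cc_bounded[OF u] by metis
  have "integrable \<mu> (\<lambda>x. T t u x * u x)" "integrable \<mu> (\<lambda>x. u x * u x)"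
    using integrable_Cc_mult[OF u T_measurable[OF u_measurable] T_bounded[OF u_measurable B(2)]]
      integrable_Cc_mult[OF u u_measurable B(2)] by auto
  then show ?thesis by (simp add: approx_form_def F_nonpos left_diff_distrib power2_eq_square) (simp add: F_def)
qed

end

end

section \<open>The subordinate form\<close>

text \<open>On each of n^2 cells of length 1/n, covering [0,n), the value at the right end of the
  cell, and 0 beyond n; negative times count as 0. The right end is chosen so that right continuity
  suffices for convergence, and a random time inserted here is replaced by finitely many fixed
  ones.\<close>

definition right_step :: "nat \<Rightarrow> (real \<Rightarrow> real) \<Rightarrow> real \<Rightarrow> real" where
  "right_step n F s = (\<Sum>k<n * n. indicator {real k / real n..<real (Suc k) / real n} (max 0 s) * F (real (Suc k) / real n))"

lemma right_step_eq:
  assumes "0 \<le> s" "s < real n"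
  shows "right_step n F s = F (real (Suc (nat \<lfloor>real n * s\<rfloor>)) / real n)"
proof -
  have n: "0 < real n" using assms by linarith
  define k where "k = nat \<lfloor>real n * s\<rfloor>"
  have k: "real k \<le> real n * s" "real n * s < real k + 1" using assms n by (auto simp: k_def)
  have "real k < real (n * n)" using k(1) mult_strict_left_mono[OF assms(2) n] by simp
  then have kn: "k < n * n" by (simp only: of_nat_less_iff)
  have ind: "indicator {real j / real n..<real (Suc j) / real n} s = (if j = k then 1 else 0 :: real)" for j
  proof -
    have "s \<in> {real j / real n..<real (Suc j) / real n} \<longleftrightarrow> real j \<le> real n * s \<and> real n * s < real j + 1"
      using n by (auto simp: field_simps)
    also have "\<dots> \<longleftrightarrow> j = k"
    proof
      assume "real j \<le> real n * s \<and> real n * s < real j + 1"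
      then have "real j < real k + 1" "real k < real j + 1" using k by auto
      then show "j = k" by linarith
    qed (use k in auto)
    finally show ?thesis by (simp add: indicator_def)
  qed
  have "right_step n F s = (\<Sum>j<n * n. if j = k then F (real (Suc j) / real n) else 0)"
    unfolding right_step_def using assms by (intro sum.cong) (simp_all only: max.absorb2 ind, simp)
  also have "\<dots> = F (real (Suc k) / real n)" using kn by simp
  finally show ?thesis by (simp add: k_def)
qed

lemma right_step_tendsto:
  assumes rc: "(F \<longlongrightarrow> F (max 0 s)) (at_right (max 0 s))"
  shows "(\<lambda>n. right_step n F s) \<longlonglongrightarrow> F (max 0 s)"
proof -
  define r where "r = max 0 s"
  have r: "0 \<le> r" by (simp add: r_def)
  define v where "v = (\<lambda>n. real (Suc (nat \<lfloor>real n * r\<rfloor>)) / real n)"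
  obtain n0 where n0: "max 1 r < real n0" using reals_Archimedean2 by blast
  have ev: "eventually (\<lambda>n. max 1 r < real n) sequentially"
    using eventually_ge_at_top[of n0] by (rule eventually_mono) (use n0 in auto)
  have v: "r < v n" "v n \<le> r + 1 / real n" if "max 1 r < real n" for n
  proof -
    have n: "0 < real n" using that by linarith
    have "real n * r < real (Suc (nat \<lfloor>real n * r\<rfloor>))" "real (Suc (nat \<lfloor>real n * r\<rfloor>)) \<le> real n * r + 1"
      using r by auto linarith+
    then show "r < v n" "v n \<le> r + 1 / real n" using n by (auto simp: v_def field_simps)
  qed
  have "(\<lambda>n. r + 1 / real n) \<longlonglongrightarrow> r + 0" by (intro tendsto_intros lim_1_over_n)
  moreover have "eventually (\<lambda>n. r \<le> v n) sequentially" "eventually (\<lambda>n. v n \<le> r + 1 / real n) sequentially"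
    by (rule eventually_mono[OF ev], use v in \<open>blast intro: less_imp_le\<close>)+
  ultimately have vl: "v \<longlonglongrightarrow> r"
    using tendsto_sandwich[of "\<lambda>_. r" v sequentially "\<lambda>n. r + 1 / real n" r] by simp
  have "filterlim v (at_right r) sequentially"
    unfolding filterlim_at
  proof (intro conjI)
    show "eventually (\<lambda>n. v n \<in> {r<..} \<and> v n \<noteq> r) sequentially"
      by (rule eventually_mono[OF ev], drule v(1), simp)
  qed (rule vl)
  from filterlim_compose[OF rc[folded r_def] this] have "(\<lambda>n. F (v n)) \<longlonglongrightarrow> F r" .
  moreover have "eventually (\<lambda>n. F (v n) = right_step n F s) sequentially"
    using ev
  proof (rule eventually_mono)
    fix n assume n: "max 1 r < real n"
    have "right_step n F s = right_step n F r" by (simp add: right_step_def r_def)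
    then show "F (v n) = right_step n F s" using n r right_step_eq[of r n F] by (simp add: v_def)
  qed
  ultimately show ?thesis unfolding r_def[symmetric] by (rule Lim_transform_eventually)
qed

lemma right_step_bounded:
  assumes B: "\<And>t. 0 \<le> t \<Longrightarrow> \<bar>F t\<bar> \<le> B" shows "\<bar>right_step n F s\<bar> \<le> B"
proof (cases "max 0 s < real n")
  case True
  have "right_step n F s = right_step n F (max 0 s)" by (simp add: right_step_def)
  then show ?thesis using True B by (simp add: right_step_eq)
next
  case False
  have "indicator {real k / real n..<real (Suc k) / real n} (max 0 s) = (0 :: real)" if "k < n * n" for k
  proof (cases "n = 0")
    case n: False
    have "Suc k \<le> n * n" using that by simp
    then have "real (Suc k) \<le> real n * real n" by (metis of_nat_le_iff of_nat_mult)
    then have "real (Suc k) / real n \<le> real n" using n by (simp add: field_simps)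
    then have "real (Suc k) / real n \<le> max 0 s" using False by linarith
    then show ?thesis by (intro indicator_simps(2)) (simp only: atLeastLessThan_iff not_less de_Morgan_conj simp_thms)
  qed simp
  then have "right_step n F s = 0" by (simp add: right_step_def)
  then show ?thesis using B[of 0] by simp
qed

text \<open>Independence is stated for one time of \<open>S\<close> and one time of
  \<open>X\<close>, which is what step functions in time ask for.\<close>

locale subordinated = heat_process P X \<mu> p + subordinator_laws \<nu> \<eta> \<Phi>
  for P :: "'a::{metric_space,second_countable_topology} option \<Rightarrow> 'w measure" and X \<mu> p \<nu> \<eta> \<Phi> +
  fixes S :: "real \<Rightarrow> 'w \<Rightarrow> real"
  assumes sigma_finite_nu: "sigma_finite_measure \<nu>"
    and S_measurable: "0 \<le> t \<Longrightarrow> S t \<in> borel_measurable (P x)"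
    and S_law: "0 \<le> t \<Longrightarrow> distr (P x) borel (S t) = \<eta> t"
    and S_indep: "0 \<le> t \<Longrightarrow> A \<in> sets borel \<Longrightarrow> D \<in> sets borel_cem \<Longrightarrow>
      measure (P x) ((S t -` A \<inter> space (P x)) \<inter> (X s -` D \<inter> space (P x))) =
      measure (P x) (S t -` A \<inter> space (P x)) * measure (P x) (X s -` D \<inter> space (P x))"
begin

abbreviation TS where "TS \<equiv> transition P (subordinate X S)"

lemma expectation_indep:
  fixes g :: "'a option \<Rightarrow> real"
  assumes t: "0 \<le> t" and [measurable]: "A \<in> sets borel" "g \<in> borel_measurable borel_cem" and B: "\<And>z. \<bar>g z\<bar> \<le> B"
  shows "(\<integral>\<omega>. indicator A (S t \<omega>) * g (X s \<omega>) \<partial>P x) = measure (\<eta> t) A * (\<integral>z. g z \<partial>kern s x)"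
proof -
  interpret prob_space "P x" by (rule prob)
  interpret e: prob_space "\<eta> t" using t by (rule prob_eta)
  interpret k: prob_space "kern s x" by (rule prob_space_kern)
  interpret ek: pair_prob_space "\<eta> t" "kern s x" ..
  note S_measurable[OF t, measurable]
  have d: "\<eta> t \<Otimes>\<^sub>M kern s x = distr (P x) (borel \<Otimes>\<^sub>M borel_cem) (\<lambda>\<omega>. (S t \<omega>, X s \<omega>))"
  proof (rule pair_measure_eqI)
    show "sigma_finite_measure (\<eta> t)" "sigma_finite_measure (kern s x)" by unfold_locales
    show "sets (\<eta> t \<Otimes>\<^sub>M kern s x) = sets (distr (P x) (borel \<Otimes>\<^sub>M borel_cem) (\<lambda>\<omega>. (S t \<omega>, X s \<omega>)))"
      by (simp cong: sets_pair_measure_cong)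
    fix A :: "real set" and D assume "A \<in> sets (\<eta> t)" "D \<in> sets (kern s x)"
    then have A [measurable]: "A \<in> sets borel" and D [measurable]: "D \<in> sets borel_cem" by auto
    have "emeasure (\<eta> t) A * emeasure (kern s x) D =
        ennreal (measure (P x) (S t -` A \<inter> space (P x)) * measure (P x) (X s -` D \<inter> space (P x)))"
      by (subst S_law[OF t, of x, symmetric]) (simp add: kern_def emeasure_distr emeasure_eq_measure ennreal_mult)
    also have "\<dots> = emeasure (P x) ((S t -` A \<inter> space (P x)) \<inter> (X s -` D \<inter> space (P x)))"
      using S_indep[OF t A D, of x s] by (simp add: emeasure_eq_measure)
    also have "(S t -` A \<inter> space (P x)) \<inter> (X s -` D \<inter> space (P x)) = (\<lambda>\<omega>. (S t \<omega>, X s \<omega>)) -` (A \<times> D) \<inter> space (P x)" by auto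
    finally show "emeasure (\<eta> t) A * emeasure (kern s x) D = emeasure (distr (P x) (borel \<Otimes>\<^sub>M borel_cem) (\<lambda>\<omega>. (S t \<omega>, X s \<omega>))) (A \<times> D)"
      by (simp add: emeasure_distr)
  qed
  have "(\<integral>\<omega>. indicator A (S t \<omega>) * g (X s \<omega>) \<partial>P x) =
      (\<integral>z. indicator A (fst z) * g (snd z) \<partial>distr (P x) (borel \<Otimes>\<^sub>M borel_cem) (\<lambda>\<omega>. (S t \<omega>, X s \<omega>)))"
    by (subst integral_distr) auto
  also have "\<dots> = (\<integral>z. indicator A (fst z) * g (snd z) \<partial>(\<eta> t \<Otimes>\<^sub>M kern s x))" by (simp only: d)
  also have "\<dots> = (\<integral>r. \<integral>z. indicator A r * g z \<partial>kern s x \<partial>\<eta> t)"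
  proof (subst ek.integral_fst'[symmetric])
    have b: "\<bar>indicator A r * g z\<bar> \<le> B" for r z using B[of z] by (auto split: split_indicator)
    show "integrable (\<eta> t \<Otimes>\<^sub>M kern s x) (\<lambda>z. indicator A (fst z) * g (snd z))"
      by (rule ek.P.integrable_const_bound[of _ B]) (use b in auto)
  qed simp
  also have "\<dots> = measure (\<eta> t) A * (\<integral>z. g z \<partial>kern s x)" by simp
  finally show ?thesis .
qed

context
  fixes u :: "'a \<Rightarrow> real"
  assumes u: "u \<in> Cc"
begin

lemma u_borel [measurable]: "u \<in> borel_measurable borel" by (rule Cc_measurable[OF u])

lemma T_max: "T (max 0 s) u x = T s u x"
  by (cases "0 \<le> s") (auto simp: T_nonpos)

lemma T_step_tendsto: "(\<lambda>n. right_step n (\<lambda>s. T s u x) s) \<longlonglongrightarrow> T s u x"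
  using right_step_tendsto[of "\<lambda>s. T s u x" s] T_right_continuous[OF u, of "max 0 s" x] by (simp add: T_max)

lemma T_measurable_time [measurable]: "(\<lambda>s. T s u x) \<in> borel_measurable borel"
proof (rule borel_measurable_LIMSEQ_real[OF T_step_tendsto])
  show "(\<lambda>s. right_step n (\<lambda>s. T s u x) s) \<in> borel_measurable borel" for n
    unfolding right_step_def by measurable
qed

lemma T_measurable_pair: "(\<lambda>z. T (fst z) u (snd z)) \<in> borel_measurable (borel \<Otimes>\<^sub>M borel)"
proof (rule borel_measurable_LIMSEQ_real[OF T_step_tendsto])
  show "(\<lambda>z. right_step n (\<lambda>s. T s u (snd z)) (fst z)) \<in> borel_measurable (borel \<Otimes>\<^sub>M borel)" for n
    unfolding right_step_def
    by (intro borel_measurable_sum borel_measurable_times measurable_compose[OF measurable_snd T_measurable[OF u_borel]]) measurable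
qed

text \<open>At a deterministic time independence factorises the expectation. The random time is
  therefore discretised by \<open>right_step\<close> on both sides, where the identity is a finite
  sum, and dominated convergence with the bound of u removes the discretisation.\<close>

lemma TS_eq: assumes t: "0 \<le> t" shows "TS t u x = (\<integral>s. T s u x \<partial>\<eta> t)"
proof -
  interpret prob_space "P (Some x)" by (rule prob)
  interpret e: prob_space "\<eta> t" using t by (rule prob_eta)
  obtain B where B: "0 < B" "\<And>x. \<bar>u x\<bar> \<le> B" using Cc_bounded[OF u] by metis
  have b: "\<bar>case_option 0 u z\<bar> \<le> B" for z using B by (cases z) auto
  note S_measurable[OF t, measurable]
  define G where "G = (\<lambda>\<omega> s. case_option 0 u (X (ennreal s) \<omega>))"
  have Gb: "\<bar>G \<omega> s\<bar> \<le> B" for \<omega> s using b by (simp add: G_def)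
  have G_meas [measurable]: "(\<lambda>\<omega>. G \<omega> s) \<in> borel_measurable (P (Some x))" for s unfolding G_def by measurable
  have Gmax: "G \<omega> (max 0 s) = G \<omega> s" for \<omega> s by (cases "0 \<le> s") (auto simp: G_def ennreal_neg)
  have Glim: "(\<lambda>n. right_step n (G \<omega>) (S t \<omega>)) \<longlonglongrightarrow> G \<omega> (S t \<omega>)" if "\<omega> \<in> space (P (Some x))" for \<omega>
    using right_step_tendsto[of "G \<omega>" "S t \<omega>"] path_right_continuous[OF u, of \<omega> "max 0 (S t \<omega>)"] that
    by (simp add: Gmax) (simp add: G_def space_P[of "Some x"] )
  have step_meas: "(\<lambda>\<omega>. right_step n (G \<omega>) (S t \<omega>)) \<in> borel_measurable (P (Some x))" for n
    unfolding right_step_def by measurable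
  have lim1: "(\<lambda>n. \<integral>\<omega>. right_step n (G \<omega>) (S t \<omega>) \<partial>P (Some x)) \<longlonglongrightarrow> (\<integral>\<omega>. G \<omega> (S t \<omega>) \<partial>P (Some x))"
  proof (rule integral_dominated_convergence[where w = "\<lambda>_. B"])
    show "(\<lambda>\<omega>. G \<omega> (S t \<omega>)) \<in> borel_measurable (P (Some x))"
      by (rule borel_measurable_LIMSEQ_real[OF Glim step_meas])
    show "AE \<omega> in P (Some x). norm (right_step n (G \<omega>) (S t \<omega>)) \<le> B" for n
      using right_step_bounded[of "G _" B n] Gb by (intro AE_I2) auto
  qed (use Glim step_meas in auto)
  have lim2: "(\<lambda>n. \<integral>s. right_step n (\<lambda>s. T s u x) s \<partial>\<eta> t) \<longlonglongrightarrow> (\<integral>s. T s u x \<partial>\<eta> t)"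
  proof (rule integral_dominated_convergence[where w = "\<lambda>_. B"])
    show "AE s in \<eta> t. norm (right_step n (\<lambda>s. T s u x) s) \<le> B" for n
      using right_step_bounded[of "\<lambda>s. T s u x" B n] T_bounded[OF u_borel B(2)] by (intro AE_I2) auto
    show "(\<lambda>s. right_step n (\<lambda>s. T s u x) s) \<in> borel_measurable (\<eta> t)" for n
      unfolding right_step_def by measurable
  qed (use T_step_tendsto in auto)
  have "(\<integral>\<omega>. right_step n (G \<omega>) (S t \<omega>) \<partial>P (Some x)) = (\<integral>s. right_step n (\<lambda>s. T s u x) s \<partial>\<eta> t)" for n
  proof -
    define A where "A = (\<lambda>k. {s. max 0 s \<in> {real k / real n..<real (Suc k) / real n}})"
    have [measurable]: "A k \<in> sets borel" for k unfolding A_def by measurable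
    have ind: "indicator {real k / real n..<real (Suc k) / real n} (max 0 s) = (indicator (A k) s :: real)" for k s
      by (simp add: A_def indicator_def)
    have i1: "integrable (P (Some x)) (\<lambda>\<omega>. indicator (A k) (S t \<omega>) * G \<omega> r)" for k r
      by (rule integrable_const_bound[of _ B]) (use Gb B in \<open>auto simp: indicator_def\<close>)
    have i2: "integrable (\<eta> t) (\<lambda>s. indicator (A k) s * r)" for k and r :: real
      by (rule e.integrable_const_bound[of _ "\<bar>r\<bar>"]) (auto simp: indicator_def)
    have "(\<integral>\<omega>. right_step n (G \<omega>) (S t \<omega>) \<partial>P (Some x)) = (\<Sum>k<n * n. \<integral>\<omega>. indicator (A k) (S t \<omega>) * G \<omega> (real (Suc k) / real n) \<partial>P (Some x))"
      unfolding right_step_def ind by (rule Bochner_Integration.integral_sum) (rule i1)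
    also have "\<dots> = (\<Sum>k<n * n. measure (\<eta> t) (A k) * T (real (Suc k) / real n) u x)"
      unfolding G_def by (intro sum.cong refl, subst expectation_indep[OF t _ _ b]) (auto simp: T_kern)
    also have "\<dots> = (\<Sum>k<n * n. \<integral>s. indicator (A k) s * T (real (Suc k) / real n) u x \<partial>\<eta> t)" by simp
    also have "\<dots> = (\<integral>s. right_step n (\<lambda>s. T s u x) s \<partial>\<eta> t)"
      unfolding right_step_def ind by (rule Bochner_Integration.integral_sum[symmetric]) (rule i2)
    finally show ?thesis .
  qed
  with lim1 lim2 have "(\<integral>\<omega>. G \<omega> (S t \<omega>) \<partial>P (Some x)) = (\<integral>s. T s u x \<partial>\<eta> t)"
    using LIMSEQ_unique by simp
  then show ?thesis by (simp add: transition_def subordinate_def G_def)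
qed

lemma TS_energy: assumes t: "0 < t"
  shows "approx_form \<mu> TS t u u = (\<integral>s. F u 0 - F u s \<partial>\<eta> t) / t"
proof -
  interpret e: prob_space "\<eta> t" using t by (intro prob_eta) simp
  interpret m: pair_sigma_finite "\<eta> t" \<mu> ..
  obtain B where B: "0 < B" "\<And>x. \<bar>u x\<bar> \<le> B" using Cc_bounded[OF u] by metis
  have uu: "integrable \<mu> (\<lambda>x. u x * u x)" by (rule integrable_Cc_mult[OF u u_borel B(2)])
  have ui: "integrable \<mu> u" using integrable_Cc_mult[OF u, of "\<lambda>_. 1" 1] by simp
  have mT: "(\<lambda>z. T (fst z) u (snd z) * u (snd z)) \<in> borel_measurable (\<eta> t \<Otimes>\<^sub>M \<mu>)"
  proof -
    have "(\<lambda>z. T (fst z) u (snd z)) \<in> borel_measurable (\<eta> t \<Otimes>\<^sub>M \<mu>)"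
      using T_measurable_pair by (simp cong: measurable_cong_sets sets_pair_measure_cong)
    then show ?thesis by (intro borel_measurable_times) auto
  qed
  have int: "integrable (\<eta> t \<Otimes>\<^sub>M \<mu>) (\<lambda>(s, x). T s u x * u x)"
  proof (rule integrableI_bounded)
    show "(\<lambda>(s, x). T s u x * u x) \<in> borel_measurable (\<eta> t \<Otimes>\<^sub>M \<mu>)" using mT by (simp add: case_prod_unfold)
    have "(\<integral>\<^sup>+z. ennreal (norm (case z of (s, x) \<Rightarrow> T s u x * u x)) \<partial>(\<eta> t \<Otimes>\<^sub>M \<mu>)) \<le>
      (\<integral>\<^sup>+z. ennreal (B * \<bar>u (snd z)\<bar>) \<partial>(\<eta> t \<Otimes>\<^sub>M \<mu>))"
      using T_bounded[OF u_borel B(2)]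
      by (intro nn_integral_mono) (auto simp: abs_mult intro!: ennreal_leI mult_right_mono)
    also have "\<dots> = (\<integral>\<^sup>+s. \<integral>\<^sup>+x. ennreal (B * \<bar>u x\<bar>) \<partial>\<mu> \<partial>\<eta> t)"
      by (subst nn_integral_fst[symmetric]) auto
    also have "\<dots> = (\<integral>\<^sup>+x. ennreal (B * \<bar>u x\<bar>) \<partial>\<mu>)" using e.emeasure_space_1 by simp
    also have "\<dots> < \<infinity>"
    proof -
      have "integrable \<mu> (\<lambda>x. B * \<bar>u x\<bar>)" using ui by simp
      from nn_integral_eq_integral[OF this] B(1) show ?thesis by simp
    qed
    finally show "(\<integral>\<^sup>+z. ennreal (norm (case z of (s, x) \<Rightarrow> T s u x * u x)) \<partial>(\<eta> t \<Otimes>\<^sub>M \<mu>)) < \<infinity>" .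
  qed
  have Fi: "integrable (\<eta> t) (F u)" unfolding F_def[abs_def] using m.integrable_fst[OF int] .
  have "(\<integral>x. TS t u x * u x \<partial>\<mu>) = (\<integral>x. (\<integral>s. T s u x * u x \<partial>\<eta> t) \<partial>\<mu>)"
    using t by (simp add: TS_eq)
  also have "\<dots> = (\<integral>s. F u s \<partial>\<eta> t)" unfolding F_def by (rule m.Fubini_integral[OF int])
  finally have "(\<integral>x. TS t u x * u x \<partial>\<mu>) = (\<integral>s. F u s \<partial>\<eta> t)" .
  moreover have "integrable \<mu> (\<lambda>x. TS t u x * u x)"
    using m.integrable_snd[OF int] t by (simp add: TS_eq)
  ultimately have "(\<integral>x. (u x - TS t u x) * u x \<partial>\<mu>) = F u 0 - (\<integral>s. F u s \<partial>\<eta> t)"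
    using uu by (simp add: left_diff_distrib F_nonpos[OF u] power2_eq_square)
  also have "\<dots> = (\<integral>s. F u 0 - F u s \<partial>\<eta> t)" using Fi e.prob_space by simp
  finally show ?thesis by (simp add: approx_form_def)
qed

text \<open>Valued in [0,\<infinity>] because the limit of the approximating forms always exists
  there; a finite value characterises membership in the form domain.\<close>

definition energy :: ennreal where "energy = (\<integral>\<^sup>+s. ennreal (F u 0 - F u s) \<partial>\<nu>)"

lemma approx_form_TS_tendsto: "((\<lambda>t. ennreal (approx_form \<mu> TS t u u)) \<longlongrightarrow> energy) (at_right 0)"
proof -
  have "((\<lambda>t. ennreal ((\<integral>s. F u 0 - F u s \<partial>\<eta> t) / t)) \<longlongrightarrow> energy) (at_right 0)"
    unfolding energy_def
    by (rule convex_decay_tendsto) (use F_convex[OF u] F_continuous[OF u] F_nonneg[OF u] F_antimono[OF u] in auto)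
  then show ?thesis
    by (rule tendsto_cong[THEN iffD1, rotated])
       (use eventually_at_right_less in \<open>rule eventually_mono\<close>, simp add: TS_energy)
qed

lemma approx_form_TS_nonneg: assumes "0 < t" shows "0 \<le> approx_form \<mu> TS t u u"
proof -
  have "AE s in \<eta> t. 0 \<le> F u 0 - F u s"
    using eta_nonneg[of t] assms F_antimono[OF u, of 0] by (auto elim!: eventually_mono)
  then show ?thesis using assms by (simp add: TS_energy integral_nonneg_AE)
qed

lemma form_domain_TS_iff: "u \<in> form_domain \<mu> TS \<longleftrightarrow> energy < \<infinity>"
proof
  assume "u \<in> form_domain \<mu> TS"
  then obtain l where "((\<lambda>t. approx_form \<mu> TS t u u) \<longlongrightarrow> l) (at_right 0)" by (auto simp: form_domain_def)
  then have "((\<lambda>t. ennreal (approx_form \<mu> TS t u u)) \<longlongrightarrow> ennreal l) (at_right 0)" by (rule tendsto_ennrealI)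
  then have "energy = ennreal l" using approx_form_TS_tendsto by (intro tendsto_unique) auto
  then show "energy < \<infinity>" by simp
next
  assume "energy < \<infinity>"
  have "((\<lambda>t. enn2real (ennreal (approx_form \<mu> TS t u u))) \<longlongrightarrow> enn2real energy) (at_right 0)"
    by (rule tendsto_enn2real[OF _ ]) (use approx_form_TS_tendsto \<open>energy < \<infinity>\<close> in \<open>auto simp: less_top\<close>)
  then have "((\<lambda>t. approx_form \<mu> TS t u u) \<longlongrightarrow> enn2real energy) (at_right 0)"
    by (rule tendsto_cong[THEN iffD1, rotated])
       (use eventually_at_right_less in \<open>rule eventually_mono\<close>, simp add: approx_form_TS_nonneg)
  then show "u \<in> form_domain \<mu> TS" using Cc_L2[OF u] by (auto simp: form_domain_def)
qed

lemma form_of_TS: assumes "u \<in> form_domain \<mu> TS" shows "ennreal (form_of \<mu> TS u u) = energy"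
proof -
  obtain l where l: "((\<lambda>t. approx_form \<mu> TS t u u) \<longlongrightarrow> l) (at_right 0)" using assms by (auto simp: form_domain_def)
  then have "form_of \<mu> TS u u = l" unfolding form_of_def by (intro tendsto_Lim) auto
  moreover have "((\<lambda>t. ennreal (approx_form \<mu> TS t u u)) \<longlongrightarrow> ennreal l) (at_right 0)" using l by (rule tendsto_ennrealI)
  then have "energy = ennreal l" using approx_form_TS_tendsto by (intro tendsto_unique) auto
  ultimately show ?thesis by simp
qed

end

end

section \<open>Cut-off functions and polarisation\<close>

lemma locally_compact_nbhd:
  fixes x :: "'a::metric_space"
  assumes "locally_compact_space (euclidean :: 'a topology)"
  shows "\<exists>U K. open U \<and> x \<in> U \<and> U \<subseteq> K \<and> compact K"
proof -
  have "\<exists>U K. openin euclidean U \<and> compactin euclidean K \<and> x \<in> U \<and> U \<subseteq> K"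
    using assms unfolding locally_compact_space_def by (metis UNIV_I topspace_euclidean)
  then show ?thesis by auto
qed

text \<open>Finitely many relatively compact open sets cover K, and a small closed neighbourhood of
  K lies in their union. The empty set is treated apart since \<open>infdist\<close> to it is 0
  everywhere.\<close>

lemma compact_nbhd:
  fixes K U :: "'a::metric_space set"
  assumes lc: "locally_compact_space (euclidean :: 'a topology)" and K: "compact K" "K \<subseteq> U" "open U"
  obtains e where "0 < e" "compact {x. infdist x K \<le> e}" "K \<noteq> {} \<Longrightarrow> {x. infdist x K \<le> e} \<subseteq> U"
  | "K = {}"
proof (cases "K = {}")
  case False
  let ?T = "{N :: 'a set. open N \<and> (\<exists>C. compact C \<and> N \<subseteq> C)}"
  have "x \<in> \<Union>?T" for x using locally_compact_nbhd[OF lc, of x] by auto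
  then have "K \<subseteq> \<Union>?T" by auto
  then obtain D where D: "D \<subseteq> ?T" "finite D" "K \<subseteq> \<Union>D"
    by (rule compactE[OF K(1)]) auto
  then have "\<forall>N\<in>D. \<exists>C. compact C \<and> N \<subseteq> C" by auto
  from bchoice[OF this] obtain C where C: "\<forall>N\<in>D. compact (C N) \<and> N \<subseteq> C N" ..
  define W where "W = \<Union>D \<inter> U"
  have W: "open W" "K \<subseteq> W" using D K by (auto simp: W_def intro!: open_Int open_Union)
  obtain e where e: "0 < e" "(\<Union>x\<in>K. ball x e) \<subseteq> W"
    using compact_subset_open_imp_ball_epsilon_subset[OF K(1) W] by blast
  \<comment> \<open>Half of \<open>e\<close> turns the weak inequality for the infimum into a point
    of K at distance strictly below \<open>e\<close>.\<close>
  have sub: "{x. infdist x K \<le> e / 2} \<subseteq> W"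
  proof
    fix x assume "x \<in> {x. infdist x K \<le> e / 2}"
    then have "(INF a\<in>K. dist x a) < e" using e False by (simp add: infdist_notempty)
    then obtain y where "y \<in> K" "dist x y < e" using False by (subst (asm) cINF_less_iff) auto
    then have "x \<in> (\<Union>x\<in>K. ball x e)" by (auto simp: dist_commute)
    with e(2) show "x \<in> W" by (rule subsetD)
  qed
  have cl: "closed {x. infdist x K \<le> e / 2}" by (intro closed_Collect_le continuous_intros)
  have "compact (\<Union>x\<in>D. C x)" using D C by (intro compact_UN) auto
  moreover have "\<Union>D \<subseteq> (\<Union>x\<in>D. C x)" using C by blast
  then have "{x. infdist x K \<le> e / 2} \<subseteq> (\<Union>x\<in>D. C x)" using sub unfolding W_def by blast
  ultimately have "compact {x. infdist x K \<le> e / 2}" using cl by (metis compact_Int_closed inf.absorb_iff2)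
  with that(1)[of "e / 2"] e sub show thesis by (auto simp: W_def)
qed (use that in simp)

lemma Cc_urysohn:
  fixes K U :: "'a::metric_space set"
  assumes "locally_compact_space (euclidean :: 'a topology)" and "compact K" "K \<subseteq> U" "open U"
  obtains g where "g \<in> Cc" "\<And>x. 0 \<le> g x" "\<And>x. g x \<le> 1" "\<And>x. x \<in> K \<Longrightarrow> g x = 1" "support g \<subseteq> U"
  using assms
proof (cases rule: compact_nbhd)
  case (1 e)
  show thesis
  proof (cases "K = {}")
    case True
    show thesis by (rule that[of "\<lambda>_. 0"]) (auto simp: Cc_def support_def True)
  next
    case False
    define g where "g = (\<lambda>x. max 0 (1 - infdist x K / e))"
    have cont: "continuous_on UNIV g" unfolding g_def using 1 by (intro continuous_intros) auto
    have "{x. g x \<noteq> 0} \<subseteq> {x. infdist x K \<le> e}" using 1 by (auto simp: g_def max_def field_simps split: if_splits)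
    moreover have "closed {x. infdist x K \<le> e}" using 1 by (simp add: compact_imp_closed)
    ultimately have sub: "support g \<subseteq> {x. infdist x K \<le> e}" unfolding support_def by (rule closure_minimal)
    have "compact (support g)" using sub 1 unfolding support_def
      by (metis closed_closure compact_Int_closed inf.absorb_iff2)
    then show thesis
      using sub 1 False cont infdist_nonneg[of _ K] by (intro that[of g]) (auto simp: Cc_def g_def divide_simps)
  qed
next
  case 2
  show thesis by (rule that[of "\<lambda>_. 0"]) (auto simp: Cc_def support_def 2)
qed

lemma in_support: "u x \<noteq> 0 \<Longrightarrow> x \<in> support u"
  using closure_subset[of "{x. u x \<noteq> 0}"] by (auto simp: support_def)

lemma Cc_combination:
  fixes u v :: "'a::t2_space \<Rightarrow> real"
  assumes u: "u \<in> Cc" and v: "v \<in> Cc" and f: "continuous_on UNIV (\<lambda>z. f (fst z) (snd z))" "f 0 0 = (0::real)"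
  shows "(\<lambda>x. f (u x) (v x)) \<in> Cc"
proof -
  have c: "continuous_on UNIV (\<lambda>x. f (u x) (v x))"
    using continuous_on_compose2[OF f(1), of UNIV "\<lambda>x. (u x, v x)"] u v
    by (simp add: Cc_def continuous_on_Pair)
  have "{x. f (u x) (v x) \<noteq> 0} \<subseteq> support u \<union> support v"
  proof
    fix x assume x: "x \<in> {x. f (u x) (v x) \<noteq> 0}"
    have "u x \<noteq> 0 \<or> v x \<noteq> 0"
    proof (rule ccontr)
      assume "\<not> (u x \<noteq> 0 \<or> v x \<noteq> 0)"
      then show False using x f(2) by simp
    qed
    then show "x \<in> support u \<union> support v" using in_support[of u x] in_support[of v x] by auto
  qed
  moreover have k: "compact (support u \<union> support v)" using u v by (auto simp: Cc_def)
  ultimately have "support (\<lambda>x. f (u x) (v x)) \<subseteq> support u \<union> support v"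
    unfolding support_def[of "\<lambda>x. f (u x) (v x)"] by (intro closure_minimal compact_imp_closed)
  then have "compact (support (\<lambda>x. f (u x) (v x)))"
    using k by (metis closed_closure compact_Int_closed inf.absorb_iff2 support_def)
  with c show ?thesis by (simp add: Cc_def)
qed

lemma Cc_linear: "u \<in> Cc \<Longrightarrow> v \<in> Cc \<Longrightarrow> (\<lambda>x. a * u x + b * v x) \<in> Cc" for u v :: "'a::t2_space \<Rightarrow> real"
  by (rule Cc_combination[where f = "\<lambda>r s. a * r + b * s"]) (auto intro!: continuous_intros)

text \<open>A function in the domain that is uniformly close to a continuous cut-off function is turned into a
  cut-off function by applying the normal contraction \<open>v \<mapsto> 4 ((v \<and> 1/2)\<^sup>+ - (v \<and> 1/4)\<^sup>+)\<close>,
  which vanishes where \<open>v \<le> 1/4\<close>.\<close>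

lemma regular_bump:
  fixes K U :: "'a::{metric_space,second_countable_topology} set"
  assumes lc: "locally_compact_space (euclidean :: 'a topology)" and reg: "regular_dirichlet_form \<mu> E F"
    and K: "compact K" "K \<subseteq> U" "open U"
  obtains w where "w \<in> F" "w \<in> Cc" "\<And>x. 0 \<le> w x" "\<And>x. w x \<le> 1" "\<And>x. x \<in> K \<Longrightarrow> w x = 1" "support w \<subseteq> U"
proof -
  obtain g where g: "g \<in> Cc" "\<And>x. 0 \<le> g x" "\<And>x. g x \<le> 1" "\<And>x. x \<in> K \<Longrightarrow> g x = 1" "support g \<subseteq> U"
    using Cc_urysohn[OF lc K] by metis
  \<comment> \<open>Within 1/4 of g, the function v exceeds 3/4 on K and is below 1/4 where g
    vanishes, so the thresholds 1/2 and 1/4 separate the two regions.\<close>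
  obtain v where v: "v \<in> F" "v \<in> Cc" "\<And>x. \<bar>g x - v x\<bar> < 1 / 4"
    using reg g(1) unfolding regular_dirichlet_form_def by (metis IntD1 IntD2 zero_less_divide_1_iff zero_less_numeral)
  have lin: "(\<lambda>x. a * f x + b * h x) \<in> F" if "f \<in> F" "h \<in> F" for a b f h
    using reg that by (auto simp: regular_dirichlet_form_def dirichlet_form_def symmetric_form_def)
  have mar: "(\<lambda>x. min (max (f x) 0) 1) \<in> F" if "f \<in> F" for f
    using reg that by (auto simp: regular_dirichlet_form_def dirichlet_form_def)
  define m where "m = (\<lambda>r :: real. min (max r 0) 1)"
  have sc: "(\<lambda>x. c * v x) \<in> F" for c using lin[OF v(1) v(1), of c 0] by simp
  \<comment> \<open>The contraction above in terms of the unit contraction \<open>m\<close> supplied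
    by the Markov property: \<open>2 * m (2 * r)\<close> is four times the positive part of min(r,
    1/2), and \<open>m (4 * r)\<close> four times that of min(r, 1/4).\<close>
  define f where "f = (\<lambda>r :: real. 2 * m (2 * r) - m (4 * r))"
  define w where "w = (\<lambda>x. f (v x))"
  have "(\<lambda>x. 2 * m (2 * v x) + (- 1) * m (4 * v x)) \<in> F"
    by (rule lin) (use mar[OF sc[of 2]] mar[OF sc[of 4]] in \<open>auto simp: m_def\<close>)
  then have wF: "w \<in> F" by (simp add: w_def f_def)
  have wC: "w \<in> Cc"
    unfolding w_def
  proof (rule Cc_combination[OF v(2) v(2), of "\<lambda>r s. f r"])
    show "continuous_on UNIV (\<lambda>z :: real \<times> real. f (fst z))"
      unfolding f_def m_def by (intro continuous_intros)
  qed (simp add: f_def m_def)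
  have f: "0 \<le> f r" "f r \<le> 1" "r \<le> 1 / 4 \<Longrightarrow> f r = 0" "1 / 2 \<le> r \<Longrightarrow> f r = 1" for r
    by (auto simp: f_def m_def min_def max_def)
  have w1: "w x = 1" if "x \<in> K" for x using g(4)[OF that] v(3)[of x] f(4)[of "v x"] by (simp add: w_def abs_if split: if_splits)
  have "{x. w x \<noteq> 0} \<subseteq> {x. g x \<noteq> 0}"
  proof
    fix x assume "x \<in> {x. w x \<noteq> 0}"
    then have "f (v x) \<noteq> 0" by (simp add: w_def)
    then have "\<not> v x \<le> 1 / 4" using f(3) by blast
    then show "x \<in> {x. g x \<noteq> 0}" using v(3)[of x] by auto
  qed
  then have "support w \<subseteq> support g" unfolding support_def by (rule closure_mono)
  with g(5) have "support w \<subseteq> U" by simp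
  with wF wC f w1 show thesis by (intro that[of w]) (auto simp: w_def)
qed

text \<open>With disjoint supports, \<open>(A - B)\<^sup>2 = (A + B)\<^sup>2 + 4 (u(x) v(y) + u(y) v(x))\<close> for
  \<open>A = u(x) - u(y)\<close> and \<open>B = v(x) - v(y)\<close>, and neither the local nor the killing part distinguishes \<open>u + v\<close>
  from \<open>u - v\<close>.\<close>

lemma beurling_deny_polarization:
  fixes E :: "('a::{metric_space,second_countable_topology} \<Rightarrow> real) \<Rightarrow> ('a \<Rightarrow> real) \<Rightarrow> real"
  assumes bd: "beurling_deny E F Ec Jm k" and u: "u \<in> F \<inter> Cc" and v: "v \<in> F \<inter> Cc"
    and nonneg: "\<And>x. 0 \<le> u x" "\<And>x. 0 \<le> v x" and disj: "support u \<inter> support v = {}"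
  shows "ennreal (E (\<lambda>x. u x - v x) (\<lambda>x. u x - v x)) =
    ennreal (E (\<lambda>x. u x + v x) (\<lambda>x. u x + v x)) + 8 * (\<integral>\<^sup>+z. ennreal (u (fst z) * v (snd z)) \<partial>Jm)"
proof -
  let ?D = "F \<inter> Cc"
  have Ec: "symmetric_form ?D Ec" "strongly_local ?D Ec" and sJ [measurable_cong]: "sets Jm = sets borel"
    and sw: "distr Jm borel prod.swap = Jm" and sk [measurable_cong]: "sets k = sets borel"
    and eq: "\<And>f. f \<in> ?D \<Longrightarrow> ennreal (E f f) = ennreal (Ec f f) + (\<integral>\<^sup>+z. ennreal ((f (fst z) - f (snd z))\<^sup>2) \<partial>Jm) + (\<integral>\<^sup>+x. ennreal ((f x)\<^sup>2) \<partial>k)"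
    using bd by (auto simp: beurling_deny_def radon_measure_def)
  have [measurable]: "u \<in> borel_measurable borel" "v \<in> borel_measurable borel"
    using u v by (auto simp: Cc_def intro: borel_measurable_continuous_onI)
  have lin: "(\<lambda>x. a * f x + b * g x) \<in> ?D" if "f \<in> ?D" "g \<in> ?D" for a b f g
    using Ec(1) that by (auto simp: symmetric_form_def)
  have D: "(\<lambda>x. u x + v x) \<in> ?D" "(\<lambda>x. u x - v x) \<in> ?D"
    using lin[OF u v, of 1 1] lin[OF u v, of 1 "-1"] by simp_all
  have uv: "u x = 0 \<or> v x = 0" for x using disj in_support[of u x] in_support[of v x] by auto
  have loc: "Ec u v = 0"
  proof -
    \<comment> \<open>Strong locality applies because v is constant, namely 0, on the complement of
      its support, a neighbourhood of the support of u.\<close>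
    have "open (- support v)" "support u \<subseteq> - support v" "\<forall>x\<in>- support v. v x = 0"
      using disj in_support[of v] by (auto simp: support_def)
    then show ?thesis using Ec(2) u v unfolding strongly_local_def by blast
  qed
  have bil: "Ec (\<lambda>x. u x + c * v x) (\<lambda>x. u x + c * v x) = Ec u u + c * c * Ec v v" for c
  proof -
    have S: "\<And>f g w a b. f \<in> ?D \<Longrightarrow> g \<in> ?D \<Longrightarrow> w \<in> ?D \<Longrightarrow> Ec (\<lambda>x. a * f x + b * g x) w = a * Ec f w + b * Ec g w"
      and C: "\<And>f g. f \<in> ?D \<Longrightarrow> g \<in> ?D \<Longrightarrow> Ec f g = Ec g f"
      using Ec(1) by (auto simp: symmetric_form_def)
    define w where "w = (\<lambda>x. u x + c * v x)"
    have w: "w \<in> ?D" using lin[OF u v, of 1 c] by (simp add: w_def)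
    have e: "Ec w f = Ec u f + c * Ec v f" if "f \<in> ?D" for f using S[OF u v that, of 1 c] by (simp add: w_def)
    have "Ec w w = Ec w u + c * Ec w v" using e[OF w] C[OF w u] C[OF w v] by simp
    also have "\<dots> = Ec u u + c * c * Ec v v" using e[OF u] e[OF v] C[OF u v] loc by simp
    finally show ?thesis by (simp add: w_def)
  qed
  have Eceq: "Ec (\<lambda>x. u x - v x) (\<lambda>x. u x - v x) = Ec (\<lambda>x. u x + v x) (\<lambda>x. u x + v x)"
    using bil[of 1] bil[of "-1"] by simp
  have keq: "(u x - v x)\<^sup>2 = (u x + v x)\<^sup>2" for x using uv[of x] by auto
  have sq: "ennreal ((u x - v x - (u y - v y))\<^sup>2) = ennreal ((u x + v x - (u y + v y))\<^sup>2) + (4 * ennreal (u x * v y) + 4 * ennreal (u y * v x))" for x y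
  proof -
    have "(u x - v x - (u y - v y))\<^sup>2 = (u x + v x - (u y + v y))\<^sup>2 + (4 * (u x * v y) + 4 * (u y * v x))"
      using uv[of x] uv[of y] by (auto simp: power2_eq_square algebra_simps)
    then show ?thesis using nonneg by (simp add: ennreal_plus ennreal_mult)
  qed
  have swap: "(\<integral>\<^sup>+z. ennreal (u (snd z) * v (fst z)) \<partial>Jm) = (\<integral>\<^sup>+z. ennreal (u (fst z) * v (snd z)) \<partial>Jm)"
  proof -
    have [measurable]: "prod.swap \<in> Jm \<rightarrow>\<^sub>M borel"
    proof -
      have "prod.swap \<in> borel_measurable (borel :: ('a \<times> 'a) measure)"
        by (intro borel_measurable_continuous_onI continuous_on_swap)
      then show ?thesis using measurable_cong_sets[OF sJ refl] by blast
    qed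
    have m: "(\<lambda>z. ennreal (u (fst z) * v (snd z))) \<in> borel_measurable (borel :: ('a \<times> 'a) measure)"
      unfolding borel_prod[symmetric] by measurable
    have "(\<integral>\<^sup>+z. ennreal (u (fst z) * v (snd z)) \<partial>Jm) = (\<integral>\<^sup>+z. ennreal (u (fst z) * v (snd z)) \<partial>distr Jm borel prod.swap)"
      by (simp add: sw)
    also have "\<dots> = (\<integral>\<^sup>+z. ennreal (u (snd z) * v (fst z)) \<partial>Jm)"
      using m by (subst nn_integral_distr) simp_all
    finally show ?thesis by simp
  qed
  have mJ: "(\<lambda>z. ennreal (f (fst z) (snd z))) \<in> borel_measurable Jm"
    if "(\<lambda>z. ennreal (f (fst z) (snd z))) \<in> borel_measurable (borel \<Otimes>\<^sub>M borel)" for f :: "'a \<Rightarrow> 'a \<Rightarrow> real"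
    using that unfolding borel_prod measurable_cong_sets[OF sJ refl] .
  have m1: "(\<lambda>z. ennreal (u (fst z) * v (snd z))) \<in> borel_measurable Jm"
    by (rule mJ[of "\<lambda>x y. u x * v y"]) measurable
  have m2: "(\<lambda>z. ennreal (u (snd z) * v (fst z))) \<in> borel_measurable Jm"
    by (rule mJ[of "\<lambda>x y. u y * v x"]) measurable
  have m3: "(\<lambda>z. ennreal ((u (fst z) + v (fst z) - (u (snd z) + v (snd z)))\<^sup>2)) \<in> borel_measurable Jm"
    by (rule mJ[of "\<lambda>x y. (u x + v x - (u y + v y))\<^sup>2"]) measurable
  have "(\<integral>\<^sup>+z. ennreal ((u (fst z) - v (fst z) - (u (snd z) - v (snd z)))\<^sup>2) \<partial>Jm) =
      (\<integral>\<^sup>+z. ennreal ((u (fst z) + v (fst z) - (u (snd z) + v (snd z)))\<^sup>2) \<partial>Jm) +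
      (4 * (\<integral>\<^sup>+z. ennreal (u (fst z) * v (snd z)) \<partial>Jm) + 4 * (\<integral>\<^sup>+z. ennreal (u (snd z) * v (fst z)) \<partial>Jm))"
    unfolding sq nn_integral_cmult[OF m1, symmetric] nn_integral_cmult[OF m2, symmetric]
    using m1 m2 m3 by (subst nn_integral_add, simp, intro borel_measurable_add borel_measurable_times_ennreal borel_measurable_const, simp, simp)
      (subst nn_integral_add, auto intro!: borel_measurable_times_ennreal)
  also have "\<dots> = (\<integral>\<^sup>+z. ennreal ((u (fst z) + v (fst z) - (u (snd z) + v (snd z)))\<^sup>2) \<partial>Jm) + 8 * (\<integral>\<^sup>+z. ennreal (u (fst z) * v (snd z)) \<partial>Jm)"
    unfolding swap by (simp flip: distrib_right)
  finally have J: "(\<integral>\<^sup>+z. ennreal ((u (fst z) - v (fst z) - (u (snd z) - v (snd z)))\<^sup>2) \<partial>Jm) =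
      (\<integral>\<^sup>+z. ennreal ((u (fst z) + v (fst z) - (u (snd z) + v (snd z)))\<^sup>2) \<partial>Jm) + 8 * (\<integral>\<^sup>+z. ennreal (u (fst z) * v (snd z)) \<partial>Jm)" .
  show ?thesis unfolding eq[OF D(1)] eq[OF D(2)] J Eceq keq by (simp add: ac_simps)
qed

section \<open>Uniqueness and existence of the jump kernel\<close>

lemma closed_diagonal: "closed {z :: 'a::t2_space \<times> 'a. fst z = snd z}"
  by (intro closed_Collect_eq continuous_intros)

text \<open>Countability lets null sets be united over the family, interiors let a compact set off
  the diagonal be covered by finitely many of the boxes. The boxes come from closures of basis
  sets.\<close>

lemma off_diagonal_cover:
  assumes lc: "locally_compact_space (euclidean :: 'a::{metric_space,second_countable_topology} topology)"
  obtains \<C> :: "('a::{metric_space,second_countable_topology} set \<times> 'a set) set" where "countable \<C>"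
    "\<And>C D. (C, D) \<in> \<C> \<Longrightarrow> compact C \<and> compact D \<and> C \<inter> D = {}"
    "\<And>x y. x \<noteq> y \<Longrightarrow> \<exists>(C, D)\<in>\<C>. x \<in> interior C \<and> y \<in> interior D"
proof -
  obtain \<B> :: "'a set set" where B: "countable \<B>" "topological_basis \<B>"
    using ex_countable_basis by auto
  define \<C> where "\<C> = {(closure U, closure V) | U V. U \<in> \<B> \<and> V \<in> \<B> \<and> compact (closure U) \<and> compact (closure V) \<and> closure U \<inter> closure V = {}}"
  have "\<C> \<subseteq> (\<lambda>(U, V). (closure U, closure V)) ` (\<B> \<times> \<B>)" by (auto simp: \<C>_def)
  then have c1: "countable \<C>" using B(1) by (metis countable_SIGMA countable_image countable_subset)
  have c2: "compact C \<and> compact D \<and> C \<inter> D = {}" if "(C, D) \<in> \<C>" for C D using that by (auto simp: \<C>_def)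
  have c3: "\<exists>(C, D)\<in>\<C>. x \<in> interior C \<and> y \<in> interior D" if xy: "x \<noteq> y" for x y
  proof -
    \<comment> \<open>Closed balls of this radius around x and y are disjoint, and they contain the
      chosen closures.\<close>
    define e where "e = dist x y / 3"
    have e: "0 < e" using xy by (simp add: e_def)
    have nb: "\<exists>U\<in>\<B>. x \<in> U \<and> compact (closure U) \<and> closure U \<subseteq> cball x e" for x
    proof -
      obtain N K where N: "open N" "x \<in> N" "N \<subseteq> K" "compact K" using locally_compact_nbhd[OF lc, of x] by auto
      obtain U where U: "U \<in> \<B>" "x \<in> U" "U \<subseteq> N \<inter> ball x e"
        using topological_basisE[OF B(2), of "N \<inter> ball x e" x] N e by auto
      have "closure U \<subseteq> K" using U N by (intro closure_minimal compact_imp_closed) auto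
      then have "compact (closure U)" using N(4) by (metis closed_closure compact_Int_closed inf.absorb_iff2)
      moreover have "closure U \<subseteq> cball x e" using U by (intro closure_minimal) auto
      ultimately show ?thesis using U by auto
    qed
    obtain U where U: "U \<in> \<B>" "x \<in> U" "compact (closure U)" "closure U \<subseteq> cball x e" using nb by blast
    obtain V where V: "V \<in> \<B>" "y \<in> V" "compact (closure V)" "closure V \<subseteq> cball y e" using nb by blast
    have "z \<notin> closure V" if "z \<in> closure U" for z
    proof
      assume "z \<in> closure V"
      then have "dist x z \<le> e" "dist y z \<le> e" using that U(4) V(4) by auto
      moreover have "dist x y = 3 * e" by (simp add: e_def)
      ultimately show False using dist_triangle2[of x y z] e by linarith
    qed
    then have "closure U \<inter> closure V = {}" by blast
    then have "(closure U, closure V) \<in> \<C>" using U V by (auto simp: \<C>_def)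
    moreover have "U \<subseteq> interior (closure U)" "V \<subseteq> interior (closure V)"
      by (rule interior_maximal[OF closure_subset topological_basis_open[OF B(2) U(1)]]
        interior_maximal[OF closure_subset topological_basis_open[OF B(2) V(1)]])+
    ultimately show ?thesis using U(2) V(2) by (intro bexI[of _ "(closure U, closure V)"]) auto
  qed
  show thesis by (rule that[OF c1 c2 c3])
qed

text \<open>Polarisation expresses the integral of u(x) v(y) through values of \<open>E\<close>
  alone, so it is the same for both jumping measures. Bump functions with separated supports that
  tend pointwise to the indicators of A and B carry this over to the box by dominated
  convergence.\<close>

lemma beurling_deny_unique_box:
  fixes E :: "('a::{metric_space,second_countable_topology} \<Rightarrow> real) \<Rightarrow> ('a \<Rightarrow> real) \<Rightarrow> real"
  assumes bd: "beurling_deny E F Ec1 J1 k1" "beurling_deny E F Ec2 J2 k2"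
    and bump: "\<And>K U. compact K \<Longrightarrow> open U \<Longrightarrow> K \<subseteq> U \<Longrightarrow>
      \<exists>w\<in>F \<inter> Cc. (\<forall>x. 0 \<le> w x \<and> w x \<le> 1) \<and> (\<forall>x\<in>K. w x = 1) \<and> support w \<subseteq> U"
    and A: "compact A" and B: "compact B" and disj: "A \<inter> B = {}"
  shows "emeasure J1 (A \<times> B) = emeasure J2 (A \<times> B)"
proof (cases "A = {} \<or> B = {}")
  case False
  then have ne: "A \<noteq> {}" "B \<noteq> {}" by auto
  have cl: "closed A" "closed B" using A B by (auto intro: compact_imp_closed)
  \<comment> \<open>The points strictly closer to A than to B, and vice versa for \<open>V0\<close>:
    disjoint open neighbourhoods of the two sets.\<close>
  define U0 where "U0 = {x. infdist x A < infdist x B}"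
  define V0 where "V0 = {x. infdist x B < infdist x A}"
  have UV: "open U0" "open V0" "U0 \<inter> V0 = {}"
    by (auto simp: U0_def V0_def intro!: open_Collect_less continuous_intros)
  have "A \<subseteq> U0"
  proof
    fix x assume "x \<in> A"
    then have "infdist x A = 0" "infdist x B \<noteq> 0" using cl ne disj by (auto simp: in_closed_iff_infdist_zero[symmetric])
    then show "x \<in> U0" using infdist_nonneg[of x B] by (simp add: U0_def)
  qed
  have "B \<subseteq> V0"
  proof
    fix x assume "x \<in> B"
    then have "infdist x B = 0" "infdist x A \<noteq> 0" using cl ne disj by (auto simp: in_closed_iff_infdist_zero[symmetric])
    then show "x \<in> V0" using infdist_nonneg[of x A] by (simp add: V0_def)
  qed
  obtain a where a: "a \<in> F \<inter> Cc" "\<And>x. 0 \<le> a x" "\<And>x. x \<in> A \<Longrightarrow> a x = 1" "support a \<subseteq> U0"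
    using bump[OF A UV(1) \<open>A \<subseteq> U0\<close>] by blast
  obtain b where b: "b \<in> F \<inter> Cc" "\<And>x. 0 \<le> b x" "\<And>x. x \<in> B \<Longrightarrow> b x = 1" "support b \<subseteq> V0"
    using bump[OF B UV(2) \<open>B \<subseteq> V0\<close>] by blast
  have seq: "\<exists>w. \<forall>n. w n \<in> F \<inter> Cc \<and> (\<forall>x. 0 \<le> w n x) \<and> (\<forall>x. w n x \<le> 2 * a x) \<and> support (w n) \<subseteq> support a \<and> (\<forall>x. (\<lambda>n. w n x) \<longlonglongrightarrow> indicator A x)"
    if A: "compact A" and ne: "A \<noteq> {}" and a: "a \<in> F \<inter> Cc" "\<And>x. 0 \<le> a x" "\<And>x. x \<in> A \<Longrightarrow> a x = 1" for A and a :: "'a \<Rightarrow> real"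
  proof -
    \<comment> \<open>The condition 1/2 < a yields w \<le> 2 a, hence the common integrable bound 4
      a(x) b(y); the shrinking distance yields convergence to the indicator of A.\<close>
    define U where "U = (\<lambda>n. {x. 1 / 2 < a x} \<inter> {x. infdist x A < 1 / real (Suc n)})"
    have ca: "continuous_on UNIV a" using a by (auto simp: Cc_def)
    have "open (U n)" for n unfolding U_def by (intro open_Int open_Collect_less continuous_intros ca)
    moreover have "A \<subseteq> U n" for n using a(3) ne by (auto simp: U_def)
    ultimately have "\<forall>n. \<exists>w. w \<in> F \<inter> Cc \<and> (\<forall>x. 0 \<le> w x \<and> w x \<le> 1) \<and> (\<forall>x\<in>A. w x = 1) \<and> support w \<subseteq> U n"
      using bump[OF A] by blast
    from choice[OF this] obtain w where w: "\<And>n. w n \<in> F \<inter> Cc" "\<And>n x. 0 \<le> w n x" "\<And>n x. w n x \<le> 1" "\<And>n x. x \<in> A \<Longrightarrow> w n x = 1" "\<And>n. support (w n) \<subseteq> U n"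
      by blast
    have wz: "w n x = 0" if "x \<notin> U n" for n x using w(5)[of n] in_support[of "w n" x] that by auto
    have "w n x \<le> 2 * a x" for n x
    proof (cases "x \<in> U n")
      case True
      then have "1 / 2 < a x" by (simp add: U_def)
      then show ?thesis using w(3)[of n x] by simp
    qed (simp add: wz a)
    moreover have "support (w n) \<subseteq> support a" for n
    proof -
      have "U n \<subseteq> support a" by (auto simp: U_def intro: in_support)
      then show ?thesis using w(5)[of n] by blast
    qed
    moreover have "(\<lambda>n. w n x) \<longlonglongrightarrow> indicator A x" for x
    proof (cases "x \<in> A")
      case True
      then show ?thesis using w(4) by simp
    next
      case False
      then have "0 < infdist x A"
        using in_closed_iff_infdist_zero[OF compact_imp_closed[OF A] ne] infdist_nonneg[of x A] by (auto simp: less_le)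
      then obtain N where N: "inverse (real (Suc N)) < infdist x A" using reals_Archimedean by blast
      have "w n x = 0" if "N \<le> n" for n
      proof (rule wz)
        have "1 / real (Suc n) \<le> 1 / real (Suc N)" using that by (intro divide_left_mono) auto
        then show "x \<notin> U n" using N by (auto simp: U_def inverse_eq_divide)
      qed
      then have "eventually (\<lambda>n. w n x = indicator A x) sequentially"
        using False by (auto intro!: eventually_sequentiallyI[of N])
      then show ?thesis by (rule tendsto_eventually)
    qed
    ultimately show ?thesis using w by (intro exI[of _ w]) auto
  qed
  obtain w where w: "\<And>n. w n \<in> F \<inter> Cc" "\<And>n x. 0 \<le> w n x" "\<And>n x. w n x \<le> 2 * a x" "\<And>n. support (w n) \<subseteq> support a" "\<And>x. (\<lambda>n. w n x) \<longlonglongrightarrow> indicator A x"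
    using seq[OF A ne(1) a(1-3)] by blast
  obtain v where v: "\<And>n. v n \<in> F \<inter> Cc" "\<And>n x. 0 \<le> v n x" "\<And>n x. v n x \<le> 2 * b x" "\<And>n. support (v n) \<subseteq> support b" "\<And>x. (\<lambda>n. v n x) \<longlonglongrightarrow> indicator B x"
    using seq[OF B ne(2) b(1-3)] by blast
  have sab: "support a \<inter> support b = {}" using a(4) b(4) UV(3) by auto
  define I where "I = (\<lambda>J u v. \<integral>\<^sup>+z. ennreal (u (fst z) * v (snd z)) \<partial>(J :: ('a \<times> 'a) measure))"
  have Ieq: "I J1 u v = I J2 u v" "I J1 u v < \<infinity>"
    if "u \<in> F \<inter> Cc" "v \<in> F \<inter> Cc" "\<And>x. 0 \<le> u x" "\<And>x. 0 \<le> v x" "support u \<inter> support v = {}" for u v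
  proof -
    let ?X = "ennreal (E (\<lambda>x. u x + v x) (\<lambda>x. u x + v x))"
    let ?Y = "ennreal (E (\<lambda>x. u x - v x) (\<lambda>x. u x - v x))"
    have 1: "?Y = ?X + 8 * I J1 u v" unfolding I_def by (rule beurling_deny_polarization[OF bd(1) that])
    have 2: "?Y = ?X + 8 * I J2 u v" unfolding I_def by (rule beurling_deny_polarization[OF bd(2) that])
    \<comment> \<open>\<open>?X\<close> may be cancelled in \<open>ennreal\<close> because it is the
      image of a real number and hence finite.\<close>
    have "?X + 8 * I J1 u v = ?X + 8 * I J2 u v" using 1 2 by (simp only:)
    then have "8 * I J1 u v = 8 * I J2 u v" unfolding ennreal_add_left_cancel by simp
    then show "I J1 u v = I J2 u v" unfolding ennreal_mult_cancel_left by simp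
    have "8 * I J1 u v \<le> ?Y" using 1 by simp
    also have "?Y < \<infinity>" by simp
    finally show "I J1 u v < \<infinity>" by (auto simp: ennreal_mult_less_top less_top)
  qed
  have lim: "(\<lambda>n. I J (w n) (v n)) \<longlonglongrightarrow> emeasure J (A \<times> B)"
    if bd: "beurling_deny E F Ec J k" and fin: "I J a b < \<infinity>" for Ec J k
  proof -
    have sJ: "sets J = sets borel" using bd by (simp add: beurling_deny_def)
    have m: "(\<lambda>z. ennreal (u (fst z) * v (snd z))) \<in> borel_measurable J" if "u \<in> Cc" "v \<in> Cc" for u v :: "'a \<Rightarrow> real"
    proof -
      note Cc_measurable[OF that(1), measurable] Cc_measurable[OF that(2), measurable]
      have "(\<lambda>z. ennreal (u (fst z) * v (snd z))) \<in> borel_measurable (borel \<Otimes>\<^sub>M borel)" by measurable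
      then show ?thesis unfolding borel_prod measurable_cong_sets[OF sJ refl] .
    qed
    have AB: "A \<times> B \<in> sets J" unfolding sJ using cl by (intro borel_closed closed_Times)
    have "(\<lambda>n. I J (w n) (v n)) \<longlonglongrightarrow> (\<integral>\<^sup>+z. indicator (A \<times> B) z \<partial>J)"
      unfolding I_def
    proof (rule nn_integral_dominated_convergence[where w = "\<lambda>z. 4 * ennreal (a (fst z) * b (snd z))"])
      show "(\<lambda>z. ennreal (w n (fst z) * v n (snd z))) \<in> borel_measurable J" for n using w(1) v(1) by (intro m) auto
      show "(\<lambda>z. 4 * ennreal (a (fst z) * b (snd z))) \<in> borel_measurable J"
        using m[of a b] a(1) b(1) by (intro borel_measurable_times_ennreal) auto
      show "indicator (A \<times> B) \<in> borel_measurable J" using AB by simp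
      show "AE z in J. ennreal (w n (fst z) * v n (snd z)) \<le> 4 * ennreal (a (fst z) * b (snd z))" for n
      proof (intro AE_I2)
        fix z :: "'a \<times> 'a"
        have "w n (fst z) * v n (snd z) \<le> (2 * a (fst z)) * (2 * b (snd z))"
          using w v a b by (intro mult_mono) auto
        then have "ennreal (w n (fst z) * v n (snd z)) \<le> ennreal (4 * (a (fst z) * b (snd z)))" by (intro ennreal_leI) simp
        then show "ennreal (w n (fst z) * v n (snd z)) \<le> 4 * ennreal (a (fst z) * b (snd z))" using a b by (simp add: ennreal_mult)
      qed
      have "(\<integral>\<^sup>+z. 4 * ennreal (a (fst z) * b (snd z)) \<partial>J) = 4 * I J a b"
        unfolding I_def using m[of a b] a(1) b(1) by (intro nn_integral_cmult) auto
      also have "\<dots> < \<infinity>" using fin by (auto simp: ennreal_mult_less_top less_top)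
      finally show "(\<integral>\<^sup>+z. 4 * ennreal (a (fst z) * b (snd z)) \<partial>J) < \<infinity>" .
      show "AE z in J. (\<lambda>n. ennreal (w n (fst z) * v n (snd z))) \<longlonglongrightarrow> indicator (A \<times> B) z"
      proof (intro AE_I2)
        fix z :: "'a \<times> 'a"
        have "(\<lambda>n. ennreal (w n (fst z) * v n (snd z))) \<longlonglongrightarrow> ennreal (indicator A (fst z) * indicator B (snd z))"
          by (intro tendsto_ennrealI tendsto_mult w v)
        also have "ennreal (indicator A (fst z) * indicator B (snd z)) = indicator (A \<times> B) z"
          by (cases z) (auto simp: indicator_def)
        finally show "(\<lambda>n. ennreal (w n (fst z) * v n (snd z))) \<longlonglongrightarrow> indicator (A \<times> B) z" .
      qed
    qed
    then show ?thesis using AB by simp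
  qed
  have fin1: "I J1 a b < \<infinity>" "I J2 a b < \<infinity>" using Ieq[OF a(1) b(1) a(2) b(2) sab] by auto
  have "I J1 (w n) (v n) = I J2 (w n) (v n)" for n
    using w(4)[of n] v(4)[of n] sab by (intro Ieq(1) w v) blast
  then show ?thesis using lim[OF bd(1) fin1(1)] lim[OF bd(2) fin1(2)] by (simp add: LIMSEQ_unique)
qed auto

lemma nn_integral_mult_linear:
  fixes g f1 f2 :: "'z \<Rightarrow> ennreal"
  assumes [measurable]: "g \<in> borel_measurable M" "f1 \<in> borel_measurable M" "f2 \<in> borel_measurable M"
  shows "(\<integral>\<^sup>+x. g x * (c1 * f1 x + c2 * f2 x) \<partial>M) = c1 * (\<integral>\<^sup>+x. g x * f1 x \<partial>M) + c2 * (\<integral>\<^sup>+x. g x * f2 x \<partial>M)"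
proof -
  have "(\<integral>\<^sup>+x. g x * (c1 * f1 x + c2 * f2 x) \<partial>M) = (\<integral>\<^sup>+x. c1 * (g x * f1 x) + c2 * (g x * f2 x) \<partial>M)"
    by (intro nn_integral_cong) (simp add: distrib_left mult_ac)
  also have "\<dots> = c1 * (\<integral>\<^sup>+x. g x * f1 x \<partial>M) + c2 * (\<integral>\<^sup>+x. g x * f2 x \<partial>M)"
    by (simp add: nn_integral_add nn_integral_cmult)
  finally show ?thesis .
qed

section \<open>Okura's formula for functions in \<open>Cc\<close>\<close>

context subordinated
begin

text \<open>\<open>p\<close> is only controlled for positive times; its value at time \<open>1\<close> replaces the junk at \<open>s \<le> 0\<close>, a null set of \<open>\<nu>\<close>.\<close>

definition pp :: "real \<Rightarrow> 'a \<times> 'a \<Rightarrow> real" where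
  "pp s z = p (if s > 0 then s else 1) (fst z) (snd z)"

definition jump_density :: "'a \<times> 'a \<Rightarrow> ennreal" where
  "jump_density z = (\<integral>\<^sup>+s. ennreal (pp s z / 2) \<partial>\<nu>)"

definition killing_density :: "'a \<Rightarrow> ennreal" where
  "killing_density x = (\<integral>\<^sup>+s. 1 - (\<integral>\<^sup>+y. ennreal (pp s (x, y)) \<partial>\<mu>) \<partial>\<nu>)"

lemma pp_pos [simp]: "0 < s \<Longrightarrow> pp s z = p s (fst z) (snd z)" by (simp add: pp_def)

lemma pp_nonneg: "0 \<le> pp s z" using p_nonneg[of s] p_nonneg[of 1] by (simp add: pp_def)

lemma sets_nu_pair: "sets (\<nu> \<Otimes>\<^sub>M (\<mu> \<Otimes>\<^sub>M \<mu>)) = sets (borel \<Otimes>\<^sub>M (\<mu> \<Otimes>\<^sub>M \<mu>))"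
  by (rule sets_pair_measure_cong) simp_all

lemma measurable_pp [measurable]: "(\<lambda>w. pp (fst w) (snd w)) \<in> borel_measurable (\<nu> \<Otimes>\<^sub>M (\<mu> \<Otimes>\<^sub>M \<mu>))"
  using measurable_p3 unfolding pp_def measurable_cong_sets[OF sets_nu_pair refl] .

lemma measurable_pp_swap: "(\<lambda>w. pp (snd w) (fst w)) \<in> borel_measurable ((\<mu> \<Otimes>\<^sub>M \<mu>) \<Otimes>\<^sub>M \<nu>)"
  using measurable_compose[OF measurable_pair_swap' measurable_pp] by (simp add: case_prod_unfold)

lemma measurable_pp3: "(\<lambda>w. pp (fst (fst w)) (snd (fst w), snd w)) \<in> borel_measurable ((\<nu> \<Otimes>\<^sub>M \<mu>) \<Otimes>\<^sub>M \<mu>)"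
proof -
  have "(\<lambda>w. (fst (fst w), (snd (fst w), snd w))) \<in> (\<nu> \<Otimes>\<^sub>M \<mu>) \<Otimes>\<^sub>M \<mu> \<rightarrow>\<^sub>M \<nu> \<Otimes>\<^sub>M (\<mu> \<Otimes>\<^sub>M \<mu>)"
    by (intro measurable_Pair measurable_compose[OF measurable_fst measurable_fst] measurable_compose[OF measurable_fst measurable_snd] measurable_snd)
  from measurable_compose[OF this measurable_pp] show ?thesis by simp
qed

lemma measurable_mass3: "(\<lambda>w. \<integral>\<^sup>+y. ennreal (pp (fst w) (snd w, y)) \<partial>\<mu>) \<in> borel_measurable (\<nu> \<Otimes>\<^sub>M \<mu>)"
  using measurable_pp3 by (intro borel_measurable_nn_integral) (simp add: case_prod_unfold)

lemma measurable_jump_density [measurable]: "jump_density \<in> borel_measurable (\<mu> \<Otimes>\<^sub>M \<mu>)"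
proof -
  interpret n: sigma_finite_measure \<nu> by (rule sigma_finite_nu)
  show ?thesis
    unfolding jump_density_def[abs_def] using measurable_pp_swap
    by (intro n.borel_measurable_nn_integral) (simp add: case_prod_unfold)
qed

lemma measurable_killing_density [measurable]: "killing_density \<in> borel_measurable borel"
proof -
  interpret n: sigma_finite_measure \<nu> by (rule sigma_finite_nu)
  have "(\<lambda>w. \<integral>\<^sup>+y. ennreal (pp (snd w) (fst w, y)) \<partial>\<mu>) \<in> borel_measurable (\<mu> \<Otimes>\<^sub>M \<nu>)"
    using measurable_compose[OF measurable_pair_swap' measurable_mass3] by (simp add: case_prod_unfold)
  then have "(\<lambda>w. 1 - (\<integral>\<^sup>+y. ennreal (pp (snd w) (fst w, y)) \<partial>\<mu>)) \<in> borel_measurable (\<mu> \<Otimes>\<^sub>M \<nu>)"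
    by (intro borel_measurable_minus_ennreal borel_measurable_const)
  then have "killing_density \<in> borel_measurable \<mu>"
    unfolding killing_density_def[abs_def]
    by (intro n.borel_measurable_nn_integral) (simp add: case_prod_unfold)
  then show ?thesis by simp
qed

text \<open>The energy identity for each kernel is integrated over \<nu>, and Tonelli exchanges the
  order in both parts. As everything lies in [0,\<infinity>], this holds even for u of infinite
  energy.\<close>

lemma energy_eq: assumes u: "u \<in> Cc"
  shows "energy u = (\<integral>\<^sup>+z. jump_density z * ennreal ((u (fst z) - u (snd z))\<^sup>2) \<partial>(\<mu> \<Otimes>\<^sub>M \<mu>)) +
    (\<integral>\<^sup>+x. killing_density x * ennreal ((u x)\<^sup>2) \<partial>\<mu>)"
proof -
  interpret n: sigma_finite_measure \<nu> by (rule sigma_finite_nu)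
  interpret nm: pair_sigma_finite \<nu> \<mu> ..
  interpret mm: sigma_finite_measure "\<mu> \<Otimes>\<^sub>M \<mu>" by (rule pair.sigma_finite_measure_axioms)
  interpret nmm: pair_sigma_finite \<nu> "\<mu> \<Otimes>\<^sub>M \<mu>" ..
  note Cc_measurable[OF u, measurable]
  define d where "d = (\<lambda>z. ennreal ((u (fst z) - u (snd z))\<^sup>2))"
  define k where "k = (\<lambda>x. ennreal ((u x)\<^sup>2))"
  define m where "m = (\<lambda>s x. \<integral>\<^sup>+y. ennreal (pp s (x, y)) \<partial>\<mu>)"
  have [measurable]: "d \<in> borel_measurable (\<mu> \<Otimes>\<^sub>M \<mu>)" "k \<in> borel_measurable borel" unfolding d_def k_def by measurable
  have mA: "(\<lambda>w. ennreal (pp (fst w) (snd w) / 2) * d (snd w)) \<in> borel_measurable (\<nu> \<Otimes>\<^sub>M (\<mu> \<Otimes>\<^sub>M \<mu>))" by measurable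
  have mB: "(\<lambda>w. (1 - m (fst w) (snd w)) * k (snd w)) \<in> borel_measurable (\<nu> \<Otimes>\<^sub>M \<mu>)"
    unfolding m_def by (intro borel_measurable_times_ennreal borel_measurable_minus_ennreal borel_measurable_const measurable_mass3) measurable
  have "energy u = (\<integral>\<^sup>+s. (\<integral>\<^sup>+z. ennreal (pp s z / 2) * d z \<partial>(\<mu> \<Otimes>\<^sub>M \<mu>)) + (\<integral>\<^sup>+x. (1 - m s x) * k x \<partial>\<mu>) \<partial>\<nu>)"
    unfolding energy_def[OF u] using nu_pos
    by (intro nn_integral_cong_AE, eventually_elim) (simp add: F_energy[OF u] d_def k_def m_def)
  also have "\<dots> = (\<integral>\<^sup>+s. \<integral>\<^sup>+z. ennreal (pp s z / 2) * d z \<partial>(\<mu> \<Otimes>\<^sub>M \<mu>) \<partial>\<nu>) + (\<integral>\<^sup>+s. \<integral>\<^sup>+x. (1 - m s x) * k x \<partial>\<mu> \<partial>\<nu>)"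
    using mA mB by (intro nn_integral_add sigma_finite_measure.borel_measurable_nn_integral[OF pair.sigma_finite_measure_axioms] borel_measurable_nn_integral) (simp_all add: case_prod_unfold)
  also have "(\<integral>\<^sup>+s. \<integral>\<^sup>+z. ennreal (pp s z / 2) * d z \<partial>(\<mu> \<Otimes>\<^sub>M \<mu>) \<partial>\<nu>) = (\<integral>\<^sup>+z. \<integral>\<^sup>+s. ennreal (pp s z / 2) * d z \<partial>\<nu> \<partial>(\<mu> \<Otimes>\<^sub>M \<mu>))"
    using mA by (intro nmm.Fubini'[symmetric]) (simp add: case_prod_unfold)
  also have "\<dots> = (\<integral>\<^sup>+z. jump_density z * d z \<partial>(\<mu> \<Otimes>\<^sub>M \<mu>))"
  proof (intro nn_integral_cong)
    fix z assume z: "z \<in> space (\<mu> \<Otimes>\<^sub>M \<mu>)"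
    have "(\<lambda>s. pp s z) \<in> borel_measurable \<nu>"
      using measurable_compose[OF measurable_Pair2'[OF z] measurable_pp] by simp
    then show "(\<integral>\<^sup>+s. ennreal (pp s z / 2) * d z \<partial>\<nu>) = jump_density z * d z"
      unfolding jump_density_def by (intro nn_integral_multc) simp
  qed
  also have "(\<integral>\<^sup>+s. \<integral>\<^sup>+x. (1 - m s x) * k x \<partial>\<mu> \<partial>\<nu>) = (\<integral>\<^sup>+x. \<integral>\<^sup>+s. (1 - m s x) * k x \<partial>\<nu> \<partial>\<mu>)"
    using mB by (intro nm.Fubini'[symmetric]) (simp add: case_prod_unfold)
  also have "\<dots> = (\<integral>\<^sup>+x. killing_density x * k x \<partial>\<mu>)"
  proof (intro nn_integral_cong)
    fix x :: 'a
    have "(\<lambda>s. m s x) \<in> borel_measurable \<nu>"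
      using measurable_compose[OF measurable_Pair2'[of x \<mu>] measurable_mass3] unfolding m_def by simp
    then show "(\<integral>\<^sup>+s. (1 - m s x) * k x \<partial>\<nu>) = killing_density x * k x"
      unfolding killing_density_def m_def by (intro nn_integral_multc borel_measurable_minus_ennreal) auto
  qed
  finally show ?thesis unfolding d_def k_def .
qed

text \<open>Each kernel is symmetric off a null set depending on s; exchanging the two quantifiers
  by Fubini gives, for almost every pair, symmetry at almost every s.\<close>

lemma jump_density_symmetric: "AE z in \<mu> \<Otimes>\<^sub>M \<mu>. jump_density (snd z, fst z) = jump_density z"
proof -
  interpret n: sigma_finite_measure \<nu> by (rule sigma_finite_nu)
  interpret mm: sigma_finite_measure "\<mu> \<Otimes>\<^sub>M \<mu>" by (rule pair.sigma_finite_measure_axioms)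
  interpret nmm: pair_sigma_finite \<nu> "\<mu> \<Otimes>\<^sub>M \<mu>" ..
  have sw: "(\<lambda>w. pp (fst w) (snd (snd w), fst (snd w))) \<in> borel_measurable (\<nu> \<Otimes>\<^sub>M (\<mu> \<Otimes>\<^sub>M \<mu>))"
  proof -
    have "(\<lambda>w. (fst w, (snd (snd w), fst (snd w)))) \<in> \<nu> \<Otimes>\<^sub>M (\<mu> \<Otimes>\<^sub>M \<mu>) \<rightarrow>\<^sub>M \<nu> \<Otimes>\<^sub>M (\<mu> \<Otimes>\<^sub>M \<mu>)"
      by (intro measurable_Pair measurable_fst measurable_compose[OF measurable_snd measurable_snd] measurable_compose[OF measurable_snd measurable_fst])
    from measurable_compose[OF this measurable_pp] show ?thesis by simp
  qed
  have "AE s in \<nu>. AE z in \<mu> \<Otimes>\<^sub>M \<mu>. pp s z = pp s (snd z, fst z)"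
    using nu_pos by (rule eventually_mono) (simp add: p_symmetric)
  moreover have "{w \<in> space (\<nu> \<Otimes>\<^sub>M (\<mu> \<Otimes>\<^sub>M \<mu>)). pp (fst w) (snd w) = pp (fst w) (snd (snd w), fst (snd w))} \<in> sets (\<nu> \<Otimes>\<^sub>M (\<mu> \<Otimes>\<^sub>M \<mu>))"
    by (rule borel_measurable_eq[OF measurable_pp sw])
  ultimately have "AE z in \<mu> \<Otimes>\<^sub>M \<mu>. AE s in \<nu>. pp s z = pp s (snd z, fst z)"
    by (subst (asm) nmm.AE_commute)
  then show ?thesis
    by (rule eventually_mono) (auto simp: jump_density_def intro!: nn_integral_cong_AE elim!: eventually_mono)
qed

end

section \<open>Beurling-Deny decomposition of the subordinate form\<close>

locale regular_subordinated = subordinated P X \<mu> p \<nu> \<eta> \<Phi> S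
  for P :: "'a::{metric_space,second_countable_topology} option \<Rightarrow> 'w measure" and X \<mu> p \<nu> \<eta> \<Phi> S +
  fixes E :: "('a \<Rightarrow> real) \<Rightarrow> ('a \<Rightarrow> real) \<Rightarrow> real" and FD :: "('a \<Rightarrow> real) set"
  assumes lc: "locally_compact_space (euclidean :: 'a topology)"
    and reg: "regular_dirichlet_form \<mu> E FD" and FD: "FD = form_domain \<mu> (transition P (real_time X))"
begin

abbreviation DS where "DS \<equiv> form_domain \<mu> TS \<inter> Cc"

lemma DS_iff: "u \<in> DS \<longleftrightarrow> u \<in> Cc \<and> energy u < \<infinity>" using form_domain_TS_iff by auto

lemma DS_energy: "u \<in> DS \<Longrightarrow> energy u < \<infinity>" and DS_Cc: "u \<in> DS \<Longrightarrow> u \<in> Cc"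
  unfolding DS_iff by auto

text \<open>Membership in the original domain means that (F u 0 - F u t)/t converges as t tends to
  0, so the decay is at most a multiple of \<open>min 1 t\<close> and its integral against \<nu> is
  finite. This transfers the bump functions to the subordinate form.\<close>

lemma domain_subset: assumes "u \<in> FD" and u: "u \<in> Cc" shows "u \<in> DS"
proof -
  from assms(1) obtain l where "((\<lambda>t. approx_form \<mu> T t u u) \<longlongrightarrow> l) (at_right 0)"
    by (auto simp: FD form_domain_def)
  then have "((\<lambda>t. (F u 0 - F u t) / t) \<longlongrightarrow> l) (at_right 0)" by (simp add: approx_form_T[OF u])
  then have "eventually (\<lambda>t. (F u 0 - F u t) / t < l + 1) (at_right 0)" by (rule order_tendstoD) simp
  then obtain e where e: "0 < e" "\<And>t. 0 < t \<Longrightarrow> t < e \<Longrightarrow> (F u 0 - F u t) / t < l + 1"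
    unfolding eventually_at_right_field by auto
  \<comment> \<open>Three ranges of t: below \<open>e\<close> the difference quotient is under l +
    1, between \<open>e\<close> and 1 the decay is at most \<open>F u 0 / e\<close> times t, and
    from 1 on it is at most \<open>F u 0\<close>.\<close>
  define B where "B = max (\<bar>l\<bar> + 1) (max (F u 0 / e) (F u 0))"
  have F0: "0 \<le> F u 0" "\<And>t. 0 < t \<Longrightarrow> 0 \<le> F u 0 - F u t \<and> F u 0 - F u t \<le> F u 0"
    using F_nonneg[OF u] F_antimono[OF u, of 0] by auto
  have "\<bar>F u 0 - F u t\<bar> \<le> B * min 1 t" if t: "0 < t" for t
  proof (cases "1 \<le> t")
    case True
    have "F u 0 - F u t \<le> B" using F0(2)[OF t] unfolding B_def by linarith
    then show ?thesis using True F0(2)[OF t] by simp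
  next
    case False
    have "F u 0 - F u t \<le> B * t"
    proof (cases "t < e")
      case True
      have "(F u 0 - F u t) / t \<le> B" using e(2)[OF t True] unfolding B_def by linarith
      then show ?thesis using t by (simp add: field_simps)
    next
      case False
      have "F u 0 - F u t \<le> F u 0 / e * e" using F0(2)[OF t] e by simp
      also have "\<dots> \<le> B * t" using False e F0(1) t by (intro mult_mono) (auto simp: B_def)
      finally show ?thesis .
    qed
    then show ?thesis using False F0(2)[OF t] by simp
  qed
  then have i: "integrable \<nu> (\<lambda>s. F u 0 - F u s)"
    using F_continuous[OF u] by (intro integrable_nu) (auto intro!: borel_measurable_continuous_onI continuous_on_diff continuous_on_const)
  have "energy u = ennreal (\<integral>s. F u 0 - F u s \<partial>\<nu>)"
    unfolding energy_def[OF u] using nu_pos F0(2) by (intro nn_integral_eq_integral i) (auto elim!: eventually_mono)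
  then show ?thesis using u unfolding DS_iff by simp
qed

lemma bump: assumes "compact K" "open U" "K \<subseteq> U"
  shows "\<exists>w\<in>DS. (\<forall>x. 0 \<le> w x \<and> w x \<le> 1) \<and> (\<forall>x\<in>K. w x = 1) \<and> support w \<subseteq> U"
proof -
  obtain w where w: "w \<in> FD" "w \<in> Cc" "\<And>x. 0 \<le> w x" "\<And>x. w x \<le> 1" "\<And>x. x \<in> K \<Longrightarrow> w x = 1" "support w \<subseteq> U"
    using regular_bump[OF lc reg assms(1,3,2)] by metis
  then show ?thesis using domain_subset by (intro bexI[of _ w]) auto
qed

lemma DS_linear: assumes u: "u \<in> DS" and v: "v \<in> DS" shows "(\<lambda>x. a * u x + b * v x) \<in> DS"
proof -
  have C: "u \<in> Cc" "v \<in> Cc" "(\<lambda>x. a * u x + b * v x) \<in> Cc" using u v by (auto intro: Cc_linear)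
  note Cc_measurable[OF C(1), measurable] Cc_measurable[OF C(2), measurable]
  have sq: "ennreal ((a * r + b * s)\<^sup>2) \<le> ennreal (2 * a\<^sup>2) * ennreal (r\<^sup>2) + ennreal (2 * b\<^sup>2) * ennreal (s\<^sup>2)" for r s
  proof -
    have "(a * r + b * s)\<^sup>2 \<le> 2 * a\<^sup>2 * r\<^sup>2 + 2 * b\<^sup>2 * s\<^sup>2"
      using zero_le_power2[of "a * r - b * s"] by (simp add: power2_eq_square algebra_simps)
    then have "ennreal ((a * r + b * s)\<^sup>2) \<le> ennreal (2 * a\<^sup>2 * r\<^sup>2 + 2 * b\<^sup>2 * s\<^sup>2)" by (rule ennreal_leI)
    then show ?thesis by (simp add: ennreal_plus ennreal_mult)
  qed
  have "energy (\<lambda>x. a * u x + b * v x) \<le>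
    (\<integral>\<^sup>+z. jump_density z * (ennreal (2 * a\<^sup>2) * ennreal ((u (fst z) - u (snd z))\<^sup>2) + ennreal (2 * b\<^sup>2) * ennreal ((v (fst z) - v (snd z))\<^sup>2)) \<partial>(\<mu> \<Otimes>\<^sub>M \<mu>)) +
    (\<integral>\<^sup>+x. killing_density x * (ennreal (2 * a\<^sup>2) * ennreal ((u x)\<^sup>2) + ennreal (2 * b\<^sup>2) * ennreal ((v x)\<^sup>2)) \<partial>\<mu>)"
    unfolding energy_eq[OF C(3)]
  proof (intro add_mono nn_integral_mono mult_left_mono sq)
    fix z :: "'a \<times> 'a"
    have "a * u (fst z) + b * v (fst z) - (a * u (snd z) + b * v (snd z)) = a * (u (fst z) - u (snd z)) + b * (v (fst z) - v (snd z))"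
      by (simp add: algebra_simps)
    then show "ennreal ((a * u (fst z) + b * v (fst z) - (a * u (snd z) + b * v (snd z)))\<^sup>2) \<le>
      ennreal (2 * a\<^sup>2) * ennreal ((u (fst z) - u (snd z))\<^sup>2) + ennreal (2 * b\<^sup>2) * ennreal ((v (fst z) - v (snd z))\<^sup>2)"
      by (simp only: sq)
  qed auto
  also have "\<dots> = ennreal (2 * a\<^sup>2) * energy u + ennreal (2 * b\<^sup>2) * energy v"
    unfolding energy_eq[OF C(1)] energy_eq[OF C(2)]
    by (subst (1 2) nn_integral_mult_linear) (simp_all only: distrib_left ac_simps, measurable)
  also have "\<dots> < \<infinity>" using DS_energy[OF u] DS_energy[OF v] by (simp add: ennreal_mult_less_top)
  finally show ?thesis using C unfolding DS_iff by simp
qed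

text \<open>A bump function that is 1 on C and 0 on D has (w(x) - w(y))^2 = 1 on the box, so its
  finite energy bounds the mass there.\<close>

lemma jump_density_box_finite:
  assumes C: "compact C" and D: "compact D" and disj: "C \<inter> D = {}"
  shows "(\<integral>\<^sup>+z. jump_density z * indicator (C \<times> D) z \<partial>(\<mu> \<Otimes>\<^sub>M \<mu>)) < \<infinity>"
proof -
  have "C \<subseteq> - D" using disj by auto
  then obtain w where w: "w \<in> DS" "\<And>x. x \<in> C \<Longrightarrow> w x = 1" "support w \<subseteq> - D"
    using bump[OF C open_Compl[OF compact_imp_closed[OF D]]] by blast
  have wD: "w x = 0" if "x \<in> D" for x using in_support[of w x] w(3) that by auto
  have "(\<integral>\<^sup>+z. jump_density z * indicator (C \<times> D) z \<partial>(\<mu> \<Otimes>\<^sub>M \<mu>)) \<le>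
      (\<integral>\<^sup>+z. jump_density z * ennreal ((w (fst z) - w (snd z))\<^sup>2) \<partial>(\<mu> \<Otimes>\<^sub>M \<mu>))"
    by (intro nn_integral_mono mult_left_mono) (auto split: split_indicator simp: w(2) wD)
  also have "\<dots> \<le> energy w" by (subst energy_eq[OF DS_Cc[OF w(1)]]) auto
  also have "\<dots> < \<infinity>" using w(1) by (rule DS_energy)
  finally show ?thesis .
qed

text \<open>The diagonal is removed by hand, since the product measure charges it whenever \<mu> has
  atoms.\<close>

definition jump_measure :: "('a \<times> 'a) measure" where
  "jump_measure = density (\<mu> \<Otimes>\<^sub>M \<mu>) (\<lambda>z. jump_density z * indicator (- {z. fst z = snd z}) z)"

lemma emeasure_jump_measure:
  assumes "A \<in> sets borel"
  shows "emeasure jump_measure A = (\<integral>\<^sup>+z. jump_density z * indicator (- {z. fst z = snd z}) z * indicator A z \<partial>(\<mu> \<Otimes>\<^sub>M \<mu>))"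
proof -
  have [measurable]: "A \<in> sets (\<mu> \<Otimes>\<^sub>M \<mu>)" using assms unfolding sets_pair .
  have [measurable]: "- {z :: 'a \<times> 'a. fst z = snd z} \<in> sets (\<mu> \<Otimes>\<^sub>M \<mu>)"
    unfolding sets_pair by (intro borel_open open_Compl closed_diagonal)
  show ?thesis unfolding jump_measure_def by (rule emeasure_density) measurable
qed

lemma jump_measure_compact_finite:
  assumes K: "compact K" "K \<inter> {z. fst z = snd z} = {}" shows "emeasure jump_measure K < \<infinity>"
proof -
  obtain \<C> :: "('a set \<times> 'a set) set" where \<C>: "countable \<C>"
    "\<And>C D. (C, D) \<in> \<C> \<Longrightarrow> compact C \<and> compact D \<and> C \<inter> D = {}"
    "\<And>x y. x \<noteq> y \<Longrightarrow> \<exists>(C, D)\<in>\<C>. x \<in> interior C \<and> y \<in> interior D"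
    using off_diagonal_cover[OF lc] by metis
  let ?O = "\<lambda>(C, D). interior C \<times> interior D"
  have "K \<subseteq> (\<Union>c\<in>\<C>. ?O c)"
  proof
    fix z assume "z \<in> K"
    then have "fst z \<noteq> snd z" using K by auto
    from \<C>(3)[OF this] show "z \<in> (\<Union>c\<in>\<C>. ?O c)" by (cases z) auto
  qed
  moreover have "open (?O c)" for c by (cases c) (simp add: open_Times)
  ultimately obtain \<D> where \<D>: "\<D> \<subseteq> \<C>" "finite \<D>" "K \<subseteq> (\<Union>c\<in>\<D>. ?O c)"
    using compactE_image[OF K(1), of \<C> ?O] by metis
  have fin: "emeasure jump_measure (C \<times> D) < \<infinity>" "C \<times> D \<in> sets borel" if "(C, D) \<in> \<C>" for C D
  proof -
    have c: "compact C" "compact D" "C \<inter> D = {}" using \<C>(2)[OF that] by auto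
    show s: "C \<times> D \<in> sets borel" using c by (intro borel_closed closed_Times compact_imp_closed)
    have "emeasure jump_measure (C \<times> D) \<le> (\<integral>\<^sup>+z. jump_density z * indicator (C \<times> D) z \<partial>(\<mu> \<Otimes>\<^sub>M \<mu>))"
      unfolding emeasure_jump_measure[OF s] by (intro nn_integral_mono) (auto split: split_indicator)
    then show "emeasure jump_measure (C \<times> D) < \<infinity>" using jump_density_box_finite[OF c] by simp
  qed
  have sj: "sets jump_measure = sets borel" unfolding jump_measure_def sets_density by (rule sets_pair)
  have fin': "fst c \<times> snd c \<in> sets borel" "emeasure jump_measure (fst c \<times> snd c) < \<infinity>" if "c \<in> \<D>" for c
  proof -
    have "(fst c, snd c) \<in> \<C>" using that \<D>(1) by auto
    then show "fst c \<times> snd c \<in> sets borel" "emeasure jump_measure (fst c \<times> snd c) < \<infinity>" by (rule fin)+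
  qed
  have "emeasure jump_measure K \<le> emeasure jump_measure (\<Union>c\<in>\<D>. fst c \<times> snd c)"
  proof (rule emeasure_mono)
    show "K \<subseteq> (\<Union>c\<in>\<D>. fst c \<times> snd c)"
    proof
      fix z assume "z \<in> K"
      then obtain c where c: "c \<in> \<D>" "z \<in> ?O c" using \<D>(3) by blast
      then have "z \<in> interior (fst c) \<times> interior (snd c)" by (simp add: case_prod_unfold)
      then have "z \<in> fst c \<times> snd c" using interior_subset[of "fst c"] interior_subset[of "snd c"] by (auto simp: mem_Times_iff)
      then show "z \<in> (\<Union>c\<in>\<D>. fst c \<times> snd c)" using c(1) by blast
    qed
    show "(\<Union>c\<in>\<D>. fst c \<times> snd c) \<in> sets jump_measure"
      unfolding sj using \<D>(2) fin'(1) by (intro sets.finite_UN)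
  qed
  also have "\<dots> \<le> (\<Sum>c\<in>\<D>. emeasure jump_measure (fst c \<times> snd c))"
    using \<D>(2) fin'(1) by (intro emeasure_subadditive_finite) (auto simp: sj)
  also have "\<dots> < \<infinity>" using \<D>(2) fin'(2) by (simp add: less_top[symmetric])
  finally show ?thesis .
qed

text \<open>The strongly local part is 0, reflecting a Bernstein function without drift: jumps and
  killing already exhaust the energy. Radon finiteness of both measures is extracted from the finite
  energy of bump functions.\<close>

lemma beurling_deny_TS:
  "beurling_deny (form_of \<mu> TS) (form_domain \<mu> TS) (\<lambda>_ _. 0) jump_measure (density \<mu> killing_density)"
  unfolding beurling_deny_def
proof (intro conjI ballI allI impI)
  have "energy (\<lambda>x. 0) = 0" by (subst energy_eq) (auto simp: Cc_def support_def)
  then have "(\<lambda>x. 0) \<in> DS" unfolding DS_iff by (simp add: Cc_def support_def)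
  then show "symmetric_form DS (\<lambda>_ _. 0)" using DS_linear unfolding symmetric_form_def by auto
  show "strongly_local DS (\<lambda>_ _. 0)" by (simp add: strongly_local_def)
  show sj: "sets jump_measure = sets borel" unfolding jump_measure_def sets_density by (rule sets_pair)
  have off: "- {z :: 'a \<times> 'a. fst z = snd z} \<in> sets (\<mu> \<Otimes>\<^sub>M \<mu>)"
    unfolding sets_pair by (intro borel_open open_Compl closed_diagonal)
  note [measurable] = off
  show "distr jump_measure borel prod.swap = jump_measure"
  proof (rule measure_eqI)
    show "sets (distr jump_measure borel prod.swap) = sets jump_measure" by (simp add: sj)
    fix A assume "A \<in> sets (distr jump_measure borel prod.swap)"
    then have A: "A \<in> sets borel" by simp
    then have Am [measurable]: "A \<in> sets (\<mu> \<Otimes>\<^sub>M \<mu>)" unfolding sets_pair .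
    have sw: "prod.swap \<in> borel_measurable (borel :: ('a \<times> 'a) measure)"
      by (intro borel_measurable_continuous_onI continuous_on_swap)
    then have sw': "prod.swap \<in> jump_measure \<rightarrow>\<^sub>M borel" unfolding measurable_cong_sets[OF sj refl] .
    have sA: "prod.swap -` A \<in> sets borel" using measurable_sets[OF sw A] by simp
    have "space jump_measure = UNIV" using sets_eq_imp_space_eq[OF sj] by simp
    then have "emeasure (distr jump_measure borel prod.swap) A = emeasure jump_measure (prod.swap -` A)"
      using A sw' by (simp add: emeasure_distr)
    also have "\<dots> = (\<integral>\<^sup>+z. jump_density z * indicator (- {z. fst z = snd z}) z * indicator (prod.swap -` A) z \<partial>(\<mu> \<Otimes>\<^sub>M \<mu>))"
      by (rule emeasure_jump_measure[OF sA])
    also have "\<dots> = (\<integral>\<^sup>+z. jump_density (snd z, fst z) * indicator (- {z. fst z = snd z}) z * indicator A z \<partial>(\<mu> \<Otimes>\<^sub>M \<mu>))"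
    proof (subst nn_integral_swap)
      have "prod.swap -` A \<in> sets (\<mu> \<Otimes>\<^sub>M \<mu>)" using sA unfolding sets_pair .
      then show "(\<lambda>z. jump_density z * indicator (- {z. fst z = snd z}) z * indicator (prod.swap -` A) z) \<in> borel_measurable (\<mu> \<Otimes>\<^sub>M \<mu>)"
        using off by (intro borel_measurable_times_ennreal measurable_jump_density borel_measurable_indicator)
    qed (auto intro!: nn_integral_cong split: split_indicator)
    also have "\<dots> = (\<integral>\<^sup>+z. jump_density z * indicator (- {z. fst z = snd z}) z * indicator A z \<partial>(\<mu> \<Otimes>\<^sub>M \<mu>))"
      using jump_density_symmetric by (intro nn_integral_cong_AE) (auto elim!: eventually_mono)
    also have "\<dots> = emeasure jump_measure A" by (rule emeasure_jump_measure[OF A, symmetric])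
    finally show "emeasure (distr jump_measure borel prod.swap) A = emeasure jump_measure A" .
  qed
  have "emeasure jump_measure {z. fst z = snd z} = (\<integral>\<^sup>+z. 0 \<partial>(\<mu> \<Otimes>\<^sub>M \<mu>))"
    unfolding emeasure_jump_measure[OF borel_closed[OF closed_diagonal]]
    by (intro nn_integral_cong) (auto split: split_indicator)
  then show "emeasure jump_measure {z. fst z = snd z} = 0" by simp
  show "emeasure jump_measure K < \<infinity>" if "compact K \<and> K \<inter> {z. fst z = snd z} = {}" for K
    using jump_measure_compact_finite that by blast
  show "radon_measure (density \<mu> killing_density)"
    unfolding radon_measure_def
  proof (intro conjI allI impI)
    show "sets (density \<mu> killing_density) = sets borel" by simp
    fix K :: "'a set" assume K: "compact K"
    obtain w where w: "w \<in> DS" "\<And>x. x \<in> K \<Longrightarrow> w x = 1" using bump[OF K open_UNIV] by auto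
    have "emeasure (density \<mu> killing_density) K = (\<integral>\<^sup>+x. killing_density x * indicator K x \<partial>\<mu>)"
      using K by (intro emeasure_density) (auto simp: borel_compact)
    also have "\<dots> \<le> (\<integral>\<^sup>+x. killing_density x * ennreal ((w x)\<^sup>2) \<partial>\<mu>)"
      using w(2) by (intro nn_integral_mono mult_left_mono) (auto split: split_indicator)
    also have "\<dots> \<le> energy w" by (subst energy_eq[OF DS_Cc[OF w(1)]]) auto
    also have "\<dots> < \<infinity>" using w(1) by (rule DS_energy)
    finally show "emeasure (density \<mu> killing_density) K < \<infinity>" .
  qed
  fix u assume u: "u \<in> DS"
  note Cc_measurable[of u, measurable]
  have um [measurable]: "u \<in> borel_measurable borel" using u by (auto intro: Cc_measurable)
  have "ennreal (form_of \<mu> TS u u) = energy u" using u by (intro form_of_TS) auto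
  also have "\<dots> = (\<integral>\<^sup>+z. jump_density z * ennreal ((u (fst z) - u (snd z))\<^sup>2) \<partial>(\<mu> \<Otimes>\<^sub>M \<mu>)) +
    (\<integral>\<^sup>+x. killing_density x * ennreal ((u x)\<^sup>2) \<partial>\<mu>)" using u by (intro energy_eq) auto
  also have "(\<integral>\<^sup>+z. jump_density z * ennreal ((u (fst z) - u (snd z))\<^sup>2) \<partial>(\<mu> \<Otimes>\<^sub>M \<mu>)) =
    (\<integral>\<^sup>+z. ennreal ((u (fst z) - u (snd z))\<^sup>2) \<partial>jump_measure)"
    unfolding jump_measure_def
    by (subst nn_integral_density) (auto intro!: nn_integral_cong split: split_indicator)
  also have "(\<integral>\<^sup>+x. killing_density x * ennreal ((u x)\<^sup>2) \<partial>\<mu>) = (\<integral>\<^sup>+x. ennreal ((u x)\<^sup>2) \<partial>density \<mu> killing_density)"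
    by (subst nn_integral_density) auto
  finally show "ennreal (form_of \<mu> TS u u) = ennreal 0 + (\<integral>\<^sup>+z. ennreal ((u (fst z) - u (snd z))\<^sup>2) \<partial>jump_measure) +
    (\<integral>\<^sup>+x. ennreal ((u x)\<^sup>2) \<partial>density \<mu> killing_density)" by simp
qed

lemma AE_off_diagonal:
  assumes "\<And>C D. compact C \<Longrightarrow> compact D \<Longrightarrow> C \<inter> D = {} \<Longrightarrow> AE z in \<mu> \<Otimes>\<^sub>M \<mu>. z \<in> C \<times> D \<longrightarrow> Q z"
  shows "AE z in \<mu> \<Otimes>\<^sub>M \<mu>. fst z \<noteq> snd z \<longrightarrow> Q z"
proof -
  obtain \<C> :: "('a set \<times> 'a set) set" where \<C>: "countable \<C>"
    "\<And>C D. (C, D) \<in> \<C> \<Longrightarrow> compact C \<and> compact D \<and> C \<inter> D = {}"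
    "\<And>x y. x \<noteq> y \<Longrightarrow> \<exists>(C, D)\<in>\<C>. x \<in> interior C \<and> y \<in> interior D"
    using off_diagonal_cover[OF lc] by metis
  have "AE z in \<mu> \<Otimes>\<^sub>M \<mu>. \<forall>c\<in>\<C>. z \<in> fst c \<times> snd c \<longrightarrow> Q z"
    using \<C>(2) assms by (subst AE_ball_countable[OF \<C>(1)]) auto
  then show ?thesis
  proof (rule eventually_mono, intro impI)
    fix z assume *: "\<forall>c\<in>\<C>. z \<in> fst c \<times> snd c \<longrightarrow> Q z" and "fst z \<noteq> snd z"
    then obtain C D where "(C, D) \<in> \<C>" "fst z \<in> interior C" "snd z \<in> interior D" using \<C>(3) by blast
    then have "z \<in> fst (C, D) \<times> snd (C, D)"
      using interior_subset[of C] interior_subset[of D] by (auto simp: mem_Times_iff)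
    then show "Q z" using * \<open>(C, D) \<in> \<C>\<close> by blast
  qed
qed

lemma jump_density_finite: "AE z in \<mu> \<Otimes>\<^sub>M \<mu>. fst z \<noteq> snd z \<longrightarrow> jump_density z < \<infinity>"
proof (rule AE_off_diagonal)
  fix C D :: "'a set" assume c: "compact C" "compact D" "C \<inter> D = {}"
  have s: "C \<times> D \<in> sets (\<mu> \<Otimes>\<^sub>M \<mu>)" unfolding sets_pair using c by (intro borel_closed closed_Times compact_imp_closed)
  have "AE z in \<mu> \<Otimes>\<^sub>M \<mu>. jump_density z * indicator (C \<times> D) z \<noteq> \<infinity>"
    using jump_density_box_finite[OF c] s by (intro nn_integral_PInf_AE) auto
  then show "AE z in \<mu> \<Otimes>\<^sub>M \<mu>. z \<in> C \<times> D \<longrightarrow> jump_density z < \<infinity>"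
    by (rule eventually_mono) (auto split: split_indicator_asm simp: less_top)
qed

text \<open>\<open>enn2real\<close> loses nothing: off the diagonal the density is finite almost
  everywhere, and on the diagonal the kernel is not tested.\<close>

theorem jump_kernel_exists: "jump_kernel \<mu> (form_of \<mu> TS) (form_domain \<mu> TS) (\<lambda>x y. enn2real (jump_density (x, y)))"
  unfolding jump_kernel_def
proof (intro conjI allI exI ballI impI)
  show "(\<lambda>z. enn2real (jump_density (fst z, snd z))) \<in> borel_measurable (\<mu> \<Otimes>\<^sub>M \<mu>)"
    using measurable_jump_density by simp
  show "beurling_deny (form_of \<mu> TS) (form_domain \<mu> TS) (\<lambda>_ _. 0) jump_measure (density \<mu> killing_density)"
    by (rule beurling_deny_TS)
  fix A :: "('a \<times> 'a) set" assume A: "A \<in> sets borel" "A \<inter> {z. fst z = snd z} = {}"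
  show "emeasure jump_measure A = (\<integral>\<^sup>+z\<in>A. ennreal (enn2real (jump_density (fst z, snd z))) \<partial>(\<mu> \<Otimes>\<^sub>M \<mu>))"
    unfolding emeasure_jump_measure[OF A(1)]
  proof (rule nn_integral_cong_AE, rule eventually_mono[OF jump_density_finite])
    fix z assume "fst z \<noteq> snd z \<longrightarrow> jump_density z < \<infinity>"
    then show "jump_density z * indicator (- {z. fst z = snd z}) z * indicator A z = ennreal (enn2real (jump_density (fst z, snd z))) * indicator A z"
      using A(2) by (auto split: split_indicator)
  qed
qed simp

theorem jump_kernel_unique:
  assumes J: "jump_kernel \<mu> (form_of \<mu> TS) (form_domain \<mu> TS) J"
  shows "AE z in \<mu> \<Otimes>\<^sub>M \<mu>. fst z \<noteq> snd z \<longrightarrow> ennreal (J (fst z) (snd z)) = jump_density z"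
proof (rule AE_off_diagonal)
  fix C D :: "'a set" assume c: "compact C" "compact D" "C \<inter> D = {}"
  have [measurable]: "(\<lambda>z. J (fst z) (snd z)) \<in> borel_measurable (\<mu> \<Otimes>\<^sub>M \<mu>)" using J by (simp add: jump_kernel_def)
  obtain Ec Jm k where bd: "beurling_deny (form_of \<mu> TS) (form_domain \<mu> TS) Ec Jm k"
    and Jm: "\<And>A. A \<in> sets borel \<Longrightarrow> A \<inter> {z. fst z = snd z} = {} \<Longrightarrow>
      emeasure Jm A = (\<integral>\<^sup>+z\<in>A. ennreal (J (fst z) (snd z)) \<partial>(\<mu> \<Otimes>\<^sub>M \<mu>))"
    using J unfolding jump_kernel_def by blast
  have eq: "(\<integral>\<^sup>+z. ennreal (J (fst z) (snd z)) * indicator (A \<times> B) z \<partial>(\<mu> \<Otimes>\<^sub>M \<mu>)) = (\<integral>\<^sup>+z. jump_density z * indicator (A \<times> B) z \<partial>(\<mu> \<Otimes>\<^sub>M \<mu>))"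
    if AB: "closed A" "closed B" "A \<subseteq> C" "B \<subseteq> D" for A B
  proof -
    have cp: "compact A" "compact B" "A \<inter> B = {}" using AB c compact_Int_closed[OF c(1) AB(1)] compact_Int_closed[OF c(2) AB(2)]
      by (auto simp: Int_absorb1)
    have s: "A \<times> B \<in> sets borel" using AB by (intro borel_closed closed_Times)
    have d: "A \<times> B \<inter> {z. fst z = snd z} = {}" using cp(3) by auto
    have "(\<integral>\<^sup>+z. ennreal (J (fst z) (snd z)) * indicator (A \<times> B) z \<partial>(\<mu> \<Otimes>\<^sub>M \<mu>)) = emeasure Jm (A \<times> B)"
      using Jm[OF s d] by simp
    also have "\<dots> = emeasure jump_measure (A \<times> B)"
      by (rule beurling_deny_unique_box[OF bd beurling_deny_TS bump cp])
    also have "\<dots> = (\<integral>\<^sup>+z. jump_density z * indicator (A \<times> B) z \<partial>(\<mu> \<Otimes>\<^sub>M \<mu>))"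
      unfolding emeasure_jump_measure[OF s] using d by (intro nn_integral_cong) (auto split: split_indicator)
    finally show ?thesis .
  qed
  show "AE z in \<mu> \<Otimes>\<^sub>M \<mu>. z \<in> C \<times> D \<longrightarrow> ennreal (J (fst z) (snd z)) = jump_density z"
  proof (rule AE_eq_on_box)
    show "(\<integral>\<^sup>+z. ennreal (J (fst z) (snd z)) * indicator (C \<times> D) z \<partial>(\<mu> \<Otimes>\<^sub>M \<mu>)) < \<infinity>"
      using eq[of C D] c jump_density_box_finite[OF c] by (simp add: compact_imp_closed)
  qed (use c eq in \<open>auto intro: compact_imp_closed\<close>)
qed

end

section \<open>Volume doubling and the jump kernel estimate\<close>

lemma small_ball_finite:
  fixes x :: "'a::{metric_space,second_countable_topology}"
  assumes "metric_measure_space \<mu>"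
  obtains r where "0 < r" "emeasure \<mu> (ball x r) < \<infinity>"
proof -
  have lc: "locally_compact_space (euclidean :: 'a topology)" and r: "radon_measure \<mu>"
    using assms by (auto simp: metric_measure_space_def)
  obtain U K where U: "open U" "x \<in> U" "U \<subseteq> K" "compact K" using locally_compact_nbhd[OF lc, of x] by auto
  then obtain r where "0 < r" "ball x r \<subseteq> U" using open_contains_ball by blast
  moreover have "emeasure \<mu> (ball x r) \<le> emeasure \<mu> K"
    using calculation U r by (intro emeasure_mono) (auto simp: radon_measure_def borel_compact)
  moreover have "emeasure \<mu> K < \<infinity>" using r U(4) by (simp add: radon_measure_def)
  ultimately show thesis using that by (meson le_less_trans)
qed

text \<open>Local compactness makes some small ball finite, and doubling, being stated in
  \<open>ennreal\<close>, propagates this to all radii.\<close>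

lemma volume_doubling_ball_finite:
  assumes m: "metric_measure_space \<mu>" and vd: "volume_doubling \<mu>"
  shows "emeasure \<mu> (ball x R) < \<infinity>"
proof -
  obtain C d where C: "1 \<le> C" "\<And>x r R. 0 < r \<Longrightarrow> r \<le> R \<Longrightarrow>
      emeasure \<mu> (ball x R) \<le> ennreal (C * (R / r) powr d) * emeasure \<mu> (ball x r)"
    using vd unfolding volume_doubling_def by blast
  obtain r where r: "0 < r" "emeasure \<mu> (ball x r) < \<infinity>" using small_ball_finite[OF m] by blast
  have sets: "sets \<mu> = sets borel" using m by (simp add: metric_measure_space_def radon_measure_def)
  have "emeasure \<mu> (ball x R) \<le> emeasure \<mu> (ball x (max r R))" using sets by (intro emeasure_mono) auto
  also have "\<dots> \<le> ennreal (C * (max r R / r) powr d) * emeasure \<mu> (ball x r)" using r by (intro C(2)) auto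
  also have "\<dots> < \<infinity>" using r by (simp add: ennreal_mult_less_top)
  finally show ?thesis .
qed

lemma volume_doubling_vol:
  assumes m: "metric_measure_space \<mu>" and vd: "volume_doubling \<mu>"
  obtains D d where "1 \<le> D" "0 < d"
    "\<And>x r R. 0 < r \<Longrightarrow> r \<le> R \<Longrightarrow> vol \<mu> x R \<le> D * (R / r) powr d * vol \<mu> x r"
proof -
  obtain D d where D: "1 \<le> D" "0 < d" "\<And>x r R. 0 < r \<Longrightarrow> r \<le> R \<Longrightarrow>
      emeasure \<mu> (ball x R) \<le> ennreal (D * (R / r) powr d) * emeasure \<mu> (ball x r)"
    using vd unfolding volume_doubling_def by blast
  have e: "emeasure \<mu> (ball x R) = ennreal (vol \<mu> x R)" for x R
    unfolding vol_def using volume_doubling_ball_finite[OF m vd, of x R] by (intro emeasure_eq_ennreal_measure) (auto simp: less_top)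
  have "vol \<mu> x R \<le> D * (R / r) powr d * vol \<mu> x r" if "0 < r" "r \<le> R" for x r R
  proof -
    have "ennreal (vol \<mu> x R) \<le> ennreal (D * (R / r) powr d * vol \<mu> x r)"
      using D(3)[OF that, of x] D(1) by (simp add: e ennreal_mult vol_def)
    then show ?thesis using D(1) by (subst (asm) ennreal_le_iff) (auto simp: vol_def)
  qed
  with D(1,2) show thesis by (rule that)
qed

lemma ball_finite_measure_volume_doubling:
  assumes m: "metric_measure_space \<mu>" and vd: "volume_doubling \<mu>"
  shows "ball_finite_measure \<mu>"
proof (rule ball_finite_measure.intro)
  show sets: "sets \<mu> = sets borel" using m by (simp add: metric_measure_space_def radon_measure_def)
  fix x r
  have "emeasure \<mu> (cball x r) \<le> emeasure \<mu> (ball x (r + 1))" using sets by (intro emeasure_mono) auto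
  then show "emeasure \<mu> (cball x r) < \<infinity>" using volume_doubling_ball_finite[OF m vd, of x "r + 1"] by (rule le_less_trans)
qed

lemma vol_pos:
  assumes m: "metric_measure_space \<mu>" and vd: "volume_doubling \<mu>" and "0 < r"
  shows "0 < vol \<mu> x r"
proof -
  have "0 < emeasure \<mu> (ball x r)"
    using m assms(3) centre_in_ball[of x r] unfolding metric_measure_space_def by (metis empty_iff open_ball)
  then show ?thesis
    using volume_doubling_ball_finite[OF m vd, of x r] by (simp add: vol_def measure_def enn2real_positive_iff)
qed

lemma vol_mono:
  assumes m: "metric_measure_space \<mu>" and vd: "volume_doubling \<mu>" and "r \<le> R"
  shows "vol \<mu> x r \<le> vol \<mu> x R"
proof -
  have sets: "sets \<mu> = sets borel" using m by (simp add: metric_measure_space_def radon_measure_def)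
  show ?thesis unfolding vol_def
    using assms(3) sets volume_doubling_ball_finite[OF m vd, of x R]
    by (intro measure_mono_fmeasurable) (auto simp: fmeasurable_def)
qed

lemma (in levy_scaling) sigma_finite_levy_measure: "sigma_finite_measure N"
  unfolding levy_measure_def by (subst sigma_finite_measure.sigma_finite_iff_density_finite[OF sigma_finite_lborel]) auto

lemma subordinator_laws_levy:
  assumes ls: "levy_scaling \<phi> a b C \<psi> a' b' C'"
    and int: "set_integrable lborel {0<..} (\<lambda>t. min 1 t * levy_density \<phi> \<psi> t)"
    and S: "subordinator Q S (bernstein \<phi> \<psi>)"
  shows "subordinator_laws (levy_measure \<phi> \<psi>) (\<lambda>t. distr Q borel (S t)) (bernstein \<phi> \<psi>)"
proof -
  interpret levy_scaling \<phi> a b C \<psi> a' b' C' by fact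
  have Q: "prob_space Q" "\<And>t. 0 \<le> t \<Longrightarrow> S t \<in> borel_measurable Q" "AE \<omega> in Q. \<forall>t\<ge>0. 0 \<le> S t \<omega>"
    "\<And>t l. 0 \<le> t \<Longrightarrow> 0 < l \<Longrightarrow> (\<integral>\<omega>. exp (- l * S t \<omega>) \<partial>Q) = exp (- t * bernstein \<phi> \<psi> l)"
    using S by (auto simp: subordinator_def levy_process_def)
  show ?thesis
  proof (rule subordinator_laws.intro)
    show "prob_space (distr Q borel (S t))" if "0 \<le> t" for t
      using prob_space.prob_space_distr[OF Q(1) Q(2)[OF that]] .
    show "AE s in distr Q borel (S t). 0 \<le> s" if "0 \<le> t" for t
      using Q(2)[OF that] Q(3) that by (subst AE_distr_iff) (auto elim!: eventually_mono)
    show "(\<integral>s. exp (- l * s) \<partial>distr Q borel (S t)) = exp (- t * bernstein \<phi> \<psi> l)" if "0 \<le> t" "0 < l" for t l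
      using Q(2)[OF that(1)] Q(4)[OF that] by (subst integral_distr) auto
  qed (use AE_N_pos nn_integral_min1_finite[OF int] bernstein_pos[OF int] bernstein_eq[OF int] in auto)
qed

text \<open>The law of \<open>S t\<close> must be one and the same under all starting points.
  Equality of the Laplace transforms gives this, so \<open>P None\<close> can serve as
  reference.\<close>

lemma subordinated_levy:
  assumes hp: "heat_process P X \<mu> p" and ls: "levy_scaling \<phi> a b C \<psi> a' b' C'"
    and int: "set_integrable lborel {0<..} (\<lambda>t. min 1 t * levy_density \<phi> \<psi> t)"
    and S: "independent_subordinator P X S (bernstein \<phi> \<psi>)"
  shows "subordinated P X \<mu> p (levy_measure \<phi> \<psi>) (\<lambda>t. distr (P None) borel (S t)) (bernstein \<phi> \<psi>) S"
proof -
  interpret heat_process P X \<mu> p by fact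
  interpret levy_scaling \<phi> a b C \<psi> a' b' C' by fact
  have sub: "subordinator (P x) S (bernstein \<phi> \<psi>)" for x using S by (simp add: independent_subordinator_def)
  interpret subordinator_laws "levy_measure \<phi> \<psi>" "\<lambda>t. distr (P None) borel (S t)" "bernstein \<phi> \<psi>"
    by (rule subordinator_laws_levy[OF ls int sub])
  have Sm: "S t \<in> borel_measurable (P x)" if "0 \<le> t" for t x
    using sub[of x] that by (simp add: subordinator_def levy_process_def)
  show ?thesis
  proof (intro subordinated.intro subordinated_axioms.intro)
    show "distr (P x) borel (S t) = distr (P None) borel (S t)" if t: "0 \<le> t" for x t
    proof (rule Laplace_uniqueness)
      interpret x: subordinator_laws "levy_measure \<phi> \<psi>" "\<lambda>t. distr (P x) borel (S t)" "bernstein \<phi> \<psi>"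
        by (rule subordinator_laws_levy[OF ls int sub])
      show "prob_space (distr (P x) borel (S t))" "AE s in distr (P x) borel (S t). 0 \<le> s"
        by (rule x.prob_eta[OF t], rule x.eta_nonneg[OF t])
      show "(\<integral>s. exp (- l * s) \<partial>distr (P x) borel (S t)) = (\<integral>s. exp (- l * s) \<partial>distr (P None) borel (S t))" if "0 < l" for l
        using x.eta[OF t that] eta[OF t that] by simp
    qed (use prob_eta[OF t] eta_nonneg[OF t] in auto)
    fix t A D x s assume t: "(0::real) \<le> t" and A: "A \<in> sets (borel :: real measure)" and D: "D \<in> sets (borel_cem :: 'a option measure)"
    have ind: "prob_space.indep_set (P x) (sets (history (space (P x)) X \<infinity>))
          (sigma_sets (space (P x)) {S s -` A \<inter> space (P x) | s A. 0 \<le> s \<and> A \<in> sets borel})"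
      using S by (simp add: independent_subordinator_def)
    have "X s -` D \<inter> space (P x) \<in> sets (history (space (P x)) X \<infinity>)"
      unfolding history_def using D by (subst sets_measure_of) (auto intro!: sigma_sets.Basic)
    moreover have "S t -` A \<inter> space (P x) \<in> sigma_sets (space (P x)) {S s -` A \<inter> space (P x) | s A. 0 \<le> s \<and> A \<in> sets borel}"
      by (rule sigma_sets.Basic) (use t A in blast)
    ultimately have "measure (P x) ((X s -` D \<inter> space (P x)) \<inter> (S t -` A \<inter> space (P x))) =
      measure (P x) (X s -` D \<inter> space (P x)) * measure (P x) (S t -` A \<inter> space (P x))"
      by (rule prob_space.indep_setD[OF prob ind])
    then show "measure (P x) ((S t -` A \<inter> space (P x)) \<inter> (X s -` D \<inter> space (P x))) =
      measure (P x) (S t -` A \<inter> space (P x)) * measure (P x) (X s -` D \<inter> space (P x))"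
      by (simp only: Int_commute mult.commute)
  qed (use hp subordinator_laws_axioms sigma_finite_levy_measure Sm in auto)
qed

lemma (in subordinated) jump_density_bounds:
  assumes z: "fst z \<noteq> snd z"
  shows "jump_density z \<le> (\<integral>\<^sup>+s. ennreal (pp s z) \<partial>\<nu>)" "(\<integral>\<^sup>+s. ennreal (pp s z) \<partial>\<nu>) = 2 * jump_density z"
    "(\<lambda>s. pp s z) \<in> borel_measurable borel"
proof -
  have m: "(\<lambda>s. pp s z) \<in> borel_measurable \<nu>"
    using measurable_compose[OF measurable_Pair2'[of z "\<mu> \<Otimes>\<^sub>M \<mu>"] measurable_pp] by (simp add: space_pair_measure)
  then show "(\<lambda>s. pp s z) \<in> borel_measurable borel" unfolding measurable_cong_sets[OF sets_nu refl] .
  show "jump_density z \<le> (\<integral>\<^sup>+s. ennreal (pp s z) \<partial>\<nu>)"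
    unfolding jump_density_def using pp_nonneg by (intro nn_integral_mono ennreal_leI) simp
  have "(\<integral>\<^sup>+s. ennreal (pp s z) \<partial>\<nu>) = (\<integral>\<^sup>+s. 2 * ennreal (pp s z / 2) \<partial>\<nu>)"
  proof (intro nn_integral_cong)
    fix s
    have "ennreal (pp s z) = ennreal (2 * (pp s z / 2))" by simp
    also have "\<dots> = ennreal 2 * ennreal (pp s z / 2)" using pp_nonneg by (intro ennreal_mult) auto
    finally show "ennreal (pp s z) = 2 * ennreal (pp s z / 2)" by simp
  qed
  also have "\<dots> = 2 * jump_density z" unfolding jump_density_def using m by (intro nn_integral_cmult) simp
  finally show "(\<integral>\<^sup>+s. ennreal (pp s z) \<partial>\<nu>) = 2 * jump_density z" .
qed

section \<open>Comparison of an arbitrary jump kernel with the integrated heat kernel\<close>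

theorem proposition3p3:
  fixes \<mu> :: "'a::{metric_space,second_countable_topology} measure"
    and \<phi>c \<phi>j \<psi> :: "real \<Rightarrow> real"
    and \<beta>1c \<beta>2c \<beta>1j \<beta>2j :: real
    and E :: "('a \<Rightarrow> real) \<Rightarrow> ('a \<Rightarrow> real) \<Rightarrow> real" and F :: "('a \<Rightarrow> real) set"
    and P :: "'a option \<Rightarrow> 'w measure" and X :: "ennreal \<Rightarrow> 'w \<Rightarrow> 'a option"
    and S :: "real \<Rightarrow> 'w \<Rightarrow> real"
  defines "\<phi> \<equiv> scale_min \<phi>c \<phi>j"
  defines "TS \<equiv> transition P (subordinate X S)"
  assumes "metric_measure_space \<mu>" and "volume_doubling \<mu>"
    and "LU \<beta>1c \<beta>2c \<phi>c" and "LU \<beta>1j \<beta>2j \<phi>j" and "1 < \<beta>1c"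
    and "\<And>r. 0 < r \<Longrightarrow> r \<le> 1 \<Longrightarrow> \<phi>c r \<le> \<phi>j r"
    and "\<And>r. 1 < r \<Longrightarrow> \<phi>c r \<ge> \<phi>j r"
    and "scale_function \<psi>"
    and "set_integrable lborel {0<..} (\<lambda>t. min 1 t * levy_density \<phi> \<psi> t)"
    and "regular_dirichlet_form \<mu> E F" and "diffusion_jump_type E F"
    and "associated_hunt_process \<mu> E F P X"
    and "HK_minus \<mu> P X \<phi>c \<phi>j"
    and "independent_subordinator P X S (bernstein \<phi> \<psi>)"
  shows "(\<exists>J. jump_kernel \<mu> (form_of \<mu> TS) (form_domain \<mu> TS) J) \<and>
    (\<forall>J. jump_kernel \<mu> (form_of \<mu> TS) (form_domain \<mu> TS) J \<longrightarrow>
      (\<exists>C>0. AE (x, y) in \<mu> \<Otimes>\<^sub>M \<mu>. x \<noteq> y \<longrightarrow>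
        (let r = dist x y;
             K = 1 / vol \<mu> x r * (1 / \<psi> r + bernstein \<phi> \<psi> (1 / \<phi>j r))
         in K / C \<le> J x y \<and> J x y \<le> C * K)))"
proof -
  note m = \<open>metric_measure_space \<mu>\<close> and vd = \<open>volume_doubling \<mu>\<close>
  note int = \<open>set_integrable lborel {0<..} (\<lambda>t. min 1 t * levy_density \<phi> \<psi> t)\<close>
  obtain Cc where c: "scaling \<phi>c \<beta>1c \<beta>2c Cc" using LU_scaling[OF \<open>LU \<beta>1c \<beta>2c \<phi>c\<close>] by blast
  obtain Cj where j: "scaling \<phi>j \<beta>1j \<beta>2j Cj" using LU_scaling[OF \<open>LU \<beta>1j \<beta>2j \<phi>j\<close>] by blast
  obtain \<alpha>1 \<alpha>2 Cp where psi: "scaling \<psi> \<alpha>1 \<alpha>2 Cp"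
    using \<open>scale_function \<psi>\<close> LU_scaling unfolding scale_function_def by metis
  have ls: "levy_scaling \<phi> (min \<beta>1c \<beta>1j) (max \<beta>2c \<beta>2j) (max Cc Cj) \<psi> \<alpha>1 \<alpha>2 Cp"
    unfolding \<phi>_def by (intro levy_scaling.intro scaling_scale_min c j psi)
  obtain D d where D: "1 \<le> D" "0 < d"
    "\<And>x r R. 0 < r \<Longrightarrow> r \<le> R \<Longrightarrow> vol \<mu> x R \<le> D * (R / r) powr d * vol \<mu> x r"
    using volume_doubling_vol[OF m vd] by metis
  have ke: "kernel_estimate \<phi>c \<beta>1c \<beta>2c Cc \<phi>j \<beta>1j \<beta>2j Cj (min \<beta>1c \<beta>1j) (max \<beta>2c \<beta>2j) (max Cc Cj) \<psi> \<alpha>1 \<alpha>2 Cp \<mu> D d"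
  proof (rule kernel_estimate.intro[OF c j ls[unfolded \<phi>_def] kernel_estimate_axioms.intro])
    show "1 < \<beta>1c" by fact
    show "set_integrable lborel {0<..} (\<lambda>t. min 1 t * levy_density (scale_min \<phi>c \<phi>j) \<psi> t)"
      using int unfolding \<phi>_def .
    show "0 < vol \<mu> x r" if "0 < r" for x r using vol_pos[OF m vd that] .
    show "vol \<mu> x r \<le> vol \<mu> x R" if "r \<le> R" for x r R using vol_mono[OF m vd that] .
    show "1 \<le> D" "0 < d" by (rule D)+
    show "vol \<mu> x R \<le> D * (R / r) powr d * vol \<mu> x r" if "0 < r" "r \<le> R" for x r R using D(3)[OF that] .
  qed
  obtain p N c1 c2 c3 c4 where hk: "heat_kernel \<mu> (transition P (real_time X)) p" and N: "properly_exceptional \<mu> P X N"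
    and cs: "0 < c1" "0 < c2" "0 < c3" "0 < c4"
    and "\<forall>t>0. \<forall>x y. x \<notin> N \<and> y \<notin> N \<longrightarrow>
           (let r = dist x y; \<phi> = scale_min \<phi>c \<phi>j in
            c1 * ((if \<phi> (c2 * r) \<le> t then 1 / vol \<mu> x (scale_inv \<phi> t) else 0) +
                  (if \<phi> (c2 * r) > t then t / (vol \<mu> x r * \<phi>j r) else 0)) \<le> p t x y \<and>
            p t x y \<le> c3 * min (1 / vol \<mu> x (scale_inv \<phi> t))
                              (p_c \<mu> \<phi>c (c4 * t) x y + p_j \<mu> \<phi>j t x y))"
    using \<open>HK_minus \<mu> P X \<phi>c \<phi>j\<close> unfolding HK_minus_def by (elim exE conjE) (rule that)
  then have bounds: "c1 * ((if \<phi> (c2 * dist x y) \<le> t then 1 / vol \<mu> x (scale_inv \<phi> t) else 0) +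
            (if \<phi> (c2 * dist x y) > t then t / (vol \<mu> x (dist x y) * \<phi>j (dist x y)) else 0)) \<le> p t x y \<and>
      p t x y \<le> c3 * min (1 / vol \<mu> x (scale_inv \<phi> t)) (p_c \<mu> \<phi>c (c4 * t) x y + p_j \<mu> \<phi>j t x y)"
    if "0 < t" "x \<notin> N" "y \<notin> N" for t x y
    using that unfolding Let_def \<phi>_def by (elim allE impE) (assumption | rule conjI)+
  note lower = bounds[THEN conjunct1] and upper = bounds[THEN conjunct2]
  have as: "hunt_process P X" "symmetric_process \<mu> P (real_time X)" "F = form_domain \<mu> (transition P (real_time X))"
    using \<open>associated_hunt_process \<mu> E F P X\<close> by (auto simp: associated_hunt_process_def)
  have hp: "heat_process P X \<mu> p"
    by (intro heat_process.intro heat_process_axioms.intro hunt_process_cemetery_process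
      ball_finite_measure_volume_doubling m vd as hk)
  have lc: "locally_compact_space (euclidean :: 'a topology)" using m by (simp add: metric_measure_space_def)
  interpret regular_subordinated P X \<mu> p "levy_measure \<phi> \<psi>" "\<lambda>t. distr (P None) borel (S t)" "bernstein \<phi> \<psi>" S E F
    by (intro regular_subordinated.intro regular_subordinated_axioms.intro
      subordinated_levy[OF hp ls int \<open>independent_subordinator P X S (bernstein \<phi> \<psi>)\<close>] lc
      \<open>regular_dirichlet_form \<mu> E F\<close> as(3))
  define k where "k = (\<lambda>x y. 1 / vol \<mu> x (dist x y) * (1 / \<psi> (dist x y) + bernstein \<phi> \<psi> (1 / \<phi>j (dist x y))))"
  obtain K1 where K1: "0 < K1" and up: "\<And>x y f. x \<noteq> y \<Longrightarrow> f \<in> borel_measurable borel \<Longrightarrow>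
    (\<And>t. 0 < t \<Longrightarrow> f t \<le> c3 * min (1 / vol \<mu> x (scale_inv \<phi> t)) (p_c \<mu> \<phi>c (c4 * t) x y + p_j \<mu> \<phi>j t x y)) \<Longrightarrow>
    (\<integral>\<^sup>+t. ennreal (f t) \<partial>levy_measure \<phi> \<psi>) \<le> ennreal (K1 * k x y)"
    using kernel_estimate.jump_upper[OF ke cs(3,4)] unfolding k_def \<phi>_def by metis
  obtain K2 where K2: "0 < K2" and lo: "\<And>x y f. x \<noteq> y \<Longrightarrow> f \<in> borel_measurable borel \<Longrightarrow> (\<And>t. 0 \<le> f t) \<Longrightarrow>
    (\<And>t. 0 < t \<Longrightarrow> c1 * ((if \<phi> (c2 * dist x y) \<le> t then 1 / vol \<mu> x (scale_inv \<phi> t) else 0) +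
      (if \<phi> (c2 * dist x y) > t then t / (vol \<mu> x (dist x y) * \<phi>j (dist x y)) else 0)) \<le> f t) \<Longrightarrow>
    ennreal (k x y) \<le> ennreal K2 * (\<integral>\<^sup>+t. ennreal (f t) \<partial>levy_measure \<phi> \<psi>)"
    using kernel_estimate.jump_lower[OF ke cs(1,2)] unfolding k_def \<phi>_def by metis
  have k0: "0 \<le> k x y" if "x \<noteq> y" for x y
    using that vol_pos[OF m vd, of "dist x y" x] scaling.pos[OF psi, of "dist x y"] scaling.pos[OF j, of "dist x y"]
      levy_scaling.bernstein_nonneg[OF ls int, of "1 / \<phi>j (dist x y)"]
    by (simp add: k_def)
  have null: "N \<in> null_sets \<mu>" using N by (simp add: properly_exceptional_def)
  \<comment> \<open>The set \<open>N\<close> does not depend on time, so for almost every pair the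
    heat kernel bounds hold for all t > 0 simultaneously and may be integrated in t.\<close>
  have AEN: "AE z in \<mu> \<Otimes>\<^sub>M \<mu>. fst z \<notin> N \<and> snd z \<notin> N"
  proof (rule pair.AE_pair_measure)
    have "N \<in> sets \<mu>" using null by auto
    then show "{z \<in> space (\<mu> \<Otimes>\<^sub>M \<mu>). fst z \<notin> N \<and> snd z \<notin> N} \<in> sets (\<mu> \<Otimes>\<^sub>M \<mu>)" by measurable
    show "AE x in \<mu>. AE y in \<mu>. fst (x, y) \<notin> N \<and> snd (x, y) \<notin> N"
      using AE_not_in[OF null] by eventually_elim (use AE_not_in[OF null] in \<open>auto elim!: eventually_mono\<close>)
  qed
  have main: "\<exists>C>0. AE (x, y) in \<mu> \<Otimes>\<^sub>M \<mu>. x \<noteq> y \<longrightarrow> k x y / C \<le> J x y \<and> J x y \<le> C * k x y"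
    if J: "jump_kernel \<mu> (form_of \<mu> TS) (form_domain \<mu> TS) J" for J
  proof (intro exI conjI)
    \<comment> \<open>The factor 2 compensates the 1/2 in Okura's formula in the lower bound; in the
      upper bound that 1/2 is simply dropped.\<close>
    define C where "C = max K1 (2 * K2)"
    show "0 < C" using K1 by (simp add: C_def)
    have J0: "0 \<le> J x y" for x y using J by (simp add: jump_kernel_def)
    have "AE z in \<mu> \<Otimes>\<^sub>M \<mu>. fst z \<noteq> snd z \<longrightarrow> k (fst z) (snd z) / C \<le> J (fst z) (snd z) \<and> J (fst z) (snd z) \<le> C * k (fst z) (snd z)"
      using AEN jump_kernel_unique[OF J[unfolded TS_def]]
    proof eventually_elim
      fix z assume z: "fst z \<notin> N \<and> snd z \<notin> N" and u: "fst z \<noteq> snd z \<longrightarrow> ennreal (J (fst z) (snd z)) = jump_density z"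
      show "fst z \<noteq> snd z \<longrightarrow> k (fst z) (snd z) / C \<le> J (fst z) (snd z) \<and> J (fst z) (snd z) \<le> C * k (fst z) (snd z)"
      proof (intro impI conjI)
        assume ne: "fst z \<noteq> snd z"
        note b = jump_density_bounds[OF ne]
        note kz = k0[OF ne]
        have "ennreal (J (fst z) (snd z)) \<le> (\<integral>\<^sup>+t. ennreal (pp t z) \<partial>levy_measure \<phi> \<psi>)" using u ne b(1) by simp
        also have "\<dots> \<le> ennreal (K1 * k (fst z) (snd z))"
          by (rule up[OF ne b(3)]) (use upper z in simp)
        finally have "J (fst z) (snd z) \<le> K1 * k (fst z) (snd z)" using K1 kz by (subst (asm) ennreal_le_iff) auto
        also have "\<dots> \<le> C * k (fst z) (snd z)" using kz by (intro mult_right_mono) (auto simp: C_def)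
        finally show "J (fst z) (snd z) \<le> C * k (fst z) (snd z)" .
        have "ennreal (k (fst z) (snd z)) \<le> ennreal K2 * (\<integral>\<^sup>+t. ennreal (pp t z) \<partial>levy_measure \<phi> \<psi>)"
          by (rule lo[OF ne b(3) pp_nonneg]) (use lower z in simp)
        also have "\<dots> = ennreal K2 * (ennreal 2 * ennreal (J (fst z) (snd z)))" using u ne by (simp add: b(2))
        also have "\<dots> = ennreal (2 * K2 * J (fst z) (snd z))" using K2 J0 by (simp add: ennreal_mult[symmetric] del: ennreal_numeral)
        finally have "k (fst z) (snd z) \<le> 2 * K2 * J (fst z) (snd z)" using K2 J0 by (subst (asm) ennreal_le_iff) auto
        also have "\<dots> \<le> C * J (fst z) (snd z)" using J0 by (intro mult_right_mono) (auto simp: C_def)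
        finally show "k (fst z) (snd z) / C \<le> J (fst z) (snd z)" using \<open>0 < C\<close> by (simp add: field_simps)
      qed
    qed
    then show "AE (x, y) in \<mu> \<Otimes>\<^sub>M \<mu>. x \<noteq> y \<longrightarrow> k x y / C \<le> J x y \<and> J x y \<le> C * k x y"
      by (rule eventually_mono) (simp add: case_prod_unfold)
  qed
  show ?thesis
    using jump_kernel_exists main unfolding TS_def Let_def k_def by blast
qed

end
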